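(* Consider MDLAG with parameters $$\gamma=\frac{\alpha'\beta'\mu_{\min}^2}{288D\|\sqrt{P_K(U)}\|^4}e^{-\frac{2D}{\sqrt{\kappa_F}}},\quad c=\frac{\alpha'\beta'\mu_{\min}^2}{1200D\|\sqrt{P_K(U)}\|^4}e^{-\frac{2(D+1)}{\sqrt{\kappa_F}}}<1,\quad\eta=\frac2{15}\frac1{\beta'},\quad s=10,$$ where $\alpha'=\frac{\sigma_{n-1}(P_K(U))}{L_{\max}}$ and $\beta'=\frac{\sigma_1(P_K(U))}{\mu_{\min}}$, and where at each iteration every worker applies Katyusha, warm started at its previous approximate dual gradient, with $\mathcal O(m+\sqrt{m\kappa_{\max}})$ stochastic gradient evaluations. Then, in order to obtain an $\varepsilon$-suboptimal solution of the dual problem $\min_{\xi\in\mathbb R^{d\times n}}F^*(\xi\sqrt U)$, MDLAG needs an iteration complexity of $$\mathcal I_{\mathrm{MDLAG}}(\varepsilon)=\mathcal O\big(\sqrt{\kappa_F}\log(1/\varepsilon)\big)$$ in expectation, and a stochastic gradient complexity of $$\mathcal G_{\mathrm{MDLAG}}(\varepsilon)=\mathcal O\big(n(m+\sqrt{m\kappa_{\max}})\sqrt{\kappa_F}\log(1/\varepsilon)\big).$$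
   Context: Problem. There are $n$ workers. Worker $i$ has $f_i=\frac1m\sum_{j=1}^m f_{i,j}$ with $f_{i,j}:\mathbb R^d\to\mathbb R$ differentiable, $L_i$-smooth ($f_{i,j}(y)\le f_{i,j}(x)+\langle\nabla f_{i,j}(x),y-x\rangle+\frac{L_i}2\|y-x\|^2$) and $\mu_i$-strongly convex, $\mu_i>0$. Put $\kappa_i=L_i/\mu_i$, $\mu_{\min}=\min_i\mu_i$, $L_{\max}=\max_iL_i$, $\kappa_{\max}=\max_i\kappa_i$, $\kappa_F=L_{\max}/\mu_{\min}$. For $\Theta=(\theta_1,\dots,\theta_n)\in\mathbb R^{d\times n}$ let $F(\Theta)=\sum_if_i(\theta_i)$. A star denotes the convex conjugate; $F^*(x)=\sum_if_i^*(x_i)$. $\|\cdot\|$ is the Euclidean norm of vectors and the Frobenius norm of matrices. Network. $\mathcal G=(\{1,\dots,n\},\mathcal E)$ is an undirected graph. $W\in\mathbb R^{n\times n}$ is symmetric, $W_{ij}\ne0$ iff $(i,j)\in\mathcal E$, $U=I-W$ is positive semidefinite and $\mathrm{null}(U)=\mathrm{span}\{\mathbf 1\}$. For a positive semidefinite $M\in\mathbb R^{n\times n}$ with null space $\mathrm{span}\{\mathbf 1\}$ let $\sigma_1(M)\ge\dots\ge\sigma_{n-1}(M)>\sigma_n(M)=0$ be its eigenvalues, $\zeta(M)=\sigma_{n-1}(M)/\sigma_1(M)$, and $\sqrt M$ its positive semidefinite square root. Accelerated gossip matrix. $K=\lfloor1/\sqrt{\zeta(U)}\rfloor$, $c_2=\frac{1+\zeta(U)}{1-\zeta(U)}$,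 $c_3=\frac2{(1+\zeta(U))\sigma_1(U)}$, and $P_K(U)=I-T_K\big(c_2(I-c_3U)\big)/T_K(c_2)$, where $T_K$ is the Chebyshev polynomial of degree $K$ (for $K=1$ this is $P_1(U)=c_3U$, which is also the definition when $\zeta(U)=1$). Let $\kappa'=\kappa_F/\zeta(P_K(U))$. MDLAG. Parameters: step size $\eta>0$, $s\ge1$, $c\in(0,1)$, $\gamma>0$, maximal delay $D\ge1$ (integer). Initialization: $x^0=y^0=0\in\mathbb R^{d\times n}$, $\hat\theta_i^0=\theta_i^0=\nabla f_i^*(0)$, $d_i^0=0$. At iteration $k\ge1$ each worker $i$ computes $\theta_i^k\approx\arg\min_\theta\frac1m\sum_{j=1}^m(f_{i,j}(\theta)-\langle\theta,x_i^k\rangle)$ (exact minimizer $\nabla f_i^*(x_i^k)$) by Katyusha started at $\theta_i^{k-1}$, with fresh independent random samples. The lazy condition of worker $i$ at iteration $k$ is $$\|\hat\theta_i^{k-1}-\theta_i^k\|^2\le\frac3{\mu_{\min}^2}\Big[\sum_{j=0}^{k-D-1}c^{k-D-j}\delta_i^j+\sum_{j=0}^{k-1}c^{k-j}\delta_i^j+\sum_{j=k-D}^{k-1}c\,\delta_i^j+\sum_{j=k-D}^{k-1}\gamma\,\delta_i^j\Big],\quad\delta_i^j=\|x_i^j-x_i^{j+1}\|^2,$$ where empty sums and terms with negative $j$ are $0$. If it fails or $d_i^{k-1}=D$, then $\hat\theta_i^k=\theta_i^k$, $d_i^k=0$ (worker $i$ sends $\theta_i^k-\hat\theta_i^{k-1}$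 to its neighbors); otherwise $\hat\theta_i^k=\hat\theta_i^{k-1}$, $d_i^k=d_i^{k-1}+1$. With $\hat\Theta^k=(\hat\theta_1^k,\dots,\hat\theta_n^k)$, for $k\ge0$: $$y^{k+1}=x^k-\eta\hat\Theta^kP_K(U),\qquad x^{k+1}=y^{k+1}+\tfrac{\sqrt{s\kappa'}-1}{\sqrt{s\kappa'}+1}(y^{k+1}-y^k).$$ Katyusha (Allen-Zhu). For $\min_\theta\frac1m\sum_jh_j(\theta)+\psi(\theta)$ with $h_j$ convex $L$-smooth, $\psi$ $\mu$-strongly convex, started at $\theta^{0}$: set $\tau_2=\frac12$, $\tau_1=\min\{\sqrt{2m\mu/(3L)},\frac12\}$, $a=\frac1{3\tau_1L}$, $p_0=z_0=\tilde u^0=\theta^0$. In epoch $e=0,1,\dots$ compute $g=\frac1m\sum_j\nabla h_j(\tilde u^e)$; for $l=0,\dots,2m-1$, with $t=2me+l$: $u_{t+1}=\tau_1z_t+\tau_2\tilde u^e+(1-\tau_1-\tau_2)p_t$; draw $j$ uniformly; $\tilde g=g+\nabla h_j(u_{t+1})-\nabla h_j(\tilde u^e)$; $z_{t+1}=\arg\min_z\{\frac1{2a}\|z-z_t\|^2+\langle\tilde g,z\rangle+\psi(z)\}$; $p_{t+1}=\arg\min_p\{\frac{3L}2\|p-u_{t+1}\|^2+\langle\tilde g,p\rangle+\psi(p)\}$. Then $\tilde u^{e+1}$ is the weighted average of $p_{2me+1},\dots,p_{2me+2m}$ with weights proportional to $(1+a\mu)^{l}$, $l=0,\dots,2m-1$.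 The output is the last $\tilde u^{e}$. Here $h_j=f_{i,j}-\frac{\mu_i}2\|\cdot\|^2$, $\psi(\theta)=\frac{\mu_i}2\|\theta\|^2-\langle\theta,x_i^k\rangle$, $L=L_i$, $\mu=\mu_i$. Each epoch costs $O(m)$ stochastic gradient evaluations. Complexity conventions. "Katyusha with $\mathcal O(m+\sqrt{m\kappa_{\max}})$ evaluations" means: at most a sufficiently large universal constant times $(m+\sqrt{m\kappa_{\max}})\log(2\kappa_{\max}/c)$ evaluations per worker per iteration (i.e. $\lceil C_0(1+\sqrt{\kappa_{\max}/m})\log(2\kappa_{\max}/c)\rceil$ epochs for a suitable universal $C_0$), the factor $\log(2\kappa_{\max}/c)$ being suppressed in $\mathcal O$. $\varepsilon$-suboptimality of the iterate $y^k$ (which has the form $\xi\sqrt U$) means $\mathbb E[F^*(y^k)]-\min_\xi F^*(\xi\sqrt U)\le\varepsilon$. The iteration complexity is the number of iterations to reach it; the stochastic gradient complexity is the total number of stochastic gradients used by all workers. In the complexity bounds the initial dual suboptimality gap is treated as a constant. *)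

theory Defs
  imports
    "HOL-Probability.Product_PMF"
    "HOL-Library.Monad_Syntax"
    "Jordan_Normal_Form.Char_Poly"
    "Jordan_Normal_Form.Matrix_Kernel"
begin

no_notation inner (infixl \<open>\<bullet>\<close> 70)
hide_type (open) Finite_Cartesian_Product.vec
hide_const (open) Finite_Cartesian_Product.vec Finite_Cartesian_Product.mat

text \<open>
  The number \<open>n\<close> of workers, the number \<open>m\<close> of samples per worker and the dimension \<open>d\<close> are
  natural numbers that can be quantified inside a formula, because the constants of the complexity
  bounds must not depend on them. So \<open>carrier_vec d\<close> plays the role of Euclidean \<open>d\<close>-space and
  \<open>carrier_mat d n\<close> that of the \<open>d\<close> by \<open>n\<close> matrices; workers, samples, rows and columns are
  numbered from 0.
\<close>

definition vnorm :: "real vec \<Rightarrow> real" where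
  "vnorm x = sqrt (x \<bullet> x)"

definition fro_norm :: "real mat \<Rightarrow> real" where
  "fro_norm A = sqrt (\<Sum>i<dim_row A. \<Sum>j<dim_col A. (A $$ (i, j))\<^sup>2)"

definition has_gradient :: "nat \<Rightarrow> (real vec \<Rightarrow> real) \<Rightarrow> real vec \<Rightarrow> real vec \<Rightarrow> bool" where
  "has_gradient d h x g \<longleftrightarrow> g \<in> carrier_vec d \<and>
     (\<forall>e>0. \<exists>r>0. \<forall>v\<in>carrier_vec d. vnorm v < r \<longrightarrow>
        \<bar>h (x + v) - h x - g \<bullet> v\<bar> \<le> e * vnorm v)"

definition gradient :: "nat \<Rightarrow> (real vec \<Rightarrow> real) \<Rightarrow> real vec \<Rightarrow> real vec" where
  "gradient d h x = (THE g. has_gradient d h x g)"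

definition differentiable_fun :: "nat \<Rightarrow> (real vec \<Rightarrow> real) \<Rightarrow> bool" where
  "differentiable_fun d h \<longleftrightarrow> (\<forall>x\<in>carrier_vec d. \<exists>g. has_gradient d h x g)"

definition smooth_fun :: "nat \<Rightarrow> real \<Rightarrow> (real vec \<Rightarrow> real) \<Rightarrow> bool" where
  "smooth_fun d L h \<longleftrightarrow> (\<forall>x\<in>carrier_vec d. \<forall>y\<in>carrier_vec d.
     h y \<le> h x + gradient d h x \<bullet> (y - x) + L / 2 * (vnorm (y - x))\<^sup>2)"

definition strongly_convex_fun :: "nat \<Rightarrow> real \<Rightarrow> (real vec \<Rightarrow> real) \<Rightarrow> bool" where
  "strongly_convex_fun d \<mu> h \<longleftrightarrow> (\<forall>x\<in>carrier_vec d. \<forall>y\<in>carrier_vec d.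
     h y \<ge> h x + gradient d h x \<bullet> (y - x) + \<mu> / 2 * (vnorm (y - x))\<^sup>2)"

text \<open>
  The supremum is taken in the reals, so this is the convex conjugate only where the latter is
  finite, which for strongly convex functions is everywhere.
\<close>

definition convex_conjugate :: "nat \<Rightarrow> (real vec \<Rightarrow> real) \<Rightarrow> real vec \<Rightarrow> real" where
  "convex_conjugate d h x = (SUP \<theta>\<in>carrier_vec d. \<theta> \<bullet> x - h \<theta>)"

definition psd_mat :: "nat \<Rightarrow> real mat \<Rightarrow> bool" where
  "psd_mat n M \<longleftrightarrow> M \<in> carrier_mat n n \<and> transpose_mat M = M \<and>
     (\<forall>v\<in>carrier_vec n. v \<bullet> (M *\<^sub>v v) \<ge> 0)"

definition psd_sqrt :: "nat \<Rightarrow> real mat \<Rightarrow> real mat" where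
  "psd_sqrt n M = (THE S. psd_mat n S \<and> S * S = M)"

text \<open>The eigenvalues with multiplicity in descending order; \<open>eigenvalue_desc M i\<close> counts them from 1.\<close>

definition eigenvalues_desc :: "real mat \<Rightarrow> real list" where
  "eigenvalues_desc M =
     (THE xs. sorted_wrt (\<ge>) xs \<and> char_poly M = (\<Prod>x\<leftarrow>xs. [:- x, 1:]))"

definition eigenvalue_desc :: "real mat \<Rightarrow> nat \<Rightarrow> real" where
  "eigenvalue_desc M i = eigenvalues_desc M ! (i - 1)"

definition zeta :: "nat \<Rightarrow> real mat \<Rightarrow> real" where
  "zeta n M = eigenvalue_desc M (n - 1) / eigenvalue_desc M 1"

fun chebyshev_T :: "nat \<Rightarrow> real poly" where
  "chebyshev_T 0 = 1"
| "chebyshev_T (Suc 0) = [:0, 1:]"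
| "chebyshev_T (Suc (Suc k)) = [:0, 2:] * chebyshev_T (Suc k) - chebyshev_T k"

definition poly_mat :: "nat \<Rightarrow> real poly \<Rightarrow> real mat \<Rightarrow> real mat" where
  "poly_mat n p A = fold_coeffs (\<lambda>a B. a \<cdot>\<^sub>m 1\<^sub>m n + A * B) p (0\<^sub>m n n)"

text \<open>The edge set \<open>E\<close> may or may not contain loops; the diagonal of \<open>W\<close> is not constrained by it.\<close>

definition gossip_network :: "nat \<Rightarrow> (nat \<times> nat) set \<Rightarrow> real mat \<Rightarrow> bool" where
  "gossip_network n E W \<longleftrightarrow>
     E \<subseteq> {..<n} \<times> {..<n} \<and> sym E \<and>
     W \<in> carrier_mat n n \<and> transpose_mat W = W \<and>
     (\<forall>i<n. \<forall>j<n. i \<noteq> j \<longrightarrow> (W $$ (i, j) \<noteq> 0 \<longleftrightarrow> (i, j) \<in> E)) \<and>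
     psd_mat n (1\<^sub>m n - W) \<and>
     mat_kernel (1\<^sub>m n - W) = range (\<lambda>a. a \<cdot>\<^sub>v vec n (\<lambda>_. 1))"

definition accel_gossip :: "nat \<Rightarrow> real mat \<Rightarrow> real mat" where
  "accel_gossip n U =
     (let z = zeta n U;
          K = nat \<lfloor>1 / sqrt z\<rfloor>;
          c2 = (1 + z) / (1 - z);
          c3 = 2 / ((1 + z) * eigenvalue_desc U 1)
      in if z = 1 then c3 \<cdot>\<^sub>m U
         else 1\<^sub>m n - (1 / poly (chebyshev_T K) c2) \<cdot>\<^sub>m
                poly_mat n (chebyshev_T K) (c2 \<cdot>\<^sub>m (1\<^sub>m n - c3 \<cdot>\<^sub>m U)))"

text \<open>
  \<open>katyusha_inner\<close> performs \<open>l\<close> inner steps of the epoch with snapshot \<open>u\<close> and returns \<open>p\<close>, \<open>z\<close> and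
  the sum of the new points \<open>p\<close> weighted with the powers of \<open>1 + a \<mu>\<close>. Every step evaluates the
  two stochastic gradients at the sampled index.
\<close>

primrec katyusha_inner ::
  "nat \<Rightarrow> nat \<Rightarrow> (nat \<Rightarrow> real vec \<Rightarrow> real) \<Rightarrow> (real vec \<Rightarrow> real) \<Rightarrow> real \<Rightarrow> real \<Rightarrow>
   real vec \<Rightarrow> real vec \<Rightarrow> real vec \<Rightarrow> nat \<Rightarrow> (real vec \<times> real vec \<times> real vec \<times> nat) pmf" where
  "katyusha_inner d m h \<psi> L \<mu> u p0 z0 0 = return_pmf (p0, z0, 0\<^sub>v d, 0)"
| "katyusha_inner d m h \<psi> L \<mu> u p0 z0 (Suc l) =
     do {
       (p, z, acc, cost) \<leftarrow> katyusha_inner d m h \<psi> L \<mu> u p0 z0 l;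
       j \<leftarrow> pmf_of_set {..<m};
       let \<tau>1 = min (sqrt (2 * real m * \<mu> / (3 * L))) (1 / 2);
           \<tau>2 = 1 / 2;
           a = 1 / (3 * \<tau>1 * L);
           g = (1 / real m) \<cdot>\<^sub>v finsum_vec TYPE(real) d (\<lambda>j. gradient d (h j) u) {..<m};
           v = \<tau>1 \<cdot>\<^sub>v z + \<tau>2 \<cdot>\<^sub>v u + (1 - \<tau>1 - \<tau>2) \<cdot>\<^sub>v p;
           gt = g + gradient d (h j) v - gradient d (h j) u;
           z' = arg_min_on (\<lambda>w. 1 / (2 * a) * (vnorm (w - z))\<^sup>2 + gt \<bullet> w + \<psi> w) (carrier_vec d);
           p' = arg_min_on (\<lambda>w. 3 * L / 2 * (vnorm (w - v))\<^sup>2 + gt \<bullet> w + \<psi> w) (carrier_vec d)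
       in return_pmf (p', z', acc + (1 + a * \<mu>) ^ l \<cdot>\<^sub>v p', cost + 2)
     }"

text \<open>
  The components of the result are the snapshot, \<open>p\<close>, \<open>z\<close> and the number of stochastic gradient
  evaluations; an epoch starts with the \<open>m\<close> evaluations for the full gradient at the snapshot.
\<close>

primrec katyusha_epochs ::
  "nat \<Rightarrow> nat \<Rightarrow> (nat \<Rightarrow> real vec \<Rightarrow> real) \<Rightarrow> (real vec \<Rightarrow> real) \<Rightarrow> real \<Rightarrow> real \<Rightarrow>
   real vec \<Rightarrow> nat \<Rightarrow> (real vec \<times> real vec \<times> real vec \<times> nat) pmf" where
  "katyusha_epochs d m h \<psi> L \<mu> \<theta>0 0 = return_pmf (\<theta>0, \<theta>0, \<theta>0, 0)"
| "katyusha_epochs d m h \<psi> L \<mu> \<theta>0 (Suc e) =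
     do {
       (u, p, z, cost) \<leftarrow> katyusha_epochs d m h \<psi> L \<mu> \<theta>0 e;
       (p', z', acc, inner_cost) \<leftarrow> katyusha_inner d m h \<psi> L \<mu> u p z (2 * m);
       let \<tau>1 = min (sqrt (2 * real m * \<mu> / (3 * L))) (1 / 2);
           a = 1 / (3 * \<tau>1 * L);
           u' = (1 / (\<Sum>l<2 * m. (1 + a * \<mu>) ^ l)) \<cdot>\<^sub>v acc
       in return_pmf (u', p', z', cost + m + inner_cost)
     }"

definition katyusha ::
  "nat \<Rightarrow> nat \<Rightarrow> (nat \<Rightarrow> real vec \<Rightarrow> real) \<Rightarrow> (real vec \<Rightarrow> real) \<Rightarrow> real \<Rightarrow> real \<Rightarrow>
   real vec \<Rightarrow> nat \<Rightarrow> (real vec \<times> nat) pmf" where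
  "katyusha d m h \<psi> L \<mu> \<theta>0 epochs =
     map_pmf (\<lambda>(u, p, z, cost). (u, cost)) (katyusha_epochs d m h \<psi> L \<mu> \<theta>0 epochs)"

record mdlag_state =
  xs_of :: "nat \<Rightarrow> real mat"     \<comment> \<open>the iterates x produced so far\<close>
  y_of :: "real mat"
  theta_of :: "nat \<Rightarrow> real vec"
  hat_of :: "nat \<Rightarrow> real vec"
  delay_of :: "nat \<Rightarrow> nat"
  evals_of :: nat                \<comment> \<open>stochastic gradients evaluated by all workers so far\<close>

locale decentralized_problem =
  fixes n m d :: nat
    and f :: "nat \<Rightarrow> nat \<Rightarrow> real vec \<Rightarrow> real"
    and L \<mu> :: "nat \<Rightarrow> real"
begin

definition well_posed :: bool where
  "well_posed \<longleftrightarrow> n \<ge> 2 \<and> m \<ge> 1 \<and> d \<ge> 1 \<and>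
     (\<forall>i<n. \<mu> i > 0 \<and>
       (\<forall>j<m. differentiable_fun d (f i j) \<and> smooth_fun d (L i) (f i j) \<and>
              strongly_convex_fun d (\<mu> i) (f i j)))"

definition local_loss :: "nat \<Rightarrow> real vec \<Rightarrow> real" where
  "local_loss i \<theta> = (1 / real m) * (\<Sum>j<m. f i j \<theta>)"

definition dual_fun :: "real mat \<Rightarrow> real" where
  "dual_fun X = (\<Sum>i<n. convex_conjugate d (local_loss i) (col X i))"

definition \<mu>_min :: real where "\<mu>_min = Min (\<mu> ` {..<n})"
definition L_max :: real where "L_max = Max (L ` {..<n})"
definition \<kappa>_max :: real where "\<kappa>_max = Max ((\<lambda>i. L i / \<mu> i) ` {..<n})"
definition \<kappa>_F :: real where "\<kappa>_F = L_max / \<mu>_min"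

end

locale mdlag = decentralized_problem n m d f L \<mu>
  for n m d :: nat and f :: "nat \<Rightarrow> nat \<Rightarrow> real vec \<Rightarrow> real" and L \<mu> :: "nat \<Rightarrow> real" +
  fixes U :: "real mat"
    and \<eta> s c \<gamma> :: real
    and D epochs :: nat
begin

definition momentum :: real where
  "momentum =
     (let \<kappa>' = \<kappa>_F / zeta n (accel_gossip n U) in (sqrt (s * \<kappa>') - 1) / (sqrt (s * \<kappa>') + 1))"

definition init_state :: mdlag_state where
  "init_state =
     \<lparr> xs_of = (\<lambda>_. 0\<^sub>m d n), y_of = 0\<^sub>m d n,
       theta_of = (\<lambda>i. gradient d (convex_conjugate d (local_loss i)) (0\<^sub>v d)),
       hat_of = (\<lambda>i. gradient d (convex_conjugate d (local_loss i)) (0\<^sub>v d)),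
       delay_of = (\<lambda>_. 0), evals_of = 0 \<rparr>"

text \<open>
  Truncated subtraction implements the convention that sums over negative indices vanish.
\<close>

definition lazy_condition ::
  "nat \<Rightarrow> (nat \<Rightarrow> real mat) \<Rightarrow> nat \<Rightarrow> real vec \<Rightarrow> real vec \<Rightarrow> bool" where
  "lazy_condition k x i hat \<theta> \<longleftrightarrow>
     (let \<delta> = (\<lambda>j. (vnorm (col (x j) i - col (x (Suc j)) i))\<^sup>2) in
      (vnorm (hat - \<theta>))\<^sup>2 \<le> 3 / \<mu>_min\<^sup>2 *
        ((\<Sum>j\<in>{0..<k - D}. c ^ (k - D - j) * \<delta> j) + (\<Sum>j\<in>{0..<k}. c ^ (k - j) * \<delta> j)
         + (\<Sum>j\<in>{k - D..<k}. c * \<delta> j) + (\<Sum>j\<in>{k - D..<k}. \<gamma> * \<delta> j)))"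

definition local_solver :: "nat \<Rightarrow> real vec \<Rightarrow> real vec \<Rightarrow> (real vec \<times> nat) pmf" where
  "local_solver i x \<theta>0 =
     katyusha d m (\<lambda>j \<theta>. f i j \<theta> - \<mu> i / 2 * (vnorm \<theta>)\<^sup>2)
       (\<lambda>\<theta>. \<mu> i / 2 * (vnorm \<theta>)\<^sup>2 - \<theta> \<bullet> x) (L i) (\<mu> i) \<theta>0 epochs"

definition worker_step :: "nat \<Rightarrow> mdlag_state \<Rightarrow> mdlag_state pmf" where
  "worker_step k S =
     do {
       r \<leftarrow> Pi_pmf {..<n} (0\<^sub>v d, 0) (\<lambda>i. local_solver i (col (xs_of S k) i) (theta_of S i));
       let \<theta> = (\<lambda>i. fst (r i));
           send = (\<lambda>i. \<not> lazy_condition k (xs_of S) i (hat_of S i) (\<theta> i) \<or> delay_of S i = D)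
       in return_pmf (S \<lparr> theta_of := \<theta>,
            hat_of := (\<lambda>i. if send i then \<theta> i else hat_of S i),
            delay_of := (\<lambda>i. if send i then 0 else delay_of S i + 1),
            evals_of := evals_of S + (\<Sum>i<n. snd (r i)) \<rparr>)
     }"

definition gossip_update :: "nat \<Rightarrow> mdlag_state \<Rightarrow> mdlag_state" where
  "gossip_update k S =
     (let H = mat_of_cols d (map (hat_of S) [0..<n]);
          y' = xs_of S k - \<eta> \<cdot>\<^sub>m (H * accel_gossip n U);
          x' = y' + momentum \<cdot>\<^sub>m (y' - y_of S)
      in S \<lparr> xs_of := (xs_of S)(Suc k := x'), y_of := y' \<rparr>)"

text \<open>
  The distribution of the state after the iterations \<open>0, \<dots>, k - 1\<close>; it contains the iterates
  \<open>x\<^sup>0, \<dots>, x\<^sup>k\<close> and \<open>y\<^sup>k\<close>.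
\<close>

primrec run :: "nat \<Rightarrow> mdlag_state pmf" where
  "run 0 = return_pmf init_state"
| "run (Suc k) =
     do {
       S \<leftarrow> run k;
       S' \<leftarrow> (if k = 0 then return_pmf S else worker_step k S);
       return_pmf (gossip_update k S')
     }"

definition suboptimal :: "real \<Rightarrow> nat \<Rightarrow> bool" where
  "suboptimal \<epsilon> k \<longleftrightarrow>
     (\<exists>\<xi>. is_arg_min (\<lambda>\<xi>. dual_fun (\<xi> * psd_sqrt n U)) (\<lambda>\<xi>. \<xi> \<in> carrier_mat d n) \<xi> \<and>
        measure_pmf.expectation (run k) (\<lambda>S. dual_fun (y_of S)) - dual_fun (\<xi> * psd_sqrt n U) \<le> \<epsilon>)"

definition iteration_complexity :: "real \<Rightarrow> nat" where
  "iteration_complexity \<epsilon> = (LEAST k. suboptimal \<epsilon> k)"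

definition gradient_complexity :: "real \<Rightarrow> real" where
  "gradient_complexity \<epsilon> =
     measure_pmf.expectation (run (iteration_complexity \<epsilon>)) (\<lambda>S. real (evals_of S))"

end

end

theory Submission
  imports Defs "Jordan_Normal_Form.Spectral_Radius"
begin

text \<open>Let \<open>S\<close> be the square root of the accelerated gossip matrix. In the coordinates \<open>\<xi>\<close> with
  \<open>x = \<xi> S\<close> the iteration is Nesterov's method with an inexact gradient for \<open>\<xi> \<mapsto> F\<^sup>*(\<xi> S)\<close>, which
  has modulus \<open>\<alpha>'\<close> and smoothness constant \<open>\<beta>'\<close> on the complement of the null space; by the
  Chebyshev bound \<open>\<zeta>(P\<^sub>K(U)) \<ge> 1 / 4\<close> its condition number is at most \<open>4 \<kappa>\<^sub>F\<close>. Step size and momentum are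
  tuned to the smaller modulus \<open>3 / 4 \<alpha>'\<close>. Then the Lyapunov function (dual gap plus a squared distance
  to the minimizer) contracts by \<open>1 - 1 / \<surd>(10 \<kappa>')\<close>, up to a multiple of the squared gradient error and with a
  negative multiple of \<open>\<parallel>x\<^sup>k\<^sup>+\<^sup>1 - x\<^sup>k\<parallel>\<^sup>2\<close> left over.

  The lazy condition bounds the communication error by a weighted sum of past movements
  \<open>\<parallel>x\<^sup>j\<^sup>+\<^sup>1 - x\<^sup>j\<parallel>\<^sup>2\<close>; Katyusha, warm started, contracts the local error by \<open>c / 2\<close>, so that error satisfies
  a geometric recursion driven by the same movements. As \<open>c\<close> and \<open>\<gamma>\<close> are at most of order \<open>\<alpha>' / (\<beta>' D)\<close>, damped by
  \<open>exp (- 2 D / \<surd>\<kappa>\<^sub>F)\<close> against the growth of the weights over a delay of \<open>D\<close> iterations, the negative term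
  absorbs all of these contributions.\<close>

no_notation inner (infixl \<open>\<bullet>\<close> 70)
no_notation vec_nth (infixl \<open>$\<close> 90)

section \<open>Symmetric real matrices\<close>

text \<open>The optimality claim concerns \<open>\<xi> sqrt U\<close>, the iteration the root of the
  accelerated matrix. Both matrices vanish exactly on the multiples of the ones vector, so both
  parametrizations have the same range, the matrices with zero row sums, and gap and minimizer can
  be compared there without coordinates. The obstacle is that neither error source contracts alone:
  the Katyusha target moves with \<open>x\<close>, and stale gradients depend on a whole window of
  the past. No one-step inequality closes; only after weighting iteration \<open>k\<close> with
  \<open>(1 / (1 - r)) ^ k\<close> and summing is everything a weighted sum of expected squared
  movements, in which the order of summation can be exchanged. The numbers fit because the Frobenius
  norm of the root dominates its spectral norm, so \<open>c\<close> and \<open>\<gamma>\<close>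
  carry a factor of at most \<open>\<alpha> / \<beta>\<close>, and
  \<open>28 / 1200 + 6 / 1200 + 6 / 288 < 1 / 10\<close>. The exponent
  \<open>2 / sqrt \<kappa>_F\<close> per iteration comes from
  \<open>1 / (1 - r) \<le> exp (2 * r)\<close> and
  \<open>r \<le> 1 / sqrt \<kappa>_F\<close>.\<close>

lemma symmetric_scalar_prod:
  fixes M :: "real mat"
  assumes "M \<in> carrier_mat n n" "transpose_mat M = M" "v \<in> carrier_vec n" "w \<in> carrier_vec n"
  shows "v \<bullet> (M *\<^sub>v w) = (M *\<^sub>v v) \<bullet> w"
  using transpose_vec_mult_scalar[of M n n w v] assms by simp

lemma scalar_prod_self_nonneg: "0 \<le> (v :: real vec) \<bullet> v"
  by (simp add: scalar_prod_def sum_nonneg)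

lemma scalar_prod_self_eq_0:
  fixes v :: "real vec"
  assumes "v \<in> carrier_vec n"
  shows "v \<bullet> v = 0 \<longleftrightarrow> v = 0\<^sub>v n"
proof
  assume "v \<bullet> v = 0"
  then have "\<forall>i\<in>{0..<n}. v $ i * v $ i = 0"
    using assms by (subst sum_nonneg_eq_0_iff[symmetric]) (auto simp: scalar_prod_def)
  then show "v = 0\<^sub>v n" using assms by (intro eq_vecI) auto
qed (use assms in auto)

text \<open>A complex eigenvector \<open>a + i b\<close> exists. Comparing
  \<open>b \<bullet> M a\<close> with \<open>M b \<bullet> a\<close> gives
  \<open>Im k * (a \<bullet> a + b \<bullet> b) = 0\<close>, so the eigenvalue is real and whichever
  of \<open>a\<close>, \<open>b\<close> is nonzero is a real eigenvector.\<close>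

lemma symmetric_real_eigenvector:
  fixes M :: "real mat"
  assumes M: "M \<in> carrier_mat n n" "transpose_mat M = M" and n: "n > 0"
  shows "\<exists>k v. v \<in> carrier_vec n \<and> v \<noteq> 0\<^sub>v n \<and> M *\<^sub>v v = k \<cdot>\<^sub>v v"
proof -
  define A where "A = map_mat complex_of_real M"
  have A: "A \<in> carrier_mat n n" using M by (auto simp: A_def)
  obtain k v where v: "v \<in> carrier_vec n" "v \<noteq> 0\<^sub>v n" and e: "A *\<^sub>v v = k \<cdot>\<^sub>v v"
    using spectrum_non_empty[OF A n] A by (auto simp: spectrum_def eigenvalue_def eigenvector_def)
  define a where "a = map_vec Re v"
  define b where "b = map_vec Im v"
  have ab: "a \<in> carrier_vec n" "b \<in> carrier_vec n" using v by (auto simp: a_def b_def)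
  have entry: "(\<Sum>j = 0..<n. complex_of_real (M $$ (i, j)) * v $ j) = k * v $ i" if "i < n" for i
  proof -
    have "(A *\<^sub>v v) $ i = (k \<cdot>\<^sub>v v) $ i" using e by simp
    then show ?thesis using that M v by (simp add: A_def scalar_prod_def)
  qed
  have Ma: "M *\<^sub>v a = Re k \<cdot>\<^sub>v a - Im k \<cdot>\<^sub>v b"
  proof (rule eq_vecI)
    fix i assume "i < dim_vec (Re k \<cdot>\<^sub>v a - Im k \<cdot>\<^sub>v b)"
    then have i: "i < n" using ab by simp
    from arg_cong[OF entry[OF i], of Re] show "(M *\<^sub>v a) $ i = (Re k \<cdot>\<^sub>v a - Im k \<cdot>\<^sub>v b) $ i"
      using i M v by (simp add: a_def b_def scalar_prod_def)
  qed (use M ab in auto)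
  have Mb: "M *\<^sub>v b = Re k \<cdot>\<^sub>v b + Im k \<cdot>\<^sub>v a"
  proof (rule eq_vecI)
    fix i assume "i < dim_vec (Re k \<cdot>\<^sub>v b + Im k \<cdot>\<^sub>v a)"
    then have i: "i < n" using ab by simp
    from arg_cong[OF entry[OF i], of Im] show "(M *\<^sub>v b) $ i = (Re k \<cdot>\<^sub>v b + Im k \<cdot>\<^sub>v a) $ i"
      using i M v by (simp add: a_def b_def scalar_prod_def)
  qed (use M ab in auto)
  have "b \<bullet> (M *\<^sub>v a) = (M *\<^sub>v b) \<bullet> a" by (rule symmetric_scalar_prod[OF M ab(2,1)])
  then have "Re k * (b \<bullet> a) - Im k * (b \<bullet> b) = Re k * (b \<bullet> a) + Im k * (a \<bullet> a)"
    using ab unfolding Ma Mb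
    by (simp add: scalar_prod_minus_distrib[of _ n] add_scalar_prod_distrib[of _ n])
  then have "Im k * (a \<bullet> a + b \<bullet> b) = 0" by (simp add: algebra_simps)
  moreover have "a \<bullet> a + b \<bullet> b \<noteq> 0"
  proof
    assume "a \<bullet> a + b \<bullet> b = 0"
    then have "a = 0\<^sub>v n" "b = 0\<^sub>v n"
      using scalar_prod_self_nonneg[of a] scalar_prod_self_nonneg[of b]
        scalar_prod_self_eq_0[OF ab(1)] scalar_prod_self_eq_0[OF ab(2)] by auto
    then have "Re (v $ i) = 0" "Im (v $ i) = 0" if "i < n" for i
      using that v index_map_vec(1)[of i v Re] index_map_vec(1)[of i v Im] by (auto simp: a_def b_def)
    then have "v = 0\<^sub>v n" using v by (intro eq_vecI) (auto simp: complex_eq_iff)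
    with v show False by simp
  qed
  ultimately have k: "Im k = 0" by simp
  have Ma': "M *\<^sub>v a = Re k \<cdot>\<^sub>v a" and Mb': "M *\<^sub>v b = Re k \<cdot>\<^sub>v b"
    unfolding Ma Mb k using ab by (auto simp: minus_vec_def plus_vec_def)
  show ?thesis
  proof (cases "a = 0\<^sub>v n")
    case False then show ?thesis using Ma' ab by blast
  next
    case True
    then have "b \<noteq> 0\<^sub>v n" using \<open>a \<bullet> a + b \<bullet> b \<noteq> 0\<close> ab by auto
    then show ?thesis using Mb' ab by blast
  qed
qed

text \<open>The Householder reflection; for \<open>q $ 0 = 1\<close> its coefficient is the junk value \<open>1 / 0 = 0\<close>.\<close>

lemma orthogonal_mat_with_first_col:
  fixes q :: "real vec"
  assumes q: "q \<in> carrier_vec n" "q \<bullet> q = 1" and n: "n > 0"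
  shows "\<exists>H \<in> carrier_mat n n. transpose_mat H = H \<and> H * H = 1\<^sub>m n \<and> col H 0 = q"
proof -
  define w where "w i = q $ i - (if i = 0 then 1 else 0)" for i
  define c where "c = 1 / (1 - q $ 0)"
  define H where "H = mat n n (\<lambda>(i, j). (if i = j then 1 else 0) - c * w i * w j)"
  have qq: "(\<Sum>i<n. (q $ i)\<^sup>2) = 1"
    using q by (simp add: scalar_prod_def power2_eq_square atLeast0LessThan)
  have "(\<Sum>i<n. (w i)\<^sup>2) = (\<Sum>i<n. (q $ i)\<^sup>2 + (if i = 0 then 1 - 2 * q $ 0 else 0))"
    by (rule sum.cong) (auto simp: w_def power2_eq_square algebra_simps)
  also have "\<dots> = 2 - 2 * q $ 0"
    using n unfolding sum.distrib qq by (simp add: sum.delta)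
  finally have ww: "(\<Sum>i<n. (w i)\<^sup>2) = 2 - 2 * q $ 0" .
  have w0: "w i = 0" if "q $ 0 = 1" "i < n" for i
  proof -
    have "\<forall>i\<in>{..<n}. (w i)\<^sup>2 = 0"
      using ww that by (subst sum_nonneg_eq_0_iff[symmetric]) auto
    then show ?thesis using that by simp
  qed
  have H: "H \<in> carrier_mat n n" "transpose_mat H = H" by (auto simp: H_def intro!: eq_matI)
  have "H * H = 1\<^sub>m n"
  proof (rule eq_matI)
    fix i j assume "i < dim_row (1\<^sub>m n :: real mat)" "j < dim_col (1\<^sub>m n :: real mat)"
    then have ij: "i < n" "j < n" by auto
    have "(H * H) $$ (i, j) = (\<Sum>k<n. ((if i = k then 1 else 0) - c * w i * w k) * ((if k = j then 1 else 0) - c * w k * w j))"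
      using ij by (simp add: H_def scalar_prod_def atLeast0LessThan)
    also have "\<dots> = (\<Sum>k<n. (if i = k then if k = j then 1 else 0 else 0) - (if k = j then c * w i * w k else 0)
        - (if i = k then c * w k * w j else 0) + c * c * w i * w j * (w k)\<^sup>2)"
      by (rule sum.cong) (auto simp: algebra_simps power2_eq_square)
    also have "\<dots> = (if i = j then 1 else 0) - c * w i * w j - c * w i * w j + c * c * w i * w j * (\<Sum>k<n. (w k)\<^sup>2)"
      using ij by (simp add: sum.distrib sum_subtractf sum.delta sum_distrib_left)
    also have "\<dots> = (if i = j then 1 else 0)"
    proof (cases "q $ 0 = 1")
      case True then show ?thesis using w0 ij by simp
    next
      case False
      then have "c * (2 - 2 * q $ 0) = 2" by (simp add: c_def field_simps)
      then have "c * c * w i * w j * (2 - 2 * q $ 0) = 2 * (c * w i * w j)"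
        by (metis (no_types, opaque_lifting) mult.assoc mult.commute)
      then show ?thesis unfolding ww by simp
    qed
    finally show "(H * H) $$ (i, j) = 1\<^sub>m n $$ (i, j)" using ij by simp
  qed (use H in auto)
  moreover have "col H 0 = q"
  proof (rule eq_vecI)
    fix i assume "i < dim_vec q"
    then have i: "i < n" using q by simp
    have "c * w i * w 0 = - w i"
    proof (cases "q $ 0 = 1")
      case True then show ?thesis using w0 i by simp
    next
      case False then show ?thesis by (simp add: c_def w_def[of 0] field_simps)
    qed
    then show "col H 0 $ i = q $ i" using i n by (simp add: H_def) (simp add: w_def)
  qed (use H q in auto)
  ultimately show ?thesis using H by blast
qed

text \<open>Induction on the dimension. Conjugation with a reflection \<open>H\<close> whose first
  column is a unit eigenvector makes the first column of \<open>H M H\<close> a multiple of the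
  first unit vector; by symmetry so is the first row, and the remaining block falls under the
  induction hypothesis.\<close>

theorem real_spectral_decomposition:
  fixes M :: "real mat"
  assumes "M \<in> carrier_mat n n" "transpose_mat M = M"
  shows "\<exists>Q e. Q \<in> carrier_mat n n \<and> transpose_mat Q * Q = 1\<^sub>m n \<and>
    M = Q * mat_diag n e * transpose_mat Q"
  using assms
proof (induction n arbitrary: M)
  case 0
  then show ?case by (intro exI[of _ "1\<^sub>m 0"] exI[of _ "\<lambda>_. 0"]) (auto intro!: eq_matI)
next
  case (Suc n)
  note M = Suc.prems
  obtain k v where v: "v \<in> carrier_vec (Suc n)" "v \<noteq> 0\<^sub>v (Suc n)" "M *\<^sub>v v = k \<cdot>\<^sub>v v"
    using symmetric_real_eigenvector[OF M] by auto
  define q where "q = (1 / sqrt (v \<bullet> v)) \<cdot>\<^sub>v v"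
  have pos: "v \<bullet> v > 0"
    using scalar_prod_self_nonneg[of v] scalar_prod_self_eq_0[OF v(1)] v(2) by linarith
  have q: "q \<in> carrier_vec (Suc n)" "q \<bullet> q = 1" "M *\<^sub>v q = k \<cdot>\<^sub>v q"
    using v pos M by (auto simp: q_def mult_mat_vec smult_smult_assoc mult.commute power2_eq_square[symmetric])
  obtain H where H: "H \<in> carrier_mat (Suc n) (Suc n)" "transpose_mat H = H" "H * H = 1\<^sub>m (Suc n)" "col H 0 = q"
    using orthogonal_mat_with_first_col[OF q(1,2)] by auto
  define N where "N = H * (M * H)"
  have "transpose_mat (M * H) = H * M"
    using transpose_mult[OF M(1) H(1)] H M by simp
  then have N: "N \<in> carrier_mat (Suc n) (Suc n)" "transpose_mat N = N"
    using H(1,2) M(1) transpose_mult[OF H(1), of "M * H" "Suc n"] by (auto simp: N_def)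
  have "col N 0 = H *\<^sub>v (M *\<^sub>v col H 0)"
    unfolding N_def by (simp add: col_mult2[OF H(1) mult_carrier_mat[OF M(1) H(1)]] col_mult2[OF M(1) H(1)]
        del: col_mult)
  also have "\<dots> = k \<cdot>\<^sub>v (H *\<^sub>v col H 0)"
    using H q by (simp add: mult_mat_vec[OF H(1) q(1)])
  \<comment> \<open>The reflection is its own inverse, so it sends its first column back to the
    first unit vector.\<close>
  also have "H *\<^sub>v col H 0 = col (H * H) 0" by (rule col_mult2[OF H(1) H(1), symmetric]) simp
  also have "\<dots> = unit_vec (Suc n) 0" using H(3) by simp
  finally have colN: "col N 0 = k \<cdot>\<^sub>v unit_vec (Suc n) 0" .
  have N0: "N $$ (i, 0) = (if i = 0 then k else 0)" if "i < Suc n" for i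
    using arg_cong[OF colN, of "\<lambda>x. x $ i"] that N by auto
  have N0': "N $$ (0, i) = (if i = 0 then k else 0)" if "i < Suc n" for i
  proof -
    have "N $$ (0, i) = transpose_mat N $$ (i, 0)" using that N(1) by simp
    then show ?thesis unfolding N(2) using N0[OF that] by simp
  qed
  define N' where "N' = mat n n (\<lambda>(i, j). N $$ (Suc i, Suc j))"
  have N'sym: "N $$ (Suc i, Suc j) = N $$ (Suc j, Suc i)" if "i < n" "j < n" for i j
  proof -
    have "N $$ (Suc i, Suc j) = transpose_mat N $$ (Suc j, Suc i)" using that N(1) by simp
    then show ?thesis unfolding N(2) .
  qed
  have N': "N' \<in> carrier_mat n n" "transpose_mat N' = N'"
    by (auto simp: N'_def N'sym intro!: eq_matI)
  obtain Q' e' where Q': "Q' \<in> carrier_mat n n" "transpose_mat Q' * Q' = 1\<^sub>m n"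
      "N' = Q' * mat_diag n e' * transpose_mat Q'"
    using Suc.IH[OF N'] by blast
  define G where "G = four_block_mat (1\<^sub>m 1) (0\<^sub>m 1 n) (0\<^sub>m n 1) Q'"
  define e where "e i = (if i = 0 then k else e' (i - 1))" for i
  have e: "mat_diag (Suc n) e = four_block_mat (mat 1 1 (\<lambda>_. k)) (0\<^sub>m 1 n) (0\<^sub>m n 1) (mat_diag n e')"
    by (rule eq_matI) (auto simp: mat_diag_def e_def)
  have NN: "N = four_block_mat (mat 1 1 (\<lambda>_. k)) (0\<^sub>m 1 n) (0\<^sub>m n 1) N'"
  proof (rule eq_matI)
    fix i j
    assume "i < dim_row (four_block_mat (mat 1 1 (\<lambda>_. k)) (0\<^sub>m 1 n) (0\<^sub>m n 1) N')"
      "j < dim_col (four_block_mat (mat 1 1 (\<lambda>_. k)) (0\<^sub>m 1 n) (0\<^sub>m n 1) N')"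
    then have "i < Suc n" "j < Suc n" using N' by auto
    then show "N $$ (i, j) = four_block_mat (mat 1 1 (\<lambda>_. k)) (0\<^sub>m 1 n) (0\<^sub>m n 1) N' $$ (i, j)"
      using N0[of i] N0'[of j] by (cases i; cases j) (auto simp: N'_def)
  qed (use N N' in auto)
  have G: "G \<in> carrier_mat (Suc n) (Suc n)" using Q' by (auto simp: G_def)
  have Gt: "transpose_mat G = four_block_mat (1\<^sub>m 1) (0\<^sub>m 1 n) (0\<^sub>m n 1) (transpose_mat Q')"
    using Q' by (simp add: G_def transpose_four_block_mat[of _ 1 1 _ n _ n])
  have GG: "transpose_mat G * G = 1\<^sub>m (Suc n)"
    unfolding Gt unfolding G_def using Q'
    by (subst mult_four_block_mat[of _ 1 1 _ n _ n _ _ 1 _ n]) (auto intro!: eq_matI)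
  have k1: "mat 1 1 (\<lambda>_. k) * 1\<^sub>m 1 = mat 1 1 (\<lambda>_. k)" "1\<^sub>m 1 * mat 1 1 (\<lambda>_. k) = mat 1 1 (\<lambda>_. k)"
    by (rule right_mult_one_mat[of _ 1], simp, rule left_mult_one_mat[of _ _ 1], simp)
  have GD: "G * mat_diag (Suc n) e = four_block_mat (mat 1 1 (\<lambda>_. k)) (0\<^sub>m 1 n) (0\<^sub>m n 1) (Q' * mat_diag n e')"
    unfolding e G_def using Q' k1 left_mult_zero_mat[OF mat_diag_dim[of n e'], of 1]
    by (subst mult_four_block_mat[of _ 1 1 _ n _ n _ _ 1 _ n]) (auto simp del: One_nat_def)
  have QD': "Q' * mat_diag n e' \<in> carrier_mat n n" using Q' mult_carrier_mat[OF Q'(1) mat_diag_dim] by simp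
  have NG: "N = G * mat_diag (Suc n) e * transpose_mat G"
    unfolding GD Gt NN Q'(3)
    using Q'(1) k1 QD' right_mult_zero_mat[OF QD', of 1] left_add_zero_mat[OF mult_carrier_mat[OF QD', of "transpose_mat Q'" n]]
    by (subst mult_four_block_mat[of _ 1 1 _ n _ n _ _ 1 _ n]) (auto simp del: One_nat_def)
  define Q where "Q = H * G"
  note as = assoc_mult_mat[of _ "Suc n" "Suc n" _ "Suc n" _ "Suc n"]
  have Q: "Q \<in> carrier_mat (Suc n) (Suc n)" using H G by (auto simp: Q_def)
  have Qt: "transpose_mat Q = transpose_mat G * H"
    using H G by (simp add: Q_def transpose_mult[of _ "Suc n" "Suc n"])
  have QQ: "transpose_mat Q * Q = 1\<^sub>m (Suc n)"
  proof -
    have "transpose_mat Q * Q = transpose_mat G * ((H * H) * G)"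
      unfolding Qt using H(1) G by (simp add: Q_def as)
    then show ?thesis using H(3) G GG by simp
  qed
  have "M = (H * H) * M * (H * H)" using M H by simp
  also have "\<dots> = H * N * H" unfolding N_def using M H(1) by (simp add: as)
  also have "\<dots> = Q * mat_diag (Suc n) e * transpose_mat Q"
  proof -
    define K where "K = mat_diag (Suc n) e"
    have K: "K \<in> carrier_mat (Suc n) (Suc n)" by (simp add: K_def)
    have Gt': "transpose_mat G \<in> carrier_mat (Suc n) (Suc n)" using G by simp
    note KG = mult_carrier_mat[OF K Gt'] and c = mult_carrier_mat[OF G mult_carrier_mat[OF K Gt']]
    show ?thesis
      unfolding NG Qt K_def[symmetric] using H(1) G K Gt' KG c by (simp add: Q_def as)
  qed
  finally show ?case using Q QQ by blast
qed


section \<open>Orthonormal eigenbases\<close>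

definition eigen_decomp :: "nat \<Rightarrow> real mat \<Rightarrow> real mat \<Rightarrow> (nat \<Rightarrow> real) \<Rightarrow> bool" where
  "eigen_decomp n M Q e \<longleftrightarrow> Q \<in> carrier_mat n n \<and> transpose_mat Q * Q = 1\<^sub>m n \<and>
     M = Q * mat_diag n e * transpose_mat Q"

lemma eigen_decomp_carrier:
  assumes "eigen_decomp n M Q e"
  shows "M \<in> carrier_mat n n" "Q \<in> carrier_mat n n" "i < n \<Longrightarrow> col Q i \<in> carrier_vec n"
    "Q * transpose_mat Q = 1\<^sub>m n"
  using assms mat_mult_left_right_inverse[of "transpose_mat Q" n Q] by (auto simp: eigen_decomp_def)

lemma eigen_decomp_orthonormal:
  assumes "eigen_decomp n M Q e" "i < n" "j < n"
  shows "col Q i \<bullet> col Q j = (if i = j then 1 else 0)"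
proof -
  have "(transpose_mat Q * Q) $$ (i, j) = (1\<^sub>m n :: real mat) $$ (i, j)"
    using assms by (simp add: eigen_decomp_def)
  then show ?thesis using eigen_decomp_carrier[OF assms(1)] assms(2,3) by auto
qed

lemma eigen_decomp_eigenvector:
  assumes "eigen_decomp n M Q e" "i < n"
  shows "M *\<^sub>v col Q i = e i \<cdot>\<^sub>v col Q i"
proof -
  have Q: "Q \<in> carrier_mat n n" "transpose_mat Q * Q = 1\<^sub>m n" and M: "M = Q * mat_diag n e * transpose_mat Q"
    using assms by (auto simp: eigen_decomp_def)
  have QD: "Q * mat_diag n e \<in> carrier_mat n n" using Q mat_diag_dim[of n e] by auto
  have "M * Q = Q * mat_diag n e"
    unfolding M using Q QD right_mult_one_mat[OF QD] by (simp add: assoc_mult_mat[of _ n n _ n Q n])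
  then have "col (M * Q) i = col (Q * mat_diag n e) i" by simp
  also have "col (Q * mat_diag n e) i = e i \<cdot>\<^sub>v col Q i"
    unfolding mat_diag_mult_right[OF Q(1)] using Q assms(2) by (intro eq_vecI) auto
  finally show ?thesis using eigen_decomp_carrier[OF assms(1)] Q assms(2) by (simp del: col_mult)
qed

text \<open>Reduces spectral claims to the action on one fixed basis. Roots, products, the
  pseudo-inverse and polynomials of a matrix can all share the same \<open>Q\<close>, and only their
  eigenvalue functions have to be compared.\<close>

lemma eigen_decompI:
  assumes Q: "Q \<in> carrier_mat n n" "transpose_mat Q * Q = 1\<^sub>m n" and M: "M \<in> carrier_mat n n"
    and e: "\<And>i. i < n \<Longrightarrow> M *\<^sub>v col Q i = e i \<cdot>\<^sub>v col Q i"
  shows "eigen_decomp n M Q e"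
proof -
  have "M * Q = Q * mat_diag n e"
  proof (rule mat_col_eqI)
    fix i assume "i < dim_col (Q * mat_diag n e)"
    then have i: "i < n" by (simp add: mat_diag_def)
    have "col (Q * mat_diag n e) i = e i \<cdot>\<^sub>v col Q i"
      unfolding mat_diag_mult_right[OF Q(1)] using Q i by (intro eq_vecI) auto
    then show "col (M * Q) i = col (Q * mat_diag n e) i" using e[OF i] M Q i by (simp del: col_mult)
  qed (use M Q in \<open>auto simp: mat_diag_def\<close>)
  then have "M * (Q * transpose_mat Q) = Q * mat_diag n e * transpose_mat Q"
    using M Q by (simp add: assoc_mult_mat[of M n n Q n _ n, symmetric])
  moreover have "Q * transpose_mat Q = 1\<^sub>m n"
    using mat_mult_left_right_inverse[of "transpose_mat Q" n Q] Q by auto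
  ultimately show ?thesis using M Q by (simp add: eigen_decomp_def)
qed

lemma eigen_decomp_exists:
  assumes "M \<in> carrier_mat n n" "transpose_mat M = M"
  obtains Q e where "eigen_decomp n M Q e"
  using real_spectral_decomposition[OF assms] by (auto simp: eigen_decomp_def)

lemma eigen_decomp_parseval:
  assumes Q: "eigen_decomp n M Q e" and v: "v \<in> carrier_vec n" "w \<in> carrier_vec n"
  shows "v \<bullet> w = (\<Sum>i<n. (col Q i \<bullet> v) * (col Q i \<bullet> w))"
proof -
  note C = eigen_decomp_carrier[OF Q]
  have "w = Q *\<^sub>v (transpose_mat Q *\<^sub>v w)"
    using C v by (simp add: assoc_mult_mat_vec[of Q n n _ n, symmetric])
  then have "v \<bullet> w = v \<bullet> (Q *\<^sub>v (transpose_mat Q *\<^sub>v w))" by simp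
  also have "\<dots> = (transpose_mat Q *\<^sub>v v) \<bullet> (transpose_mat Q *\<^sub>v w)"
    using C v by (simp add: transpose_vec_mult_scalar[of Q n n "transpose_mat Q *\<^sub>v w" v])
  also have "\<dots> = (\<Sum>i<n. (col Q i \<bullet> v) * (col Q i \<bullet> w))"
    using C v by (auto simp: scalar_prod_def[of "_ *\<^sub>v _"] atLeast0LessThan intro!: sum.cong)
  finally show ?thesis .
qed

lemma eigen_decomp_symmetric:
  assumes Q: "eigen_decomp n M Q e"
  shows "transpose_mat M = M"
proof -
  have Qc: "Q \<in> carrier_mat n n" and M: "M = Q * mat_diag n e * transpose_mat Q"
    using Q by (auto simp: eigen_decomp_def)
  have "transpose_mat (mat_diag n e) = mat_diag n e"
    by (rule eq_matI) (auto simp: mat_diag_def)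
  then have "transpose_mat (Q * mat_diag n e) = mat_diag n e * transpose_mat Q"
    using transpose_mult[OF Qc mat_diag_dim] by simp
  moreover have "transpose_mat M = transpose_mat (transpose_mat Q) * transpose_mat (Q * mat_diag n e)"
    unfolding M using Qc mult_carrier_mat[OF Qc mat_diag_dim]
    by (intro transpose_mult[of _ n n _ n]) auto
  ultimately show ?thesis
    unfolding M using Qc mat_diag_dim[of n e] by (simp add: assoc_mult_mat[of _ n n _ n _ n])
qed

lemma eigen_decomp_quadratic_form:
  assumes Q: "eigen_decomp n M Q e" and v: "v \<in> carrier_vec n"
  shows "v \<bullet> (M *\<^sub>v v) = (\<Sum>i<n. e i * (col Q i \<bullet> v)\<^sup>2)"
proof -
  note C = eigen_decomp_carrier[OF Q]
  have "col Q i \<bullet> (M *\<^sub>v v) = e i * (col Q i \<bullet> v)" if i: "i < n" for i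
    using symmetric_scalar_prod[OF C(1) eigen_decomp_symmetric[OF Q] C(3)[OF i] v]
      eigen_decomp_eigenvector[OF Q i] C(3)[OF i] v by simp
  then show ?thesis
    using C v by (subst eigen_decomp_parseval[OF Q v(1)])
      (auto intro!: sum.cong simp: power2_eq_square mult_ac)
qed

section \<open>The ordered list of eigenvalues\<close>

lemma char_poly_eigen_decomp:
  assumes "eigen_decomp n M Q e"
  shows "char_poly M = (\<Prod>x\<leftarrow>map e [0..<n]. [:- x, 1:])"
proof -
  have "similar_mat M (mat_diag n e)"
  proof (rule similar_matI)
    show "M = Q * mat_diag n e * transpose_mat Q" using assms unfolding eigen_decomp_def by blast
    show "{M, mat_diag n e, Q, transpose_mat Q} \<subseteq> carrier_mat n n"
      using eigen_decomp_carrier[OF assms] by auto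
    show "Q * transpose_mat Q = 1\<^sub>m n" "transpose_mat Q * Q = 1\<^sub>m n"
      using assms eigen_decomp_carrier[OF assms] by (auto simp: eigen_decomp_def)
  qed
  then have "char_poly M = char_poly (mat_diag n e)" by (rule char_poly_similar)
  also have "\<dots> = (\<Prod>x\<leftarrow>diag_mat (mat_diag n e). [:- x, 1:])"
    by (rule char_poly_upper_triangular[of _ n]) (auto simp: mat_diag_def)
  also have "diag_mat (mat_diag n e) = map e [0..<n]"
    by (auto simp: diag_mat_def mat_diag_def)
  finally show ?thesis .
qed

lemma mset_roots_eq:
  fixes xs ys :: "real list"
  assumes "(\<Prod>x\<leftarrow>xs. [:- x, 1:]) = (\<Prod>x\<leftarrow>ys. [:- x, 1:])"
  shows "mset xs = mset ys"
proof -
  have "proots (\<Prod>x\<leftarrow>xs. [:- x, 1:]) = mset xs" for xs :: "real list"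
  proof (induction xs)
    case (Cons a xs)
    have "(0 :: real poly) \<notin> set (map (\<lambda>x. [:- x, 1:]) xs)" by auto
    then have nz: "(\<Prod>x\<leftarrow>xs. [:- x, 1:]) \<noteq> (0 :: real poly)" by (simp only: prod_list_zero_iff not_False_eq_True)
    have "proots (\<Prod>x\<leftarrow>a # xs. [:- x, 1:]) = proots [:- a, 1:] + proots (\<Prod>x\<leftarrow>xs. [:- x, 1:])"
      unfolding list.map prod_list.Cons by (rule proots_mult[OF _ nz]) simp
    then show ?case unfolding Cons by simp
  qed simp
  then show ?thesis using assms by metis
qed

text \<open>Resolves the definite description: the characteristic polynomial determines the multiset
  of its linear factors, and a sorted list is determined by its multiset.\<close>

lemma eigenvalues_desc_eigen_decomp:
  assumes "eigen_decomp n M Q e"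
  shows "eigenvalues_desc M = rev (sort (map e [0..<n]))"
  unfolding eigenvalues_desc_def
proof (rule the_equality, intro conjI)
  show "sorted_wrt (\<ge>) (rev (sort (map e [0..<n])))"
    by (simp add: sorted_wrt_rev)
  have perm: "prod_mset (mset (map (\<lambda>x. [:- x, 1:]) (rev (sort (map e [0..<n]))))) =
      prod_mset (mset (map (\<lambda>x. [:- x, 1:]) (map e [0..<n])))"
    by (simp only: mset_map mset_rev mset_sort)
  show "char_poly M = (\<Prod>x\<leftarrow>rev (sort (map e [0..<n])). [:- x, 1:])"
    unfolding char_poly_eigen_decomp[OF assms] using perm by (simp only: prod_mset_prod_list)
next
  fix xs assume xs: "sorted_wrt (\<ge>) xs \<and> char_poly M = (\<Prod>x\<leftarrow>xs. [:- x, 1:])"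
  then have "mset (map e [0..<n]) = mset (rev xs)"
    using mset_roots_eq char_poly_eigen_decomp[OF assms] by (metis mset_rev)
  moreover have "sorted (rev xs)" using xs by (simp add: sorted_wrt_rev)
  ultimately have "sort (map e [0..<n]) = rev xs" by (metis properties_for_sort)
  then show "xs = rev (sort (map e [0..<n]))" by simp
qed

section \<open>Square roots of positive semidefinite matrices\<close>

lemma psd_mat_carrier: "psd_mat n M \<Longrightarrow> M \<in> carrier_mat n n"
  and psd_mat_symmetric: "psd_mat n M \<Longrightarrow> transpose_mat M = M"
  by (auto simp: psd_mat_def)

lemma psd_mat_eigenvalue_nonneg:
  assumes "psd_mat n M" "eigen_decomp n M Q e" "i < n"
  shows "0 \<le> e i"
proof -
  have "0 \<le> col Q i \<bullet> (M *\<^sub>v col Q i)"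
    using assms eigen_decomp_carrier[OF assms(2)] by (auto simp: psd_mat_def)
  then show ?thesis
    using eigen_decomp_eigenvector[OF assms(2,3)] eigen_decomp_orthonormal[OF assms(2,3,3)]
      eigen_decomp_carrier(3)[OF assms(2,3)] by simp
qed

lemma psd_mat_sqrt_exists:
  assumes "psd_mat n M"
  shows "\<exists>S. psd_mat n S \<and> S * S = M"
proof -
  obtain Q e where Q: "eigen_decomp n M Q e"
    using eigen_decomp_exists assms psd_mat_carrier psd_mat_symmetric by metis
  note C = eigen_decomp_carrier[OF Q]
  define S where "S = Q * mat_diag n (\<lambda>i. sqrt (e i)) * transpose_mat Q"
  have S: "eigen_decomp n S Q (\<lambda>i. sqrt (e i))"
    using Q by (simp add: eigen_decomp_def S_def)
  have "0 \<le> v \<bullet> (S *\<^sub>v v)" if "v \<in> carrier_vec n" for v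
    using psd_mat_eigenvalue_nonneg[OF assms Q]
    by (auto simp: eigen_decomp_quadratic_form[OF S that] intro!: sum_nonneg)
  then have psd: "psd_mat n S"
    using eigen_decomp_carrier(1)[OF S] eigen_decomp_symmetric[OF S] by (simp add: psd_mat_def)
  have "(S * S) *\<^sub>v col Q i = e i \<cdot>\<^sub>v col Q i" if i: "i < n" for i
    using eigen_decomp_carrier(1)[OF S] C(3)[OF i] eigen_decomp_eigenvector[OF S i]
      psd_mat_eigenvalue_nonneg[OF assms Q i]
    by (simp add: assoc_mult_mat_vec[of _ n n _ n] mult_mat_vec[of _ n n] smult_smult_assoc)
  then have "eigen_decomp n (S * S) Q e"
    using eigen_decomp_carrier(1)[OF S] Q by (intro eigen_decompI) (auto simp: eigen_decomp_def)
  then have "S * S = M" using Q by (simp add: eigen_decomp_def)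
  with psd show ?thesis by blast
qed

text \<open>\<open>T\<close> must act on each eigenvector \<open>q\<close> of \<open>S\<close> as
  \<open>S\<close> does. If \<open>e i > 0\<close>, the defect \<open>w = T q - e i q\<close>
  satisfies \<open>T w = - e i w\<close>, which positivity of \<open>T\<close> allows only for
  \<open>w = 0\<close>; if \<open>e i = 0\<close>, then \<open>T q\<close> has squared norm
  \<open>q \<bullet> T (T q) = 0\<close>.\<close>

lemma psd_mat_sqrt_unique:
  assumes S: "psd_mat n S" and T: "psd_mat n T" and eq: "S * S = T * T"
  shows "S = T"
proof -
  obtain Q e where Q: "eigen_decomp n S Q e"
    using eigen_decomp_exists S psd_mat_carrier psd_mat_symmetric by metis
  note C = eigen_decomp_carrier[OF Q] and Tc = psd_mat_carrier[OF T]
  have "T *\<^sub>v col Q i = e i \<cdot>\<^sub>v col Q i" if i: "i < n" for i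
  proof -
    define q where "q = col Q i"
    have q: "q \<in> carrier_vec n" "S *\<^sub>v q = e i \<cdot>\<^sub>v q"
      using C(3)[OF i] eigen_decomp_eigenvector[OF Q i] by (auto simp: q_def)
    have Tq: "T *\<^sub>v q \<in> carrier_vec n" using Tc q by simp
    have "T *\<^sub>v (T *\<^sub>v q) = (S * S) *\<^sub>v q" unfolding eq using Tc q by simp
    also have "\<dots> = e i \<cdot>\<^sub>v (e i \<cdot>\<^sub>v q)"
      using C(1) q by (simp add: assoc_mult_mat_vec[of _ n n _ n] mult_mat_vec[of _ n n])
    finally have TT: "T *\<^sub>v (T *\<^sub>v q) = e i \<cdot>\<^sub>v (e i \<cdot>\<^sub>v q)" .
    show ?thesis
    proof (cases "e i = 0")
      case True
      have "(T *\<^sub>v q) \<bullet> (T *\<^sub>v q) = q \<bullet> (T *\<^sub>v (T *\<^sub>v q))"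
        using symmetric_scalar_prod[OF Tc psd_mat_symmetric[OF T] q(1) Tq] by simp
      also have "\<dots> = 0" unfolding TT True using q by simp
      finally have "T *\<^sub>v q = 0\<^sub>v n" using scalar_prod_self_eq_0[OF Tq] by simp
      then show ?thesis using True q C by (intro eq_vecI) (auto simp: q_def)
    next
      case False
      then have pos: "e i > 0" using psd_mat_eigenvalue_nonneg[OF S Q i] by simp
      define w where "w = T *\<^sub>v q - e i \<cdot>\<^sub>v q"
      have w: "w \<in> carrier_vec n" using Tq q by (simp add: w_def)
      have "T *\<^sub>v w = T *\<^sub>v (T *\<^sub>v q) - T *\<^sub>v (e i \<cdot>\<^sub>v q)"
        unfolding w_def using Tc Tq q by (intro mult_minus_distrib_mat_vec[of _ n n]) auto
      also have "\<dots> = e i \<cdot>\<^sub>v (e i \<cdot>\<^sub>v q) - e i \<cdot>\<^sub>v (T *\<^sub>v q)"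
        unfolding TT using Tc q by (simp add: mult_mat_vec[of _ n n])
      also have "\<dots> = (- e i) \<cdot>\<^sub>v w"
        unfolding w_def using Tc q Tq by (intro eq_vecI) (auto simp: algebra_simps)
      finally have "w \<bullet> (T *\<^sub>v w) = - e i * (w \<bullet> w)" using w by simp
      moreover have "0 \<le> w \<bullet> (T *\<^sub>v w)" using T w by (auto simp: psd_mat_def)
      ultimately have "e i * (w \<bullet> w) \<le> 0" by simp
      then have "w \<bullet> w = 0"
        using pos scalar_prod_self_nonneg[of w] by (auto simp: mult_le_0_iff)
      then have "w = 0\<^sub>v n" using scalar_prod_self_eq_0[OF w] by simp
      show ?thesis
      proof (rule eq_vecI)
        fix j assume "j < dim_vec (e i \<cdot>\<^sub>v col Q i)"
        then have j: "j < n" using C by simp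
        have "w $ j = 0" using \<open>w = 0\<^sub>v n\<close> j by simp
        then show "(T *\<^sub>v col Q i) $ j = (e i \<cdot>\<^sub>v col Q i) $ j"
          using j q Tq C by (simp add: w_def q_def)
      qed (use Tc C in auto)
    qed
  qed
  then have "eigen_decomp n T Q e"
    using Q Tc by (intro eigen_decompI) (auto simp: eigen_decomp_def)
  then show ?thesis using Q by (simp add: eigen_decomp_def)
qed

lemma psd_sqrt:
  assumes "psd_mat n M"
  shows "psd_mat n (psd_sqrt n M)" "psd_sqrt n M * psd_sqrt n M = M"
proof -
  have "\<exists>!S. psd_mat n S \<and> S * S = M"
    using psd_mat_sqrt_exists[OF assms] psd_mat_sqrt_unique by metis
  from theI'[OF this] show "psd_mat n (psd_sqrt n M)" "psd_sqrt n M * psd_sqrt n M = M"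
    by (simp_all add: psd_sqrt_def)
qed

section \<open>Gossip matrices\<close>

definition ones_vec :: "nat \<Rightarrow> real vec" where
  "ones_vec n = vec n (\<lambda>_. 1)"

text \<open>The interface shared by \<open>1 - W\<close> and its Chebyshev acceleration; eigenvalue
  bounds, roots and pseudo-inverses are proved once for both.\<close>

definition gossip_mat :: "nat \<Rightarrow> real mat \<Rightarrow> bool" where
  "gossip_mat n M \<longleftrightarrow> n \<ge> 2 \<and> psd_mat n M \<and>
     (\<forall>v\<in>carrier_vec n. M *\<^sub>v v = 0\<^sub>v n \<longleftrightarrow> (\<exists>a. v = a \<cdot>\<^sub>v ones_vec n))"

lemma ones_vec_carrier [simp]: "ones_vec n \<in> carrier_vec n"
  and ones_vec_self: "ones_vec n \<bullet> ones_vec n = real n"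
  by (auto simp: ones_vec_def scalar_prod_def)

lemma gossip_network_gossip_mat:
  assumes "gossip_network n E W" "n \<ge> 2"
  shows "gossip_mat n (1\<^sub>m n - W)"
proof -
  have W: "W \<in> carrier_mat n n" and psd: "psd_mat n (1\<^sub>m n - W)"
    and ker: "mat_kernel (1\<^sub>m n - W) = range (\<lambda>a. a \<cdot>\<^sub>v ones_vec n)"
    using assms by (auto simp: gossip_network_def ones_vec_def)
  have "(1\<^sub>m n - W) *\<^sub>v v = 0\<^sub>v n \<longleftrightarrow> v \<in> mat_kernel (1\<^sub>m n - W)" if "v \<in> carrier_vec n" for v
    using that W by (auto simp: mat_kernel_def)
  then show ?thesis using assms psd unfolding gossip_mat_def ker by auto
qed

lemma eigen_decomp_symmetric_scalar_prod:
  assumes Q: "eigen_decomp n M Q e" and v: "v \<in> carrier_vec n" and i: "i < n"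
  shows "col Q i \<bullet> (M *\<^sub>v v) = e i * (col Q i \<bullet> v)"
  using symmetric_scalar_prod[OF eigen_decomp_carrier(1)[OF Q] eigen_decomp_symmetric[OF Q]
      eigen_decomp_carrier(3)[OF Q i] v]
    eigen_decomp_eigenvector[OF Q i] eigen_decomp_carrier(3)[OF Q i] v by simp

lemma eigen_decomp_nontrivial_component:
  assumes Q: "eigen_decomp n M Q e" and v: "v \<in> carrier_vec n" "v \<noteq> 0\<^sub>v n"
  obtains i where "i < n" "col Q i \<bullet> v \<noteq> 0"
proof -
  have "v \<bullet> v \<noteq> 0" using v scalar_prod_self_eq_0 by blast
  then have "(\<Sum>i<n. (col Q i \<bullet> v) * (col Q i \<bullet> v)) \<noteq> 0"
    using eigen_decomp_parseval[OF Q v(1) v(1)] by simp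
  then obtain i where "i \<in> {..<n}" "(col Q i \<bullet> v) * (col Q i \<bullet> v) \<noteq> 0"
    by (meson sum.neutral)
  then show ?thesis using that by auto
qed

text \<open>The ones vector has a nonzero component along some basis column, whose eigenvalue must
  then be 0. Every column with eigenvalue 0 is a multiple of the ones vector, and two orthonormal
  columns cannot both be.\<close>

lemma gossip_mat_null_index:
  assumes M: "gossip_mat n M" and Q: "eigen_decomp n M Q e"
  obtains i0 where "i0 < n" "e i0 = 0" "\<And>i. i < n \<Longrightarrow> i \<noteq> i0 \<Longrightarrow> 0 < e i"
    "\<And>v. v \<in> carrier_vec n \<Longrightarrow> v \<bullet> ones_vec n = 0 \<Longrightarrow> col Q i0 \<bullet> v = 0"
proof -
  note C = eigen_decomp_carrier[OF Q]
  have n: "n \<ge> 2" and psd: "psd_mat n M"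
    and ker: "\<And>v. v \<in> carrier_vec n \<Longrightarrow> M *\<^sub>v v = 0\<^sub>v n \<longleftrightarrow> (\<exists>a. v = a \<cdot>\<^sub>v ones_vec n)"
    using M by (auto simp: gossip_mat_def)
  have "ones_vec n \<bullet> ones_vec n \<noteq> 0" unfolding ones_vec_self using n by simp
  then have "ones_vec n \<noteq> 0\<^sub>v n"
    using scalar_prod_self_eq_0[OF ones_vec_carrier[of n]] by blast
  then obtain i0 where i0: "i0 < n" "col Q i0 \<bullet> ones_vec n \<noteq> 0"
    using eigen_decomp_nontrivial_component[OF Q ones_vec_carrier] by metis
  have "M *\<^sub>v ones_vec n = 0\<^sub>v n"
    using ker[OF ones_vec_carrier] by (metis one_smult_vec)
  then have "e i0 = 0"
    using eigen_decomp_symmetric_scalar_prod[OF Q ones_vec_carrier i0(1)] i0 C(3)[OF i0(1)] by simp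
  have mult: "\<exists>a. col Q i = a \<cdot>\<^sub>v ones_vec n" if "i < n" "e i = 0" for i
  proof -
    have "M *\<^sub>v col Q i = 0\<^sub>v n"
      unfolding eigen_decomp_eigenvector[OF Q that(1)] that(2)
      using C(3)[OF that(1)] C(2) by (intro eq_vecI) auto
    then show ?thesis using ker[OF C(3)[OF that(1)]] by simp
  qed
  obtain a where a: "col Q i0 = a \<cdot>\<^sub>v ones_vec n" using mult i0 \<open>e i0 = 0\<close> by blast
  show ?thesis
  proof (rule that[OF i0(1) \<open>e i0 = 0\<close>])
    fix i assume i: "i < n" "i \<noteq> i0"
    have "e i \<noteq> 0"
    proof
      assume "e i = 0"
      then obtain b where b: "col Q i = b \<cdot>\<^sub>v ones_vec n" using mult i by blast
      have "col Q i \<bullet> col Q i = 1" "col Q i0 \<bullet> col Q i0 = 1" "col Q i \<bullet> col Q i0 = 0"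
        using eigen_decomp_orthonormal[OF Q] i i0(1) by auto
      then show False
        unfolding a b by (auto simp: smult_scalar_prod_distrib[of _ n] ones_vec_self)
    qed
    then show "0 < e i" using psd_mat_eigenvalue_nonneg[OF psd Q i(1)] by simp
  next
    fix v assume "v \<in> carrier_vec n" "v \<bullet> ones_vec n = 0"
    then show "col Q i0 \<bullet> v = 0"
      unfolding a by (simp add: comm_scalar_prod[of v n])
  qed
qed

text \<open>The eigenvalues are nonnegative, so the last entry of the decreasing list is the 0
  belonging to the ones vector. Removing this one occurrence leaves the multiset of positive
  eigenvalues, so entry \<open>n - 1\<close> counted from 1, which is entry \<open>n - 2\<close> of
  the list, is the least positive one.\<close>

lemma gossip_mat_eigenvalue_bounds:
  assumes M: "gossip_mat n M" and Q: "eigen_decomp n M Q e"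
  defines "lo \<equiv> eigenvalue_desc M (n - 1)" and "hi \<equiv> eigenvalue_desc M 1"
  shows "0 < lo" "\<And>i. i < n \<Longrightarrow> e i \<noteq> 0 \<Longrightarrow> lo \<le> e i" "\<And>i. i < n \<Longrightarrow> e i \<le> hi"
    "\<exists>i<n. e i = lo" "\<exists>i<n. e i = hi"
proof -
  have n: "n \<ge> 2" using M by (simp add: gossip_mat_def)
  obtain i0 where i0: "i0 < n" "e i0 = 0" "\<And>i. i < n \<Longrightarrow> i \<noteq> i0 \<Longrightarrow> 0 < e i"
    using gossip_mat_null_index[OF M Q] by metis
  define xs where "xs = eigenvalues_desc M"
  have xs: "xs = rev (sort (map e [0..<n]))"
    unfolding xs_def by (rule eigenvalues_desc_eigen_decomp[OF Q])
  have len: "length xs = n" and set: "set xs = e ` {..<n}" by (auto simp: xs)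
  have anti: "xs ! j \<le> xs ! i" if "i \<le> j" "j < n" for i j
  proof -
    have "sorted_wrt (\<ge>) xs" by (simp add: xs sorted_wrt_rev)
    then show ?thesis using that len by (cases "i = j") (auto simp: sorted_wrt_iff_nth_less)
  qed
  have lo: "lo = xs ! (n - 2)" and hi: "hi = xs ! 0"
    using n by (simp_all add: lo_def hi_def eigenvalue_desc_def xs_def numeral_2_eq_2 del: One_nat_def)
  have last: "xs ! (n - 1) = 0"
  proof -
    have "0 \<in> set xs" using i0 by (auto simp: set)
    then obtain j where "j < n" "xs ! j = 0" using len by (auto simp: in_set_conv_nth)
    then have "xs ! (n - 1) \<le> 0" using anti[of j "n - 1"] n by auto
    moreover have "xs ! (n - 1) \<in> set xs" using len n by auto
    then have "xs ! (n - 1) \<ge> 0" using i0 unfolding set by (metis imageE lessThan_iff less_imp_le order_refl)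
    ultimately show ?thesis by simp
  qed
  have xsb: "xs = butlast xs @ [0]"
    using last len n by (metis append_butlast_last_id last_conv_nth length_0_conv not_numeral_le_zero)
  have "mset xs = image_mset e (mset_set {..<n})"
    by (simp add: xs atLeast0LessThan)
  also have "\<dots> = add_mset 0 (image_mset e (mset_set ({..<n} - {i0})))"
    using i0 by (simp add: mset_set.remove[of "{..<n}" i0])
  finally have "mset (butlast xs) = image_mset e (mset_set ({..<n} - {i0}))"
    by (subst (asm) xsb) simp
  then have bl: "set (butlast xs) = e ` ({..<n} - {i0})"
    by (metis finite_Diff finite_lessThan finite_set_mset_mset_set set_image_mset set_mset_mset)
  have lo_in: "lo \<in> set (butlast xs)"
  proof -
    have "n - 2 < length (butlast xs)" using len n by simp
    then show ?thesis using nth_mem nth_butlast lo by metis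
  qed
  then obtain i where "i < n" "i \<noteq> i0" "e i = lo" unfolding bl by auto
  then show "0 < lo" "\<exists>i<n. e i = lo" using i0 by auto
  show "\<exists>i<n. e i = hi" using hi set len n nth_mem[of 0 xs] by (auto simp: image_iff)
  show "e i \<le> hi" if "i < n" for i
  proof -
    have "e i \<in> set xs" using that by (auto simp: set)
    then obtain j where "j < n" "xs ! j = e i" using len by (auto simp: in_set_conv_nth)
    then show ?thesis using anti[of 0 j] by (simp add: hi)
  qed
  show "lo \<le> e i" if "i < n" "e i \<noteq> 0" for i
  proof -
    have "e i \<in> set (butlast xs)" using that i0 unfolding bl by auto
    then obtain j where "j < length (butlast xs)" "butlast xs ! j = e i" by (auto simp: in_set_conv_nth)
    then have "j < n - 1" "xs ! j = e i" using len by (auto simp: nth_butlast)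
    then show ?thesis using anti[of j "n - 2"] unfolding lo by auto
  qed
qed

lemma gossip_mat_decomp:
  assumes "gossip_mat n M"
  obtains Q e where "eigen_decomp n M Q e"
  using assms eigen_decomp_exists psd_mat_carrier psd_mat_symmetric unfolding gossip_mat_def by metis

lemma gossip_mat_eigenvalues_order:
  assumes "gossip_mat n M"
  shows "0 < eigenvalue_desc M (n - 1)" "eigenvalue_desc M (n - 1) \<le> eigenvalue_desc M 1"
  using gossip_mat_decomp[OF assms] gossip_mat_eigenvalue_bounds[OF assms] by metis+

lemma gossip_mat_quadratic_le:
  assumes M: "gossip_mat n M" and v: "v \<in> carrier_vec n"
  shows "v \<bullet> (M *\<^sub>v v) \<le> eigenvalue_desc M 1 * (v \<bullet> v)"
proof -
  obtain Q e where Q: "eigen_decomp n M Q e" using gossip_mat_decomp[OF M] .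
  show ?thesis
    unfolding eigen_decomp_quadratic_form[OF Q v] eigen_decomp_parseval[OF Q v v] sum_distrib_left
    using gossip_mat_eigenvalue_bounds(3)[OF M Q]
    by (intro sum_mono) (auto simp: power2_eq_square[symmetric] intro!: mult_right_mono)
qed

lemma gossip_mat_quadratic_ge:
  assumes M: "gossip_mat n M" and v: "v \<in> carrier_vec n" "v \<bullet> ones_vec n = 0"
  shows "eigenvalue_desc M (n - 1) * (v \<bullet> v) \<le> v \<bullet> (M *\<^sub>v v)"
proof -
  obtain Q e where Q: "eigen_decomp n M Q e" using gossip_mat_decomp[OF M] .
  obtain i0 where i0: "i0 < n" "\<And>i. i < n \<Longrightarrow> i \<noteq> i0 \<Longrightarrow> 0 < e i" "col Q i0 \<bullet> v = 0"
    using gossip_mat_null_index[OF M Q] v by metis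
  have "eigenvalue_desc M (n - 1) * ((col Q i \<bullet> v) * (col Q i \<bullet> v)) \<le> e i * (col Q i \<bullet> v)\<^sup>2" if "i < n" for i
  proof (cases "i = i0")
    case False
    then have "eigenvalue_desc M (n - 1) \<le> e i"
      using gossip_mat_eigenvalue_bounds(2)[OF M Q that] i0(2)[OF that] by auto
    then show ?thesis by (auto simp: power2_eq_square[symmetric] intro!: mult_right_mono)
  qed (use i0 in simp)
  then show ?thesis
    unfolding eigen_decomp_quadratic_form[OF Q v(1)] eigen_decomp_parseval[OF Q v(1) v(1)] sum_distrib_left
    by (intro sum_mono) auto
qed

lemma gossip_mat_ones:
  assumes "gossip_mat n M"
  shows "M *\<^sub>v ones_vec n = 0\<^sub>v n"
  using assms unfolding gossip_mat_def by (metis one_smult_vec ones_vec_carrier)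

section \<open>The accelerated gossip matrix\<close>

lemma smult_mat_mult_vec:
  fixes A :: "real mat"
  assumes "A \<in> carrier_mat nr nc" "v \<in> carrier_vec nc"
  shows "(a \<cdot>\<^sub>m A) *\<^sub>v v = a \<cdot>\<^sub>v (A *\<^sub>v v)"
  using assms by (intro eq_vecI) (auto simp: scalar_prod_def sum_distrib_left mult_ac)

lemma poly_mat_eigenvector:
  assumes A: "A \<in> carrier_mat n n" and v: "v \<in> carrier_vec n" "A *\<^sub>v v = l \<cdot>\<^sub>v v"
  shows "poly_mat n p A \<in> carrier_mat n n \<and> poly_mat n p A *\<^sub>v v = poly p l \<cdot>\<^sub>v v"
proof (induction p)
  case 0
  then show ?case using v by (auto simp: poly_mat_def)
next
  case (pCons a p)
  have eq: "poly_mat n (pCons a p) A = a \<cdot>\<^sub>m 1\<^sub>m n + A * poly_mat n p A"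
    using pCons.hyps by (auto simp: poly_mat_def)
  have "(A * poly_mat n p A) *\<^sub>v v = A *\<^sub>v (poly p l \<cdot>\<^sub>v v)"
    using A v pCons by (simp add: assoc_mult_mat_vec[of A n n _ n])
  also have "\<dots> = (poly p l * l) \<cdot>\<^sub>v v"
    using A v by (simp add: mult_mat_vec[of A n n] smult_smult_assoc)
  finally have "(a \<cdot>\<^sub>m 1\<^sub>m n + A * poly_mat n p A) *\<^sub>v v = a \<cdot>\<^sub>v v + (poly p l * l) \<cdot>\<^sub>v v"
    using A v pCons by (simp add: add_mult_distrib_mat_vec[of _ n n] smult_mat_mult_vec[of _ n n])
  also have "\<dots> = poly (pCons a p) l \<cdot>\<^sub>v v"
    using v by (intro eq_vecI) (auto simp: algebra_simps)
  finally show ?case unfolding eq using A pCons by auto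
qed

text \<open>On \<open>[-1, 1]\<close> the recursion is that of the multiple-angle cosine, via
  \<open>x = cos t\<close>.\<close>

lemma chebyshev_T_bound:
  assumes "\<bar>x\<bar> \<le> 1"
  shows "\<bar>poly (chebyshev_T k) x\<bar> \<le> 1"
proof -
  define t where "t = arccos x"
  have x: "x = cos t" using assms by (simp add: t_def cos_arccos_abs)
  have "poly (chebyshev_T k) x = cos (real k * t)"
  proof (induction k rule: chebyshev_T.induct)
    case (3 k)
    have "cos (real k * t) + cos (real (Suc (Suc k)) * t) = 2 * cos t * cos (real (Suc k) * t)"
      using cos_plus_cos[of "real (Suc (Suc k)) * t" "real k * t"]
      by (simp add: algebra_simps add_divide_distrib diff_divide_distrib)
    then show ?case using 3 by (simp add: x)
  qed (simp_all add: x)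
  then show ?thesis by simp
qed

text \<open>The counterpart of the cosine formula outside \<open>[-1, 1]\<close>; it gives the
  growth of the normalizing denominator at \<open>c2 > 1\<close>.\<close>

lemma chebyshev_T_joukowski:
  fixes w :: real
  assumes "w \<noteq> 0"
  shows "poly (chebyshev_T k) ((w + 1 / w) / 2) = (w ^ k + 1 / w ^ k) / 2"
proof (induction k rule: chebyshev_T.induct)
  case (3 k)
  let ?x = "(w + 1 / w) / 2"
  have "poly (chebyshev_T (Suc (Suc k))) ?x = 2 * ?x * poly (chebyshev_T (Suc k)) ?x - poly (chebyshev_T k) ?x"
    by simp
  also have "\<dots> = 2 * ?x * ((w ^ Suc k + 1 / w ^ Suc k) / 2) - (w ^ k + 1 / w ^ k) / 2"
    by (simp only: 3)
  also have "\<dots> = (w ^ Suc (Suc k) + 1 / w ^ Suc (Suc k)) / 2"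
    using assms by (simp add: field_simps)
  finally show ?case .
qed (simp_all add: assms)


lemma zeta_bounds:
  assumes "gossip_mat n U"
  shows "0 < zeta n U" "zeta n U \<le> 1"
  using gossip_mat_eigenvalues_order[OF assms] by (auto simp: zeta_def divide_simps)

text \<open>With \<open>r = sqrt \<zeta>\<close> the number \<open>c\<^sub>2\<close> is the Joukowski image of \<open>w = (1 + r) / (1 - r)\<close>, and
  \<open>r K > 1 - r\<close> gives \<open>w\<^sup>K \<ge> 1 + K (w - 1) \<ge> 3\<close>.\<close>

lemma chebyshev_T_gossip_ge:
  fixes z :: real
  assumes z: "0 < z" "z < 1"
  shows "poly (chebyshev_T (nat \<lfloor>1 / sqrt z\<rfloor>)) ((1 + z) / (1 - z)) \<ge> 5 / 3"
proof -
  define r where "r = sqrt z"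
  define w where "w = (1 + r) / (1 - r)"
  define K where "K = nat \<lfloor>1 / r\<rfloor>"
  have r: "0 < r" "r < 1" "r * r = z" using z by (auto simp: r_def real_sqrt_lt_1_iff)
  have w: "w - 1 = 2 * r / (1 - r)" "w > 1" using r by (auto simp: w_def field_simps)
  have arg: "(1 + z) / (1 - z) = (w + 1 / w) / 2"
  proof -
    have "(w + 1 / w) / 2 = ((1 + r)\<^sup>2 + (1 - r)\<^sup>2) / (2 * ((1 - r) * (1 + r)))"
      using r unfolding w_def by (simp add: add_frac_eq power2_eq_square)
    also have "\<dots> = (1 + z) / (1 - z)"
      using r z by (simp add: power2_eq_square algebra_simps frac_eq_eq)
    finally show ?thesis by (rule sym)
  qed
  have "real K > 1 / r - 1" using r by (simp add: K_def)
  then have "r * real K > 1 - r" using r by (simp add: field_simps)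
  then have "real K * (w - 1) \<ge> 2" unfolding w(1) using r by (simp add: field_simps)
  moreover have "(1 + (w - 1)) ^ K \<ge> 1 + real K * (w - 1)" using w by (intro Bernoulli_inequality) auto
  ultimately have wK: "w ^ K \<ge> 3" by simp
  have "w ^ K + 1 / w ^ K \<ge> 10 / 3"
  proof -
    have "y + 1 / y \<ge> 10 / 3" if "y \<ge> 3" for y :: real
    proof -
      have "(y - 3) * (3 * y - 1) \<ge> 0" using that by (intro mult_nonneg_nonneg) auto
      then show ?thesis using that by (simp add: field_simps)
    qed
    then show ?thesis using wK by blast
  qed
  then show ?thesis
    using chebyshev_T_joukowski[of w K] w unfolding arg K_def r_def by simp
qed

text \<open>The affine map \<open>c2 * (1 - c3 * e)\<close> sends the positive spectrum of
  \<open>U\<close> into \<open>[-1, 1]\<close>, where the Chebyshev polynomial is at most 1, and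
  sends 0 to \<open>c2\<close>, where it is at least \<open>5 / 3\<close>. So positive eigenvalues
  land within \<open>3 / 5\<close> of 1, while 0 stays 0.\<close>

lemma accel_gossip_spectrum:
  assumes U: "gossip_mat n U" and Q: "eigen_decomp n U Q e"
  obtains p where "eigen_decomp n (accel_gossip n U) Q p"
    "\<And>i. i < n \<Longrightarrow> e i = 0 \<Longrightarrow> p i = 0" "\<And>i. i < n \<Longrightarrow> e i \<noteq> 0 \<Longrightarrow> 2 / 5 \<le> p i \<and> p i \<le> 8 / 5"
proof -
  define lo where "lo = eigenvalue_desc U (n - 1)"
  define hi where "hi = eigenvalue_desc U 1"
  define z where "z = zeta n U"
  have lohi: "0 < lo" "lo \<le> hi" using gossip_mat_eigenvalues_order[OF U] by (auto simp: lo_def hi_def)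
  have zlo: "z * hi = lo" using lohi by (simp add: z_def zeta_def lo_def hi_def)
  have z: "0 < z" "z \<le> 1" using zeta_bounds[OF U] by (auto simp: z_def)
  note C = eigen_decomp_carrier[OF Q]
  have Qc: "Q \<in> carrier_mat n n" "transpose_mat Q * Q = 1\<^sub>m n" using Q by (auto simp: eigen_decomp_def)
  have bnd: "lo \<le> e i \<and> e i \<le> hi" if "i < n" "e i \<noteq> 0" for i
    using gossip_mat_eigenvalue_bounds[OF U Q] that by (auto simp: lo_def hi_def)
  define c3 where "c3 = 2 / ((1 + z) * hi)"
  show ?thesis
  proof (cases "z = 1")
    case True
    have P: "accel_gossip n U = c3 \<cdot>\<^sub>m U"
      using True by (simp add: accel_gossip_def c3_def z_def hi_def)
    have "eigen_decomp n (accel_gossip n U) Q (\<lambda>i. c3 * e i)"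
      unfolding P using C Qc eigen_decomp_eigenvector[OF Q]
      by (intro eigen_decompI) (auto simp: smult_mat_mult_vec[of _ n n] smult_smult_assoc)
    \<comment> \<open>\<open>z = 1\<close> means that all positive eigenvalues coincide;
      \<open>c3\<close> is then the reciprocal of their common value.\<close>
    moreover have "c3 * e i = 1" if "i < n" "e i \<noteq> 0" for i
      using bnd[OF that] True zlo lohi by (simp add: c3_def)
    ultimately show ?thesis using that[of "\<lambda>i. c3 * e i"] by fastforce
  next
    case False
    then have z1: "z < 1" using z by simp
    define c2 where "c2 = (1 + z) / (1 - z)"
    define K where "K = nat \<lfloor>1 / sqrt z\<rfloor>"
    define T where "T = poly (chebyshev_T K) c2"
    define A where "A = c2 \<cdot>\<^sub>m (1\<^sub>m n - c3 \<cdot>\<^sub>m U)"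
    define p where "p i = 1 - (1 / T) * poly (chebyshev_T K) (c2 * (1 - c3 * e i))" for i
    have T: "T \<ge> 5 / 3" using chebyshev_T_gossip_ge[OF z(1) z1] by (simp add: T_def K_def c2_def)
    have P: "accel_gossip n U = 1\<^sub>m n - (1 / T) \<cdot>\<^sub>m poly_mat n (chebyshev_T K) A"
      using False by (simp add: accel_gossip_def Let_def c3_def z_def hi_def T_def K_def c2_def A_def)
    have A: "A \<in> carrier_mat n n" using C by (auto simp: A_def)
    have Av: "A *\<^sub>v col Q i = (c2 * (1 - c3 * e i)) \<cdot>\<^sub>v col Q i" if i: "i < n" for i
    proof -
      have "A *\<^sub>v col Q i = c2 \<cdot>\<^sub>v (col Q i - c3 \<cdot>\<^sub>v (e i \<cdot>\<^sub>v col Q i))"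
      proof -
        have cU: "c3 \<cdot>\<^sub>m U \<in> carrier_mat n n" and c1: "1\<^sub>m n - c3 \<cdot>\<^sub>m U \<in> carrier_mat n n" using C(1) by auto
        show ?thesis
          unfolding A_def smult_mat_mult_vec[OF c1 C(3)[OF i]] minus_mult_distrib_mat_vec[OF one_carrier_mat cU C(3)[OF i]]
            smult_mat_mult_vec[OF C(1) C(3)[OF i]] eigen_decomp_eigenvector[OF Q i]
          using C(3)[OF i] by simp
      qed
      also have "\<dots> = (c2 * (1 - c3 * e i)) \<cdot>\<^sub>v col Q i"
        using C(3)[OF i] by (intro eq_vecI) (auto simp: algebra_simps)
      finally show ?thesis .
    qed
    have Pc: "poly_mat n (chebyshev_T K) A \<in> carrier_mat n n"
      using poly_mat_eigenvector[OF A C(3) Av, of 0] U by (simp add: gossip_mat_def)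
    have "accel_gossip n U *\<^sub>v col Q i = p i \<cdot>\<^sub>v col Q i" if i: "i < n" for i
    proof -
      have "accel_gossip n U *\<^sub>v col Q i = col Q i - (1 / T) \<cdot>\<^sub>v (poly (chebyshev_T K) (c2 * (1 - c3 * e i)) \<cdot>\<^sub>v col Q i)"
        using Pc C(3)[OF i] poly_mat_eigenvector[OF A C(3)[OF i] Av[OF i], of "chebyshev_T K"] unfolding P
        by (simp add: smult_mat_mult_vec[of _ n n] minus_mult_distrib_mat_vec[of _ n n])
      also have "\<dots> = p i \<cdot>\<^sub>v col Q i"
        using C(3)[OF i] by (intro eq_vecI) (auto simp: p_def algebra_simps)
      finally show ?thesis .
    qed
    then have "eigen_decomp n (accel_gossip n U) Q p"
      using Pc Qc unfolding P by (intro eigen_decompI) auto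
    moreover have "p i = 0" if "e i = 0" for i
      using T that by (simp add: p_def T_def)
    moreover have "2 / 5 \<le> p i \<and> p i \<le> 8 / 5" if i: "i < n" "e i \<noteq> 0" for i
    proof -
      have c3: "0 \<le> c3" using lohi z by (simp add: c3_def)
      have "c3 * hi = 2 / (1 + z)" using lohi z by (simp add: c3_def)
      moreover have "c3 * lo = 2 * z / (1 + z)" using lohi z zlo[symmetric] by (simp add: c3_def)
      moreover have "c3 * lo \<le> c3 * e i" "c3 * e i \<le> c3 * hi"
        using bnd[OF i] c3 by (auto intro: mult_left_mono)
      \<comment> \<open>\<open>c3\<close> centres the interval: its scaled endpoints are
        \<open>1 - (1 - z) / (1 + z)\<close> and \<open>1 + (1 - z) / (1 + z)\<close>, and
        \<open>c2\<close> is the reciprocal of this radius.\<close>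
      ultimately have "\<bar>1 - c3 * e i\<bar> \<le> (1 - z) / (1 + z)"
      proof -
        have "(1 - z) / (1 + z) = 1 - 2 * z / (1 + z)" "(1 - z) / (1 + z) = 2 / (1 + z) - 1"
          using z by (simp_all add: field_simps)
        then show ?thesis using \<open>c3 * hi = _\<close> \<open>c3 * lo = _\<close> \<open>c3 * lo \<le> c3 * e i\<close> \<open>c3 * e i \<le> c3 * hi\<close>
          unfolding abs_le_iff by linarith
      qed
      then have "c2 * \<bar>1 - c3 * e i\<bar> \<le> c2 * ((1 - z) / (1 + z))"
        using z z1 by (intro mult_left_mono) (auto simp: c2_def)
      also have "\<dots> = 1" using z z1 by (simp add: c2_def)
      finally have "\<bar>c2 * (1 - c3 * e i)\<bar> \<le> 1"
        using z z1 by (simp add: abs_mult c2_def)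
      from chebyshev_T_bound[OF this, of K] have "\<bar>poly (chebyshev_T K) (c2 * (1 - c3 * e i))\<bar> \<le> 3 / 5 * T"
        using T by linarith
      then have "\<bar>(1 / T) * poly (chebyshev_T K) (c2 * (1 - c3 * e i))\<bar> \<le> 3 / 5"
        using T by (simp add: abs_mult field_simps)
      then show ?thesis unfolding p_def abs_le_iff by linarith
    qed
    ultimately show ?thesis using that by blast
  qed
qed

text \<open>In a common eigenbasis the null space depends only on which eigenvalues vanish, so
  acceleration preserves it. The bound \<open>1 / 4\<close> is
  \<open>(2 / 5) / (8 / 5)\<close>.\<close>

lemma accel_gossip_gossip_mat:
  assumes U: "gossip_mat n U"
  shows "gossip_mat n (accel_gossip n U)" "1 / 4 \<le> zeta n (accel_gossip n U)"
proof -
  obtain Q e where Q: "eigen_decomp n U Q e" using gossip_mat_decomp[OF U] .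
  obtain p where P: "eigen_decomp n (accel_gossip n U) Q p"
    and p0: "\<And>i. i < n \<Longrightarrow> e i = 0 \<Longrightarrow> p i = 0"
    and p1: "\<And>i. i < n \<Longrightarrow> e i \<noteq> 0 \<Longrightarrow> 2 / 5 \<le> p i \<and> p i \<le> 8 / 5"
    using accel_gossip_spectrum[OF U Q] by metis
  note C = eigen_decomp_carrier[OF P] and CU = eigen_decomp_carrier[OF Q]
  let ?P = "accel_gossip n U"
  have "0 \<le> v \<bullet> (?P *\<^sub>v v)" if "v \<in> carrier_vec n" for v
  proof -
    have "0 \<le> p i" if "i < n" for i using p0[OF that] p1[OF that] by (cases "e i = 0") auto
    then show ?thesis
      unfolding eigen_decomp_quadratic_form[OF P that] by (intro sum_nonneg) auto
  qed
  then have psd: "psd_mat n ?P" using C eigen_decomp_symmetric[OF P] by (auto simp: psd_mat_def)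
  have zero_iff: "A *\<^sub>v v = 0\<^sub>v n \<longleftrightarrow> (\<forall>i<n. ev i * (col Q i \<bullet> v) = 0)"
    if A: "eigen_decomp n A Q ev" and v: "v \<in> carrier_vec n" for A ev v
  proof -
    note D = eigen_decomp_carrier[OF A]
    have Av: "A *\<^sub>v v \<in> carrier_vec n" using D(1) v by simp
    show ?thesis
      using eigen_decomp_nontrivial_component[OF A Av] eigen_decomp_symmetric_scalar_prod[OF A v]
        D(3) by (metis scalar_prod_right_zero)
  qed
  have "?P *\<^sub>v v = 0\<^sub>v n \<longleftrightarrow> U *\<^sub>v v = 0\<^sub>v n" if "v \<in> carrier_vec n" for v
    unfolding zero_iff[OF P that] zero_iff[OF Q that] using p0 p1 by force
  then show PU: "gossip_mat n ?P" using U psd by (simp add: gossip_mat_def)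
  obtain i j where i: "i < n" "p i = eigenvalue_desc ?P (n - 1)" and j: "j < n" "p j = eigenvalue_desc ?P 1"
    using gossip_mat_eigenvalue_bounds(4,5)[OF PU P] by auto
  have "p i \<noteq> 0" "p j \<noteq> 0" using gossip_mat_eigenvalues_order[OF PU] i j by auto
  then have "2 / 5 \<le> p i" "p j \<le> 8 / 5" "0 < p j" using p0 p1 i j by force+
  then show "1 / 4 \<le> zeta n ?P" unfolding zeta_def i(2)[symmetric] j(2)[symmetric]
    by (simp add: field_simps)
qed

hide_const (open) VectorSpace.subspace

section \<open>Finitely supported functions as an inner product space\<close>

text \<open>The carrier sets of vectors and matrices of all dimensions embed isometrically into this space,
  which makes the library for \<^class>\<open>real_inner\<close> available for a dimension that is a term.\<close>

typedef 'a fsv = "{f :: 'a \<Rightarrow> real. finite {i. f i \<noteq> 0}}"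
  morphisms fsv_nth Abs_fsv
  by (rule exI[of _ "\<lambda>_. 0"]) simp

lemma finite_support_fsv [simp]: "finite {i. fsv_nth x i \<noteq> 0}"
  using fsv_nth by blast

lemma fsv_eqI: "(\<And>i. fsv_nth x i = fsv_nth y i) \<Longrightarrow> x = y"
  by (simp add: fsv_nth_inject[symmetric] ext)

lemma fsv_nth_Abs: "finite {i. f i \<noteq> 0} \<Longrightarrow> fsv_nth (Abs_fsv f) i = f i"
  by (simp add: Abs_fsv_inverse)

instantiation fsv :: (type) real_vector
begin

definition "0 = Abs_fsv (\<lambda>_. 0)"
definition "x + y = Abs_fsv (\<lambda>i. fsv_nth x i + fsv_nth y i)"
definition "x - y = Abs_fsv (\<lambda>i. fsv_nth x i - fsv_nth y i)"
definition "- x = Abs_fsv (\<lambda>i. - fsv_nth x i)"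
definition "a *\<^sub>R x = Abs_fsv (\<lambda>i. a * fsv_nth x i)"

lemma fsv_nth_ops [simp]:
  "fsv_nth 0 i = 0"
  "fsv_nth (x + y) i = fsv_nth x i + fsv_nth y i"
  "fsv_nth (x - y) i = fsv_nth x i - fsv_nth y i"
  "fsv_nth (- x) i = - fsv_nth x i"
  "fsv_nth (a *\<^sub>R x) i = a * fsv_nth x i"
proof -
  have *: "finite ({i. fsv_nth x i \<noteq> 0} \<union> {i. fsv_nth y i \<noteq> 0})"
    by simp
  show "fsv_nth (x + y) i = fsv_nth x i + fsv_nth y i"
    unfolding plus_fsv_def by (intro fsv_nth_Abs finite_subset[OF _ *]) auto
  show "fsv_nth (x - y) i = fsv_nth x i - fsv_nth y i"
    unfolding minus_fsv_def by (intro fsv_nth_Abs finite_subset[OF _ *]) auto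
  show "fsv_nth (- x) i = - fsv_nth x i"
    unfolding uminus_fsv_def by (intro fsv_nth_Abs finite_subset[OF _ finite_support_fsv[of x]]) auto
  show "fsv_nth (a *\<^sub>R x) i = a * fsv_nth x i"
    unfolding scaleR_fsv_def by (intro fsv_nth_Abs finite_subset[OF _ finite_support_fsv[of x]]) auto
qed (simp add: zero_fsv_def fsv_nth_Abs)

instance
  by standard (auto intro!: fsv_eqI simp: algebra_simps)

end

instantiation fsv :: (type) real_inner
begin

definition inner_fsv :: "'a fsv \<Rightarrow> 'a fsv \<Rightarrow> real" where
  "inner_fsv x y = (\<Sum>i | fsv_nth x i \<noteq> 0. fsv_nth x i * fsv_nth y i)"
definition norm_fsv :: "'a fsv \<Rightarrow> real" where
  "norm_fsv x = sqrt (inner x x)"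
definition dist_fsv :: "'a fsv \<Rightarrow> 'a fsv \<Rightarrow> real" where
  "dist_fsv x y = norm (x - y)"
definition sgn_fsv :: "'a fsv \<Rightarrow> 'a fsv" where
  "sgn_fsv x = x /\<^sub>R norm x"
definition uniformity_fsv :: "('a fsv \<times> 'a fsv) filter" where
  "uniformity_fsv = (INF e\<in>{0<..}. principal {(x, y). dist x y < e})"
definition open_fsv :: "'a fsv set \<Rightarrow> bool" where
  "open_fsv S = (\<forall>x\<in>S. \<forall>\<^sub>F (x', y) in uniformity. x' = x \<longrightarrow> y \<in> S)"

lemma inner_fsv_eq_sum:
  assumes "finite A" "\<And>i. i \<notin> A \<Longrightarrow> fsv_nth x i = 0 \<or> fsv_nth y i = 0"
  shows "inner x y = (\<Sum>i\<in>A. fsv_nth x i * fsv_nth y i)"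
  unfolding inner_fsv_def using assms by (intro sum.mono_neutral_cong) auto

instance
proof
  fix x y z :: "'a fsv" and r :: real
  define A where "A = {i. fsv_nth x i \<noteq> 0} \<union> {i. fsv_nth y i \<noteq> 0} \<union> {i. fsv_nth z i \<noteq> 0}"
  have A: "finite A" by (simp add: A_def)
  have xA: "fsv_nth x i = 0" "fsv_nth y i = 0" "fsv_nth z i = 0" if "i \<notin> A" for i
    using that by (auto simp: A_def)
  show "inner x y = inner y x"
    using A xA by (simp add: inner_fsv_eq_sum[of A] mult.commute)
  show "inner (x + y) z = inner x z + inner y z"
    using A xA by (simp add: inner_fsv_eq_sum[of A] algebra_simps sum.distrib)
  show "inner (r *\<^sub>R x) y = r * inner x y"
    using A xA by (simp add: inner_fsv_eq_sum[of A] sum_distrib_left mult_ac)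
  show "0 \<le> inner x x"
    using A xA by (simp add: inner_fsv_eq_sum[of A] sum_nonneg)
  show "inner x x = 0 \<longleftrightarrow> x = 0"
  proof
    assume "inner x x = 0"
    then have "\<forall>i\<in>A. fsv_nth x i * fsv_nth x i = 0"
      using A xA by (subst sum_nonneg_eq_0_iff[symmetric]) (auto simp: inner_fsv_eq_sum[of A])
    then show "x = 0" using xA by (intro fsv_eqI) auto
  qed (simp add: inner_fsv_def)
qed (simp_all add: norm_fsv_def dist_fsv_def sgn_fsv_def uniformity_fsv_def open_fsv_def)

end

definition supported :: "'a set \<Rightarrow> 'a fsv set" where
  "supported A = {x. \<forall>i. i \<notin> A \<longrightarrow> fsv_nth x i = 0}"

lemma subspace_supported: "subspace (supported A)"
  by (rule real_vector.subspaceI) (auto simp: supported_def)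

text \<open>The space of finitely supported functions on an infinite index type is not complete;
  minimizers are therefore sought only inside a fixed finite coordinate set, where Cauchy sequences
  converge coordinatewise.\<close>

lemma complete_supported:
  assumes A: "finite A"
  shows "complete (supported A :: 'a fsv set)"
  unfolding complete_def
proof safe
  fix X :: "nat \<Rightarrow> 'a fsv" assume X: "\<forall>n. X n \<in> supported A" and C: "Cauchy X"
  have le: "\<bar>fsv_nth x i\<bar> \<le> norm x" if "x \<in> supported A" for x :: "'a fsv" and i
  proof (cases "i \<in> A")
    case True
    have "(fsv_nth x i)\<^sup>2 \<le> (\<Sum>j\<in>A. fsv_nth x j * fsv_nth x j)"
      unfolding power2_eq_square using True A by (intro member_le_sum) auto
    also have "\<dots> = (norm x)\<^sup>2"
      using that A by (simp add: power2_norm_eq_inner inner_fsv_eq_sum[of A] supported_def)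
    finally show ?thesis by (simp add: abs_le_square_iff[symmetric] power2_le_iff_abs_le)
  qed (use that in \<open>auto simp: supported_def\<close>)
  have sub: "x - y \<in> supported A" if "x \<in> supported A" "y \<in> supported A" for x y :: "'a fsv"
    using that real_vector.subspace_diff[OF subspace_supported] by blast
  have "Cauchy (\<lambda>n. fsv_nth (X n) i)" for i
  proof (rule metric_CauchyI)
    fix e :: real assume "e > 0"
    then obtain M where M: "\<And>m n. m \<ge> M \<Longrightarrow> n \<ge> M \<Longrightarrow> dist (X m) (X n) < e"
      using metric_CauchyD[OF C] by blast
    have "dist (fsv_nth (X m) i) (fsv_nth (X n) i) < e" if "m \<ge> M" "n \<ge> M" for m n
      using M[OF that] le[OF sub, of "X m" "X n" i] X by (simp add: dist_norm)
    then show "\<exists>M. \<forall>m\<ge>M. \<forall>n\<ge>M. dist (fsv_nth (X m) i) (fsv_nth (X n) i) < e" by blast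
  qed
  then have "\<forall>i. \<exists>l. (\<lambda>n. fsv_nth (X n) i) \<longlonglongrightarrow> l"
    by (simp add: Cauchy_convergent_iff convergent_def)
  then obtain l where l: "\<And>i. (\<lambda>n. fsv_nth (X n) i) \<longlonglongrightarrow> l i" by metis
  define x where "x = Abs_fsv (\<lambda>i. if i \<in> A then l i else 0)"
  have x: "fsv_nth x i = (if i \<in> A then l i else 0)" for i
    unfolding x_def using A by (intro fsv_nth_Abs) (auto intro: rev_finite_subset)
  have xs: "x \<in> supported A" by (simp add: supported_def x)
  have "(\<lambda>n. norm (X n - x)) \<longlonglongrightarrow> 0"
  proof -
    have "norm (X n - x) = sqrt (\<Sum>i\<in>A. (fsv_nth (X n) i - l i) * (fsv_nth (X n) i - l i))" for n
    proof -
      have "X n - x \<in> supported A" using sub xs X by blast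
      then show ?thesis
        using A by (auto simp: norm_eq_sqrt_inner inner_fsv_eq_sum[of A] supported_def x intro!: sum.cong)
    qed
    moreover have "(\<lambda>n. sqrt (\<Sum>i\<in>A. (fsv_nth (X n) i - l i) * (fsv_nth (X n) i - l i)))
        \<longlonglongrightarrow> sqrt (\<Sum>i\<in>A. (l i - l i) * (l i - l i))"
      by (intro tendsto_intros l)
    ultimately show ?thesis by simp
  qed
  then show "\<exists>l\<in>supported A. X \<longlonglongrightarrow> l"
    using xs by (auto simp: tendsto_iff dist_norm)
qed

section \<open>Embedding vectors and matrices\<close>

definition emb :: "real vec \<Rightarrow> nat fsv" where
  "emb v = Abs_fsv (\<lambda>i. if i < dim_vec v then v $ i else 0)"

definition unemb :: "nat \<Rightarrow> nat fsv \<Rightarrow> real vec" where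
  "unemb d x = vec d (fsv_nth x)"

lemma fsv_nth_emb: "fsv_nth (emb v) i = (if i < dim_vec v then v $ i else 0)"
  unfolding emb_def by (intro fsv_nth_Abs) (auto intro: finite_subset[of _ "{..<dim_vec v}"])

lemma emb_supported: "v \<in> carrier_vec d \<Longrightarrow> emb v \<in> supported {..<d}"
  by (auto simp: supported_def fsv_nth_emb)

lemma unemb_carrier [simp]: "unemb d x \<in> carrier_vec d"
  by (simp add: unemb_def)

lemma unemb_emb [simp]: "v \<in> carrier_vec d \<Longrightarrow> unemb d (emb v) = v"
  by (rule eq_vecI) (simp_all add: unemb_def fsv_nth_emb)

lemma emb_unemb: "x \<in> supported {..<d} \<Longrightarrow> emb (unemb d x) = x"
  by (auto intro!: fsv_eqI simp: unemb_def fsv_nth_emb supported_def)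

lemma emb_ops:
  assumes "v \<in> carrier_vec d" "w \<in> carrier_vec d"
  shows "emb (v + w) = emb v + emb w" "emb (v - w) = emb v - emb w"
  using assms by (auto intro!: fsv_eqI simp: fsv_nth_emb)

lemma emb_smult: "emb (a \<cdot>\<^sub>v v) = a *\<^sub>R emb v"
  and emb_zero: "emb (0\<^sub>v d) = 0"
  by (auto intro!: fsv_eqI simp: fsv_nth_emb)

lemma inner_emb:
  assumes "v \<in> carrier_vec d" "w \<in> carrier_vec d"
  shows "inner (emb v) (emb w) = v \<bullet> w"
  using assms by (subst inner_fsv_eq_sum[of "{..<d}"]) (auto simp: fsv_nth_emb scalar_prod_def atLeast0LessThan)

lemma vnorm_eq_norm_emb: "vnorm v = norm (emb v)"
  unfolding vnorm_def norm_eq_sqrt_inner by (subst inner_emb[of v "dim_vec v" v]) auto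

lemma emb_inject:
  assumes "v \<in> carrier_vec d" "w \<in> carrier_vec d"
  shows "emb v = emb w \<longleftrightarrow> v = w"
  using assms unemb_emb by metis

lemma emb_finsum_vec:
  assumes "finite A" "\<And>j. j \<in> A \<Longrightarrow> v j \<in> carrier_vec d"
  shows "finsum_vec TYPE(real) d v A \<in> carrier_vec d" "emb (finsum_vec TYPE(real) d v A) = (\<Sum>j\<in>A. emb (v j))"
proof -
  have "finsum_vec TYPE(real) d v A \<in> carrier_vec d \<and> emb (finsum_vec TYPE(real) d v A) = (\<Sum>j\<in>A. emb (v j))"
    using assms
  proof (induction A)
    case empty
    then show ?case by (simp add: finsum_vec_empty emb_zero)
  next
    case (insert a A)
    then have "finsum_vec TYPE(real) d v (insert a A) = v a + finsum_vec TYPE(real) d v A"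
      by (intro finsum_vec_insert) auto
    then show ?case using insert by (simp add: emb_ops[of _ d])
  qed
  then show "finsum_vec TYPE(real) d v A \<in> carrier_vec d" "emb (finsum_vec TYPE(real) d v A) = (\<Sum>j\<in>A. emb (v j))"
    by auto
qed

definition embM :: "real mat \<Rightarrow> (nat \<times> nat) fsv" where
  "embM A = Abs_fsv (\<lambda>(i, j). if i < dim_row A \<and> j < dim_col A then A $$ (i, j) else 0)"

definition unembM :: "nat \<Rightarrow> nat \<Rightarrow> (nat \<times> nat) fsv \<Rightarrow> real mat" where
  "unembM d n x = mat d n (fsv_nth x)"

lemma fsv_nth_embM: "fsv_nth (embM A) (i, j) = (if i < dim_row A \<and> j < dim_col A then A $$ (i, j) else 0)"
proof -
  have "{p. (case p of (i, j) \<Rightarrow> if i < dim_row A \<and> j < dim_col A then A $$ (i, j) else 0) \<noteq> 0}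
      \<subseteq> {..<dim_row A} \<times> {..<dim_col A}"
    by (auto split: if_splits)
  then have "finite {p. (case p of (i, j) \<Rightarrow> if i < dim_row A \<and> j < dim_col A then A $$ (i, j) else 0) \<noteq> 0}"
    by (rule finite_subset) simp
  from fsv_nth_Abs[OF this] show ?thesis by (simp add: embM_def)
qed

lemma embM_supported: "A \<in> carrier_mat d n \<Longrightarrow> embM A \<in> supported ({..<d} \<times> {..<n})"
  by (auto simp: supported_def fsv_nth_embM)

lemma unembM_carrier [simp]: "unembM d n x \<in> carrier_mat d n"
  by (simp add: unembM_def)

lemma embM_unembM: "x \<in> supported ({..<d} \<times> {..<n}) \<Longrightarrow> embM (unembM d n x) = x"
proof (rule fsv_eqI)
  fix i assume "x \<in> supported ({..<d} \<times> {..<n})"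
  then show "fsv_nth (embM (unembM d n x)) i = fsv_nth x i"
    by (cases i) (auto simp: unembM_def fsv_nth_embM supported_def)
qed

lemma unembM_embM [simp]: "A \<in> carrier_mat d n \<Longrightarrow> unembM d n (embM A) = A"
  by (rule eq_matI) (simp_all add: unembM_def fsv_nth_embM)

lemma embM_eqI:
  assumes "\<And>i j. fsv_nth x (i, j) = fsv_nth y (i, j)"
  shows "x = y"
  using assms by (intro fsv_eqI) auto

lemma embM_ops:
  assumes "A \<in> carrier_mat d n" "B \<in> carrier_mat d n"
  shows "embM (A + B) = embM A + embM B" "embM (A - B) = embM A - embM B"
  using assms by (auto intro!: embM_eqI simp: fsv_nth_embM)

lemma embM_smult: "embM (a \<cdot>\<^sub>m A) = a *\<^sub>R embM A"
  and embM_zero: "embM (0\<^sub>m d n) = 0"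
  by (auto intro!: embM_eqI simp: fsv_nth_embM)

lemma inner_embM:
  assumes A: "A \<in> carrier_mat d n" and B: "B \<in> carrier_mat d n"
  shows "inner (embM A) (embM B) = (\<Sum>j<n. inner (emb (col A j)) (emb (col B j)))"
    "inner (embM A) (embM B) = (\<Sum>i<d. row A i \<bullet> row B i)"
proof -
  have *: "inner (embM A) (embM B) = (\<Sum>i<d. \<Sum>j<n. A $$ (i, j) * B $$ (i, j))"
    using A B by (subst inner_fsv_eq_sum[of "{..<d} \<times> {..<n}"])
      (auto simp: fsv_nth_embM sum.cartesian_product intro!: sum.cong split: if_splits)
  have "inner (emb (col A j)) (emb (col B j)) = (\<Sum>i<d. A $$ (i, j) * B $$ (i, j))" if "j < n" for j
    using that A B by (subst inner_emb[of _ d]) (auto simp: scalar_prod_def atLeast0LessThan)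
  then show "inner (embM A) (embM B) = (\<Sum>j<n. inner (emb (col A j)) (emb (col B j)))"
    unfolding * by (subst sum.swap) simp
  show "inner (embM A) (embM B) = (\<Sum>i<d. row A i \<bullet> row B i)"
    unfolding * using A B by (auto simp: scalar_prod_def atLeast0LessThan intro!: sum.cong)
qed

lemma norm_embM_sq:
  assumes "A \<in> carrier_mat d n"
  shows "(norm (embM A))\<^sup>2 = (\<Sum>j<n. (norm (emb (col A j)))\<^sup>2)"
  using inner_embM(1)[OF assms assms] by (simp add: power2_norm_eq_inner)

lemma row_mult_symmetric:
  fixes A S :: "real mat"
  assumes A: "A \<in> carrier_mat d n" and S: "S \<in> carrier_mat n n" "transpose_mat S = S" and i: "i < d"
  shows "row (A * S) i = S *\<^sub>v row A i"
proof (rule eq_vecI)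
  fix j assume "j < dim_vec (S *\<^sub>v row A i)"
  then have j: "j < n" using S by simp
  have "col S j = row S j" using S j by (metis carrier_matD(2) row_transpose)
  then show "row (A * S) i $ j = (S *\<^sub>v row A i) $ j"
    using A S i j by (simp add: comm_scalar_prod[of "row A i" n])
qed (use A S in auto)

lemma inner_embM_mult_symmetric:
  assumes A: "A \<in> carrier_mat d n" and B: "B \<in> carrier_mat d n"
    and S: "S \<in> carrier_mat n n" "transpose_mat S = S"
  shows "inner (embM (A * S)) (embM B) = inner (embM A) (embM (B * S))"
proof -
  have AS: "A * S \<in> carrier_mat d n" and BS: "B * S \<in> carrier_mat d n" using A B S by auto
  have "(S *\<^sub>v row A i) \<bullet> row B i = row A i \<bullet> (S *\<^sub>v row B i)" if "i < d" for i
    using symmetric_scalar_prod[OF S, of "row A i" "row B i"] A B that by simp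
  then show ?thesis
    unfolding inner_embM(2)[OF AS B] inner_embM(2)[OF A BS]
    using A B S by (auto simp: row_mult_symmetric[OF _ S] simp del: row_mult intro!: sum.cong)
qed

text \<open>Matrices of iterates are multiplied from the right, so the root acts on rows. This turns
  the Frobenius norm into a sum of quadratic forms of \<open>S * S\<close>, to which the eigenvalue
  bounds for single vectors apply.\<close>

lemma norm_mult_sqrt_sq:
  assumes A: "A \<in> carrier_mat d n" and S: "S \<in> carrier_mat n n" "transpose_mat S = S"
  shows "(norm (embM (A * S)))\<^sup>2 = (\<Sum>i<d. row A i \<bullet> ((S * S) *\<^sub>v row A i))"
proof -
  have AS: "A * S \<in> carrier_mat d n" using A S by auto
  have "(norm (embM (A * S)))\<^sup>2 = inner (embM A) (embM (A * S * S))"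
    unfolding power2_norm_eq_inner by (rule inner_embM_mult_symmetric[OF A AS S])
  also have "A * S * S = A * (S * S)" using A S by (simp add: assoc_mult_mat[of _ d n _ n _ n])
  also have "inner (embM A) (embM (A * (S * S))) = (\<Sum>i<d. row A i \<bullet> row (A * (S * S)) i)"
    using A S by (intro inner_embM(2)) auto
  also have "\<dots> = (\<Sum>i<d. row A i \<bullet> ((S * S) *\<^sub>v row A i))"
    using S by (intro sum.cong refl arg_cong2[where f = scalar_prod] row_mult_symmetric[OF A])
      (auto simp: transpose_mult[of _ n n _ n])
  finally show ?thesis .
qed

lemma norm_mult_gossip_sqrt_le:
  assumes M: "gossip_mat n M" and S: "S \<in> carrier_mat n n" "transpose_mat S = S" "S * S = M"
    and A: "A \<in> carrier_mat d n"
  shows "(norm (embM (A * S)))\<^sup>2 \<le> eigenvalue_desc M 1 * (norm (embM A))\<^sup>2"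
  unfolding norm_mult_sqrt_sq[OF A S(1,2)] S(3)
  unfolding power2_norm_eq_inner inner_embM(2)[OF A A] sum_distrib_left
  using A by (intro sum_mono gossip_mat_quadratic_le[OF M]) auto

lemma norm_mult_gossip_sqrt_ge:
  assumes M: "gossip_mat n M" and S: "S \<in> carrier_mat n n" "transpose_mat S = S" "S * S = M"
    and A: "A \<in> carrier_mat d n" "A *\<^sub>v ones_vec n = 0\<^sub>v d"
  shows "eigenvalue_desc M (n - 1) * (norm (embM A))\<^sup>2 \<le> (norm (embM (A * S)))\<^sup>2"
proof -
  have "row A i \<bullet> ones_vec n = 0" if "i < d" for i
    using arg_cong[OF A(2), of "\<lambda>v. v $ i"] that A(1) by simp
  then show ?thesis
    unfolding norm_mult_sqrt_sq[OF A(1) S(1,2)] S(3)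
  unfolding power2_norm_eq_inner inner_embM(2)[OF A(1) A(1)] sum_distrib_left
    using A by (intro sum_mono gossip_mat_quadratic_ge[OF M]) auto
qed

section \<open>Smooth strongly convex functions\<close>

lemma inner_le_young:
  fixes x y :: "'a :: real_inner"
  assumes "t > 0"
  shows "inner x y \<le> t / 2 * (norm x)\<^sup>2 + (norm y)\<^sup>2 / (2 * t)"
proof -
  have "0 \<le> (norm (t *\<^sub>R x - y))\<^sup>2" by simp
  also have "\<dots> = t\<^sup>2 * (norm x)\<^sup>2 - 2 * t * inner x y + (norm y)\<^sup>2"
    unfolding power2_norm_eq_inner
    by (simp add: inner_diff_left inner_diff_right inner_commute algebra_simps power2_eq_square)
  finally have "2 * t * inner x y \<le> t\<^sup>2 * (norm x)\<^sup>2 + (norm y)\<^sup>2" by simp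
  then show ?thesis using assms by (simp add: field_simps power2_eq_square)
qed

lemma norm_add_sq_le:
  fixes x y :: "'a :: real_inner"
  shows "(norm (x + y))\<^sup>2 \<le> 2 * (norm x)\<^sup>2 + 2 * (norm y)\<^sup>2"
proof -
  have "2 * (norm x)\<^sup>2 + 2 * (norm y)\<^sup>2 - (norm (x + y))\<^sup>2 = (norm (x - y))\<^sup>2"
    by (simp add: power2_norm_eq_inner inner_diff_left inner_diff_right inner_add_left inner_add_right inner_commute)
  then show ?thesis by (metis diff_ge_0_iff_ge zero_le_power2)
qed

text \<open>Only quadratic minorants are required, and \<open>g x\<close> may leave
  \<open>V\<close>. This matters for the dual function on matrices with zero row sums, whose
  gradients need not have zero row sums.\<close>

locale strongly_convex_on =
  fixes V :: "'a :: real_inner set" and \<phi> :: "'a \<Rightarrow> real" and g :: "'a \<Rightarrow> 'a" and \<mu> :: real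
  assumes V: "complete V" "subspace V"
    and mu_pos: "0 < \<mu>"
    and lower: "x \<in> V \<Longrightarrow> y \<in> V \<Longrightarrow> \<phi> x + inner (g x) (y - x) + \<mu> / 2 * (norm (y - x))\<^sup>2 \<le> \<phi> y"
begin

lemma midpoint:
  assumes "x \<in> V" "y \<in> V"
  shows "\<phi> ((1 / 2) *\<^sub>R (x + y)) \<le> (\<phi> x + \<phi> y) / 2 - \<mu> / 8 * (norm (x - y))\<^sup>2"
proof -
  define z where "z = (1 / 2) *\<^sub>R (x + y)"
  have z: "z \<in> V" using V(2) assms
    by (simp add: z_def real_vector.subspace_add real_vector.subspace_scale del: scaleR_add_right)
  have "x - z = (1 / 2) *\<^sub>R (x - y)" "y - z = (- 1 / 2) *\<^sub>R (x - y)"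
    by (simp_all add: z_def algebra_simps scaleR_2[symmetric])
  then show ?thesis
    using lower[OF z assms(1)] lower[OF z assms(2)]
    by (simp add: z_def[symmetric] power_mult_distrib power2_eq_square) (simp add: field_simps)
qed

lemma bounded_below: "x \<in> V \<Longrightarrow> \<phi> 0 - (norm (g 0))\<^sup>2 / (2 * \<mu>) \<le> \<phi> x"
  using lower[of 0 x] inner_le_young[OF mu_pos, of x "- g 0"] V(2)
  by (simp add: real_vector.subspace_0 inner_commute)

text \<open>Direct method: by the midpoint inequality any minimizing sequence is Cauchy, and
  completeness of \<open>V\<close> supplies its limit.\<close>

lemma minimizer_exists: "\<exists>x\<in>V. \<forall>y\<in>V. \<phi> x \<le> \<phi> y"
proof -
  define I where "I = (INF x\<in>V. \<phi> x)"
  have bdd: "bdd_below (\<phi> ` V)" using bounded_below by (auto intro!: bdd_belowI)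
  have V0: "V \<noteq> {}" using V(2) real_vector.subspace_0 by blast
  have I_le: "I \<le> \<phi> x" if "x \<in> V" for x unfolding I_def using bdd that by (rule cINF_lower)
  have "\<exists>x\<in>V. \<phi> x < I + 1 / real (Suc k)" for k
  proof -
    have "I < I + 1 / real (Suc k)" by simp
    then show ?thesis unfolding I_def using cINF_less_iff[OF V0 bdd] by blast
  qed
  then obtain X where X: "\<And>k. X k \<in> V" "\<And>k. \<phi> (X k) < I + 1 / real (Suc k)" by metis
  have bound: "\<mu> / 8 * (norm (X k - X l))\<^sup>2 < 1 / real (Suc N)" if "N \<le> k" "N \<le> l" for k l N
  proof -
    have "(1 / 2) *\<^sub>R (X k + X l) \<in> V"
      using V(2) X by (simp add: real_vector.subspace_add real_vector.subspace_scale del: scaleR_add_right)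
    from I_le[OF this] midpoint[OF X(1)[of k] X(1)[of l]]
    have "I \<le> (\<phi> (X k) + \<phi> (X l)) / 2 - \<mu> / 8 * (norm (X k - X l))\<^sup>2" by (rule order_trans)
    moreover have "c < (p + q) / 2" if "I \<le> (a + b) / 2 - c" "a < I + p" "b < I + q" for a b c p q :: real
      using that by (simp add: add_divide_distrib)
    ultimately have "\<mu> / 8 * (norm (X k - X l))\<^sup>2 < (1 / real (Suc k) + 1 / real (Suc l)) / 2"
      using X(2)[of k] X(2)[of l] by blast
    moreover have "1 / real (Suc k) \<le> 1 / real (Suc N)" "1 / real (Suc l) \<le> 1 / real (Suc N)"
      using that by (auto intro!: divide_left_mono)
    moreover have "c < n" if "c < (p + q) / 2" "p \<le> n" "q \<le> n" for c p q n :: real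
      using that by (simp add: add_divide_distrib)
    ultimately show ?thesis by blast
  qed
  have "Cauchy X"
  proof (rule metric_CauchyI)
    fix e :: real assume e: "e > 0"
    then have "\<mu> / 8 * e\<^sup>2 > 0" using mu_pos by simp
    then obtain N where N: "1 / real (Suc N) < \<mu> / 8 * e\<^sup>2"
      using reals_Archimedean by (metis inverse_eq_divide)
    have "dist (X k) (X l) < e" if "k \<ge> N" "l \<ge> N" for k l
    proof -
      have "\<mu> / 8 * (norm (X k - X l))\<^sup>2 < \<mu> / 8 * e\<^sup>2" using bound[OF that] N by linarith
      then have "(norm (X k - X l))\<^sup>2 < e\<^sup>2" using mu_pos by simp
      then show ?thesis using e by (simp add: dist_norm power_less_imp_less_base)
    qed
    then show "\<exists>N. \<forall>k\<ge>N. \<forall>l\<ge>N. dist (X k) (X l) < e" by blast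
  qed
  then obtain x where x: "x \<in> V" "X \<longlonglongrightarrow> x" using V(1) X(1) unfolding complete_def by blast
  \<comment> \<open>Lower semicontinuity comes for free: the affine minorant at the limit point
    \<open>x\<close> is continuous and lies below \<open>\<phi>\<close> along the sequence.\<close>
  have "\<phi> x \<le> I"
  proof (rule LIMSEQ_le)
    show "(\<lambda>k. \<phi> x + inner (g x) (X k - x)) \<longlonglongrightarrow> \<phi> x"
      by (rule tendsto_eq_intros x(2) refl | simp)+
    show "(\<lambda>k. I + 1 / real (Suc k)) \<longlonglongrightarrow> I"
      using tendsto_add[OF tendsto_const LIMSEQ_inverse_real_of_nat, of I] by (simp add: inverse_eq_divide)
    have "\<phi> x + inner (g x) (X k - x) \<le> I + 1 / real (Suc k)" for k
    proof -
      have "0 \<le> \<mu> / 2 * (norm (X k - x))\<^sup>2" using mu_pos by simp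
      then show ?thesis using lower[OF x(1) X(1)[of k]] X(2)[of k] by linarith
    qed
    then show "\<exists>N. \<forall>k\<ge>N. \<phi> x + inner (g x) (X k - x) \<le> I + 1 / real (Suc k)" by blast
  qed
  then show ?thesis using x I_le by force
qed

end

locale smooth_strongly_convex_on = strongly_convex_on V \<phi> g \<mu>
  for V :: "'a :: real_inner set" and \<phi> g \<mu> +
  fixes L :: real
  assumes L_pos: "0 < L"
    and grad_in: "x \<in> V \<Longrightarrow> g x \<in> V"
    and upper: "x \<in> V \<Longrightarrow> y \<in> V \<Longrightarrow> \<phi> y \<le> \<phi> x + inner (g x) (y - x) + L / 2 * (norm (y - x))\<^sup>2"
begin

text \<open>The maximizer in the definition of the convex conjugate, that is, the gradient of the
  conjugate at \<open>x\<close>. Taking it as a primitive avoids differentiating the conjugate in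
  the abstract setting.\<close>

definition conj_arg :: "'a \<Rightarrow> 'a" where
  "conj_arg x = (SOME t. t \<in> V \<and> (\<forall>y\<in>V. \<phi> t - inner t x \<le> \<phi> y - inner y x))"

definition conj_val :: "'a \<Rightarrow> real" where
  "conj_val x = inner (conj_arg x) x - \<phi> (conj_arg x)"

lemma conj_arg:
  "conj_arg x \<in> V" "y \<in> V \<Longrightarrow> \<phi> (conj_arg x) - inner (conj_arg x) x \<le> \<phi> y - inner y x"
proof -
  interpret shifted: strongly_convex_on V "\<lambda>t. \<phi> t - inner t x" "\<lambda>t. g t - x" \<mu>
    using V mu_pos by unfold_locales
      (use lower in \<open>fastforce simp: inner_diff_left inner_diff_right inner_commute\<close>)+
  have "\<exists>t. t \<in> V \<and> (\<forall>y\<in>V. \<phi> t - inner t x \<le> \<phi> y - inner y x)"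
    using shifted.minimizer_exists by blast
  from someI_ex[OF this] show "conj_arg x \<in> V"
    "y \<in> V \<Longrightarrow> \<phi> (conj_arg x) - inner (conj_arg x) x \<le> \<phi> y - inner y x"
    by (auto simp: conj_arg_def)
qed

lemma conj_val_ge: "y \<in> V \<Longrightarrow> inner y x - \<phi> y \<le> conj_val x"
  using conj_arg(2)[of y x] by (simp add: conj_val_def)

text \<open>First-order optimality without derivatives: a gradient step of length
  \<open>1 / L\<close> from the minimizer would lower the objective by
  \<open>|g t - x|^2 / (2 L)\<close>.\<close>

lemma grad_conj_arg:
  assumes x: "x \<in> V"
  shows "g (conj_arg x) = x"
proof -
  define t where "t = conj_arg x"
  define w where "w = t - (1 / L) *\<^sub>R (g t - x)"
  have t: "t \<in> V" by (simp add: t_def conj_arg)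
  have w: "w \<in> V"
    unfolding w_def using V(2) t x grad_in
    by (intro real_vector.subspace_diff real_vector.subspace_scale) auto
  have "0 \<le> inner (g t - x) (w - t) + L / 2 * (norm (w - t))\<^sup>2"
    using conj_arg(2)[OF w, of x] upper[OF t w] by (simp add: t_def inner_diff_left inner_diff_right inner_commute)
  also have "\<dots> = - (norm (g t - x))\<^sup>2 / (2 * L)"
  proof -
    have wt: "w - t = - (1 / L) *\<^sub>R (g t - x)" by (simp add: w_def)
    have "inner (g t - x) (w - t) = - (norm (g t - x))\<^sup>2 / L"
      unfolding wt inner_scaleR_right power2_norm_eq_inner by simp
    moreover have "L / 2 * (norm (w - t))\<^sup>2 = (norm (g t - x))\<^sup>2 / (2 * L)"
      unfolding wt norm_scaleR power_mult_distrib using L_pos by (simp add: power2_eq_square)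
    ultimately show ?thesis using L_pos by (simp add: field_simps)
  qed
  finally have "(norm (g t - x))\<^sup>2 \<le> 0" using L_pos by (simp add: field_simps)
  then show ?thesis by (simp add: t_def)
qed

lemma conj_arg_lower:
  assumes "x \<in> V" "y \<in> V"
  shows "\<phi> (conj_arg x) + inner x (y - conj_arg x) + \<mu> / 2 * (norm (y - conj_arg x))\<^sup>2 \<le> \<phi> y"
  using lower[OF conj_arg(1)[of x] assms(2)] by (simp add: grad_conj_arg[OF assms(1)])

lemma conj_arg_upper:
  assumes "x \<in> V" "y \<in> V"
  shows "\<phi> y \<le> \<phi> (conj_arg x) + inner x (y - conj_arg x) + L / 2 * (norm (y - conj_arg x))\<^sup>2"
  using upper[OF conj_arg(1)[of x] assms(2)] by (simp add: grad_conj_arg[OF assms(1)])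

text \<open>Smoothness dualizes to strong convexity with modulus \<open>1 / L\<close>: the supremum
  at \<open>y\<close> is tested at the point reached from \<open>conj_arg x\<close> by moving
  \<open>(y - x) / L\<close>.\<close>

lemma conj_val_lower:
  assumes x: "x \<in> V" and y: "y \<in> V"
  shows "conj_val x + inner (conj_arg x) (y - x) + (norm (y - x))\<^sup>2 / (2 * L) \<le> conj_val y"
proof -
  define t where "t = conj_arg x"
  define w where "w = t + (1 / L) *\<^sub>R (y - x)"
  have w: "w \<in> V"
    unfolding w_def t_def using V(2) conj_arg(1) x y
    by (intro real_vector.subspace_add real_vector.subspace_diff real_vector.subspace_scale) auto
  have "w - t = (1 / L) *\<^sub>R (y - x)" by (simp add: w_def)
  have "\<phi> w \<le> \<phi> t + inner x (w - t) + L / 2 * (norm (w - t))\<^sup>2"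
    using conj_arg_upper[OF x w] by (simp add: t_def)
  then have "conj_val x + inner t (y - x) + inner (w - t) (y - x) - L / 2 * (norm (w - t))\<^sup>2 \<le> inner w y - \<phi> w"
    by (simp add: conj_val_def t_def inner_diff_left inner_diff_right inner_commute)
  moreover have "inner (w - t) (y - x) - L / 2 * (norm (w - t))\<^sup>2 = (norm (y - x))\<^sup>2 / (2 * L)"
  proof -
    have "inner (w - t) (y - x) = (norm (y - x))\<^sup>2 / L"
      unfolding \<open>w - t = _\<close> inner_scaleR_left power2_norm_eq_inner by simp
    moreover have "L / 2 * (norm (w - t))\<^sup>2 = (norm (y - x))\<^sup>2 / (2 * L)"
      unfolding \<open>w - t = _\<close> norm_scaleR power_mult_distrib using L_pos by (simp add: power2_eq_square)
    ultimately show ?thesis using L_pos by (simp add: field_simps)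
  qed
  ultimately show ?thesis using conj_val_ge[OF w, of y] by (simp add: t_def)
qed

text \<open>Strong convexity dualizes to smoothness with constant \<open>1 / \<mu>\<close>:
  comparing the two maximizers leaves a linear minus a quadratic term in their difference, which
  Young's inequality bounds.\<close>

lemma conj_val_upper:
  assumes x: "x \<in> V" and y: "y \<in> V"
  shows "conj_val y \<le> conj_val x + inner (conj_arg x) (y - x) + (norm (y - x))\<^sup>2 / (2 * \<mu>)"
proof -
  define t where "t = conj_arg x"
  define w where "w = conj_arg y"
  have "\<phi> t + inner x (w - t) + \<mu> / 2 * (norm (w - t))\<^sup>2 \<le> \<phi> w"
    using conj_arg_lower[OF x conj_arg(1)[of y]] by (simp add: t_def w_def)
  then have "conj_val y \<le> conj_val x + inner t (y - x) + (inner (w - t) (y - x) - \<mu> / 2 * (norm (w - t))\<^sup>2)"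
    by (simp add: conj_val_def t_def w_def inner_diff_left inner_diff_right inner_commute)
  then show ?thesis using inner_le_young[OF mu_pos, of "w - t" "y - x"] by (simp add: t_def)
qed

lemma conj_arg_lipschitz:
  assumes x: "x \<in> V" and y: "y \<in> V"
  shows "(norm (conj_arg x - conj_arg y))\<^sup>2 \<le> (norm (x - y))\<^sup>2 / \<mu>\<^sup>2"
proof -
  define t where "t = conj_arg x"
  define w where "w = conj_arg y"
  have "\<phi> t + inner x (w - t) + \<mu> / 2 * (norm (w - t))\<^sup>2 \<le> \<phi> w"
    using conj_arg_lower[OF x conj_arg(1)[of y]] by (simp add: t_def w_def)
  moreover have "\<phi> w + inner y (t - w) + \<mu> / 2 * (norm (w - t))\<^sup>2 \<le> \<phi> t"
    using conj_arg_lower[OF y conj_arg(1)[of x]] by (simp add: t_def w_def norm_minus_commute)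
  ultimately have "\<mu> * (norm (w - t))\<^sup>2 \<le> inner (w - t) (y - x)"
    by (simp add: inner_diff_left inner_diff_right inner_commute)
  also have "\<dots> \<le> \<mu> / 2 * (norm (w - t))\<^sup>2 + (norm (y - x))\<^sup>2 / (2 * \<mu>)"
    by (rule inner_le_young[OF mu_pos])
  finally have "\<mu> / 2 * (norm (w - t))\<^sup>2 \<le> (norm (y - x))\<^sup>2 / (2 * \<mu>)" by simp
  then show ?thesis
    using mu_pos by (simp add: t_def w_def norm_minus_commute field_simps power2_eq_square)
qed

end

text \<open>The convexity bound from \<open>v\<close> and the smoothness bound from \<open>u\<close>
  are compared at the point that minimizes the difference between the latter and the former. This
  later bounds the variance of the Katyusha gradient estimate by a Bregman distance.\<close>

lemma cocoercive:
  fixes G :: "'a :: real_inner \<Rightarrow> 'a"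
  assumes V: "subspace V" and L: "L > 0" and uv: "u \<in> V" "v \<in> V" and G: "G u \<in> V" "G v \<in> V"
    and convex: "\<And>y. y \<in> V \<Longrightarrow> h v + inner (G v) (y - v) \<le> h y"
    and smooth: "\<And>y. y \<in> V \<Longrightarrow> h y \<le> h u + inner (G u) (y - u) + L / 2 * (norm (y - u))\<^sup>2"
  shows "(norm (G u - G v))\<^sup>2 \<le> 2 * L * (h u - h v - inner (G v) (u - v))"
proof -
  define w where "w = u - (1 / L) *\<^sub>R (G u - G v)"
  have w: "w \<in> V" unfolding w_def using V uv G
    by (intro real_vector.subspace_diff real_vector.subspace_scale) auto
  have "h v + inner (G v) (w - v) \<le> h u + inner (G u) (w - u) + L / 2 * (norm (w - u))\<^sup>2"
    using convex[OF w] smooth[OF w] by linarith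
  moreover have "inner (G v) (w - v) = inner (G v) (u - v) + inner (G v) (w - u)"
    by (simp add: inner_diff_right)
  moreover have "inner (G u) (w - u) - inner (G v) (w - u) + L / 2 * (norm (w - u))\<^sup>2 = - (norm (G u - G v))\<^sup>2 / (2 * L)"
  proof -
    have wu: "w - u = - (1 / L) *\<^sub>R (G u - G v)" by (simp add: w_def)
    have "inner (G u) (w - u) - inner (G v) (w - u) = inner (G u - G v) (w - u)"
      by (simp add: inner_diff_left)
    also have "\<dots> = - (norm (G u - G v))\<^sup>2 / L"
      unfolding wu inner_scaleR_right power2_norm_eq_inner by simp
    finally have "inner (G u) (w - u) - inner (G v) (w - u) = - (norm (G u - G v))\<^sup>2 / L" .
    moreover have "L / 2 * (norm (w - u))\<^sup>2 = (norm (G u - G v))\<^sup>2 / (2 * L)"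
      unfolding wu norm_scaleR power_mult_distrib using L by (simp add: power2_eq_square)
    ultimately show ?thesis using L by (simp add: field_simps)
  qed
  ultimately have "(norm (G u - G v))\<^sup>2 / (2 * L) \<le> h u - h v - inner (G v) (u - v)" by linarith
  then show ?thesis using L by (simp add: field_simps)
qed

section \<open>One step of Katyusha\<close>

text \<open>The step inequality is multiplied by \<open>\<tau> / a = 3 \<tau>\<^sup>2 L\<close>, so that no division by \<open>\<tau>\<close> occurs.\<close>

lemma katyusha_sample_step:
  fixes z u p v w gt p' z' x G :: "'a :: real_inner"
  assumes par: "0 < \<tau>" "\<tau> \<le> 1 / 2" "0 < L" "0 < \<mu>"
    and r: "r = 3 * \<tau>\<^sup>2 * L"
    and v: "v = \<tau> *\<^sub>R z + (1 / 2) *\<^sub>R u + (1 / 2 - \<tau>) *\<^sub>R p"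
    and z': "(r + \<tau> * \<mu>) *\<^sub>R z' = r *\<^sub>R z - \<tau> *\<^sub>R gt + \<tau> *\<^sub>R x"
    and p': "(3 * L + \<mu>) *\<^sub>R p' = (3 * L) *\<^sub>R v - gt + x"
    and smooth: "hp' \<le> hv + inner G (p' - v) + L / 2 * (norm (p' - v))\<^sup>2"
  defines "\<psi> \<equiv> \<lambda>y. \<mu> / 2 * (norm y)\<^sup>2 - inner y x"
  shows "\<tau> * inner gt (z - w) - \<tau> * \<psi> w \<le> 1 / 2 * \<psi> u + (1 / 2 - \<tau>) * \<psi> p - (hp' + \<psi> p') + hv
      + (norm (gt - G))\<^sup>2 / (4 * L) + r / 2 * (norm (z - w))\<^sup>2 - (r + \<tau> * \<mu>) / 2 * (norm (z' - w))\<^sup>2"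
proof -
  note expand = power2_norm_eq_inner inner_diff_left inner_diff_right inner_add_left inner_add_right
  \<comment> \<open>The competitor for the proximal point \<open>p'\<close>: the same combination as
    \<open>v\<close>, with the updated \<open>z'\<close> in place of \<open>z\<close>. It links the
    gradient step to the mirror step.\<close>
  define vv where "vv = \<tau> *\<^sub>R z' + (1 / 2) *\<^sub>R u + (1 / 2 - \<tau>) *\<^sub>R p"
  have vvv: "vv - v = \<tau> *\<^sub>R (z' - z)" by (simp add: vv_def v scaleR_diff_right)
  have tx: "\<tau> * inner y x = (r + \<tau> * \<mu>) * inner y z' - r * inner y z + \<tau> * inner y gt" for y
    using arg_cong[OF z', of "inner y"] by (simp add: inner_diff_right inner_add_right)
  have px: "inner y x = (3 * L + \<mu>) * inner y p' - 3 * L * inner y v + inner y gt" for y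
    using arg_cong[OF p', of "inner y"] by (simp add: inner_diff_right inner_add_right)
  \<comment> \<open>An exact three-point identity, since the mirror subproblem is quadratic and
    \<open>z'\<close> solves its linear optimality equation.\<close>
  have mirror: "\<tau> * inner gt (z' - w) + \<tau> * \<psi> z' - \<tau> * \<psi> w =
      r / 2 * (norm (z - w))\<^sup>2 - r / 2 * (norm (z - z'))\<^sup>2 - (r + \<tau> * \<mu>) / 2 * (norm (z' - w))\<^sup>2"
  proof -
    have "\<tau> * \<psi> y = \<tau> * \<mu> / 2 * inner y y - ((r + \<tau> * \<mu>) * inner y z' - r * inner y z + \<tau> * inner y gt)" for y
      unfolding tx[symmetric] by (simp add: \<psi>_def expand right_diff_distrib)
    from this[of z'] this[of w] show ?thesis by (simp add: expand inner_commute algebra_simps add_divide_distrib diff_divide_distrib)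
  qed
  have prox: "3 * L / 2 * (norm (p' - v))\<^sup>2 + inner gt (p' - v) + \<psi> p' \<le>
      3 * L / 2 * (norm (vv - v))\<^sup>2 + inner gt (vv - v) + \<psi> vv"
  proof -
    have "3 * L / 2 * (norm (vv - v))\<^sup>2 + inner gt (vv - v) + \<psi> vv
        - (3 * L / 2 * (norm (p' - v))\<^sup>2 + inner gt (p' - v) + \<psi> p') = (3 * L + \<mu>) / 2 * (norm (vv - p'))\<^sup>2"
      unfolding \<psi>_def px by (simp add: expand inner_commute algebra_simps add_divide_distrib diff_divide_distrib)
    moreover have "0 \<le> (3 * L + \<mu>) / 2 * (norm (vv - p'))\<^sup>2" using par by simp
    ultimately show ?thesis by linarith
  qed
  have lin: "3 * L / 2 * (norm (vv - v))\<^sup>2 + inner gt (vv - v) = r / 2 * (norm (z - z'))\<^sup>2 - \<tau> * inner gt (z - z')"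
    unfolding vvv r norm_scaleR power_mult_distrib inner_scaleR_right
    by (simp add: norm_minus_commute[of z' z] inner_diff_right algebra_simps)
  have conv: "\<psi> vv \<le> \<tau> * \<psi> z' + 1 / 2 * \<psi> u + (1 / 2 - \<tau>) * \<psi> p"
  proof -
    have "\<tau> * (norm z')\<^sup>2 + 1 / 2 * (norm u)\<^sup>2 + (1 / 2 - \<tau>) * (norm p)\<^sup>2 - (norm vv)\<^sup>2 =
       \<tau> / 2 * (norm (z' - u))\<^sup>2 + \<tau> * (1 / 2 - \<tau>) * (norm (z' - p))\<^sup>2 + (1 / 2 - \<tau>) / 2 * (norm (u - p))\<^sup>2"
      unfolding vv_def power2_norm_eq_inner
      by (simp add: expand inner_commute algebra_simps add_divide_distrib diff_divide_distrib power2_eq_square)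
    moreover have "0 \<le> \<tau> / 2 * (norm (z' - u))\<^sup>2 + \<tau> * (1 / 2 - \<tau>) * (norm (z' - p))\<^sup>2 + (1 / 2 - \<tau>) / 2 * (norm (u - p))\<^sup>2"
      using par by simp
    ultimately have "(norm vv)\<^sup>2 \<le> \<tau> * (norm z')\<^sup>2 + 1 / 2 * (norm u)\<^sup>2 + (1 / 2 - \<tau>) * (norm p)\<^sup>2" by linarith
    then have "\<mu> / 2 * (norm vv)\<^sup>2 \<le> \<mu> / 2 * (\<tau> * (norm z')\<^sup>2 + 1 / 2 * (norm u)\<^sup>2 + (1 / 2 - \<tau>) * (norm p)\<^sup>2)"
      using par by (intro mult_left_mono) auto
    moreover have "inner vv x = \<tau> * inner z' x + 1 / 2 * inner u x + (1 / 2 - \<tau>) * inner p x"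
      by (simp add: vv_def inner_add_left)
    ultimately show ?thesis unfolding \<psi>_def by (simp add: algebra_simps add_divide_distrib diff_divide_distrib)
  qed
  \<comment> \<open>The parameter \<open>2 * L\<close> leaves \<open>L\<close> for the quadratic
    term; together with the \<open>L / 2\<close> from smoothness this is exactly the coefficient
    \<open>3 * L / 2\<close> of the proximal step.\<close>
  have young: "inner (p' - v) (G - gt) \<le> L * (norm (p' - v))\<^sup>2 + (norm (gt - G))\<^sup>2 / (4 * L)"
    using inner_le_young[of "2 * L" "p' - v" "G - gt"] par by (simp add: norm_minus_commute)
  have split: "inner G (p' - v) = inner gt (p' - v) + inner (p' - v) (G - gt)" "inner gt (z - w) = inner gt (z - z') + inner gt (z' - w)"
    by (simp_all add: inner_diff_left inner_diff_right inner_commute)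
  have "\<tau> * inner gt (z - w) = \<tau> * inner gt (z - z') + \<tau> * inner gt (z' - w)"
    unfolding split by (simp add: algebra_simps)
  then show ?thesis using mirror prox lin conv young smooth split(1)
    by (simp only: mult.assoc)
qed

text \<open>The expectation over the drawn index, written as a sum over \<open>m\<close> samples.
  The variance bound divided by \<open>4 * L\<close> is half the Bregman distance from
  \<open>v\<close> to the snapshot; the weight \<open>1 / 2\<close> of the snapshot turns exactly
  this into \<open>1 / 2 * h u\<close>.\<close>

lemma katyusha_step:
  fixes z u p v w x G :: "'a :: real_inner" and gt p' z' :: "nat \<Rightarrow> 'a" and h :: "'a \<Rightarrow> real"
  assumes par: "0 < \<tau>" "\<tau> \<le> 1 / 2" "0 < L" "0 < \<mu>" "0 < m"
    and r: "r = 3 * \<tau>\<^sup>2 * L"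
    and v: "v = \<tau> *\<^sub>R z + (1 / 2) *\<^sub>R u + (1 / 2 - \<tau>) *\<^sub>R p"
    and z': "\<And>j. j < m \<Longrightarrow> (r + \<tau> * \<mu>) *\<^sub>R z' j = r *\<^sub>R z - \<tau> *\<^sub>R gt j + \<tau> *\<^sub>R x"
    and p': "\<And>j. j < m \<Longrightarrow> (3 * L + \<mu>) *\<^sub>R p' j = (3 * L) *\<^sub>R v - gt j + x"
    and smooth: "\<And>j. j < m \<Longrightarrow> h (p' j) \<le> h v + inner G (p' j - v) + L / 2 * (norm (p' j - v))\<^sup>2"
    and convex: "h v + inner G (p - v) \<le> h p" "h v + inner G (w - v) \<le> h w"
    and mean: "(\<Sum>j<m. gt j) = real m *\<^sub>R G"
    and var: "(\<Sum>j<m. (norm (gt j - G))\<^sup>2) \<le> real m * (2 * L * (h u - h v - inner G (u - v)))"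
  defines "F \<equiv> \<lambda>y. h y + (\<mu> / 2 * (norm y)\<^sup>2 - inner y x)"
  shows "(\<Sum>j<m. F (p' j) - F w + (r + \<tau> * \<mu>) / 2 * (norm (z' j - w))\<^sup>2) \<le>
    real m * (1 / 2 * (F u - F w) + (1 / 2 - \<tau>) * (F p - F w) + r / 2 * (norm (z - w))\<^sup>2)"
proof -
  define \<psi> where "\<psi> y = \<mu> / 2 * (norm y)\<^sup>2 - inner y x" for y
  have F: "F y = h y + \<psi> y" for y by (simp add: F_def \<psi>_def)
  define c where "c = 1 / 2 * \<psi> u + (1 / 2 - \<tau>) * \<psi> p + h v + r / 2 * (norm (z - w))\<^sup>2 + \<tau> * \<psi> w"
  have "(\<Sum>j<m. F (p' j) + (r + \<tau> * \<mu>) / 2 * (norm (z' j - w))\<^sup>2)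
     \<le> (\<Sum>j<m. c - \<tau> * inner (gt j) (z - w) + (norm (gt j - G))\<^sup>2 / (4 * L))"
  proof (rule sum_mono)
    fix j assume "j \<in> {..<m}"
    then have j: "j < m" by simp
    show "F (p' j) + (r + \<tau> * \<mu>) / 2 * (norm (z' j - w))\<^sup>2 \<le> c - \<tau> * inner (gt j) (z - w) + (norm (gt j - G))\<^sup>2 / (4 * L)"
      using katyusha_sample_step[OF par(1-4) r v z'[OF j] p'[OF j] smooth[OF j], of w]
      unfolding \<psi>_def[symmetric] F c_def by linarith
  qed
  also have "\<dots> = real m * c - \<tau> * inner (\<Sum>j<m. gt j) (z - w) + (\<Sum>j<m. (norm (gt j - G))\<^sup>2) / (4 * L)"
    by (simp add: sum.distrib sum_subtractf inner_sum_left sum_distrib_left sum_divide_distrib)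
  also have "\<dots> \<le> real m * c - \<tau> * (real m * inner G (z - w)) + real m * (1 / 2 * (h u - h v - inner G (u - v)))"
  proof -
    have "(\<Sum>j<m. (norm (gt j - G))\<^sup>2) / (4 * L) \<le> real m * (2 * L * (h u - h v - inner G (u - v))) / (4 * L)"
      using var par by (intro divide_right_mono) auto
    also have "\<dots> = real m * (1 / 2 * (h u - h v - inner G (u - v)))"
      using par by (simp add: field_simps)
    finally show ?thesis by (simp add: mean)
  qed
  also have "\<dots> = real m * (c - \<tau> * inner G (z - w) + 1 / 2 * (h u - h v - inner G (u - v)))"
    by (simp add: algebra_simps)
  also have "\<dots> \<le> real m * (1 / 2 * F u + (1 / 2 - \<tau>) * F p + \<tau> * F w + r / 2 * (norm (z - w))\<^sup>2)"
  proof (intro mult_left_mono)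
    \<comment> \<open>\<open>v\<close> is the weighted mean of \<open>z\<close>, \<open>u\<close>
      and \<open>p\<close>, so the linear term in \<open>z\<close> decomposes into those at the
      snapshot, at \<open>p\<close> and at the comparison point.\<close>
    have "\<tau> *\<^sub>R (z - w) = - ((1 / 2) *\<^sub>R (u - v)) - (1 / 2 - \<tau>) *\<^sub>R (p - v) - \<tau> *\<^sub>R (w - v)"
      unfolding v by (simp add: algebra_simps) (simp add: scaleR_add_left[symmetric] algebra_simps)
    from arg_cong[OF this, of "inner G"]
    have "\<tau> * inner G (z - w) = - (1 / 2 * inner G (u - v)) - (1 / 2 - \<tau>) * inner G (p - v) - \<tau> * inner G (w - v)"
      by (simp only: inner_diff_right inner_minus_right inner_scaleR_right)
    moreover have "(1 / 2 - \<tau>) * (h v + inner G (p - v)) \<le> (1 / 2 - \<tau>) * h p"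
      using convex(1) par by (intro mult_left_mono) auto
    moreover have "\<tau> * (h v + inner G (w - v)) \<le> \<tau> * h w"
      using convex(2) par by (intro mult_left_mono) auto
    ultimately show "c - \<tau> * inner G (z - w) + 1 / 2 * (h u - h v - inner G (u - v)) \<le>
        1 / 2 * F u + (1 / 2 - \<tau>) * F p + \<tau> * F w + r / 2 * (norm (z - w))\<^sup>2"
      unfolding c_def F by (simp add: algebra_simps add_divide_distrib)
  qed simp
  finally have *: "(\<Sum>j<m. F (p' j) + (r + \<tau> * \<mu>) / 2 * (norm (z' j - w))\<^sup>2)
    \<le> real m * (1 / 2 * F u + (1 / 2 - \<tau>) * F p + \<tau> * F w + r / 2 * (norm (z - w))\<^sup>2)" .
  have "(\<Sum>j<m. F (p' j) - F w + (r + \<tau> * \<mu>) / 2 * (norm (z' j - w))\<^sup>2) =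
      (\<Sum>j<m. F (p' j) + (r + \<tau> * \<mu>) / 2 * (norm (z' j - w))\<^sup>2) - real m * F w"
    by (simp add: sum.distrib sum_subtractf)
  also have "\<dots> \<le> real m * (1 / 2 * (F u - F w) + (1 / 2 - \<tau>) * (F p - F w) + r / 2 * (norm (z - w))\<^sup>2)"
    using * by (simp add: algebra_simps add_divide_distrib diff_divide_distrib)
  finally show ?thesis .
qed

section \<open>One step of the inexact accelerated gradient method\<close>

text \<open>The step size and the momentum correspond to the strong convexity modulus \<open>3 / 4 \<alpha>\<close> instead
  of \<open>\<alpha>\<close>; the remaining quarter absorbs the gradient error \<open>e\<close>, and the negative term
  in \<open>Xp - X\<close> later absorbs the errors that the lazy communication causes.\<close>

lemma accelerated_step:
  fixes X Y Xs g e :: "'a :: real_inner"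
  assumes par: "0 < \<alpha>" "0 < \<beta>" "0 < r" "r \<le> 8 / 25" "\<alpha> = 10 * \<beta> * r\<^sup>2"
    and \<eta>: "\<eta> = 2 / (15 * \<beta>)" and q: "q = (1 - r) / (1 + r)"
    and Yp: "Yp = X - \<eta> *\<^sub>R (g + e)" and Xp: "Xp = Yp + q *\<^sub>R (Yp - Y)"
    and Z: "Z = X + (1 / r) *\<^sub>R (X - Y)" and Zp: "Zp = Xp + (1 / r) *\<^sub>R (Xp - Yp)"
    and up: "GYp \<le> GX + inner g (Yp - X) + \<beta> / 2 * (norm (Yp - X))\<^sup>2"
    and lowY: "GX + inner g (Y - X) \<le> GY"
    and lowS: "GX + inner g (Xs - X) + \<alpha> / 2 * (norm (Xs - X))\<^sup>2 \<le> Gs"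
  shows "GYp - Gs + 3 / 8 * \<alpha> * (norm (Zp - Xs))\<^sup>2 \<le> (1 - r) * (GY - Gs + 3 / 8 * \<alpha> * (norm (Z - Xs))\<^sup>2)
     + 4 * r / \<alpha> * (norm e)\<^sup>2 - 3 / 5 * \<beta> * r * (norm (Xp - X))\<^sup>2"
proof -
  note expand = power2_norm_eq_inner inner_diff_left inner_diff_right inner_add_left inner_add_right
  define h where "h = g + e"
  define d where "d = X - Y"
  define x where "x = X - Xs"
  \<comment> \<open>With this value the weight \<open>3 / 8 * \<alpha>\<close>, divided by
    \<open>r\<^sup>2\<close>, gives the cross terms with \<open>h\<close> the coefficients
    \<open>r\<close> and \<open>1 - r\<close> and the term in \<open>(norm h)\<^sup>2\<close> the
    coefficient \<open>\<eta> / 2\<close>. The cross terms then cancel against the two convexity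
    bounds.\<close>
  have ga: "\<alpha> * \<eta> = 4 / 3 * r\<^sup>2" using par by (simp add: \<eta>)
  have bh: "\<beta> * \<eta> = 2 / 15" using par by (simp add: \<eta>)
  have eta: "0 < \<eta>" using par by (simp add: \<eta>)
  have Yd: "Yp - Y = d - \<eta> *\<^sub>R h" and YX: "Yp - X = - (\<eta> *\<^sub>R h)" by (simp_all add: Yp d_def h_def)
  have ZX: "Z - Xs = x + (1 / r) *\<^sub>R d" by (simp add: Z x_def d_def)
  \<comment> \<open>The momentum is the one for which the auxiliary point obeys a recursion in
    \<open>x\<close>, \<open>d\<close> and \<open>h\<close> with step
    \<open>\<eta> / r\<close>.\<close>
  have qr: "q + q / r = (1 - r) / r" 
  proof -
    have "q * (1 + r) = 1 - r" unfolding q using par by simp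
    then show ?thesis using par by (simp add: field_simps)
  qed
  have XpYp: "Xp - Yp = q *\<^sub>R (d - \<eta> *\<^sub>R h)" by (simp add: Xp Yd)
  have "Zp - Xs = (Yp - X) + (X - Xs) + (Xp - Yp) + (1 / r) *\<^sub>R (Xp - Yp)" by (simp add: Zp)
  also have "\<dots> = x - \<eta> *\<^sub>R h + (q + q / r) *\<^sub>R (d - \<eta> *\<^sub>R h)"
    unfolding XpYp YX by (simp add: x_def scaleR_add_left)
  also have "\<dots> = x + ((1 - r) / r) *\<^sub>R d - (\<eta> / r) *\<^sub>R h"
  proof -
    have "\<eta> + (1 - r) / r * \<eta> = \<eta> / r" using par by (simp add: field_simps)
    then show ?thesis unfolding qr by (simp add: algebra_simps) (metis scaleR_add_left add.commute)
  qed
  finally have ZpX: "Zp - Xs = x + ((1 - r) / r) *\<^sub>R d - (\<eta> / r) *\<^sub>R h" .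
  have "r\<^sup>2 * ((norm (Zp - Xs))\<^sup>2 - (1 - r) * (norm (Z - Xs))\<^sup>2) =
      r * r\<^sup>2 * (norm x)\<^sup>2 - r * (1 - r) * (norm d)\<^sup>2 + \<eta>\<^sup>2 * (norm h)\<^sup>2
      - 2 * r * \<eta> * inner x h - 2 * \<eta> * (1 - r) * inner d h"
  proof -
    have "r\<^sup>2 * (norm (Zp - Xs))\<^sup>2 = (norm (r *\<^sub>R x + (1 - r) *\<^sub>R d - \<eta> *\<^sub>R h))\<^sup>2"
    proof -
      have "r *\<^sub>R x + (1 - r) *\<^sub>R d - \<eta> *\<^sub>R h = r *\<^sub>R (Zp - Xs)"
        unfolding ZpX using par by (simp add: scaleR_diff_right scaleR_add_right)
      then show ?thesis by (simp add: power_mult_distrib)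
    qed
    moreover have "r\<^sup>2 * (norm (Z - Xs))\<^sup>2 = (norm (r *\<^sub>R x + d))\<^sup>2"
    proof -
      have "r *\<^sub>R x + d = r *\<^sub>R (Z - Xs)" unfolding ZX using par by (simp add: scaleR_add_right)
      then show ?thesis by (simp add: power_mult_distrib)
    qed
    ultimately have "r\<^sup>2 * ((norm (Zp - Xs))\<^sup>2 - (1 - r) * (norm (Z - Xs))\<^sup>2) =
        (norm (r *\<^sub>R x + (1 - r) *\<^sub>R d - \<eta> *\<^sub>R h))\<^sup>2 - (1 - r) * (norm (r *\<^sub>R x + d))\<^sup>2"
      by (simp add: algebra_simps)
    also have "\<dots> = r * r\<^sup>2 * (norm x)\<^sup>2 - r * (1 - r) * (norm d)\<^sup>2 + \<eta>\<^sup>2 * (norm h)\<^sup>2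
      - 2 * r * \<eta> * inner x h - 2 * \<eta> * (1 - r) * inner d h"
      unfolding power2_norm_eq_inner by (simp add: expand inner_commute algebra_simps power2_eq_square)
    finally show ?thesis .
  qed
  then have "3 / 8 * \<alpha> * (r\<^sup>2 * ((norm (Zp - Xs))\<^sup>2 - (1 - r) * (norm (Z - Xs))\<^sup>2)) =
      3 / 8 * \<alpha> * (r * r\<^sup>2 * (norm x)\<^sup>2 - r * (1 - r) * (norm d)\<^sup>2 + \<eta>\<^sup>2 * (norm h)\<^sup>2
      - 2 * r * \<eta> * inner x h - 2 * \<eta> * (1 - r) * inner d h)" by simp
  also have "\<dots> = 3 / 8 * \<alpha> * r * r\<^sup>2 * (norm x)\<^sup>2 - 3 / 8 * \<alpha> * r * (1 - r) * (norm d)\<^sup>2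
      + 3 / 8 * (\<alpha> * \<eta>) * \<eta> * (norm h)\<^sup>2 - 3 / 4 * (\<alpha> * \<eta>) * r * inner x h - 3 / 4 * (\<alpha> * \<eta>) * (1 - r) * inner d h"
    by (simp add: algebra_simps power2_eq_square add_divide_distrib diff_divide_distrib)
  also have "\<dots> = r\<^sup>2 * (3 / 8 * \<alpha> * r * (norm x)\<^sup>2 - 15 / 4 * \<beta> * r * (1 - r) * (norm d)\<^sup>2
      + 1 / 2 * \<eta> * (norm h)\<^sup>2 - r * inner x h - (1 - r) * inner d h)"
    unfolding ga unfolding par(5) by (simp add: algebra_simps power2_eq_square add_divide_distrib diff_divide_distrib)
  finally have "r\<^sup>2 * (3 / 8 * \<alpha> * ((norm (Zp - Xs))\<^sup>2 - (1 - r) * (norm (Z - Xs))\<^sup>2)) =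
      r\<^sup>2 * (3 / 8 * \<alpha> * r * (norm x)\<^sup>2 - 15 / 4 * \<beta> * r * (1 - r) * (norm d)\<^sup>2
      + 1 / 2 * \<eta> * (norm h)\<^sup>2 - r * inner x h - (1 - r) * inner d h)"
    by (simp only: mult.left_commute)
  moreover have "r\<^sup>2 \<noteq> 0" using par by simp
  ultimately have key: "3 / 8 * \<alpha> * ((norm (Zp - Xs))\<^sup>2 - (1 - r) * (norm (Z - Xs))\<^sup>2) =
      3 / 8 * \<alpha> * r * (norm x)\<^sup>2 - 15 / 4 * \<beta> * r * (1 - r) * (norm d)\<^sup>2
      + 1 / 2 * \<eta> * (norm h)\<^sup>2 - r * inner x h - (1 - r) * inner d h"
    using mult_left_cancel by blast
  \<comment> \<open>\<open>14 / 15\<close> is \<open>1 - \<beta> * \<eta> / 2\<close>, the decrease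
    of a gradient step of this length.\<close>
  have up': "GYp \<le> GX - 14 / 15 * \<eta> * (norm h)\<^sup>2 + \<eta> * inner e h"
  proof -
    have "inner g (Yp - X) = - (\<eta> * (norm h)\<^sup>2) + \<eta> * inner e h"
      unfolding YX by (simp add: h_def expand inner_commute algebra_simps)
    moreover have "\<beta> / 2 * (norm (Yp - X))\<^sup>2 = 1 / 2 * (\<beta> * \<eta>) * \<eta> * (norm h)\<^sup>2"
      unfolding YX using eta by (simp add: power_mult_distrib power2_eq_square)
    ultimately show ?thesis using up unfolding bh by simp
  qed
  have lowY': "(1 - r) * GX \<le> (1 - r) * GY + (1 - r) * inner d h - (1 - r) * inner e d"
  proof -
    have "GX \<le> GY + inner d h - inner e d"
      using lowY by (simp add: d_def h_def expand inner_commute)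
    then have "(1 - r) * GX \<le> (1 - r) * (GY + inner d h - inner e d)" using par by (intro mult_left_mono) auto
    then show ?thesis by (simp add: algebra_simps)
  qed
  have lowS': "r * GX \<le> r * Gs + r * inner x h - r * inner e x - 1 / 2 * \<alpha> * r * (norm x)\<^sup>2"
  proof -
    have "GX \<le> Gs + inner x h - inner e x - \<alpha> / 2 * (norm x)\<^sup>2"
      using lowS by (simp add: x_def h_def norm_minus_commute[of Xs] inner_diff_left inner_diff_right
          inner_add_left inner_add_right inner_commute)
    then have "r * GX \<le> r * (Gs + inner x h - inner e x - \<alpha> / 2 * (norm x)\<^sup>2)" using par by (intro mult_left_mono) auto
    then show ?thesis by (simp add: algebra_simps)
  qed
  have y1: "\<eta> * inner e h \<le> 1 / 6 * \<eta> * (norm h)\<^sup>2 + 3 / 2 * \<eta> * (norm e)\<^sup>2"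
  proof -
    have "\<eta> * inner e h \<le> \<eta> * (3 / 2 * (norm e)\<^sup>2 + (norm h)\<^sup>2 / 6)"
      using inner_le_young[of 3 e h] eta by (intro mult_left_mono) auto
    then show ?thesis by (simp add: algebra_simps)
  qed
  \<comment> \<open>The convexity bound supplies \<open>1 / 2 * \<alpha> * r\<close> in front of the
    squared norm of \<open>x\<close>, the Lyapunov term uses \<open>3 / 8\<close>; the remaining
    \<open>1 / 8\<close> pays for this cross term.\<close>
  have y2: "- (r * inner e x) \<le> 1 / 8 * \<alpha> * r * (norm x)\<^sup>2 + 2 * r / \<alpha> * (norm e)\<^sup>2"
  proof -
    have "r * inner x (- e) \<le> r * (\<alpha> / 8 * (norm x)\<^sup>2 + (norm e)\<^sup>2 * 2 / \<alpha>)"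
      using inner_le_young[of "\<alpha> / 4" x "- e"] par by (intro mult_left_mono) (auto simp: field_simps)
    then show ?thesis by (simp add: algebra_simps inner_commute)
  qed
  \<comment> \<open>Half of the available \<open>15 / 4 * \<beta> * r * (1 - r)\<close> is spent
    here; the other half is kept for the movement term.\<close>
  have y3: "- ((1 - r) * inner e d) \<le> 15 / 8 * \<beta> * r * (1 - r) * (norm d)\<^sup>2 + 4 / 3 * r / \<alpha> * (norm e)\<^sup>2"
  proof -
    have "inner d (- e) \<le> 15 / 8 * \<beta> * r * (norm d)\<^sup>2 + (norm e)\<^sup>2 / (15 / 2 * \<beta> * r)"
      using inner_le_young[of "15 / 4 * \<beta> * r" d "- e"] par by simp
    also have "(norm e)\<^sup>2 / (15 / 2 * \<beta> * r) = 4 / 3 * r / \<alpha> * (norm e)\<^sup>2"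
      unfolding par(5) using par(1-3) by (simp add: field_simps power2_eq_square)
    finally have "(1 - r) * inner d (- e) \<le> (1 - r) * (15 / 8 * \<beta> * r * (norm d)\<^sup>2 + 4 / 3 * r / \<alpha> * (norm e)\<^sup>2)"
      using par by (intro mult_left_mono) auto
    also have "\<dots> \<le> 15 / 8 * \<beta> * r * (1 - r) * (norm d)\<^sup>2 + 4 / 3 * r / \<alpha> * (norm e)\<^sup>2"
    proof -
      have "(1 - r) * (4 / 3 * r / \<alpha> * (norm e)\<^sup>2) \<le> 1 * (4 / 3 * r / \<alpha> * (norm e)\<^sup>2)"
        using par by (intro mult_right_mono) auto
      then show ?thesis by (simp add: algebra_simps)
    qed
    finally show ?thesis by (simp add: inner_commute)
  qed
  \<comment> \<open>Uses \<open>r \<le> 8 / 25 < 1 / 3\<close>. The three shares \<open>2\<close>,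
    \<open>4 / 3\<close> and \<open>2 / 3\<close> of \<open>r / \<alpha>\<close> add up to the
    coefficient 4 of the gradient error.\<close>
  have ee: "3 / 2 * \<eta> * (norm e)\<^sup>2 \<le> 2 / 3 * r / \<alpha> * (norm e)\<^sup>2"
  proof -
    have "3 / 2 * (\<alpha> * \<eta>) / \<alpha> = 2 * r\<^sup>2 / \<alpha>" unfolding ga by simp
    then have "3 / 2 * \<eta> = 2 * r\<^sup>2 / \<alpha>" using par(1) by simp
    moreover have "r\<^sup>2 \<le> 8 / 25 * r" using par by (simp add: power2_eq_square)
    then have "2 * r\<^sup>2 / \<alpha> \<le> 2 / 3 * r / \<alpha>" using par(1,3) by (intro divide_right_mono) auto
    ultimately have "3 / 2 * \<eta> \<le> 2 / 3 * r / \<alpha>" by simp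
    then show ?thesis by (intro mult_right_mono) auto
  qed
  \<comment> \<open>What is left over: \<open>14 / 15 - 1 / 2 - 1 / 6 = 4 / 15\<close> of the term
    in \<open>h\<close>, and half of the term in \<open>d\<close>. These dominate the movement
    because \<open>Xp - X\<close> is a combination of \<open>h\<close> and \<open>d\<close> with
    coefficients at most \<open>2 * \<eta>\<close> and 1.\<close>
  have dX: "3 / 5 * \<beta> * r * (norm (Xp - X))\<^sup>2 \<le> 4 / 15 * \<eta> * (norm h)\<^sup>2 + 15 / 8 * \<beta> * r * (1 - r) * (norm d)\<^sup>2"
  proof -
    have q01: "0 \<le> q" "q \<le> 1" using par by (auto simp: q)
    have "Xp - X = - ((1 + q) * \<eta>) *\<^sub>R h + q *\<^sub>R d"
      unfolding Xp Yd using YX by (simp add: algebra_simps)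
    then have "(norm (Xp - X))\<^sup>2 \<le> 2 * ((1 + q) * \<eta>)\<^sup>2 * (norm h)\<^sup>2 + 2 * q\<^sup>2 * (norm d)\<^sup>2"
      using norm_add_sq_le[of "- ((1 + q) * \<eta>) *\<^sub>R h" "q *\<^sub>R d"] by (simp add: power_mult_distrib)
    also have "\<dots> \<le> 2 * (2 * \<eta>)\<^sup>2 * (norm h)\<^sup>2 + 2 * 1\<^sup>2 * (norm d)\<^sup>2"
      using q01 eta by (intro add_mono mult_right_mono mult_left_mono power_mono) auto
    finally have "3 / 5 * \<beta> * r * (norm (Xp - X))\<^sup>2 \<le> 3 / 5 * \<beta> * r * (2 * (2 * \<eta>)\<^sup>2 * (norm h)\<^sup>2 + 2 * 1\<^sup>2 * (norm d)\<^sup>2)"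
      using par by (intro mult_left_mono) auto
    also have "\<dots> = 24 / 5 * (\<beta> * \<eta>) * \<eta> * r * (norm h)\<^sup>2 + 6 / 5 * \<beta> * r * (norm d)\<^sup>2"
      by (simp add: algebra_simps power2_eq_square)
    also have "24 / 5 * (\<beta> * \<eta>) * \<eta> * r * (norm h)\<^sup>2 \<le> 4 / 15 * \<eta> * (norm h)\<^sup>2"
    proof -
      have "16 / 25 * r * (\<eta> * (norm h)\<^sup>2) \<le> 4 / 15 * (\<eta> * (norm h)\<^sup>2)"
        using par eta by (intro mult_right_mono) auto
      then show ?thesis unfolding bh by (simp add: algebra_simps)
    qed
    also have "6 / 5 * \<beta> * r * (norm d)\<^sup>2 \<le> 15 / 8 * \<beta> * r * (1 - r) * (norm d)\<^sup>2"
    proof -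
      have "6 / 5 * (\<beta> * r * (norm d)\<^sup>2) \<le> 15 / 8 * (1 - r) * (\<beta> * r * (norm d)\<^sup>2)"
        using par by (intro mult_right_mono) auto
      then show ?thesis by (simp add: algebra_simps)
    qed
    finally show ?thesis by simp
  qed
  define E where "E = r / \<alpha> * (norm e)\<^sup>2"
  have E: "c * r / \<alpha> * (norm e)\<^sup>2 = c * E" for c by (simp add: E_def)
  have "GX = (1 - r) * GX + r * GX" by (simp add: algebra_simps)
  then show ?thesis
    using key up' lowY' lowS' y1 y2 y3 ee dX unfolding E
    by (simp add: algebra_simps add_divide_distrib diff_divide_distrib)
qed

section \<open>Gradients\<close>

lemma has_gradient_emb:
  assumes "x \<in> carrier_vec d"
  shows "has_gradient d h x g \<longleftrightarrow> g \<in> carrier_vec d \<and>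
    (\<forall>e>0. \<exists>r>0. \<forall>v\<in>carrier_vec d. norm (emb v) < r \<longrightarrow>
      \<bar>h (x + v) - h x - inner (emb g) (emb v)\<bar> \<le> e * norm (emb v))"
  unfolding has_gradient_def vnorm_eq_norm_emb by (auto simp: inner_emb[of _ d])

text \<open>Licenses the definite description in \<open>gradient\<close>: along a small multiple of
  the difference of two candidates their linear parts agree up to any prescribed relative
  error.\<close>

lemma has_gradient_unique:
  assumes x: "x \<in> carrier_vec d" and g: "has_gradient d h x g" and g': "has_gradient d h x g'"
  shows "g = g'"
proof -
  define w where "w = g - g'"
  have c: "g \<in> carrier_vec d" "g' \<in> carrier_vec d" "w \<in> carrier_vec d"
    using g g' by (auto simp: has_gradient_def w_def)
  have ew: "emb w = emb g - emb g'" using c by (simp add: w_def emb_ops[of _ d])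
  have "norm (emb w) \<le> e" if e: "e > 0" for e
  proof (cases "emb w = 0")
    case False
    obtain r1 where r1: "r1 > 0" "\<And>v. v \<in> carrier_vec d \<Longrightarrow> norm (emb v) < r1 \<Longrightarrow>
        \<bar>h (x + v) - h x - inner (emb g) (emb v)\<bar> \<le> e / 2 * norm (emb v)"
      using g e unfolding has_gradient_emb[OF x] by (meson half_gt_zero)
    obtain r2 where r2: "r2 > 0" "\<And>v. v \<in> carrier_vec d \<Longrightarrow> norm (emb v) < r2 \<Longrightarrow>
        \<bar>h (x + v) - h x - inner (emb g') (emb v)\<bar> \<le> e / 2 * norm (emb v)"
      using g' e unfolding has_gradient_emb[OF x] by (meson half_gt_zero)
    define t where "t = min r1 r2 / (2 * norm (emb w))"
    define v where "v = t \<cdot>\<^sub>v w"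
    have t: "t > 0" "t * norm (emb w) < r1" "t * norm (emb w) < r2"
      using r1(1) r2(1) False by (auto simp: t_def)
    have v: "v \<in> carrier_vec d" "emb v = t *\<^sub>R emb w" "norm (emb v) = t * norm (emb w)"
      using c t by (auto simp: v_def emb_smult)
    have "\<bar>inner (emb g) (emb v) - inner (emb g') (emb v)\<bar> \<le> e * norm (emb v)"
    proof -
      have "norm (emb v) < r1" "norm (emb v) < r2" using v(3) t by auto
      from r1(2)[OF v(1) this(1)] r2(2)[OF v(1) this(2)] show ?thesis by linarith
    qed
    then have "\<bar>t * (norm (emb w))\<^sup>2\<bar> \<le> e * (t * norm (emb w))"
      unfolding v(3) by (simp add: v(2) inner_diff_left[symmetric] ew[symmetric] power2_norm_eq_inner[symmetric] right_diff_distrib[symmetric])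
    then show ?thesis using t False by (simp add: power2_eq_square)
  qed (use e in simp)
  then have "norm (emb w) \<le> 0" by (meson dense not_le order_less_irrefl order_less_le_trans)
  then have "emb g = emb g'" using ew by simp
  then show ?thesis using c emb_inject by blast
qed

lemma gradient_eqI:
  assumes "x \<in> carrier_vec d" "has_gradient d h x g"
  shows "gradient d h x = g"
  unfolding gradient_def using assms has_gradient_unique by (intro the_equality) auto

lemma has_gradient_gradient:
  assumes "differentiable_fun d h" "x \<in> carrier_vec d"
  shows "has_gradient d h x (gradient d h x)"
  using assms gradient_eqI unfolding differentiable_fun_def by metis

lemma gradient_minus_quadratic:
  assumes x: "x \<in> carrier_vec d" and h: "differentiable_fun d h"
  shows "gradient d (\<lambda>\<theta>. h \<theta> - \<mu> / 2 * (vnorm \<theta>)\<^sup>2) x = gradient d h x - \<mu> \<cdot>\<^sub>v x"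
proof (rule gradient_eqI[OF x])
  define g where "g = gradient d h x"
  have hg: "has_gradient d h x g" unfolding g_def by (rule has_gradient_gradient[OF h x])
  then have g: "g \<in> carrier_vec d" by (simp add: has_gradient_def)
  have eg: "emb (g - \<mu> \<cdot>\<^sub>v x) = emb g - \<mu> *\<^sub>R emb x"
    using g x by (simp add: emb_ops[of _ d] emb_smult)
  have "\<exists>r>0. \<forall>v\<in>carrier_vec d. norm (emb v) < r \<longrightarrow>
      \<bar>h (x + v) - \<mu> / 2 * (norm (emb (x + v)))\<^sup>2 - (h x - \<mu> / 2 * (norm (emb x))\<^sup>2)
        - inner (emb g - \<mu> *\<^sub>R emb x) (emb v)\<bar> \<le> e * norm (emb v)" if e: "e > 0" for e
  proof -
    obtain r1 where r1: "r1 > 0" "\<And>v. v \<in> carrier_vec d \<Longrightarrow> norm (emb v) < r1 \<Longrightarrow>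
        \<bar>h (x + v) - h x - inner (emb g) (emb v)\<bar> \<le> e / 2 * norm (emb v)"
      using hg e unfolding has_gradient_emb[OF x] by (meson half_gt_zero)
    define r where "r = min r1 (e / (\<bar>\<mu>\<bar> + 1))"
    have "r > 0" using r1 e by (simp add: r_def)
    moreover have "\<bar>h (x + v) - \<mu> / 2 * (norm (emb (x + v)))\<^sup>2 - (h x - \<mu> / 2 * (norm (emb x))\<^sup>2)
        - inner (emb g - \<mu> *\<^sub>R emb x) (emb v)\<bar> \<le> e * norm (emb v)"
      if v: "v \<in> carrier_vec d" "norm (emb v) < r" for v
    proof -
      have "norm (emb v) * (\<bar>\<mu>\<bar> + 1) \<le> e" using v(2) by (simp add: r_def field_simps)
      then have "\<bar>\<mu>\<bar> * norm (emb v) \<le> e" by (simp add: algebra_simps) (smt (verit) norm_ge_zero)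
      then have "\<bar>\<mu>\<bar> * norm (emb v) * norm (emb v) \<le> e * norm (emb v)" by (rule mult_right_mono) simp
      then have q: "\<bar>\<mu> / 2 * (norm (emb v))\<^sup>2\<bar> \<le> e / 2 * norm (emb v)"
        by (simp add: abs_mult power2_eq_square mult.assoc)
      have "h (x + v) - \<mu> / 2 * (norm (emb (x + v)))\<^sup>2 - (h x - \<mu> / 2 * (norm (emb x))\<^sup>2)
          - inner (emb g - \<mu> *\<^sub>R emb x) (emb v) = (h (x + v) - h x - inner (emb g) (emb v)) - \<mu> / 2 * (norm (emb v))\<^sup>2"
        unfolding power2_norm_eq_inner emb_ops(1)[OF x v(1)]
        by (simp add: inner_add_left inner_add_right inner_diff_left inner_commute algebra_simps add_divide_distrib)
      moreover have "norm (emb v) < r1" using v(2) by (simp add: r_def)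
      from r1(2)[OF v(1) this] have "\<bar>(h (x + v) - h x - inner (emb g) (emb v)) - \<mu> / 2 * (norm (emb v))\<^sup>2\<bar> \<le> e * norm (emb v)"
        using q by linarith
      ultimately show ?thesis by simp
    qed
    ultimately show ?thesis by blast
  qed
  then show "has_gradient d (\<lambda>\<theta>. h \<theta> - \<mu> / 2 * (vnorm \<theta>)\<^sup>2) x (gradient d h x - \<mu> \<cdot>\<^sub>v x)"
    unfolding has_gradient_emb[OF x] vnorm_eq_norm_emb g_def[symmetric] eg using g x by simp
qed

lemma arg_min_on_eqI:
  fixes f :: "'a \<Rightarrow> real"
  assumes "x \<in> S" "\<And>y. y \<in> S \<Longrightarrow> y \<noteq> x \<Longrightarrow> f x < f y"
  shows "arg_min_on f S = x"
  unfolding arg_min_on_def arg_min_def is_arg_min_def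
  using assms by (intro some_equality) force+

text \<open>Both Katyusha subproblems have this form. Completing the square identifies the chosen
  minimizer; its optimality condition is kept as a linear equation without division, the form that
  the step lemmas consume.\<close>

lemma arg_min_prox:
  assumes pos: "0 < k" "0 < \<mu>" and c: "c \<in> carrier_vec d" "gt \<in> carrier_vec d" "x \<in> carrier_vec d"
  defines "w0 \<equiv> arg_min_on (\<lambda>w. k * (vnorm (w - c))\<^sup>2 + gt \<bullet> w + (\<mu> / 2 * (vnorm w)\<^sup>2 - w \<bullet> x)) (carrier_vec d)"
  shows "w0 \<in> carrier_vec d" "(2 * k + \<mu>) *\<^sub>R emb w0 = (2 * k) *\<^sub>R emb c - emb gt + emb x"
proof -
  define p where "p = (1 / (2 * k + \<mu>)) \<cdot>\<^sub>v ((2 * k) \<cdot>\<^sub>v c - gt + x)"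
  have p: "p \<in> carrier_vec d" using c by (simp add: p_def)
  have ep: "(2 * k + \<mu>) *\<^sub>R emb p = (2 * k) *\<^sub>R emb c - emb gt + emb x"
    using pos c by (simp add: p_def emb_smult emb_ops[of _ d])
  have "w0 = p" unfolding w0_def
  proof (rule arg_min_on_eqI[OF p])
    fix y assume y: "y \<in> carrier_vec d" "y \<noteq> p"
    let ?f = "\<lambda>w. k * (vnorm (w - c))\<^sup>2 + gt \<bullet> w + (\<mu> / 2 * (vnorm w)\<^sup>2 - w \<bullet> x)"
    have f: "?f w = k * (norm (emb w - emb c))\<^sup>2 + inner (emb gt) (emb w) + (\<mu> / 2 * (norm (emb w))\<^sup>2 - inner (emb w) (emb x))"
      if "w \<in> carrier_vec d" for w
      unfolding vnorm_eq_norm_emb emb_ops(2)[OF that c(1)] inner_emb[OF c(2) that] inner_emb[OF that c(3)] ..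
    have ix: "inner w (emb x) = (2 * k + \<mu>) * inner w (emb p) - 2 * k * inner w (emb c) + inner w (emb gt)" for w
      using arg_cong[OF ep, of "inner w"] by (simp add: inner_diff_right inner_add_right)
    have "?f y - ?f p = (k + \<mu> / 2) * (norm (emb y - emb p))\<^sup>2"
      unfolding f[OF y(1)] f[OF p] ix power2_norm_eq_inner
      by (simp add: inner_diff_left inner_diff_right inner_commute algebra_simps add_divide_distrib diff_divide_distrib)
    moreover have "emb y \<noteq> emb p" using y p emb_inject by blast
    ultimately have "?f y - ?f p > 0" using pos by simp
    then show "?f p < ?f y" by simp
  qed
  then show "w0 \<in> carrier_vec d" "(2 * k + \<mu>) *\<^sub>R emb w0 = (2 * k) *\<^sub>R emb c - emb gt + emb x"
    using p ep by simp_all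
qed

section \<open>Expectations of finitely supported distributions\<close>

text \<open>Every distribution here arises from finitely many draws from finite sets, so finiteness
  of supports discharges all integrability conditions.\<close>

lemma expectation_bind:
  fixes g :: "'b \<Rightarrow> real"
  assumes "finite (set_pmf M)" "\<And>x. x \<in> set_pmf M \<Longrightarrow> finite (set_pmf (f x))"
  shows "measure_pmf.expectation (bind_pmf M f) g = measure_pmf.expectation M (\<lambda>x. measure_pmf.expectation (f x) g)"
  using assms by (subst pmf_expectation_bind[of "set_pmf M"]) (auto simp: integral_measure_pmf[of "set_pmf M"])

lemma expectation_mono:
  fixes f g :: "'a \<Rightarrow> real"
  assumes "finite (set_pmf M)" "\<And>x. x \<in> set_pmf M \<Longrightarrow> f x \<le> g x"
  shows "measure_pmf.expectation M f \<le> measure_pmf.expectation M g"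
  using assms by (intro integral_mono_AE integrable_measure_pmf_finite) (auto simp: AE_measure_pmf_iff)

lemma expectation_cong:
  fixes f g :: "'a \<Rightarrow> real"
  assumes "\<And>x. x \<in> set_pmf M \<Longrightarrow> f x = g x"
  shows "measure_pmf.expectation M f = measure_pmf.expectation M g"
  using assms by (intro integral_cong_AE) (auto simp: AE_measure_pmf_iff)

lemma expectation_linear:
  fixes f g :: "'a \<Rightarrow> real"
  assumes "finite (set_pmf M)"
  shows "measure_pmf.expectation M (\<lambda>x. f x + g x) = measure_pmf.expectation M f + measure_pmf.expectation M g"
    "measure_pmf.expectation M (\<lambda>x. f x - g x) = measure_pmf.expectation M f - measure_pmf.expectation M g"
    "measure_pmf.expectation M (\<lambda>x. a * f x) = a * measure_pmf.expectation M f"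
  using integrable_measure_pmf_finite[OF assms, of f] integrable_measure_pmf_finite[OF assms, of g] by simp_all

section \<open>The local problem of a worker\<close>

locale worker =
  fixes d m :: nat and f :: "nat \<Rightarrow> real vec \<Rightarrow> real" and L \<mu> :: real
  assumes dim_pos: "d \<ge> 1" and sample_pos: "m \<ge> 1" and mu_gt_0: "\<mu> > 0"
    and differentiable: "j < m \<Longrightarrow> differentiable_fun d (f j)"
    and smooth: "j < m \<Longrightarrow> smooth_fun d L (f j)"
    and strongly_convex: "j < m \<Longrightarrow> strongly_convex_fun d \<mu> (f j)"
begin

abbreviation "V \<equiv> supported {..<d} :: nat fsv set"

definition sample :: "nat \<Rightarrow> nat fsv \<Rightarrow> real" where
  "sample j \<theta> = f j (unemb d \<theta>)"
definition sample_grad :: "nat \<Rightarrow> nat fsv \<Rightarrow> nat fsv" where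
  "sample_grad j \<theta> = emb (gradient d (f j) (unemb d \<theta>))"
definition loss :: "nat fsv \<Rightarrow> real" where
  "loss \<theta> = (1 / real m) * (\<Sum>j<m. sample j \<theta>)"
definition loss_grad :: "nat fsv \<Rightarrow> nat fsv" where
  "loss_grad \<theta> = (1 / real m) *\<^sub>R (\<Sum>j<m. sample_grad j \<theta>)"

lemma gradient_carrier: "j < m \<Longrightarrow> x \<in> carrier_vec d \<Longrightarrow> gradient d (f j) x \<in> carrier_vec d"
  using has_gradient_gradient[OF differentiable] by (auto simp: has_gradient_def)

lemma sample_grad_in: "j < m \<Longrightarrow> sample_grad j \<theta> \<in> V"
  unfolding sample_grad_def by (intro emb_supported gradient_carrier) auto

lemma sample_bounds:
  assumes j: "j < m" and x: "x \<in> V" "y \<in> V"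
  shows "sample j x + inner (sample_grad j x) (y - x) + \<mu> / 2 * (norm (y - x))\<^sup>2 \<le> sample j y"
    "sample j y \<le> sample j x + inner (sample_grad j x) (y - x) + L / 2 * (norm (y - x))\<^sup>2"
proof -
  let ?x = "unemb d x" and ?y = "unemb d y"
  have e: "emb (?y - ?x) = y - x" using x by (simp add: emb_ops[of _ d] emb_unemb)
  have i: "gradient d (f j) ?x \<bullet> (?y - ?x) = inner (sample_grad j x) (y - x)"
    unfolding sample_grad_def e[symmetric] using gradient_carrier[OF j] by (intro inner_emb[of _ d, symmetric]) auto
  have n: "vnorm (?y - ?x) = norm (y - x)" by (simp add: vnorm_eq_norm_emb e)
  have "f j ?x + gradient d (f j) ?x \<bullet> (?y - ?x) + \<mu> / 2 * (vnorm (?y - ?x))\<^sup>2 \<le> f j ?y"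
    by (rule bspec[OF bspec[OF strongly_convex[OF j, unfolded strongly_convex_fun_def] unemb_carrier] unemb_carrier])
  then show "sample j x + inner (sample_grad j x) (y - x) + \<mu> / 2 * (norm (y - x))\<^sup>2 \<le> sample j y"
    unfolding i n sample_def .
  have "f j ?y \<le> f j ?x + gradient d (f j) ?x \<bullet> (?y - ?x) + L / 2 * (vnorm (?y - ?x))\<^sup>2"
    by (rule bspec[OF bspec[OF smooth[OF j, unfolded smooth_fun_def] unemb_carrier] unemb_carrier])
  then show "sample j y \<le> sample j x + inner (sample_grad j x) (y - x) + L / 2 * (norm (y - x))\<^sup>2"
    unfolding i n sample_def .
qed

text \<open>The two quadratic bounds sandwich the loss in the direction of a unit vector, which
  exists since \<open>d \<ge> 1\<close>.\<close>

lemma mu_le_L: "\<mu> \<le> L"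
proof -
  define y where "y = emb (unit_vec d 0)"
  have y: "y \<in> V" unfolding y_def by (intro emb_supported) simp
  have "(norm y)\<^sup>2 = unit_vec d 0 \<bullet> unit_vec d 0"
    unfolding y_def power2_norm_eq_inner by (rule inner_emb[of _ d]) auto
  then have "(norm y)\<^sup>2 = 1" using dim_pos by simp
  then show ?thesis
    using sample_bounds[of 0 0 y] y sample_pos real_vector.subspace_0[OF subspace_supported] by fastforce
qed

lemma L_gt_0: "L > 0" using mu_le_L mu_gt_0 by linarith

lemma loss_bounds:
  assumes x: "x \<in> V" "y \<in> V"
  shows "loss x + inner (loss_grad x) (y - x) + \<mu> / 2 * (norm (y - x))\<^sup>2 \<le> loss y"
    "loss y \<le> loss x + inner (loss_grad x) (y - x) + L / 2 * (norm (y - x))\<^sup>2"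
proof -
  have m: "real m > 0" using sample_pos by simp
  have av: "loss x + inner (loss_grad x) (y - x) + c =
      (1 / real m) * (\<Sum>j<m. sample j x + inner (sample_grad j x) (y - x) + c)" for c
    unfolding loss_def loss_grad_def using m
    by (simp add: sum.distrib inner_sum_left add_divide_distrib)
  show "loss x + inner (loss_grad x) (y - x) + \<mu> / 2 * (norm (y - x))\<^sup>2 \<le> loss y"
    unfolding av loss_def[of y] using sample_bounds(1)[OF _ x] m by (intro mult_left_mono sum_mono) auto
  show "loss y \<le> loss x + inner (loss_grad x) (y - x) + L / 2 * (norm (y - x))\<^sup>2"
    unfolding av loss_def[of y] using sample_bounds(2)[OF _ x] m by (intro mult_left_mono sum_mono) auto
qed

sublocale smooth_strongly_convex_on V loss loss_grad \<mu> L
proof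
  show "complete V" by (rule complete_supported) simp
  show "subspace V" by (rule subspace_supported)
  show "loss_grad x \<in> V" for x
    unfolding loss_grad_def using sample_grad_in
    by (intro real_vector.subspace_scale[OF subspace_supported] real_vector.subspace_sum[OF subspace_supported]) auto
qed (use mu_gt_0 L_gt_0 loss_bounds in auto)

lemma loss_emb: "\<theta> \<in> carrier_vec d \<Longrightarrow> loss (emb \<theta>) = (1 / real m) * (\<Sum>j<m. f j \<theta>)"
  by (simp add: loss_def sample_def)

text \<open>The real supremum is attained at \<open>conj_arg\<close>, so it is a maximum and no junk
  value of an unbounded supremum can occur.\<close>

lemma convex_conjugate_loss:
  assumes x: "x \<in> carrier_vec d"
  shows "convex_conjugate d (\<lambda>\<theta>. (1 / real m) * (\<Sum>j<m. f j \<theta>)) x = conj_val (emb x)"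
  unfolding convex_conjugate_def
proof (rule cSup_eq_maximum)
  let ?t = "conj_arg (emb x)"
  have t: "emb (unemb d ?t) = ?t" using conj_arg(1) by (rule emb_unemb)
  have i: "unemb d ?t \<bullet> x = inner ?t (emb x)"
    using inner_emb[OF unemb_carrier x, of ?t] unfolding t by (rule sym)
  have "(1 / real m) * (\<Sum>j<m. f j (unemb d ?t)) = loss ?t"
    using loss_emb[OF unemb_carrier, of ?t] unfolding t by (rule sym)
  with i have h: "unemb d ?t \<bullet> x - (1 / real m) * (\<Sum>j<m. f j (unemb d ?t)) = conj_val (emb x)"
    unfolding conj_val_def by (simp only:)
  show "conj_val (emb x) \<in> (\<lambda>\<theta>. \<theta> \<bullet> x - (1 / real m) * (\<Sum>j<m. f j \<theta>)) ` carrier_vec d"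
    unfolding h[symmetric] by (rule imageI) (rule unemb_carrier)
next
  fix y assume "y \<in> (\<lambda>\<theta>. \<theta> \<bullet> x - (1 / real m) * (\<Sum>j<m. f j \<theta>)) ` carrier_vec d"
  then obtain \<theta> where th: "\<theta> \<in> carrier_vec d" "y = \<theta> \<bullet> x - (1 / real m) * (\<Sum>j<m. f j \<theta>)" by auto
  then have "y = inner (emb \<theta>) (emb x) - loss (emb \<theta>)" using x by (simp add: inner_emb[of _ d] loss_emb)
  then show "y \<le> conj_val (emb x)" using conj_val_ge[OF emb_supported[OF th(1)]] by simp
qed

text \<open>The linearization error lies between 0 and \<open>|v|^2 / (2 \<mu>)\<close>, so the
  radius \<open>2 * \<mu> * e\<close> works for relative error \<open>e\<close>.\<close>

lemma gradient_convex_conjugate_loss: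
  assumes x: "x \<in> carrier_vec d"
  shows "gradient d (convex_conjugate d (\<lambda>\<theta>. (1 / real m) * (\<Sum>j<m. f j \<theta>))) x = unemb d (conj_arg (emb x))"
proof (rule gradient_eqI[OF x])
  let ?c = "convex_conjugate d (\<lambda>\<theta>. (1 / real m) * (\<Sum>j<m. f j \<theta>))"
  have t: "emb (unemb d (conj_arg (emb x))) = conj_arg (emb x)" using conj_arg(1) by (rule emb_unemb)
  have "\<bar>?c (x + v) - ?c x - inner (conj_arg (emb x)) (emb v)\<bar> \<le> e * norm (emb v)"
    if v: "v \<in> carrier_vec d" "norm (emb v) < 2 * \<mu> * e" for v e
  proof -
    have xv: "emb (x + v) \<in> V" "emb (x + v) - emb x = emb v"
      using emb_supported[of "x + v" d] emb_ops(1)[OF x v(1)] x v(1) by auto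
    have "norm (emb v) * norm (emb v) \<le> 2 * \<mu> * e * norm (emb v)"
      using v(2) by (intro mult_right_mono) auto
    then have "(norm (emb v))\<^sup>2 / (2 * \<mu>) \<le> e * norm (emb v)"
      using mu_gt_0 by (simp add: field_simps power2_eq_square)
    moreover have "0 \<le> (norm (emb v))\<^sup>2 / (2 * L)" using L_gt_0 by simp
    moreover have "?c (x + v) = conj_val (emb (x + v))" "?c x = conj_val (emb x)"
      by (rule convex_conjugate_loss, use x v(1) in simp)+
    ultimately show ?thesis
      using conj_val_upper[OF emb_supported[OF x] xv(1)] conj_val_lower[OF emb_supported[OF x] xv(1)]
      unfolding xv(2) by linarith
  qed
  then have "\<exists>r>0. \<forall>v\<in>carrier_vec d. norm (emb v) < r \<longrightarrow>
      \<bar>?c (x + v) - ?c x - inner (conj_arg (emb x)) (emb v)\<bar> \<le> e * norm (emb v)" if "e > 0" for e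
    using that mu_gt_0 by (intro exI[of _ "2 * \<mu> * e"]) auto
  then show "has_gradient d ?c x (unemb d (conj_arg (emb x)))"
    unfolding has_gradient_emb[OF x] t by simp
qed

end

section \<open>Convergence of Katyusha\<close>

lemma sum_norm_deviation_le:
  fixes a :: "nat \<Rightarrow> 'a :: real_inner"
  assumes m: "m > 0"
  shows "(\<Sum>j<m. (norm (a j - (1 / real m) *\<^sub>R (\<Sum>j<m. a j)))\<^sup>2) \<le> (\<Sum>j<m. (norm (a j))\<^sup>2)"
proof -
  define b where "b = (1 / real m) *\<^sub>R (\<Sum>j<m. a j)"
  have "(\<Sum>j<m. (norm (a j - b))\<^sup>2) = (\<Sum>j<m. (norm (a j))\<^sup>2 - 2 * inner (a j) b + (norm b)\<^sup>2)"
    unfolding power2_norm_eq_inner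
    by (intro sum.cong) (auto simp: inner_diff_left inner_diff_right inner_commute)
  also have "\<dots> = (\<Sum>j<m. (norm (a j))\<^sup>2) - 2 * inner (\<Sum>j<m. a j) b + real m * (norm b)\<^sup>2"
    by (simp add: sum.distrib sum_subtractf inner_sum_left sum_distrib_left)
  also have "(\<Sum>j<m. a j) = real m *\<^sub>R b" using m by (simp add: b_def)
  finally have "(\<Sum>j<m. (norm (a j - b))\<^sup>2) = (\<Sum>j<m. (norm (a j))\<^sup>2) - real m * (norm b)\<^sup>2"
    by (simp add: power2_norm_eq_inner)
  then show ?thesis by (simp add: b_def[symmetric])
qed

locale katyusha_problem = worker +
  fixes x :: "real vec"
  assumes x: "x \<in> carrier_vec d"
begin

definition h :: "nat \<Rightarrow> real vec \<Rightarrow> real" where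
  "h = (\<lambda>j \<theta>. f j \<theta> - \<mu> / 2 * (vnorm \<theta>)\<^sup>2)"
definition psi :: "real vec \<Rightarrow> real" where
  "psi = (\<lambda>\<theta>. \<mu> / 2 * (vnorm \<theta>)\<^sup>2 - \<theta> \<bullet> x)"
definition tau :: real where "tau = min (sqrt (2 * real m * \<mu> / (3 * L))) (1 / 2)"
definition step_a :: real where "step_a = 1 / (3 * tau * L)"
definition th :: real where "th = 1 + step_a * \<mu>"
text \<open>Equals \<open>tau / step_a\<close>, the coefficient of the mirror distance after the
  division by \<open>tau\<close> has been cleared.\<close>

definition rr :: real where "rr = 3 * tau\<^sup>2 * L"
definition W :: "nat \<Rightarrow> real" where "W l = (\<Sum>k<l. th ^ k)"
definition w :: "nat fsv" where "w = conj_arg (emb x)"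
definition gap :: "nat fsv \<Rightarrow> real" where
  "gap y = loss y - inner y (emb x) - (loss w - inner w (emb x))"

text \<open>\<open>kv\<close>, \<open>kg\<close>, \<open>kz\<close>, \<open>kp\<close> are the algorithm's \<open>u\<^sub>t\<^sub>+\<^sub>1\<close>, \<open>g\<close> (the variance-reduced gradient), \<open>z\<^sub>t\<^sub>+\<^sub>1\<close>, \<open>p\<^sub>t\<^sub>+\<^sub>1\<close> as
  functions of the snapshot \<open>u\<close>, the current \<open>p\<close>, \<open>z\<close> and the drawn index \<open>j\<close>.\<close>

definition kv :: "real vec \<Rightarrow> real vec \<Rightarrow> real vec \<Rightarrow> real vec" where
  "kv u p z = tau \<cdot>\<^sub>v z + (1 / 2) \<cdot>\<^sub>v u + (1 - tau - 1 / 2) \<cdot>\<^sub>v p"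
definition kg :: "real vec \<Rightarrow> real vec \<Rightarrow> real vec \<Rightarrow> nat \<Rightarrow> real vec" where
  "kg u p z j = (1 / real m) \<cdot>\<^sub>v finsum_vec TYPE(real) d (\<lambda>j. gradient d (h j) u) {..<m}
     + gradient d (h j) (kv u p z) - gradient d (h j) u"
definition kz :: "real vec \<Rightarrow> real vec \<Rightarrow> real vec \<Rightarrow> nat \<Rightarrow> real vec" where
  "kz u p z j = arg_min_on (\<lambda>w. 1 / (2 * step_a) * (vnorm (w - z))\<^sup>2 + kg u p z j \<bullet> w + psi w) (carrier_vec d)"
definition kp :: "real vec \<Rightarrow> real vec \<Rightarrow> real vec \<Rightarrow> nat \<Rightarrow> real vec" where
  "kp u p z j = arg_min_on (\<lambda>w. 3 * L / 2 * (vnorm (w - kv u p z))\<^sup>2 + kg u p z j \<bullet> w + psi w) (carrier_vec d)"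

lemma inner_Suc:
  "katyusha_inner d m h psi L \<mu> u p0 z0 (Suc l) =
     bind_pmf (katyusha_inner d m h psi L \<mu> u p0 z0 l) (\<lambda>(p, z, acc, cost).
       bind_pmf (pmf_of_set {..<m}) (\<lambda>j.
         return_pmf (kp u p z j, kz u p z j, acc + th ^ l \<cdot>\<^sub>v kp u p z j, cost + 2)))"
  by (simp only: katyusha_inner.simps Let_def kp_def kz_def kg_def kv_def th_def step_a_def tau_def)

lemma tau: "0 < tau" "tau \<le> 1 / 2" "tau\<^sup>2 \<le> 2 * real m * \<mu> / (3 * L)"
proof -
  have pos: "0 < 2 * real m * \<mu> / (3 * L)" using sample_pos mu_gt_0 L_gt_0 by simp
  then show "0 < tau" "tau \<le> 1 / 2" by (auto simp: tau_def)
  have "tau\<^sup>2 \<le> (sqrt (2 * real m * \<mu> / (3 * L)))\<^sup>2"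
    using \<open>0 < tau\<close> by (intro power_mono) (auto simp: tau_def)
  then show "tau\<^sup>2 \<le> 2 * real m * \<mu> / (3 * L)" using pos by simp
qed

lemma rr_pos: "0 < rr" using tau(1) L_gt_0 by (simp add: rr_def)

lemma rr_th: "rr * th = rr + tau * \<mu>"
  using tau(1) L_gt_0 by (simp add: rr_def th_def step_a_def field_simps power2_eq_square)

lemma step_a_pos: "0 < step_a" using tau(1) L_gt_0 by (simp add: step_a_def)

lemma th_gt_1: "1 < th" using step_a_pos mu_gt_0 by (simp add: th_def)

lemma W_Suc: "W (Suc l) = W l + th ^ l" by (simp add: W_def)

lemma W_pos: "0 < l \<Longrightarrow> 0 < W l"
  unfolding W_def using th_gt_1 by (intro sum_pos) auto

lemma W_ge: "real l \<le> W l"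
proof -
  have "(\<Sum>k<l. 1) \<le> (\<Sum>k<l. th ^ k)" using th_gt_1 by (intro sum_mono) (simp add: one_le_power)
  then show ?thesis by (simp add: W_def)
qed

text \<open>The two sources of contraction in an epoch. Bernoulli's inequality gives the growth of
  the weights, as \<open>tau \<le> 2 m * step_a * \<mu>\<close> follows from the bound on the square
  of \<open>tau\<close>. The second factor exceeds the snapshot weight \<open>1 / 2\<close> by
  \<open>1 + tau\<close>.\<close>

lemma epoch_factors:
  "1 + tau \<le> th ^ (2 * m)" "(1 + tau) / 2 \<le> 1 - (1 / 2 - tau) * th"
proof -
  have m: "real m \<ge> 1" using sample_pos by simp
  have "tau * tau \<le> 2 * real m * \<mu> / (3 * L)" using tau(3) by (simp add: power2_eq_square)
  then have "tau \<le> 2 * real m * \<mu> / (3 * L) / tau"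
    by (simp only: pos_le_divide_eq[OF tau(1)])
  also have "\<dots> = real (2 * m) * (step_a * \<mu>)" by (simp add: step_a_def)
  finally have 1: "tau \<le> real (2 * m) * (step_a * \<mu>)" .
  have "1 + real (2 * m) * (step_a * \<mu>) \<le> (1 + step_a * \<mu>) ^ (2 * m)"
    using step_a_pos mu_gt_0
    by (intro Bernoulli_inequality) (smt (verit) mult_pos_pos)
  with 1 show "1 + tau \<le> th ^ (2 * m)" by (simp add: th_def)
  have "(1 / 2 - tau) * (step_a * \<mu>) \<le> tau / 2"
  \<comment> \<open>If the cap \<open>1 / 2\<close> is active, the left side vanishes; otherwise
    \<open>tau\<close> is the square root and \<open>step_a * \<mu> = tau / (2 m)\<close>.\<close>
  proof (cases "tau = 1 / 2")
    case False
    then have t: "tau = sqrt (2 * real m * \<mu> / (3 * L))" by (auto simp: tau_def min_def split: if_splits)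
    have "tau\<^sup>2 = 2 * real m * \<mu> / (3 * L)"
      unfolding t using sample_pos mu_gt_0 L_gt_0 by simp
    then have "tau * tau = 2 * real m * \<mu> / (3 * L)" by (simp add: power2_eq_square)
    then have "step_a * \<mu> = tau / (2 * real m)"
      unfolding step_a_def using m tau(1) L_gt_0 by (simp add: field_simps)
    also have "\<dots> \<le> tau" using m tau(1) by (simp add: field_simps)
    finally have "(1 / 2 - tau) * (step_a * \<mu>) \<le> (1 / 2) * tau"
      using tau step_a_pos mu_gt_0 by (intro mult_mono) auto
    then show ?thesis by simp
  next
    case True
    show ?thesis unfolding True by simp
  qed
  then show "(1 + tau) / 2 \<le> 1 - (1 / 2 - tau) * th" by (simp add: th_def algebra_simps add_divide_distrib)
qed

lemma emb_x: "emb x \<in> V" using x by (rule emb_supported)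

lemma w_in: "w \<in> V" by (simp add: w_def conj_arg)

lemma gap_bounds:
  assumes "y \<in> V"
  shows "\<mu> / 2 * (norm (y - w))\<^sup>2 \<le> gap y" "gap y \<le> L / 2 * (norm (y - w))\<^sup>2" "0 \<le> gap y"
proof -
  show "\<mu> / 2 * (norm (y - w))\<^sup>2 \<le> gap y" "gap y \<le> L / 2 * (norm (y - w))\<^sup>2"
    using conj_arg_lower[OF emb_x assms] conj_arg_upper[OF emb_x assms]
    by (auto simp: gap_def w_def inner_diff_right inner_commute)
  moreover have "0 \<le> \<mu> / 2 * (norm (y - w))\<^sup>2" using mu_gt_0 by simp
  ultimately show "0 \<le> gap y" by linarith
qed

text \<open>Jensen's inequality in homogeneous form. Allowing \<open>a = 0\<close> covers the first
  inner step, when nothing has been accumulated yet.\<close>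

lemma gap_combination:
  assumes y: "y \<in> V" "q \<in> V" and c: "0 \<le> a" "0 < b"
  shows "(a + b) * gap ((1 / (a + b)) *\<^sub>R (a *\<^sub>R y + b *\<^sub>R q)) \<le> a * gap y + b * gap q"
proof -
  define z where "z = (1 / (a + b)) *\<^sub>R (a *\<^sub>R y + b *\<^sub>R q)"
  have z: "z \<in> V" unfolding z_def using y
    by (intro real_vector.subspace_add[OF subspace_supported] real_vector.subspace_scale[OF subspace_supported]) auto
  have low: "gap z + inner (loss_grad z - emb x) (t - z) \<le> gap t" if "t \<in> V" for t
  proof -
    have "0 \<le> \<mu> / 2 * (norm (t - z))\<^sup>2" using mu_gt_0 by simp
    then show ?thesis using loss_bounds(1)[OF z that]
      by (simp add: gap_def inner_diff_left inner_diff_right inner_commute)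
  qed
  have "(a + b) *\<^sub>R z = a *\<^sub>R y + b *\<^sub>R q" using c by (simp add: z_def)
  then have "a *\<^sub>R (y - z) + b *\<^sub>R (q - z) = 0" by (simp add: algebra_simps)
  then have "a * inner (loss_grad z - emb x) (y - z) + b * inner (loss_grad z - emb x) (q - z) = 0"
    by (metis inner_add_right inner_scaleR_right inner_zero_right)
  moreover have "a * (gap z + inner (loss_grad z - emb x) (y - z)) \<le> a * gap y"
    "b * (gap z + inner (loss_grad z - emb x) (q - z)) \<le> b * gap q"
    using low y c by (auto intro!: mult_left_mono)
  ultimately show ?thesis unfolding z_def[symmetric] by (simp add: algebra_simps)
qed

lemma h_gradient:
  assumes "j < m" "v \<in> carrier_vec d"
  shows "gradient d (h j) v \<in> carrier_vec d" "emb (gradient d (h j) v) = sample_grad j (emb v) - \<mu> *\<^sub>R emb v"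
proof -
  have *: "gradient d (h j) v = gradient d (f j) v - \<mu> \<cdot>\<^sub>v v"
    unfolding h_def by (rule gradient_minus_quadratic[OF assms(2) differentiable[OF assms(1)]])
  show "gradient d (h j) v \<in> carrier_vec d" "emb (gradient d (h j) v) = sample_grad j (emb v) - \<mu> *\<^sub>R emb v"
    unfolding * using gradient_carrier[OF assms] assms by (auto simp: emb_ops[of _ d] emb_smult sample_grad_def)
qed

lemma kv_in:
  assumes "u \<in> carrier_vec d" "p \<in> carrier_vec d" "z \<in> carrier_vec d"
  shows "kv u p z \<in> carrier_vec d" "emb (kv u p z) = tau *\<^sub>R emb z + (1 / 2) *\<^sub>R emb u + (1 / 2 - tau) *\<^sub>R emb p"
  using assms by (auto simp: kv_def emb_ops[of _ d] emb_smult)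

lemma kg_in:
  assumes c: "u \<in> carrier_vec d" "p \<in> carrier_vec d" "z \<in> carrier_vec d" and j: "j < m"
  shows "kg u p z j \<in> carrier_vec d"
    "emb (kg u p z j) = (loss_grad (emb u) - \<mu> *\<^sub>R emb u)
      + (sample_grad j (emb (kv u p z)) - \<mu> *\<^sub>R emb (kv u p z)) - (sample_grad j (emb u) - \<mu> *\<^sub>R emb u)"
proof -
  have fs: "finsum_vec TYPE(real) d (\<lambda>j. gradient d (h j) u) {..<m} \<in> carrier_vec d"
    "emb (finsum_vec TYPE(real) d (\<lambda>j. gradient d (h j) u) {..<m}) = (\<Sum>j<m. sample_grad j (emb u) - \<mu> *\<^sub>R emb u)"
    using emb_finsum_vec[of "{..<m}" "\<lambda>j. gradient d (h j) u" d] h_gradient c(1) by auto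
  have avg: "(1 / real m) *\<^sub>R (\<Sum>j<m. sample_grad j (emb u) - \<mu> *\<^sub>R emb u) = loss_grad (emb u) - \<mu> *\<^sub>R emb u"
    using sample_pos by (simp add: loss_grad_def sum_subtractf scaleR_diff_right sum_constant_scaleR)
  show "kg u p z j \<in> carrier_vec d"
    unfolding kg_def using fs h_gradient[OF j c(1)] h_gradient[OF j kv_in(1)[OF c]] by simp
  show "emb (kg u p z j) = (loss_grad (emb u) - \<mu> *\<^sub>R emb u)
      + (sample_grad j (emb (kv u p z)) - \<mu> *\<^sub>R emb (kv u p z)) - (sample_grad j (emb u) - \<mu> *\<^sub>R emb u)"
    unfolding kg_def avg[symmetric]
    using fs h_gradient[OF j c(1)] h_gradient[OF j kv_in(1)[OF c]]
    by (simp add: emb_ops[of _ d] emb_smult)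
qed

lemma kz_in:
  assumes c: "u \<in> carrier_vec d" "p \<in> carrier_vec d" "z \<in> carrier_vec d" and j: "j < m"
  shows "kz u p z j \<in> carrier_vec d"
    "(rr + tau * \<mu>) *\<^sub>R emb (kz u p z j) = rr *\<^sub>R emb z - tau *\<^sub>R emb (kg u p z j) + tau *\<^sub>R emb x"
proof -
  have k: "0 < 1 / (2 * step_a)" using step_a_pos by simp
  note prox = arg_min_prox[OF k mu_gt_0 c(3) kg_in(1)[OF c j] x, folded kz_def[unfolded psi_def]]
  then show "kz u p z j \<in> carrier_vec d" by simp
  have s: "2 * (1 / (2 * step_a)) = 3 * tau * L" by (simp add: step_a_def)
  have "tau *\<^sub>R ((3 * tau * L + \<mu>) *\<^sub>R emb (kz u p z j)) = tau *\<^sub>R ((3 * tau * L) *\<^sub>R emb z - emb (kg u p z j) + emb x)"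
    using prox(2) unfolding s by simp
  moreover have "tau * (3 * tau * L + \<mu>) = rr + tau * \<mu>" "tau * (3 * tau * L) = rr"
    by (simp_all add: rr_def algebra_simps power2_eq_square)
  ultimately show "(rr + tau * \<mu>) *\<^sub>R emb (kz u p z j) = rr *\<^sub>R emb z - tau *\<^sub>R emb (kg u p z j) + tau *\<^sub>R emb x"
    by (simp add: scaleR_add_right scaleR_diff_right)
qed

lemma kp_in:
  assumes c: "u \<in> carrier_vec d" "p \<in> carrier_vec d" "z \<in> carrier_vec d" and j: "j < m"
  shows "kp u p z j \<in> carrier_vec d"
    "(3 * L + \<mu>) *\<^sub>R emb (kp u p z j) = (3 * L) *\<^sub>R emb (kv u p z) - emb (kg u p z j) + emb x"
proof -
  have k: "0 < 3 * L / 2" using L_gt_0 by simp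
  note prox = arg_min_prox[OF k mu_gt_0 kv_in(1)[OF c] kg_in(1)[OF c j] x, folded kp_def[unfolded psi_def]]
  then show "kp u p z j \<in> carrier_vec d"
    "(3 * L + \<mu>) *\<^sub>R emb (kp u p z j) = (3 * L) *\<^sub>R emb (kv u p z) - emb (kg u p z j) + emb x"
    by simp_all
qed

lemma norm_sq_expand:
  fixes y v :: "'b :: real_inner"
  shows "(norm y)\<^sup>2 = (norm v)\<^sup>2 + 2 * inner v (y - v) + (norm (y - v))\<^sup>2"
  unfolding power2_norm_eq_inner by (simp add: inner_diff_left inner_diff_right inner_commute)

text \<open>\<open>hh\<close> is the average loss without its quadratic part. Subtracting that part
  keeps convexity and the smoothness constant \<open>L\<close>, also sample by sample. The variance
  is at most the second moment of the sampled gradient differences, each bounded by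
  cocoercivity.\<close>

lemma sampled_step:
  assumes c: "u \<in> carrier_vec d" "p \<in> carrier_vec d" "z \<in> carrier_vec d"
  shows "(\<Sum>j<m. gap (emb (kp u p z j)) + (rr + tau * \<mu>) / 2 * (norm (emb (kz u p z j) - w))\<^sup>2) \<le>
    real m * (1 / 2 * gap (emb u) + (1 / 2 - tau) * gap (emb p) + rr / 2 * (norm (emb z - w))\<^sup>2)"
proof -
  define v where "v = emb (kv u p z)"
  define hh where "hh y = loss y - \<mu> / 2 * (norm y)\<^sup>2" for y
  define G where "G = loss_grad v - \<mu> *\<^sub>R v"
  define H where "H j y = sample_grad j y - \<mu> *\<^sub>R y" for j y
  have uV: "emb u \<in> V" and pV: "emb p \<in> V" and vV: "v \<in> V"
    using c emb_supported[OF kv_in(1)[OF c]] by (auto simp: v_def intro: emb_supported)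
  have m: "m > 0" using sample_pos by simp
  have gt: "emb (kg u p z j) = (loss_grad (emb u) - \<mu> *\<^sub>R emb u) + H j v - H j (emb u)" if "j < m" for j
    using kg_in(2)[OF c that] by (simp add: H_def v_def)
  have sum_H: "(\<Sum>j<m. H j y) = real m *\<^sub>R (loss_grad y - \<mu> *\<^sub>R y)" for y
    using m by (simp add: H_def loss_grad_def sum_subtractf scaleR_diff_right sum_constant_scaleR)
  have quad: "hh v + inner G (y - v) + \<mu> / 2 * (norm (y - v))\<^sup>2 + \<mu> / 2 * (norm y)\<^sup>2 =
      loss v + inner (loss_grad v) (y - v) + \<mu> / 2 * (norm (y - v))\<^sup>2 + \<mu> / 2 * (norm (y - v))\<^sup>2" for y
    unfolding norm_sq_expand[of y v] hh_def G_def by (simp add: inner_diff_left algebra_simps)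
  have conv: "hh v + inner G (y - v) \<le> hh y" if "y \<in> V" for y
    using loss_bounds(1)[OF vV that] quad[of y] by (simp add: hh_def)
  have smo: "hh y \<le> hh v + inner G (y - v) + L / 2 * (norm (y - v))\<^sup>2" if "y \<in> V" for y
  proof -
    have "0 \<le> \<mu> / 2 * (norm (y - v))\<^sup>2" using mu_gt_0 by simp
    then show ?thesis using loss_bounds(2)[OF vV that] quad[of y] by (simp add: hh_def)
  qed
  have var1: "(norm (H j (emb u) - H j v))\<^sup>2 \<le> 2 * L * ((sample j (emb u) - \<mu> / 2 * (norm (emb u))\<^sup>2)
      - (sample j v - \<mu> / 2 * (norm v)\<^sup>2) - inner (H j v) (emb u - v))" if j: "j < m" for j
  proof (rule cocoercive[where V = V])
    have q: "(sample j t - \<mu> / 2 * (norm t)\<^sup>2) + inner (H j t) (y - t) =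
       sample j t + inner (sample_grad j t) (y - t) + \<mu> / 2 * (norm (y - t))\<^sup>2 - \<mu> / 2 * (norm y)\<^sup>2" for t y
      unfolding norm_sq_expand[of y t] H_def by (simp add: inner_diff_left algebra_simps)
    show "sample j v - \<mu> / 2 * (norm v)\<^sup>2 + inner (H j v) (y - v) \<le> sample j y - \<mu> / 2 * (norm y)\<^sup>2" if "y \<in> V" for y
      unfolding q using sample_bounds(1)[OF j vV that] by simp
    show "sample j y - \<mu> / 2 * (norm y)\<^sup>2 \<le> sample j (emb u) - \<mu> / 2 * (norm (emb u))\<^sup>2
        + inner (H j (emb u)) (y - emb u) + L / 2 * (norm (y - emb u))\<^sup>2" if "y \<in> V" for y
    proof -
      have "0 \<le> \<mu> / 2 * (norm (y - emb u))\<^sup>2" using mu_gt_0 by simp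
      then show ?thesis unfolding q using sample_bounds(2)[OF j uV that] by simp
    qed
    show "H j (emb u) \<in> V" "H j v \<in> V"
      unfolding H_def using sample_grad_in[OF j] uV vV
      by (auto intro!: real_vector.subspace_diff[OF subspace_supported] real_vector.subspace_scale[OF subspace_supported])
  qed (use uV vV L_gt_0 subspace_supported in auto)
  have dev: "emb (kg u p z j) - G = (H j v - H j (emb u)) - (1 / real m) *\<^sub>R (\<Sum>j<m. H j v - H j (emb u))" if "j < m" for j
    using m unfolding gt[OF that] sum_subtractf sum_H by (simp add: G_def scaleR_diff_right)
  have "(\<Sum>j<m. (norm (emb (kg u p z j) - G))\<^sup>2) \<le> (\<Sum>j<m. (norm (H j v - H j (emb u)))\<^sup>2)"
    using sum_norm_deviation_le[OF m, of "\<lambda>j. H j v - H j (emb u)"] dev by simp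
  also have "\<dots> \<le> (\<Sum>j<m. 2 * L * ((sample j (emb u) - \<mu> / 2 * (norm (emb u))\<^sup>2)
      - (sample j v - \<mu> / 2 * (norm v)\<^sup>2) - inner (H j v) (emb u - v)))"
    using var1 by (intro sum_mono) (auto simp: norm_minus_commute)
  also have "\<dots> = 2 * L * ((\<Sum>j<m. sample j (emb u)) - real m * (\<mu> / 2 * (norm (emb u))\<^sup>2)
      - ((\<Sum>j<m. sample j v) - real m * (\<mu> / 2 * (norm v)\<^sup>2)) - inner (\<Sum>j<m. H j v) (emb u - v))"
    by (simp add: sum_distrib_left[symmetric] sum_subtractf inner_sum_left del: sum_distrib_left)
  also have "\<dots> = real m * (2 * L * (hh (emb u) - hh v - inner G (emb u - v)))"
  proof -
    have "(\<Sum>j<m. sample j y) = real m * loss y" for y using m by (simp add: loss_def)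
    then show ?thesis unfolding sum_H by (simp add: hh_def G_def algebra_simps)
  qed
  finally have var: "(\<Sum>j<m. (norm (emb (kg u p z j) - G))\<^sup>2) \<le> real m * (2 * L * (hh (emb u) - hh v - inner G (emb u - v)))" .
  have mean: "(\<Sum>j<m. emb (kg u p z j)) = real m *\<^sub>R G"
  proof -
    have "(\<Sum>j<m. emb (kg u p z j)) = (\<Sum>j<m. (loss_grad (emb u) - \<mu> *\<^sub>R emb u) + H j v - H j (emb u))"
      using gt by (intro sum.cong) auto
    also have "\<dots> = real m *\<^sub>R (loss_grad (emb u) - \<mu> *\<^sub>R emb u) + (\<Sum>j<m. H j v) - (\<Sum>j<m. H j (emb u))"
      by (simp add: sum.distrib sum_subtractf sum_constant_scaleR scaleR_diff_right)
    also have "\<dots> = real m *\<^sub>R G" unfolding sum_H by (simp add: G_def)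
    finally show ?thesis .
  qed
  have gap: "hh y + (\<mu> / 2 * (norm y)\<^sup>2 - inner y (emb x)) - (hh w + (\<mu> / 2 * (norm w)\<^sup>2 - inner w (emb x))) = gap y" for y
    by (simp add: hh_def gap_def)
  have sm: "hh (emb (kp u p z j)) \<le> hh v + inner G (emb (kp u p z j) - v) + L / 2 * (norm (emb (kp u p z j) - v))\<^sup>2"
    if "j < m" for j using smo[OF emb_supported[OF kp_in(1)[OF c that]]] .
  show ?thesis
    using katyusha_step[OF tau(1,2) L_gt_0 mu_gt_0 m rr_def kv_in(2)[OF c, folded v_def] kz_in(2)[OF c]
        kp_in(2)[OF c, folded v_def] sm conv[OF pV] conv[OF w_in] mean var]
    unfolding gap by simp
qed

end

section \<open>Expected decrease over inner steps and epochs\<close>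

context katyusha_problem
begin

lemma samples_nonempty: "{..<m} \<noteq> {}"
proof -
  have "0 \<in> {..<m}" using sample_pos by simp
  then show ?thesis by blast
qed

lemma set_samples: "set_pmf (pmf_of_set {..<m}) = {..<m}"
  using samples_nonempty by (rule set_pmf_of_set) simp

lemma expectation_add_const:
  fixes F :: "'b \<Rightarrow> real"
  assumes "finite (set_pmf M)"
  shows "measure_pmf.expectation M (\<lambda>s. F s + c) = measure_pmf.expectation M F + c"
  using expectation_linear(1)[OF assms, of F "\<lambda>_. c"] by simp

lemma expectation_sample:
  fixes F :: "'b \<Rightarrow> real"
  shows "measure_pmf.expectation (bind_pmf (pmf_of_set {..<m}) (\<lambda>j. return_pmf (g j))) F = (\<Sum>j<m. F (g j)) / real m"
  unfolding map_pmf_def[symmetric] integral_map_pmf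
  by (subst integral_pmf_of_set) (use samples_nonempty in auto)

lemma finite_inner: "finite (set_pmf (katyusha_inner d m h psi L \<mu> u p0 z0 l))"
proof (induction l)
  case (Suc l)
  show ?case unfolding inner_Suc using Suc by (auto simp: set_samples)
qed simp

lemma inner_invariant:
  assumes c: "u \<in> carrier_vec d" "p0 \<in> carrier_vec d" "z0 \<in> carrier_vec d"
  shows "(p, z, acc, cost) \<in> set_pmf (katyusha_inner d m h psi L \<mu> u p0 z0 l) \<Longrightarrow>
    p \<in> carrier_vec d \<and> z \<in> carrier_vec d \<and> acc \<in> carrier_vec d \<and> cost = 2 * l \<and> (l = 0 \<longrightarrow> acc = 0\<^sub>v d)"
proof (induction l arbitrary: p z acc cost)
  case 0
  then show ?case using c by simp
next
  case (Suc l)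
  obtain p' z' acc' cost' j where 1: "(p', z', acc', cost') \<in> set_pmf (katyusha_inner d m h psi L \<mu> u p0 z0 l)"
    "j < m" "(p, z, acc, cost) = (kp u p' z' j, kz u p' z' j, acc' + th ^ l \<cdot>\<^sub>v kp u p' z' j, cost' + 2)"
    using Suc.prems unfolding inner_Suc by (auto simp: set_samples)
  from Suc.IH[OF 1(1)] kp_in(1)[OF c(1) _ _ 1(2)] kz_in(1)[OF c(1) _ _ 1(2)] 1(3) show ?case by auto
qed

text \<open>Designed to telescope: a new point enters with weight \<open>th ^ l\<close>, of which
  \<open>(1 / 2 - tau) * th ^ Suc l\<close> is reserved for the next step's term in
  \<open>p\<close>, and the rest goes to the running weighted average. At \<open>l = 0\<close> the
  average part is 0 because \<open>W 0 = 0\<close>.\<close>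

definition inner_potential :: "nat \<Rightarrow> real vec \<times> real vec \<times> real vec \<times> nat \<Rightarrow> real" where
  "inner_potential l = (\<lambda>(p, z, acc, cost).
     (1 - (1 / 2 - tau) * th) * (W l * gap ((1 / W l) *\<^sub>R emb acc))
     + (1 / 2 - tau) * th ^ l * gap (emb p) + rr / 2 * th ^ l * (norm (emb z - w))\<^sup>2)"

lemma inner_potential_step:
  assumes u: "u \<in> carrier_vec d" and s: "p \<in> carrier_vec d" "z \<in> carrier_vec d" "acc \<in> carrier_vec d"
    and acc0: "l = 0 \<longrightarrow> acc = 0\<^sub>v d"
  shows "(\<Sum>j<m. inner_potential (Suc l) (kp u p z j, kz u p z j, acc + th ^ l \<cdot>\<^sub>v kp u p z j, cost')) \<le>
    real m * (inner_potential l (p, z, acc, cost) + 1 / 2 * gap (emb u) * th ^ l)"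
proof -
  define A where "A = 1 - (1 / 2 - tau) * th"
  define B where "B = W l * gap ((1 / W l) *\<^sub>R emb acc)"
  have A: "A \<ge> 0" using epoch_factors(2) tau(1) by (simp add: A_def)
  have pow: "th ^ l > 0" using th_gt_1 by simp
  have comb: "W (Suc l) * gap ((1 / W (Suc l)) *\<^sub>R emb (acc + th ^ l \<cdot>\<^sub>v kp u p z j)) \<le> B + th ^ l * gap (emb (kp u p z j))"
    if j: "j < m" for j
  proof -
    have q: "emb (kp u p z j) \<in> V" using kp_in(1)[OF u s(1,2) j] by (rule emb_supported)
    have e: "emb (acc + th ^ l \<cdot>\<^sub>v kp u p z j) = emb acc + th ^ l *\<^sub>R emb (kp u p z j)"
      using s kp_in(1)[OF u s(1,2) j] by (simp add: emb_ops[of _ d] emb_smult)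
    \<comment> \<open>For \<open>l = 0\<close> the quotient \<open>1 / W l\<close> is the default
      value 0; it is harmless because the accumulator is then zero as well.\<close>
    have Wl: "W l = 0 \<and> emb acc = 0 \<or> W l > 0"
    proof (cases l)
      case 0
      then show ?thesis using acc0 by (simp add: W_def emb_zero)
    qed (use W_pos in auto)
    have y: "(1 / W l) *\<^sub>R emb acc \<in> V"
      using s by (intro real_vector.subspace_scale[OF subspace_supported] emb_supported)
    have Wacc: "W l *\<^sub>R ((1 / W l) *\<^sub>R emb acc) = emb acc" using Wl by auto
    show ?thesis
      using gap_combination[OF y q _ pow, of "W l"] Wl unfolding e W_Suc Wacc B_def by auto
  qed
  have step: "inner_potential (Suc l) (kp u p z j, kz u p z j, acc + th ^ l \<cdot>\<^sub>v kp u p z j, cost') \<le>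
      A * B + th ^ l * (gap (emb (kp u p z j)) + (rr + tau * \<mu>) / 2 * (norm (emb (kz u p z j) - w))\<^sup>2)" if j: "j < m" for j
  proof -
    have "inner_potential (Suc l) (kp u p z j, kz u p z j, acc + th ^ l \<cdot>\<^sub>v kp u p z j, cost') \<le>
      A * (B + th ^ l * gap (emb (kp u p z j))) + (1 / 2 - tau) * th ^ Suc l * gap (emb (kp u p z j))
       + rr / 2 * th ^ Suc l * (norm (emb (kz u p z j) - w))\<^sup>2"
      unfolding inner_potential_def prod.case A_def[symmetric]
      using mult_left_mono[OF comb[OF j] A] by simp
    also have "\<dots> = A * B + th ^ l * ((A + (1 / 2 - tau) * th) * gap (emb (kp u p z j))
        + (rr * th) / 2 * (norm (emb (kz u p z j) - w))\<^sup>2)"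
      by (simp add: algebra_simps)
    also have "A + (1 / 2 - tau) * th = 1" by (simp add: A_def)
    finally show ?thesis unfolding rr_th by simp
  qed
  have "(\<Sum>j<m. inner_potential (Suc l) (kp u p z j, kz u p z j, acc + th ^ l \<cdot>\<^sub>v kp u p z j, cost')) \<le>
      (\<Sum>j<m. A * B + th ^ l * (gap (emb (kp u p z j)) + (rr + tau * \<mu>) / 2 * (norm (emb (kz u p z j) - w))\<^sup>2))"
    using step by (intro sum_mono) auto
  also have "\<dots> = real m * (A * B) + th ^ l * (\<Sum>j<m. gap (emb (kp u p z j)) + (rr + tau * \<mu>) / 2 * (norm (emb (kz u p z j) - w))\<^sup>2)"
    by (simp only: sum.distrib[of "\<lambda>_. A * B"] sum_distrib_left sum_constant card_lessThan)
  also have "\<dots> \<le> real m * (A * B) + th ^ l *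
      (real m * (1 / 2 * gap (emb u) + (1 / 2 - tau) * gap (emb p) + rr / 2 * (norm (emb z - w))\<^sup>2))"
    using sampled_step[OF u s(1,2)] pow by (intro add_left_mono mult_left_mono) auto
  also have "\<dots> = real m * (inner_potential l (p, z, acc, cost) + 1 / 2 * gap (emb u) * th ^ l)"
    unfolding inner_potential_def prod.case A_def[symmetric] B_def[symmetric] by (simp add: algebra_simps)
  finally show ?thesis .
qed

lemma expectation_inner_potential:
  assumes c: "u \<in> carrier_vec d" "p0 \<in> carrier_vec d" "z0 \<in> carrier_vec d"
  shows "measure_pmf.expectation (katyusha_inner d m h psi L \<mu> u p0 z0 l) (inner_potential l) \<le>
    (1 / 2 - tau) * gap (emb p0) + rr / 2 * (norm (emb z0 - w))\<^sup>2 + 1 / 2 * gap (emb u) * W l"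
proof (induction l)
  case 0
  then show ?case by (simp add: inner_potential_def W_def)
next
  case (Suc l)
  let ?M = "katyusha_inner d m h psi L \<mu> u p0 z0 l"
  let ?E = "measure_pmf.expectation"
  have "?E (katyusha_inner d m h psi L \<mu> u p0 z0 (Suc l)) (inner_potential (Suc l)) =
    ?E ?M (\<lambda>(p, z, acc, cost). (\<Sum>j<m. inner_potential (Suc l)
      (kp u p z j, kz u p z j, acc + th ^ l \<cdot>\<^sub>v kp u p z j, cost + 2)) / real m)"
    unfolding inner_Suc
  proof (subst expectation_bind[OF finite_inner])
    show "finite (set_pmf (case s of (p, z, acc, cost) \<Rightarrow> bind_pmf (pmf_of_set {..<m}) (\<lambda>j.
        return_pmf (kp u p z j, kz u p z j, acc + th ^ l \<cdot>\<^sub>v kp u p z j, cost + 2))))" for s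
      by (cases s) (simp add: set_samples)
  qed (rule expectation_cong, simp add: expectation_sample split: prod.split)
  also have "\<dots> \<le> ?E ?M (\<lambda>s. inner_potential l s + 1 / 2 * gap (emb u) * th ^ l)"
  proof (rule expectation_mono[OF finite_inner])
    fix s assume s: "s \<in> set_pmf ?M"
    obtain p z acc cost where [simp]: "s = (p, z, acc, cost)" by (cases s)
    have inv: "p \<in> carrier_vec d" "z \<in> carrier_vec d" "acc \<in> carrier_vec d" "l = 0 \<longrightarrow> acc = 0\<^sub>v d"
      using inner_invariant[OF c] s by auto
    show "(case s of (p, z, acc, cost) \<Rightarrow> (\<Sum>j<m. inner_potential (Suc l)
      (kp u p z j, kz u p z j, acc + th ^ l \<cdot>\<^sub>v kp u p z j, cost + 2)) / real m) \<le> inner_potential l s + 1 / 2 * gap (emb u) * th ^ l"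
      using inner_potential_step[OF c(1) inv, of "cost + 2" cost] sample_pos
      by (simp add: divide_le_eq mult.commute)
  qed
  also have "\<dots> = ?E ?M (inner_potential l) + 1 / 2 * gap (emb u) * th ^ l"
    by (rule expectation_add_const[OF finite_inner])
  finally show ?case using Suc
    by (simp del: katyusha_inner.simps add: W_Suc distrib_left)
qed

text \<open>The right-hand side of the inner estimate after \<open>2 * m\<close> steps, read as a
  function of the state at the start of an epoch.\<close>

definition potential :: "real vec \<times> real vec \<times> real vec \<times> nat \<Rightarrow> real" where
  "potential = (\<lambda>(u, p, z, cost). 1 / 2 * W (2 * m) * gap (emb u) + (1 / 2 - tau) * gap (emb p)
     + rr / 2 * (norm (emb z - w))\<^sup>2)"

lemma epochs_Suc:
  "katyusha_epochs d m h psi L \<mu> \<theta>0 (Suc e) =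
     bind_pmf (katyusha_epochs d m h psi L \<mu> \<theta>0 e) (\<lambda>(u, p, z, cost).
       bind_pmf (katyusha_inner d m h psi L \<mu> u p z (2 * m)) (\<lambda>(p', z', acc, inner_cost).
         return_pmf ((1 / W (2 * m)) \<cdot>\<^sub>v acc, p', z', cost + m + inner_cost)))"
  by (simp only: katyusha_epochs.simps Let_def W_def th_def step_a_def tau_def)

lemma finite_epochs: "finite (set_pmf (katyusha_epochs d m h psi L \<mu> \<theta>0 e))"
  by (induction e) (auto simp: epochs_Suc finite_inner simp del: katyusha_epochs.simps(2))

text \<open>An epoch costs \<open>5 * m\<close> evaluations: \<open>m\<close> for the snapshot
  gradient and two in each of the \<open>2 * m\<close> inner steps.\<close>

lemma epochs_invariant:
  assumes "\<theta>0 \<in> carrier_vec d"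
  shows "(u, p, z, cost) \<in> set_pmf (katyusha_epochs d m h psi L \<mu> \<theta>0 e) \<Longrightarrow>
    u \<in> carrier_vec d \<and> p \<in> carrier_vec d \<and> z \<in> carrier_vec d \<and> cost = e * (5 * m)"
proof (induction e arbitrary: u p z cost)
  case 0
  then show ?case using assms by simp
next
  case (Suc e)
  then obtain u' p' z' cost' acc ic where 1: "(u', p', z', cost') \<in> set_pmf (katyusha_epochs d m h psi L \<mu> \<theta>0 e)"
    "(p, z, acc, ic) \<in> set_pmf (katyusha_inner d m h psi L \<mu> u' p' z' (2 * m))"
    "u = (1 / W (2 * m)) \<cdot>\<^sub>v acc" "cost = cost' + m + ic"
    unfolding epochs_Suc by auto
  from Suc.IH[OF 1(1)] inner_invariant[OF _ _ _ 1(2)] show ?case by (auto simp: 1)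
qed

text \<open>At the end of an epoch every term of \<open>inner_potential\<close> is at least
  \<open>1 + tau\<close> times the corresponding term of \<open>potential\<close> at the new
  state.\<close>

lemma expectation_potential:
  assumes c: "\<theta>0 \<in> carrier_vec d"
  shows "(1 + tau) ^ e * measure_pmf.expectation (katyusha_epochs d m h psi L \<mu> \<theta>0 e) potential \<le> potential (\<theta>0, \<theta>0, \<theta>0, 0)"
proof (induction e)
  case 0
  then show ?case by simp
next
  case (Suc e)
  let ?M = "katyusha_epochs d m h psi L \<mu> \<theta>0 e"
  let ?E = "measure_pmf.expectation"
  have Wp: "W (2 * m) > 0" using sample_pos by (intro W_pos) simp
  have step: "(1 + tau) * ?E (bind_pmf (katyusha_inner d m h psi L \<mu> u p z (2 * m)) (\<lambda>(p', z', acc, inner_cost).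
         return_pmf ((1 / W (2 * m)) \<cdot>\<^sub>v acc, p', z', cost + m + inner_cost))) potential \<le> potential (u, p, z, cost)"
    if "(u, p, z, cost) \<in> set_pmf ?M" for u p z cost
  proof -
    have inv: "u \<in> carrier_vec d" "p \<in> carrier_vec d" "z \<in> carrier_vec d"
      using epochs_invariant[OF c that] by auto
    let ?I = "katyusha_inner d m h psi L \<mu> u p z (2 * m)"
    have "(1 + tau) * ?E (bind_pmf ?I (\<lambda>(p', z', acc, inner_cost).
         return_pmf ((1 / W (2 * m)) \<cdot>\<^sub>v acc, p', z', cost + m + inner_cost))) potential =
       ?E ?I (\<lambda>(p', z', acc, ic). (1 + tau) * potential ((1 / W (2 * m)) \<cdot>\<^sub>v acc, p', z', cost + m + ic))"
      using finite_inner by (subst expectation_bind) (auto simp: case_prod_unfold)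
    also have "\<dots> \<le> ?E ?I (inner_potential (2 * m))"
    proof (rule expectation_mono[OF finite_inner])
      fix s assume s: "s \<in> set_pmf ?I"
      obtain p' z' acc ic where [simp]: "s = (p', z', acc, ic)" by (cases s)
      have i: "p' \<in> carrier_vec d" "acc \<in> carrier_vec d" using inner_invariant[OF inv] s by auto
      define g where "g = gap ((1 / W (2 * m)) *\<^sub>R emb acc)"
      have g0: "g \<ge> 0" "gap (emb p') \<ge> 0"
        unfolding g_def using i
        by (auto intro!: gap_bounds(3) real_vector.subspace_scale[OF subspace_supported] emb_supported)
      have "(1 + tau) / 2 * (W (2 * m) * g) \<le> (1 - (1 / 2 - tau) * th) * (W (2 * m) * g)"
        using epoch_factors(2) Wp g0 by (intro mult_right_mono) auto
      moreover have "(1 / 2 - tau) * gap (emb p') * (1 + tau) \<le> (1 / 2 - tau) * gap (emb p') * th ^ (2 * m)"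
        using epoch_factors(1) tau(2) g0 by (intro mult_left_mono mult_nonneg_nonneg) auto
      moreover have "rr / 2 * (norm (emb z' - w))\<^sup>2 * (1 + tau) \<le> rr / 2 * (norm (emb z' - w))\<^sup>2 * th ^ (2 * m)"
        using epoch_factors(1) rr_pos by (intro mult_left_mono) auto
      moreover have "(1 + tau) * potential ((1 / W (2 * m)) \<cdot>\<^sub>v acc, p', z', cost + m + ic) =
        (1 + tau) / 2 * (W (2 * m) * g) + (1 / 2 - tau) * gap (emb p') * (1 + tau) + rr / 2 * (norm (emb z' - w))\<^sup>2 * (1 + tau)"
        unfolding potential_def prod.case emb_smult g_def[symmetric] by (simp add: algebra_simps add_divide_distrib)
      moreover have "inner_potential (2 * m) s = (1 - (1 / 2 - tau) * th) * (W (2 * m) * g)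
        + (1 / 2 - tau) * gap (emb p') * th ^ (2 * m) + rr / 2 * (norm (emb z' - w))\<^sup>2 * th ^ (2 * m)"
        by (simp add: inner_potential_def g_def mult_ac)
      ultimately show "(case s of (p', z', acc, ic) \<Rightarrow> (1 + tau) * potential ((1 / W (2 * m)) \<cdot>\<^sub>v acc, p', z', cost + m + ic))
          \<le> inner_potential (2 * m) s" by simp
    qed
    also have "\<dots> \<le> (1 / 2 - tau) * gap (emb p) + rr / 2 * (norm (emb z - w))\<^sup>2 + 1 / 2 * gap (emb u) * W (2 * m)"
      by (rule expectation_inner_potential[OF inv])
    finally show ?thesis by (simp add: potential_def mult_ac)
  qed
  have "(1 + tau) * ?E (katyusha_epochs d m h psi L \<mu> \<theta>0 (Suc e)) potential =
     ?E ?M (\<lambda>(u, p, z, cost). (1 + tau) * ?E (bind_pmf (katyusha_inner d m h psi L \<mu> u p z (2 * m)) (\<lambda>(p', z', acc, inner_cost).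
         return_pmf ((1 / W (2 * m)) \<cdot>\<^sub>v acc, p', z', cost + m + inner_cost))) potential)"
    unfolding epochs_Suc
    by (subst expectation_bind) (auto simp: finite_epochs finite_inner case_prod_unfold)
  also have "\<dots> \<le> ?E ?M potential"
    using step by (intro expectation_mono[OF finite_epochs]) auto
  finally have "(1 + tau) ^ e * ((1 + tau) * ?E (katyusha_epochs d m h psi L \<mu> \<theta>0 (Suc e)) potential) \<le> (1 + tau) ^ e * ?E ?M potential"
    using tau(1) by (intro mult_left_mono) auto
  then show ?case using Suc by (simp del: katyusha_epochs.simps add: mult_ac)
qed

text \<open>\<open>W (2 * m) * \<mu> / 4\<close> is the factor with which the potential dominates
  the squared distance of the snapshot from the solution. It is split off so that it cancels,
  leaving the condition number.\<close>

lemma potential_init: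
  assumes c: "\<theta>0 \<in> carrier_vec d"
  shows "potential (\<theta>0, \<theta>0, \<theta>0, 0) \<le> W (2 * m) * \<mu> / 4 * (4 * (L / \<mu>) * (norm (emb \<theta>0 - w))\<^sup>2)"
proof -
  let ?N = "(norm (emb \<theta>0 - w))\<^sup>2"
  have W: "W (2 * m) \<ge> 2 * real m" "W (2 * m) \<ge> 2" using W_ge[of "2 * m"] sample_pos by auto
  have "potential (\<theta>0, \<theta>0, \<theta>0, 0) \<le> (1 / 2 * W (2 * m) + 1 / 2) * (L / 2 * ?N) + rr / 2 * ?N"
  proof -
    have g: "0 \<le> gap (emb \<theta>0)" "gap (emb \<theta>0) \<le> L / 2 * ?N" using gap_bounds[OF emb_supported[OF c]] by auto
    have "potential (\<theta>0, \<theta>0, \<theta>0, 0) = (1 / 2 * W (2 * m) + (1 / 2 - tau)) * gap (emb \<theta>0) + rr / 2 * ?N"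
      by (simp add: potential_def algebra_simps)
    also have "\<dots> \<le> (1 / 2 * W (2 * m) + 1 / 2) * (L / 2 * ?N) + rr / 2 * ?N"
      using g tau W by (intro add_right_mono mult_mono) auto
    finally show ?thesis .
  qed
  also have "\<dots> \<le> (1 / 2 * W (2 * m) + 1 / 2) * (L / 2 * ?N) + (1 / 2 * (W (2 * m) * L)) * ?N"
  proof -
    have "rr \<le> 3 * (2 * real m * \<mu> / (3 * L)) * L"
      unfolding rr_def using tau(3) L_gt_0 by (intro mult_right_mono mult_left_mono) auto
    also have "\<dots> = 2 * real m * \<mu>" using L_gt_0 by simp
    also have "\<dots> \<le> W (2 * m) * L" using W mu_le_L mu_gt_0 by (intro mult_mono) auto
    finally have "rr / 2 * ?N \<le> (1 / 2 * (W (2 * m) * L)) * ?N" by (intro mult_right_mono) auto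
    then show ?thesis by simp
  qed
  also have "\<dots> = (3 / 4 * W (2 * m) + 1 / 4) * (L * ?N)"
    by (simp add: algebra_simps add_divide_distrib)
  also have "\<dots> \<le> W (2 * m) * (L * ?N)" using W L_gt_0 by (intro mult_right_mono) auto
  also have "\<dots> = W (2 * m) * \<mu> / 4 * (4 * (L / \<mu>) * ?N)" using mu_gt_0 by simp
  finally show ?thesis .
qed

text \<open>Stated for squared distances rather than function values, since for the outer method the
  distance to the exact minimizer is the gradient error.\<close>

theorem katyusha_convergence:
  assumes c: "\<theta>0 \<in> carrier_vec d"
  shows "measure_pmf.expectation (katyusha d m h psi L \<mu> \<theta>0 e) (\<lambda>r. (norm (emb (fst r) - w))\<^sup>2)
     \<le> 4 * (L / \<mu>) / (1 + tau) ^ e * (norm (emb \<theta>0 - w))\<^sup>2"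
    "finite (set_pmf (katyusha d m h psi L \<mu> \<theta>0 e))"
    "r \<in> set_pmf (katyusha d m h psi L \<mu> \<theta>0 e) \<Longrightarrow> fst r \<in> carrier_vec d \<and> snd r = e * (5 * m)"
proof -
  let ?M = "katyusha_epochs d m h psi L \<mu> \<theta>0 e"
  let ?E = "measure_pmf.expectation"
  show "finite (set_pmf (katyusha d m h psi L \<mu> \<theta>0 e))"
    by (simp add: katyusha_def finite_epochs)
  show "r \<in> set_pmf (katyusha d m h psi L \<mu> \<theta>0 e) \<Longrightarrow> fst r \<in> carrier_vec d \<and> snd r = e * (5 * m)"
    using epochs_invariant[OF c] by (fastforce simp: katyusha_def)
  have Wp: "W (2 * m) > 0" using sample_pos by (intro W_pos) simp
  define C where "C = W (2 * m) * \<mu> / 4"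
  have C: "C > 0" using Wp mu_gt_0 by (simp add: C_def)
  have "C * ?E ?M (\<lambda>(u, p, z, cost). (norm (emb u - w))\<^sup>2) = ?E ?M (\<lambda>(u, p, z, cost). C * (norm (emb u - w))\<^sup>2)"
    by (simp add: case_prod_unfold)
  also have "\<dots> \<le> ?E ?M potential"
  proof (rule expectation_mono[OF finite_epochs])
    fix s assume s: "s \<in> set_pmf ?M"
    obtain u p z cost where [simp]: "s = (u, p, z, cost)" by (cases s)
    have i: "emb u \<in> V" "emb p \<in> V" using epochs_invariant[OF c] s by (auto intro: emb_supported)
    have "1 / 2 * W (2 * m) * (\<mu> / 2 * (norm (emb u - w))\<^sup>2) \<le> 1 / 2 * W (2 * m) * gap (emb u)"
      using gap_bounds(1)[OF i(1)] Wp by (intro mult_left_mono) auto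
    moreover have "0 \<le> (1 / 2 - tau) * gap (emb p)" using gap_bounds(3)[OF i(2)] tau(2) by simp
    moreover have "0 \<le> rr / 2 * (norm (emb z - w))\<^sup>2" using rr_pos by simp
    ultimately show "(case s of (u, p, z, cost) \<Rightarrow> C * (norm (emb u - w))\<^sup>2) \<le> potential s"
      by (simp add: potential_def C_def algebra_simps add_divide_distrib)
  qed
  finally have 1: "C * ?E ?M (\<lambda>(u, p, z, cost). (norm (emb u - w))\<^sup>2) \<le> ?E ?M potential" .
  have pw: "(1 + tau) ^ e > 0" using tau(1) by simp
  have "(1 + tau) ^ e * (C * ?E ?M (\<lambda>(u, p, z, cost). (norm (emb u - w))\<^sup>2)) \<le> (1 + tau) ^ e * ?E ?M potential"
    using 1 pw by (intro mult_left_mono) auto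
  also have "\<dots> \<le> C * (4 * (L / \<mu>) * (norm (emb \<theta>0 - w))\<^sup>2)"
    using expectation_potential[OF c, of e] potential_init[OF c] by (simp add: C_def)
  finally have "C * ((1 + tau) ^ e * ?E ?M (\<lambda>(u, p, z, cost). (norm (emb u - w))\<^sup>2)) \<le> C * (4 * (L / \<mu>) * (norm (emb \<theta>0 - w))\<^sup>2)"
    by (simp only: mult.left_commute)
  then have "(1 + tau) ^ e * ?E ?M (\<lambda>(u, p, z, cost). (norm (emb u - w))\<^sup>2) \<le> 4 * (L / \<mu>) * (norm (emb \<theta>0 - w))\<^sup>2"
    by (simp only: mult_le_cancel_left_pos[OF C])
  then have "?E ?M (\<lambda>(u, p, z, cost). (norm (emb u - w))\<^sup>2) \<le> 4 * (L / \<mu>) * (norm (emb \<theta>0 - w))\<^sup>2 / (1 + tau) ^ e"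
    unfolding pos_le_divide_eq[OF pw] by (subst mult.commute)
  then have "?E ?M (\<lambda>(u, p, z, cost). (norm (emb u - w))\<^sup>2) \<le> 4 * (L / \<mu>) / (1 + tau) ^ e * (norm (emb \<theta>0 - w))\<^sup>2"
    by (simp only: times_divide_eq_left)
  then show "?E (katyusha d m h psi L \<mu> \<theta>0 e) (\<lambda>r. (norm (emb (fst r) - w))\<^sup>2)
     \<le> 4 * (L / \<mu>) / (1 + tau) ^ e * (norm (emb \<theta>0 - w))\<^sup>2"
    by (simp add: katyusha_def case_prod_unfold)
qed

text \<open>Since \<open>1 / \<tau> \<le> 2 (1 + \<surd>(\<kappa> / m))\<close> and \<open>ln (1 + \<tau>) \<ge> \<tau> / 2\<close>, the prescribed number of epochs
  gains a factor \<open>exp (- C\<^sub>0 l / 4)\<close>.\<close>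

lemma epochs_rate:
  assumes e: "real e \<ge> C0 * (1 + sqrt (\<kappa> / real m)) * l" and \<kappa>: "L / \<mu> \<le> \<kappa>" and pos: "0 \<le> C0" "0 \<le> l"
  shows "exp (C0 * l / 4) \<le> (1 + tau) ^ e"
proof -
  have m: "real m \<ge> 1" using sample_pos by simp
  have "1 \<le> 2 * (1 + sqrt (\<kappa> / real m)) * tau"
  proof (cases "tau = 1 / 2")
    case True
    have "L / \<mu> > 0" using L_gt_0 mu_gt_0 by simp
    then have "\<kappa> / real m \<ge> 0" using \<kappa> m by simp
    then show ?thesis unfolding True by simp
  next
    case False
    then have t: "tau = sqrt (2 * real m * \<mu> / (3 * L))" by (auto simp: tau_def min_def split: if_splits)
    have k: "L / \<mu> / real m \<le> \<kappa> / real m" using \<kappa> m by (intro divide_right_mono) auto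
    have "1 \<le> sqrt (4 * (2 / 3))" by simp
    also have "\<dots> = 2 * sqrt (2 / 3)" by (simp only: real_sqrt_mult real_sqrt_four)
    also have "2 / 3 = L / \<mu> / real m * (2 * real m * \<mu> / (3 * L))"
      using m mu_gt_0 L_gt_0 by (simp add: field_simps)
    also have "2 * sqrt \<dots> = 2 * sqrt (L / \<mu> / real m) * tau" unfolding t by (simp only: real_sqrt_mult mult.assoc)
    also have "\<dots> \<le> 2 * (1 + sqrt (\<kappa> / real m)) * tau"
    proof (rule mult_right_mono)
      have "sqrt (L / \<mu> / real m) \<le> sqrt (\<kappa> / real m)" using k by (rule real_sqrt_le_mono)
      moreover have "2 * a \<le> 2 * (1 + b)" if "a \<le> b" for a b :: real using that by simp
      ultimately show "2 * sqrt (L / \<mu> / real m) \<le> 2 * (1 + sqrt (\<kappa> / real m))" by blast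
    qed (use tau(1) in simp)
    finally show ?thesis .
  qed
  then have "C0 * l * 1 \<le> C0 * l * (2 * (1 + sqrt (\<kappa> / real m)) * tau)"
    using pos by (intro mult_left_mono) auto
  also have "\<dots> = 2 * (C0 * (1 + sqrt (\<kappa> / real m)) * l) * tau" by simp
  also have "\<dots> \<le> 2 * real e * tau" using e tau(1) by (intro mult_right_mono mult_left_mono) auto
  finally have "C0 * l / 4 \<le> real e * (tau / 2)" by simp
  also have "\<dots> \<le> real e * ln (1 + tau)"
  proof (intro mult_left_mono)
    have "tau / 2 \<le> tau - tau\<^sup>2"
    proof -
      have "tau * tau \<le> tau * (1 / 2)" using tau by (intro mult_left_mono) auto
      then show ?thesis by (simp add: power2_eq_square)
    qed
    also have "\<dots> \<le> ln (1 + tau)" using tau by (intro ln_one_plus_pos_lower_bound) auto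
    finally show "tau / 2 \<le> ln (1 + tau)" .
  qed simp
  finally have "exp (C0 * l / 4) \<le> exp (real e * ln (1 + tau))" by simp
  also have "\<dots> = (1 + tau) ^ e" using tau(1) by (simp add: exp_of_nat_mult)
  finally show ?thesis .
qed

end

section \<open>The pseudo-inverse of the square root of a gossip matrix\<close>

lemma eigen_decomp_function:
  assumes Q: "eigen_decomp n M Q e"
  shows "eigen_decomp n (Q * mat_diag n g * transpose_mat Q) Q g"
  using Q by (simp add: eigen_decomp_def)

lemma eigen_decomp_mult:
  assumes A: "eigen_decomp n A Q a" and B: "eigen_decomp n B Q b"
  shows "eigen_decomp n (A * B) Q (\<lambda>i. a i * b i)"
proof (rule eigen_decompI)
  note CA = eigen_decomp_carrier[OF A] and CB = eigen_decomp_carrier[OF B]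
  show "(A * B) *\<^sub>v col Q i = (a i * b i) \<cdot>\<^sub>v col Q i" if i: "i < n" for i
    using CA(1) CB(1) CA(3)[OF i] eigen_decomp_eigenvector[OF A i] eigen_decomp_eigenvector[OF B i]
    by (simp add: assoc_mult_mat_vec[of _ n n _ n] mult_mat_vec[of _ n n] smult_smult_assoc mult.commute)
  show "Q \<in> carrier_mat n n" "A * B \<in> carrier_mat n n" using CA CB by auto
  show "transpose_mat Q * Q = 1\<^sub>m n" using A unfolding eigen_decomp_def by blast
qed

lemma eigen_decomp_unique:
  "eigen_decomp n A Q a \<Longrightarrow> eigen_decomp n B Q b \<Longrightarrow> (\<And>i. i < n \<Longrightarrow> a i = b i) \<Longrightarrow> A = B"
proof -
  assume A: "eigen_decomp n A Q a" and B: "eigen_decomp n B Q b" and ab: "\<And>i. i < n \<Longrightarrow> a i = b i"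
  have "mat_diag n a = mat_diag n b" by (rule eq_matI) (auto simp: mat_diag_def ab)
  then show "A = B" using A B by (simp add: eigen_decomp_def)
qed

text \<open>The Moore-Penrose inverse of the root: eigenvalues \<open>1 / sqrt (e i)\<close>, where
  the convention \<open>1 / 0 = 0\<close> already gives the right value on the null space.\<close>

lemma gossip_sqrt_pinv:
  assumes M: "gossip_mat n M"
  obtains R where "R \<in> carrier_mat n n" "transpose_mat R = R" "M * R = psd_sqrt n M"
    "R *\<^sub>v ones_vec n = 0\<^sub>v n"
    "\<And>v. v \<in> carrier_vec n \<Longrightarrow> v \<bullet> ones_vec n = 0 \<Longrightarrow> psd_sqrt n M *\<^sub>v (R *\<^sub>v v) = v"
proof -
  obtain Q e where Q: "eigen_decomp n M Q e" using gossip_mat_decomp[OF M] .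
  obtain i0 where i0: "i0 < n" "e i0 = 0" "\<And>i. i < n \<Longrightarrow> i \<noteq> i0 \<Longrightarrow> 0 < e i"
    "\<And>v. v \<in> carrier_vec n \<Longrightarrow> v \<bullet> ones_vec n = 0 \<Longrightarrow> col Q i0 \<bullet> v = 0"
    using gossip_mat_null_index[OF M Q] by metis
  note C = eigen_decomp_carrier[OF Q]
  have e0: "0 \<le> e i" if "i < n" for i using i0(2) i0(3)[OF that] by (cases "i = i0") auto
  have psd: "psd_mat n M" using M by (simp add: gossip_mat_def)
  define S where "S = Q * mat_diag n (\<lambda>i. sqrt (e i)) * transpose_mat Q"
  define R where "R = Q * mat_diag n (\<lambda>i. 1 / sqrt (e i)) * transpose_mat Q"
  have S: "eigen_decomp n S Q (\<lambda>i. sqrt (e i))" and R: "eigen_decomp n R Q (\<lambda>i. 1 / sqrt (e i))"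
    unfolding S_def R_def by (rule eigen_decomp_function[OF Q])+
  have "psd_mat n S"
    using eigen_decomp_carrier(1)[OF S] eigen_decomp_symmetric[OF S] e0
    by (auto simp: psd_mat_def eigen_decomp_quadratic_form[OF S] intro!: sum_nonneg)
  moreover have "S * S = M"
    using e0 by (intro eigen_decomp_unique[OF eigen_decomp_mult[OF S S] Q]) auto
  ultimately have Ssqrt: "psd_sqrt n M = S"
    using psd_mat_sqrt_unique psd_sqrt[OF psd] by metis
  show ?thesis
  proof (rule that[of R])
    show Rc: "R \<in> carrier_mat n n" and "transpose_mat R = R"
      using eigen_decomp_carrier(1)[OF R] eigen_decomp_symmetric[OF R] by auto
    have "e i * (1 / sqrt (e i)) = sqrt (e i)" if "i < n" for i
      using e0[OF that] by (metis real_div_sqrt times_divide_eq_right mult.right_neutral)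
    then show "M * R = psd_sqrt n M"
      unfolding Ssqrt by (intro eigen_decomp_unique[OF eigen_decomp_mult[OF Q R] S]) auto
    have eqI: "A = B" if A: "A \<in> carrier_vec n" and B: "B \<in> carrier_vec n"
      and c: "\<And>i. i < n \<Longrightarrow> col Q i \<bullet> A = col Q i \<bullet> B" for A B
    proof (rule ccontr)
      assume "A \<noteq> B"
      then have "A - B \<noteq> 0\<^sub>v n" using A B emb_ops(2)[OF A B] emb_inject[OF A B] emb_zero[of n] by auto
      then obtain i where i: "i < n" "col Q i \<bullet> (A - B) \<noteq> 0"
        using eigen_decomp_nontrivial_component[OF Q, of "A - B"] A B by auto
      then show False using c[OF i(1)] A B C(3)[OF i(1)] by (simp add: scalar_prod_minus_distrib[of _ n])
    qed
    show "R *\<^sub>v ones_vec n = 0\<^sub>v n"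
    proof (rule eqI)
      fix i assume i: "i < n"
      have "e i * (col Q i \<bullet> ones_vec n) = 0"
        using eigen_decomp_symmetric_scalar_prod[OF Q ones_vec_carrier i] gossip_mat_ones[OF M] C(3)[OF i] by simp
      then have "1 / sqrt (e i) * (col Q i \<bullet> ones_vec n) = 0" by auto
      then show "col Q i \<bullet> (R *\<^sub>v ones_vec n) = col Q i \<bullet> 0\<^sub>v n"
        using eigen_decomp_symmetric_scalar_prod[OF R ones_vec_carrier i] C(3)[OF i] by simp
    qed (use Rc in auto)
    fix v assume v: "v \<in> carrier_vec n" "v \<bullet> ones_vec n = 0"
    have "(S * R) *\<^sub>v v = v"
    proof (rule eqI)
      fix i assume i: "i < n"
      show "col Q i \<bullet> ((S * R) *\<^sub>v v) = col Q i \<bullet> v"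
        using eigen_decomp_symmetric_scalar_prod[OF eigen_decomp_mult[OF S R] v(1) i] i0(3)[OF i] i0(4)[OF v]
        by (cases "i = i0") auto
    qed (use Rc eigen_decomp_carrier(1)[OF S] v in auto)
    then show "psd_sqrt n M *\<^sub>v (R *\<^sub>v v) = v"
      unfolding Ssqrt using Rc eigen_decomp_carrier(1)[OF S] v by (simp add: assoc_mult_mat_vec[of _ n n _ n])
  qed
qed

lemma rows_orthogonal_ones:
  assumes "A \<in> carrier_mat d n" "A *\<^sub>v ones_vec n = 0\<^sub>v d" "i < d"
  shows "row A i \<bullet> ones_vec n = 0"
  using arg_cong[OF assms(2), of "\<lambda>v. v $ i"] assms(1,3) by simp

lemma mult_pinv_sqrt:
  assumes S: "S \<in> carrier_mat n n" "transpose_mat S = S" and R: "R \<in> carrier_mat n n" "transpose_mat R = R"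
    and inv: "\<And>v. v \<in> carrier_vec n \<Longrightarrow> v \<bullet> ones_vec n = 0 \<Longrightarrow> S *\<^sub>v (R *\<^sub>v v) = v"
    and A: "A \<in> carrier_mat d n" "A *\<^sub>v ones_vec n = 0\<^sub>v d"
  shows "A * R * S = A"
proof (rule eq_rowI)
  have AR: "A * R \<in> carrier_mat d n" using A R by simp
  fix i assume "i < dim_row A"
  then have i: "i < d" using A by simp
  show "row (A * R * S) i = row A i"
    unfolding row_mult_symmetric[OF AR S i] row_mult_symmetric[OF A(1) R i]
    using A i rows_orthogonal_ones[OF A i] by (intro inv) auto
qed (use A S in auto)

lemma sqrt_gossip_ones:
  assumes M: "gossip_mat n M"
  shows "psd_sqrt n M *\<^sub>v ones_vec n = 0\<^sub>v n"
proof -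
  have psd: "psd_mat n M" using M by (simp add: gossip_mat_def)
  define S where "S = psd_sqrt n M"
  have S: "S \<in> carrier_mat n n" "transpose_mat S = S" "S * S = M"
    using psd_sqrt[OF psd] psd_mat_carrier psd_mat_symmetric by (auto simp: S_def)
  have So: "S *\<^sub>v ones_vec n \<in> carrier_vec n" using S by simp
  have "(S *\<^sub>v ones_vec n) \<bullet> (S *\<^sub>v ones_vec n) = ones_vec n \<bullet> (S *\<^sub>v (S *\<^sub>v ones_vec n))"
    by (rule symmetric_scalar_prod[OF S(1,2) ones_vec_carrier So, symmetric])
  also have "S *\<^sub>v (S *\<^sub>v ones_vec n) = M *\<^sub>v ones_vec n"
    unfolding S(3)[symmetric] using S(1) by (simp add: assoc_mult_mat_vec[of _ n n _ n])
  finally show ?thesis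
    using scalar_prod_self_eq_0[OF So] by (simp add: gossip_mat_ones[OF M] S_def)
qed

text \<open>The Frobenius norm dominates the spectral norm: the root is applied to a unit
  eigenvector for the largest eigenvalue, followed by Cauchy-Schwarz in each row. The parameters
  contain the Frobenius norm, the analysis the eigenvalue.\<close>

lemma fro_norm_sqrt_ge:
  assumes M: "gossip_mat n M"
  shows "eigenvalue_desc M 1 \<le> (fro_norm (psd_sqrt n M))\<^sup>2"
proof -
  have psd: "psd_mat n M" using M by (simp add: gossip_mat_def)
  define S where "S = psd_sqrt n M"
  have S: "S \<in> carrier_mat n n" "transpose_mat S = S" "S * S = M"
    using psd_sqrt[OF psd] psd_mat_carrier psd_mat_symmetric by (auto simp: S_def)
  obtain Q e where Q: "eigen_decomp n M Q e" using gossip_mat_decomp[OF M] .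
  obtain i where i: "i < n" "e i = eigenvalue_desc M 1" using gossip_mat_eigenvalue_bounds(5)[OF M Q] by auto
  define q where "q = col Q i"
  have q: "q \<in> carrier_vec n" "q \<bullet> q = 1"
    using eigen_decomp_carrier(3)[OF Q i(1)] eigen_decomp_orthonormal[OF Q i(1) i(1)] by (auto simp: q_def)
  have Sq: "S *\<^sub>v q \<in> carrier_vec n" using S q by simp
  have "eigenvalue_desc M 1 = q \<bullet> (M *\<^sub>v q)"
    using eigen_decomp_eigenvector[OF Q i(1)] q i(2) by (simp add: q_def)
  also have "\<dots> = q \<bullet> (S *\<^sub>v (S *\<^sub>v q))"
    unfolding S(3)[symmetric] using S(1) q by (simp add: assoc_mult_mat_vec[of _ n n _ n])
  also have "\<dots> = (S *\<^sub>v q) \<bullet> (S *\<^sub>v q)" by (rule symmetric_scalar_prod[OF S(1,2) q(1) Sq])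
  also have "\<dots> = (\<Sum>k<n. (row S k \<bullet> q)\<^sup>2)"
    using S(1) q by (simp add: scalar_prod_def[of "S *\<^sub>v q"] atLeast0LessThan power2_eq_square)
  also have "\<dots> \<le> (\<Sum>k<n. (norm (emb (row S k)))\<^sup>2)"
  proof (intro sum_mono)
    fix k assume "k \<in> {..<n}"
    then have "row S k \<bullet> q = inner (emb (row S k)) (emb q)" using S(1) q by (intro inner_emb[symmetric]) auto
    then show "(row S k \<bullet> q)\<^sup>2 \<le> (norm (emb (row S k)))\<^sup>2"
      using Cauchy_Schwarz_ineq[of "emb (row S k)" "emb q"] by (simp add: power2_norm_eq_inner inner_emb[OF q(1) q(1)] q(2))
  qed
  also have "\<dots> = (\<Sum>k<n. \<Sum>l<n. (S $$ (k, l))\<^sup>2)"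
  proof (intro sum.cong refl)
    fix k assume k: "k \<in> {..<n}"
    then have r: "row S k \<in> carrier_vec n" using S(1) by simp
    show "(norm (emb (row S k)))\<^sup>2 = (\<Sum>l<n. (S $$ (k, l))\<^sup>2)"
      using k S(1) unfolding power2_norm_eq_inner inner_emb[OF r r]
      by (simp add: scalar_prod_def atLeast0LessThan power2_eq_square)
  qed
  also have "\<dots> = (fro_norm S)\<^sup>2"
    using S(1) by (simp add: fro_norm_def sum_nonneg)
  finally show ?thesis by (simp add: S_def)
qed

section \<open>Absorbing the delayed errors\<close>

lemma geometric_partial_le:
  fixes q :: real
  assumes "0 \<le> q" "q \<le> 1 / 2"
  shows "(\<Sum>l<N. q ^ Suc l) \<le> 2 * q"
proof -
  \<comment> \<open>The extra term is kept as slack to make the bound inductive;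
    \<open>q \<le> 1 / 2\<close> lets it pay for the next summand.\<close>
  have "(\<Sum>l<N. q ^ Suc l) + 2 * q * q ^ N \<le> 2 * q"
  proof (induction N)
    case (Suc N)
    have "q * (q * q ^ N) \<le> 1 / 2 * (q * q ^ N)" using assms by (intro mult_right_mono) auto
    then show ?case using Suc by (simp add: algebra_simps)
  qed simp
  moreover have "0 \<le> 2 * q * q ^ N" using assms by simp
  ultimately show ?thesis by linarith
qed

text \<open>Up to the factor \<open>1 / \<mu>\<^sup>2\<close>, the weight of the movement
  \<open>l\<close> iterations ago in the bound on the communicated gradient's error. The 6 is twice
  the 3 of the lazy condition; the 8 adds to it 2 from the Katyusha error.\<close>

definition delay_kernel :: "real \<Rightarrow> real \<Rightarrow> nat \<Rightarrow> nat \<Rightarrow> real" where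
  "delay_kernel c \<gamma> D l = (if D < l then 6 * c ^ (l - D) else 0) + 8 * c ^ l + (if l \<le> D then 6 * (c + \<gamma>) else 0)"

text \<open>The part older than \<open>D\<close> is a geometric series shifted by \<open>D\<close>,
  which costs \<open>R ^ D\<close> and contributes 12; the undelayed series contributes 16. The
  window has at most \<open>D\<close> terms, each with discount at most
  \<open>R ^ D\<close>.\<close>

lemma delay_kernel_sum:
  fixes R c \<gamma> :: real
  assumes R: "1 \<le> R" and c: "0 \<le> c" "0 \<le> \<gamma>" "c * R \<le> 1 / 2" and D: "D \<ge> 1"
  shows "(\<Sum>l<N. R ^ Suc l * delay_kernel c \<gamma> D (Suc l)) \<le> 28 * (c * R ^ Suc D) + 6 * ((c + \<gamma>) * real D * R ^ D)"
proof -
  let ?q = "c * R"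
  have q: "0 \<le> ?q" using R c by simp
  have "(\<Sum>l<N. R ^ Suc l * delay_kernel c \<gamma> D (Suc l)) =
     (\<Sum>l<N. if D < Suc l then 6 * (R ^ Suc l * c ^ (Suc l - D)) else 0) + 8 * (\<Sum>l<N. ?q ^ Suc l)
      + (\<Sum>l<N. if Suc l \<le> D then 6 * ((c + \<gamma>) * R ^ Suc l) else 0)"
    unfolding sum.distrib[symmetric] sum_distrib_left
    by (intro sum.cong) (auto simp: delay_kernel_def algebra_simps power_mult_distrib)
  moreover have "(\<Sum>l<N. if D < Suc l then 6 * (R ^ Suc l * c ^ (Suc l - D)) else 0) \<le> 12 * (c * R ^ Suc D)"
  proof -
    have "(\<Sum>l<N. if D < Suc l then 6 * (R ^ Suc l * c ^ (Suc l - D)) else 0) =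
        (\<Sum>l\<in>{l. l < N \<and> D \<le> l}. 6 * (R ^ Suc l * c ^ (Suc l - D)))"
      by (intro sum.mono_neutral_cong_right) auto
    also have "\<dots> = (\<Sum>l<N - D. 6 * (R ^ Suc (l + D) * c ^ Suc l))"
      by (rule sum.reindex_bij_witness[of _ "\<lambda>l. l + D" "\<lambda>l. l - D"]) (auto simp: Suc_diff_le)
    also have "\<dots> = 6 * R ^ D * (\<Sum>l<N - D. ?q ^ Suc l)"
      by (simp add: sum_distrib_left power_add power_mult_distrib mult_ac)
    also have "\<dots> \<le> 6 * R ^ D * (2 * ?q)"
      using geometric_partial_le[OF q c(3)] R by (intro mult_left_mono) auto
    finally show ?thesis by (simp add: mult_ac)
  qed
  moreover have "8 * (\<Sum>l<N. ?q ^ Suc l) \<le> 16 * (c * R ^ Suc D)"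
  proof -
    have "c * R * 1 \<le> c * R * R ^ D" using q R by (intro mult_left_mono) (auto simp: one_le_power)
    then show ?thesis using geometric_partial_le[OF q c(3), of N] by (simp add: mult_ac)
  qed
  moreover have "(\<Sum>l<N. if Suc l \<le> D then 6 * ((c + \<gamma>) * R ^ Suc l) else 0) \<le> 6 * ((c + \<gamma>) * real D * R ^ D)"
  proof -
    have "(\<Sum>l<N. if Suc l \<le> D then 6 * ((c + \<gamma>) * R ^ Suc l) else 0) =
        (\<Sum>l\<in>{l. l < N \<and> l < D}. 6 * ((c + \<gamma>) * R ^ Suc l))"
      by (intro sum.mono_neutral_cong_right) auto
    also have "\<dots> \<le> (\<Sum>l\<in>{l. l < N \<and> l < D}. 6 * ((c + \<gamma>) * R ^ D))"
      using R c by (intro sum_mono mult_left_mono power_increasing) auto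
    also have "\<dots> = real (card {l. l < N \<and> l < D}) * (6 * ((c + \<gamma>) * R ^ D))" by simp
    also have "\<dots> \<le> real D * (6 * ((c + \<gamma>) * R ^ D))"
    proof -
      have "card {l. l < N \<and> l < D} \<le> card {..<D}" by (intro card_mono) auto
      then show ?thesis using R c by (intro mult_right_mono) auto
    qed
    finally show ?thesis by (simp add: mult_ac)
  qed
  ultimately show ?thesis by linarith
qed

text \<open>Exchange of summation: the discount \<open>R ^ k\<close> factors over the lag and the
  time of the movement, so each movement meets only a partial sum of the discounted kernel.\<close>

lemma weighted_convolution_le:
  fixes a dl :: "nat \<Rightarrow> real"
  assumes R: "0 < R" and dl: "\<And>j. 0 \<le> dl j" and a: "\<And>N. (\<Sum>l<N. R ^ Suc l * a (Suc l)) \<le> K"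
  shows "(\<Sum>k<N. R ^ k * (\<Sum>j<k. a (k - j) * dl j)) \<le> K * (\<Sum>j<N. R ^ j * dl j)"
proof -
  have "(\<Sum>k<N. R ^ k * (\<Sum>j<k. a (k - j) * dl j)) = (\<Sum>k<N. \<Sum>j<N. if j < k then R ^ k * (a (k - j) * dl j) else 0)"
    unfolding sum_distrib_left by (intro sum.cong sum.mono_neutral_cong_left) auto
  also have "\<dots> = (\<Sum>j<N. \<Sum>k<N. if j < k then R ^ k * (a (k - j) * dl j) else 0)" by (rule sum.swap)
  also have "\<dots> = (\<Sum>j<N. (R ^ j * dl j) * (\<Sum>l<N - Suc j. R ^ Suc l * a (Suc l)))"
  proof (intro sum.cong refl)
    fix j assume j: "j \<in> {..<N}"
    have "(\<Sum>k<N. if j < k then R ^ k * (a (k - j) * dl j) else 0) = (\<Sum>k\<in>{j<..<N}. R ^ k * (a (k - j) * dl j))"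
      by (intro sum.mono_neutral_cong_right) auto
    also have "\<dots> = (\<Sum>l<N - Suc j. R ^ (j + Suc l) * (a (Suc l) * dl j))"
      by (rule sum.reindex_bij_witness[of _ "\<lambda>l. j + Suc l" "\<lambda>k. k - Suc j"]) (auto simp: Suc_diff_Suc)
    also have "\<dots> = (R ^ j * dl j) * (\<Sum>l<N - Suc j. R ^ Suc l * a (Suc l))"
      by (simp add: sum_distrib_left power_add mult_ac)
    finally show "(\<Sum>k<N. if j < k then R ^ k * (a (k - j) * dl j) else 0) = \<dots>" .
  qed
  also have "\<dots> \<le> (\<Sum>j<N. (R ^ j * dl j) * K)"
    using R dl a by (intro sum_mono mult_left_mono) auto
  also have "\<dots> = K * (\<Sum>j<N. R ^ j * dl j)" by (simp add: sum_distrib_left mult_ac)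
  finally show ?thesis .
qed

text \<open>The deterministic core. Multiplying by \<open>R ^ k\<close> with
  \<open>R = 1 / (1 - r)\<close> makes the recursion for \<open>v\<close> telescope; the errors then
  sum to at most \<open>A / \<mu>\<^sup>2\<close> times the kernel mass times the discounted
  movements, and \<open>absorb\<close> says that the negative terms cover this.\<close>

lemma delayed_error_contraction:
  fixes v dl er hh :: "nat \<Rightarrow> real"
  assumes r: "0 < r" "r < 1" and dl: "\<And>j. 0 \<le> dl j" and A: "0 \<le> A" and mu: "0 < \<mu>"
    and v: "\<And>k. v (Suc k) \<le> (1 - r) * v k + A * hh k - B * dl k"
    and er: "er 0 = 0" "\<And>k. er (Suc k) \<le> c * er k + c / \<mu>\<^sup>2 * dl k"
    and hh: "\<And>k. hh k \<le> 2 * er k + 6 / \<mu>\<^sup>2 * ((\<Sum>j<k - D. c ^ (k - D - j) * dl j) + (\<Sum>j<k. c ^ (k - j) * dl j)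
       + (\<Sum>j\<in>{k - D..<k}. (c + \<gamma>) * dl j))"
    and c: "0 \<le> c" "0 \<le> \<gamma>" "c * (1 / (1 - r)) \<le> 1 / 2" and D: "D \<ge> 1"
    and absorb: "A / \<mu>\<^sup>2 * (28 * (c * (1 / (1 - r)) ^ Suc D) + 6 * ((c + \<gamma>) * real D * (1 / (1 - r)) ^ D)) \<le> B"
  shows "v k \<le> (1 - r) ^ k * v 0"
proof -
  define R where "R = 1 / (1 - r)"
  have R: "1 \<le> R" using r by (simp add: R_def)
  have er_le: "er k \<le> 1 / \<mu>\<^sup>2 * (\<Sum>j<k. c ^ (k - j) * dl j)" for k
  proof (induction k)
    case (Suc k)
    have "er (Suc k) \<le> c * (1 / \<mu>\<^sup>2 * (\<Sum>j<k. c ^ (k - j) * dl j)) + c / \<mu>\<^sup>2 * dl k"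
      using er(2)[of k] mult_left_mono[OF Suc c(1)] by linarith
    also have "\<dots> = 1 / \<mu>\<^sup>2 * (\<Sum>j<Suc k. c ^ (Suc k - j) * dl j)"
      by (simp add: sum_distrib_left Suc_diff_le mult_ac algebra_simps)
    finally show ?case .
  qed (simp add: er(1))
  have hh': "hh k \<le> 1 / \<mu>\<^sup>2 * (\<Sum>j<k. delay_kernel c \<gamma> D (k - j) * dl j)" for k
  proof -
    have s1: "(\<Sum>j<k - D. c ^ (k - D - j) * dl j) = (\<Sum>j<k. (if D < k - j then c ^ (k - j - D) else 0) * dl j)"
      by (intro sum.mono_neutral_cong_left) (auto simp: diff_right_commute add.commute)
    have s2: "(\<Sum>j\<in>{k - D..<k}. (c + \<gamma>) * dl j) = (\<Sum>j<k. (if k - j \<le> D then c + \<gamma> else 0) * dl j)"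
      by (intro sum.mono_neutral_cong_left) auto
    have "2 * (1 / \<mu>\<^sup>2 * (\<Sum>j<k. c ^ (k - j) * dl j)) + 6 / \<mu>\<^sup>2 * ((\<Sum>j<k - D. c ^ (k - D - j) * dl j) + (\<Sum>j<k. c ^ (k - j) * dl j)
       + (\<Sum>j\<in>{k - D..<k}. (c + \<gamma>) * dl j)) = 1 / \<mu>\<^sup>2 * (\<Sum>j<k. delay_kernel c \<gamma> D (k - j) * dl j)"
    proof -
      have "(\<Sum>j<k. delay_kernel c \<gamma> D (k - j) * dl j) = 6 * (\<Sum>j<k. (if D < k - j then c ^ (k - j - D) else 0) * dl j)
         + 8 * (\<Sum>j<k. c ^ (k - j) * dl j) + 6 * (\<Sum>j<k. (if k - j \<le> D then c + \<gamma> else 0) * dl j)"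
        unfolding sum_distrib_left sum.distrib[symmetric]
        by (intro sum.cong) (auto simp: delay_kernel_def algebra_simps)
      then show ?thesis unfolding s1 s2 by (simp add: add_divide_distrib)
    qed
    then show ?thesis using hh[of k] er_le[of k] by linarith
  qed
  define K where "K = 28 * (c * R ^ Suc D) + 6 * ((c + \<gamma>) * real D * R ^ D)"
  have K: "(\<Sum>l<N. R ^ Suc l * delay_kernel c \<gamma> D (Suc l)) \<le> K" for N
    unfolding K_def using delay_kernel_sum[OF R c(1,2) _ D] c(3) by (simp add: R_def)
  have AK: "A / \<mu>\<^sup>2 * K \<le> B" using absorb by (simp add: K_def R_def)
  have "R ^ N * v N \<le> v 0 + R * (\<Sum>k<N. R ^ k * (A * hh k - B * dl k))" for N
  proof (induction N)
    case (Suc N)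
    have "R * R ^ N * v (Suc N) \<le> R * R ^ N * ((1 - r) * v N + A * hh N - B * dl N)"
      using v[of N] R by (intro mult_left_mono) auto
    also have "\<dots> = R ^ N * v N * (R * (1 - r)) + R * (R ^ N * (A * hh N - B * dl N))" by (simp add: algebra_simps)
    also have "R * (1 - r) = 1" using r by (simp add: R_def)
    finally show ?case using Suc by (simp add: algebra_simps)
  qed simp
  note unrolled = this[of k]
  have "(\<Sum>k<k. R ^ k * (A * hh k - B * dl k)) \<le> 0"
  proof -
    have "(\<Sum>k<k. R ^ k * (A * hh k - B * dl k)) \<le>
        (\<Sum>k<k. A / \<mu>\<^sup>2 * (R ^ k * (\<Sum>j<k. delay_kernel c \<gamma> D (k - j) * dl j)) - B * (R ^ k * dl k))"
    proof (intro sum_mono)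
      fix i
      have "R ^ i * (A * hh i) \<le> R ^ i * (A * (1 / \<mu>\<^sup>2 * (\<Sum>j<i. delay_kernel c \<gamma> D (i - j) * dl j)))"
        using hh'[of i] A R by (intro mult_left_mono) auto
      then show "R ^ i * (A * hh i - B * dl i) \<le> A / \<mu>\<^sup>2 * (R ^ i * (\<Sum>j<i. delay_kernel c \<gamma> D (i - j) * dl j)) - B * (R ^ i * dl i)"
        by (simp add: algebra_simps)
    qed
    also have "\<dots> = A / \<mu>\<^sup>2 * (\<Sum>k<k. R ^ k * (\<Sum>j<k. delay_kernel c \<gamma> D (k - j) * dl j)) - B * (\<Sum>k<k. R ^ k * dl k)"
      by (simp only: sum_subtractf sum_distrib_left)
    also have "\<dots> \<le> A / \<mu>\<^sup>2 * (K * (\<Sum>k<k. R ^ k * dl k)) - B * (\<Sum>k<k. R ^ k * dl k)"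
      using weighted_convolution_le[OF _ dl K, where N = k] R A by (intro diff_right_mono mult_left_mono) auto
    also have "\<dots> = (A / \<mu>\<^sup>2 * K - B) * (\<Sum>k<k. R ^ k * dl k)" by (simp add: algebra_simps)
    also have "\<dots> \<le> 0" using AK R dl by (intro mult_nonpos_nonneg sum_nonneg) auto
    finally show ?thesis .
  qed
  then have "R ^ k * v k \<le> v 0" using unrolled R by (smt (verit) mult_nonneg_nonpos)
  then have "(1 - r) ^ k * (R ^ k * v k) \<le> (1 - r) ^ k * v 0" using r by (intro mult_left_mono) auto
  moreover have "(1 - r) ^ k * R ^ k = 1" using r by (simp add: R_def power_mult_distrib[symmetric])
  ultimately show ?thesis by (metis mult.assoc mult_1)
qed

section \<open>The dual problem\<close>

lemma embM_mult_linear: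
  fixes X Y :: "real mat"
  assumes "X \<in> carrier_mat d n" "Y \<in> carrier_mat d n" "R \<in> carrier_mat n n"
  shows "embM ((X + Y) * R) = embM (X * R) + embM (Y * R)" "embM ((X - Y) * R) = embM (X * R) - embM (Y * R)"
    "embM ((k \<cdot>\<^sub>m X) * R) = k *\<^sub>R embM (X * R)"
  using assms
  by (simp_all add: add_mult_distrib_mat[of _ d n] minus_mult_distrib_mat[of _ d n] mult_smult_assoc_mat[of _ d n _ n]
      embM_ops[of _ d n] embM_smult)

text \<open>By the pseudo-inverse, these are exactly the matrices \<open>\<xi> S\<close> for the
  root \<open>S\<close> of any gossip matrix. The set does not depend on which gossip matrix is
  used, which connects the iteration with the problem for \<open>U\<close>.\<close>

definition balanced :: "nat \<Rightarrow> nat \<Rightarrow> real mat \<Rightarrow> bool" where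
  "balanced d n X \<longleftrightarrow> X \<in> carrier_mat d n \<and> X *\<^sub>v ones_vec n = 0\<^sub>v d"

lemma balanced_carrier: "balanced d n X \<Longrightarrow> X \<in> carrier_mat d n"
  by (simp add: balanced_def)

lemma balanced_zero: "balanced d n (0\<^sub>m d n)"
  by (auto simp: balanced_def)

lemma balanced_ops:
  assumes "balanced d n X" "balanced d n Y"
  shows "balanced d n (X + Y)" "balanced d n (X - Y)"
  using assms unfolding balanced_def
  by (auto simp: add_mult_distrib_mat_vec[of _ d n] minus_mult_distrib_mat_vec[of _ d n] minus_carrier_mat intro!: eq_vecI)

lemma balanced_smult:
  assumes "balanced d n X"
  shows "balanced d n (k \<cdot>\<^sub>m X)"
  using assms unfolding balanced_def by (auto simp: smult_mat_mult_vec[of _ d n] intro!: eq_vecI)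

lemma balanced_mult:
  assumes "H \<in> carrier_mat d n" "M \<in> carrier_mat n n" "M *\<^sub>v ones_vec n = 0\<^sub>v n"
  shows "balanced d n (H * M)"
  using assms by (auto simp: balanced_def assoc_mult_mat_vec[of _ d n _ n] intro!: eq_vecI)

lemma complete_Int_hyperplane:
  fixes A :: "'a :: real_inner set"
  assumes "complete A"
  shows "complete (A \<inter> {z. \<forall>i\<in>I. inner (a i) z = 0})"
proof -
  have "{z. \<forall>i\<in>I. inner (a i) z = 0} = (\<Inter>i\<in>I. {z. inner (a i) z = 0})" by auto
  then have cl: "closed {z. \<forall>i\<in>I. inner (a i) z = 0}"
    by (auto intro!: closed_INT closed_hyperplane)
  show ?thesis
    unfolding complete_def
  proof safe
    fix X :: "nat \<Rightarrow> 'a" assume X: "\<forall>k. X k \<in> A \<inter> {z. \<forall>i\<in>I. inner (a i) z = 0}" and C: "Cauchy X"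
    then obtain l where l: "l \<in> A" "X \<longlonglongrightarrow> l" using assms unfolding complete_def by blast
    have "l \<in> {z. \<forall>i\<in>I. inner (a i) z = 0}"
      using cl X l(2) unfolding closed_sequential_limits by blast
    then show "\<exists>l\<in>A \<inter> {z. \<forall>i\<in>I. inner (a i) z = 0}. X \<longlonglongrightarrow> l" using l by blast
  qed
qed

text \<open>The matrix inside the inner product is the indicator of row \<open>i\<close>, so each
  hyperplane is the vanishing of one row sum. This presents the feasible set as a complete
  subspace.\<close>

lemma balanced_embM:
  defines "T \<equiv> \<lambda>d n :: nat. supported ({..<d} \<times> {..<n}) \<inter>
    {z. \<forall>i\<in>{..<d}. inner (embM (mat d n (\<lambda>(k, j). if k = i then 1 else 0))) z = 0}"
  shows "complete (T d n)" "subspace (T d n)"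
    "z \<in> T d n \<Longrightarrow> balanced d n (unembM d n z)" "balanced d n X \<Longrightarrow> embM X \<in> T d n"
proof -
  let ?E = "\<lambda>i. mat d n (\<lambda>(k, j). if k = i then 1 else 0) :: real mat"
  show "complete (T d n)"
    unfolding T_def by (intro complete_Int_hyperplane complete_supported) simp
  show "subspace (T d n)"
    unfolding T_def using subspace_supported[of "{..<d} \<times> {..<n}"]
    by (auto simp: real_vector.subspace_def inner_add_right inner_scaleR_right)
  have E: "inner (embM (?E i)) (embM X) = row X i \<bullet> ones_vec n" if "X \<in> carrier_mat d n" "i < d" for X i
  proof -
    have "inner (embM (?E i)) (embM X) = (\<Sum>k<d. row (?E i) k \<bullet> row X k)"
      using that by (intro inner_embM(2)) auto
    also have "\<dots> = (\<Sum>k<d. if k = i then row X k \<bullet> ones_vec n else 0)"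
    proof (intro sum.cong refl)
      fix k assume k: "k \<in> {..<d}"
      show "row (?E i) k \<bullet> row X k = (if k = i then row X k \<bullet> ones_vec n else 0)"
        using k that(1) by (auto simp: scalar_prod_def ones_vec_def intro!: sum.neutral)
    qed
    also have "\<dots> = row X i \<bullet> ones_vec n" using that by simp
    finally show ?thesis .
  qed
  show "balanced d n (unembM d n z)" if "z \<in> T d n"
  proof -
    have z: "embM (unembM d n z) = z" using that by (intro embM_unembM) (simp add: T_def)
    have "row (unembM d n z) i \<bullet> ones_vec n = 0" if "i < d" for i
      using E[of "unembM d n z" i] that \<open>z \<in> T d n\<close> unfolding z by (simp add: T_def)
    then show ?thesis by (auto simp: balanced_def unembM_def intro!: eq_vecI)
  qed
  show "embM X \<in> T d n" if "balanced d n X"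
    using that E[of X] rows_orthogonal_ones[of X d n] by (auto simp: T_def balanced_def intro: embM_supported)
qed

section \<open>The gossip iteration in the coordinates of the root\<close>

locale mdlag_convergence = mdlag n m d f L \<mu> U \<eta> s c \<gamma> D epochs
  for n m d :: nat and f :: "nat \<Rightarrow> nat \<Rightarrow> real vec \<Rightarrow> real" and L \<mu> :: "nat \<Rightarrow> real"
    and U :: "real mat" and \<eta> s c \<gamma> :: real and D epochs :: nat +
  assumes well_posed: well_posed
    and U: "gossip_mat n U"
    and eta: "\<eta> = 2 / 15 * (1 / (eigenvalue_desc (accel_gossip n U) 1 / \<mu>_min))"
    and s: "s = 10"
begin

abbreviation "Pm \<equiv> accel_gossip n U"
abbreviation "Sm \<equiv> psd_sqrt n Pm"
abbreviation "Vd \<equiv> supported {..<d} :: nat fsv set"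

definition target :: "nat \<Rightarrow> nat fsv \<Rightarrow> nat fsv" where
  "target i = smooth_strongly_convex_on.conj_arg Vd (worker.loss d m (f i))"
definition tval :: "nat \<Rightarrow> nat fsv \<Rightarrow> real" where
  "tval i = smooth_strongly_convex_on.conj_val Vd (worker.loss d m (f i))"

definition \<alpha> :: real where "\<alpha> = eigenvalue_desc Pm (n - 1) / L_max"
definition \<beta> :: real where "\<beta> = eigenvalue_desc Pm 1 / \<mu>_min"
text \<open>The reciprocal of the root in the momentum formula for \<open>s = 10\<close>; it is also
  the contraction rate.\<close>

definition r :: real where "r = 1 / sqrt (10 * (\<kappa>_F / zeta n Pm))"

lemma n_ge_2: "n \<ge> 2" using well_posed by (simp add: well_posed_def)

lemma worker_i: "i < n \<Longrightarrow> worker d m (f i) (L i) (\<mu> i)"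
  using well_posed by unfold_locales (auto simp: well_posed_def)

lemma constants:
  "0 < \<mu>_min" "0 < L_max" "\<mu>_min \<le> L_max" "1 \<le> \<kappa>_max" "1 \<le> \<kappa>_F"
  "i < n \<Longrightarrow> \<mu>_min \<le> \<mu> i" "i < n \<Longrightarrow> L i \<le> L_max" "i < n \<Longrightarrow> L i / \<mu> i \<le> \<kappa>_max"
proof -
  have ne: "{..<n} \<noteq> {}" using n_ge_2 by (metis lessThan_iff empty_iff less_le_trans zero_less_numeral)
  show mi: "\<mu>_min \<le> \<mu> i" and Li: "L i \<le> L_max" and ki: "L i / \<mu> i \<le> \<kappa>_max" if "i < n" for i
    using that by (auto simp: \<mu>_min_def L_max_def \<kappa>_max_def)
  have "\<mu>_min \<in> \<mu> ` {..<n}" unfolding \<mu>_min_def using ne by (intro Min_in) auto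
  then show m0: "0 < \<mu>_min" using worker.mu_gt_0[OF worker_i] by auto
  have 0: "0 < n" using n_ge_2 by simp
  show l0: "0 < L_max" using worker.L_gt_0[OF worker_i[OF 0]] Li[OF 0] by simp
  show ml: "\<mu>_min \<le> L_max" using mi[OF 0] Li[OF 0] worker.mu_le_L[OF worker_i[OF 0]] by simp
  show "1 \<le> \<kappa>_max"
    using ki[OF 0] worker.mu_le_L[OF worker_i[OF 0]] worker.mu_gt_0[OF worker_i[OF 0]]
    by (meson divide_self_if le_divide_eq_1_pos order_trans)
  show "1 \<le> \<kappa>_F" using ml m0 by (simp add: \<kappa>_F_def)
qed

lemma P: "gossip_mat n Pm" "1 / 4 \<le> zeta n Pm"
  using accel_gossip_gossip_mat[OF U] by auto

lemma Pm_carrier: "Pm \<in> carrier_mat n n" and Sm: "Sm \<in> carrier_mat n n" "transpose_mat Sm = Sm" "Sm * Sm = Pm"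
proof -
  have psd: "psd_mat n Pm" using P(1) by (simp add: gossip_mat_def)
  show "Pm \<in> carrier_mat n n" "Sm \<in> carrier_mat n n" "transpose_mat Sm = Sm" "Sm * Sm = Pm"
    using psd psd_sqrt[OF psd] psd_mat_carrier psd_mat_symmetric by auto
qed

lemma \<alpha>\<beta>: "0 < \<alpha>" "\<alpha> \<le> \<beta>" "0 < \<beta>"
proof -
  note e = gossip_mat_eigenvalues_order[OF P(1)]
  show a: "0 < \<alpha>" using e constants(2) by (simp add: \<alpha>_def)
  show "\<alpha> \<le> \<beta>" unfolding \<alpha>_def \<beta>_def using e constants by (intro frac_le) auto
  with a show "0 < \<beta>" by simp
qed

text \<open>The condition number \<open>\<kappa>_F / zeta n Pm\<close> equals
  \<open>\<beta> / \<alpha>\<close>, whence the third claim. The upper bound from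
  \<open>zeta \<le> 1\<close> is what the exponential damping needs; the lower bound from
  \<open>zeta \<ge> 1 / 4\<close> gives the iteration count.\<close>

lemma r: "0 < r" "r \<le> 8 / 25" "\<alpha> = 10 * \<beta> * r\<^sup>2" "r \<le> 1 / sqrt \<kappa>_F" "1 / sqrt (40 * \<kappa>_F) \<le> r"
  "momentum = (1 - r) / (1 + r)"
proof -
  note e = gossip_mat_eigenvalues_order[OF P(1)] and z = zeta_bounds[OF P(1)]
  define q where "q = 10 * (\<kappa>_F / zeta n Pm)"
  have kz: "\<kappa>_F \<le> \<kappa>_F / zeta n Pm" using z constants(5) by (simp add: le_divide_eq)
  then have q: "q \<ge> 10 * \<kappa>_F" "q \<ge> 10" using constants(5) by (auto simp: q_def)
  have r: "r = 1 / sqrt q" by (simp add: r_def q_def)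
  show r0: "0 < r" using q by (simp add: r)
  have r2: "r\<^sup>2 = 1 / q" using q by (simp add: r power_divide)
  \<comment> \<open>\<open>8 / 25\<close> is a rational upper bound for \<open>1 / sqrt 10\<close>,
    the largest possible value of \<open>r\<close>.\<close>
  have "r\<^sup>2 \<le> 1 / 10" unfolding r2 using q by (intro divide_left_mono) auto
  also have "1 / 10 \<le> (8 / 25 :: real)\<^sup>2" by (simp add: power2_eq_square)
  finally show "r \<le> 8 / 25" by (rule power2_le_imp_le) simp
  have "q = 10 * (\<beta> / \<alpha>)"
    using e constants by (simp add: q_def \<alpha>_def \<beta>_def \<kappa>_F_def zeta_def field_simps)
  then show "\<alpha> = 10 * \<beta> * r\<^sup>2" unfolding r2 using \<alpha>\<beta> by simp
  have "sqrt \<kappa>_F \<le> sqrt q" using q constants(5) by (intro real_sqrt_le_mono) auto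
  then show "r \<le> 1 / sqrt \<kappa>_F" unfolding r using constants(5) by (intro divide_left_mono) auto
  have "\<kappa>_F / zeta n Pm \<le> \<kappa>_F / (1 / 4)" using P(2) constants(5) z by (intro divide_left_mono) auto
  then have "q \<le> 40 * \<kappa>_F" by (simp add: q_def)
  then have "sqrt q \<le> sqrt (40 * \<kappa>_F)" by (rule real_sqrt_le_mono)
  then show "1 / sqrt (40 * \<kappa>_F) \<le> r" unfolding r using q by (intro divide_left_mono) auto
  have mob: "(t - 1) / (t + 1) = (1 - 1 / t) / (1 + 1 / t)" if "t > 0" for t :: real
  proof -
    have "1 - 1 / t = (t - 1) / t" "1 + 1 / t = (t + 1) / t" using that by (simp_all add: field_simps)
    then show ?thesis using that by simp
  qed
  have "sqrt q > 0" using q by simp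
  then show "momentum = (1 - r) / (1 + r)"
    unfolding momentum_def unfolding Let_def s q_def[symmetric] r using mob by blast
qed

lemma target:
  assumes i: "i < n" and x: "x \<in> Vd" and y: "y \<in> Vd"
  shows "target i x \<in> Vd"
    "tval i x + inner (target i x) (y - x) + (norm (y - x))\<^sup>2 / (2 * L_max) \<le> tval i y"
    "tval i y \<le> tval i x + inner (target i x) (y - x) + (norm (y - x))\<^sup>2 / (2 * \<mu>_min)"
    "(norm (target i x - target i y))\<^sup>2 \<le> (norm (x - y))\<^sup>2 / \<mu>_min\<^sup>2"
proof -
  interpret w: worker d m "f i" "L i" "\<mu> i" by (rule worker_i[OF i])
  show "target i x \<in> Vd" unfolding target_def by (rule w.conj_arg)
  have "(norm (y - x))\<^sup>2 / (2 * L_max) \<le> (norm (y - x))\<^sup>2 / (2 * L i)"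
    using constants(7)[OF i] w.L_gt_0 by (intro divide_left_mono) auto
  then show "tval i x + inner (target i x) (y - x) + (norm (y - x))\<^sup>2 / (2 * L_max) \<le> tval i y"
    using w.conj_val_lower[OF x y] unfolding target_def tval_def by linarith
  have "(norm (y - x))\<^sup>2 / (2 * \<mu> i) \<le> (norm (y - x))\<^sup>2 / (2 * \<mu>_min)"
    using constants(1) constants(6)[OF i] by (intro divide_left_mono) auto
  then show "tval i y \<le> tval i x + inner (target i x) (y - x) + (norm (y - x))\<^sup>2 / (2 * \<mu>_min)"
    using w.conj_val_upper[OF x y] unfolding target_def tval_def by linarith
  have "(norm (x - y))\<^sup>2 / (\<mu> i)\<^sup>2 \<le> (norm (x - y))\<^sup>2 / \<mu>_min\<^sup>2"
    using constants(1) constants(6)[OF i] by (intro divide_left_mono power_mono) auto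
  then show "(norm (target i x - target i y))\<^sup>2 \<le> (norm (x - y))\<^sup>2 / \<mu>_min\<^sup>2"
    using w.conj_arg_lipschitz[OF x y] unfolding target_def by linarith
qed

lemma local_loss_eq: "local_loss i = (\<lambda>\<theta>. (1 / real m) * (\<Sum>j<m. f i j \<theta>))"
  by (rule ext) (simp add: local_loss_def)

lemma dual_fun_eq:
  assumes "X \<in> carrier_mat d n"
  shows "dual_fun X = (\<Sum>i<n. tval i (emb (col X i)))"
  unfolding dual_fun_def local_loss_eq tval_def
  using assms by (intro sum.cong refl worker.convex_conjugate_loss[OF worker_i]) auto

lemma conjugate_gradient:
  assumes "i < n" "x \<in> carrier_vec d"
  shows "gradient d (convex_conjugate d (local_loss i)) x = unemb d (target i (emb x))"
  unfolding local_loss_eq target_def by (rule worker.gradient_convex_conjugate_loss[OF worker_i]) (use assms in auto)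

definition collect :: "(nat \<Rightarrow> real vec) \<Rightarrow> real mat" where
  "collect h = mat_of_cols d (map h [0..<n])"

text \<open>The exact dual gradient at \<open>X\<close>, column by column.\<close>

definition opt :: "real mat \<Rightarrow> real mat" where
  "opt X = collect (\<lambda>i. unemb d (target i (emb (col X i))))"

lemma collect_carrier [simp]: "collect h \<in> carrier_mat d n"
  unfolding collect_def by (rule carrier_matI) simp_all

lemma col_collect: "i < n \<Longrightarrow> h i \<in> carrier_vec d \<Longrightarrow> col (collect h) i = h i"
  by (simp add: collect_def)

lemma opt_carrier [simp]: "opt X \<in> carrier_mat d n"
  by (simp add: opt_def)

lemma emb_col_opt:
  assumes "i < n" "X \<in> carrier_mat d n"
  shows "emb (col (opt X) i) = target i (emb (col X i))"
  unfolding opt_def col_collect[OF assms(1) unemb_carrier]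
proof (rule emb_unemb)
  have V: "emb (col X i) \<in> Vd" using assms by (intro emb_supported) auto
  show "target i (emb (col X i)) \<in> Vd" by (rule target(1)[OF assms(1) V V])
qed

lemma dual_bounds:
  assumes X: "X \<in> carrier_mat d n" and Y: "Y \<in> carrier_mat d n"
  shows "dual_fun X + inner (embM (opt X)) (embM (Y - X)) + (norm (embM (Y - X)))\<^sup>2 / (2 * L_max) \<le> dual_fun Y"
    "dual_fun Y \<le> dual_fun X + inner (embM (opt X)) (embM (Y - X)) + (norm (embM (Y - X)))\<^sup>2 / (2 * \<mu>_min)"
proof -
  have YX: "Y - X \<in> carrier_mat d n" by (rule minus_carrier_mat[OF X])
  have V: "emb (col X i) \<in> Vd" "emb (col Y i) \<in> Vd" "emb (col (Y - X) i) = emb (col Y i) - emb (col X i)" if "i < n" for i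
  proof -
    have "col (Y - X) i = col Y i - col X i" using X Y that by (intro eq_vecI) auto
    then show "emb (col (Y - X) i) = emb (col Y i) - emb (col X i)" using X Y that by (simp add: emb_ops[of _ d])
  qed (use X Y that in \<open>auto intro: emb_supported\<close>)
  have eq: "dual_fun X + inner (embM (opt X)) (embM (Y - X)) + (norm (embM (Y - X)))\<^sup>2 / q =
    (\<Sum>i<n. tval i (emb (col X i)) + inner (target i (emb (col X i))) (emb (col Y i) - emb (col X i))
      + (norm (emb (col Y i) - emb (col X i)))\<^sup>2 / q)" for q
    unfolding dual_fun_eq[OF X] inner_embM(1)[OF opt_carrier YX] norm_embM_sq[OF YX] sum.distrib sum_divide_distrib
    using V emb_col_opt[OF _ X] by simp
  show "dual_fun X + inner (embM (opt X)) (embM (Y - X)) + (norm (embM (Y - X)))\<^sup>2 / (2 * L_max) \<le> dual_fun Y"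
    unfolding eq dual_fun_eq[OF Y] using target(2) V by (intro sum_mono) auto
  show "dual_fun Y \<le> dual_fun X + inner (embM (opt X)) (embM (Y - X)) + (norm (embM (Y - X)))\<^sup>2 / (2 * \<mu>_min)"
    unfolding eq dual_fun_eq[OF Y] using target(3) V by (intro sum_mono) auto
qed

text \<open>Quadratic growth is read off from the midpoint inequality at the minimizer, so no
  optimality condition on the subspace is involved; this yields the constant
  \<open>4 * L_max\<close>.\<close>

lemma dual_minimizer:
  obtains xs where "balanced d n xs" "\<And>Y. balanced d n Y \<Longrightarrow> dual_fun xs \<le> dual_fun Y"
    "\<And>Y. balanced d n Y \<Longrightarrow> (norm (embM (Y - xs)))\<^sup>2 / (4 * L_max) \<le> dual_fun Y - dual_fun xs"
proof -
  define T where "T = supported ({..<d} \<times> {..<n}) \<inter>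
    {z. \<forall>i\<in>{..<d}. inner (embM (mat d n (\<lambda>(k, j). if k = i then 1 else 0))) z = 0}"
  note T = balanced_embM[where d = d and n = n, folded T_def]
  interpret strongly_convex_on T "\<lambda>z. dual_fun (unembM d n z)" "\<lambda>z. embM (opt (unembM d n z))" "1 / L_max"
  proof
    show "complete T" "subspace T" by (rule T)+
    show "0 < 1 / L_max" using constants by simp
    fix x y assume xy: "x \<in> T" "y \<in> T"
    have "embM (unembM d n y - unembM d n x) = y - x"
      using xy by (simp add: embM_ops[of _ d n] embM_unembM T_def)
    then show "dual_fun (unembM d n x) + inner (embM (opt (unembM d n x))) (y - x) + 1 / L_max / 2 * (norm (y - x))\<^sup>2
        \<le> dual_fun (unembM d n y)"
      using dual_bounds(1)[of "unembM d n x" "unembM d n y"] by (simp add: mult.commute)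
  qed
  obtain z where z: "z \<in> T" "\<forall>y\<in>T. dual_fun (unembM d n z) \<le> dual_fun (unembM d n y)"
    using minimizer_exists by auto
  define xs where "xs = unembM d n z"
  have xs: "balanced d n xs" "embM xs = z" unfolding xs_def using T(3) z(1) by (auto simp: T_def intro: embM_unembM)
  show ?thesis
  proof (rule that[OF xs(1)])
    fix Y assume Y: "balanced d n Y"
    then have eY: "embM Y \<in> T" "unembM d n (embM Y) = Y" using T(4) by (auto dest: balanced_carrier)
    show "dual_fun xs \<le> dual_fun Y" using z(2) eY by (auto simp: xs_def)
    have "(1 / 2) *\<^sub>R (embM Y + z) \<in> T"
      using V(2) eY z by (simp add: real_vector.subspace_add real_vector.subspace_scale del: scaleR_add_right)
    then have "dual_fun xs \<le> (dual_fun Y + dual_fun xs) / 2 - 1 / L_max / 8 * (norm (embM Y - z))\<^sup>2"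
      using z(2) midpoint[OF eY(1) z(1)] by (force simp: eY xs_def)
    then show "(norm (embM (Y - xs)))\<^sup>2 / (4 * L_max) \<le> dual_fun Y - dual_fun xs"
      using Y xs by (simp add: embM_ops[OF balanced_carrier balanced_carrier] add_divide_distrib)
  qed
qed

definition pinv :: "real mat" where
  "pinv = (SOME R. R \<in> carrier_mat n n \<and> transpose_mat R = R \<and> Pm * R = Sm \<and> R *\<^sub>v ones_vec n = 0\<^sub>v n \<and>
     (\<forall>v\<in>carrier_vec n. v \<bullet> ones_vec n = 0 \<longrightarrow> Sm *\<^sub>v (R *\<^sub>v v) = v))"

lemma pinv:
  "pinv \<in> carrier_mat n n" "transpose_mat pinv = pinv" "Pm * pinv = Sm" "pinv *\<^sub>v ones_vec n = 0\<^sub>v n"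
  "v \<in> carrier_vec n \<Longrightarrow> v \<bullet> ones_vec n = 0 \<Longrightarrow> Sm *\<^sub>v (pinv *\<^sub>v v) = v"
proof -
  have "\<exists>R. R \<in> carrier_mat n n \<and> transpose_mat R = R \<and> Pm * R = Sm \<and> R *\<^sub>v ones_vec n = 0\<^sub>v n \<and>
     (\<forall>v\<in>carrier_vec n. v \<bullet> ones_vec n = 0 \<longrightarrow> Sm *\<^sub>v (R *\<^sub>v v) = v)"
    using gossip_sqrt_pinv[OF P(1)] by metis
  from someI_ex[OF this, folded pinv_def]
  show "pinv \<in> carrier_mat n n" "transpose_mat pinv = pinv" "Pm * pinv = Sm" "pinv *\<^sub>v ones_vec n = 0\<^sub>v n"
    "v \<in> carrier_vec n \<Longrightarrow> v \<bullet> ones_vec n = 0 \<Longrightarrow> Sm *\<^sub>v (pinv *\<^sub>v v) = v"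
    by auto
qed

text \<open>The coordinates \<open>co x = x S\<^sup>+\<close> with \<open>x = co x S\<close> turn the gossip iteration into gradient steps
  on \<open>\<xi> \<mapsto> F\<^sup>*(\<xi> S)\<close>, where \<open>S\<close> is the square root of the accelerated gossip matrix.\<close>

definition co :: "real mat \<Rightarrow> (nat \<times> nat) fsv" where
  "co X = embM (X * pinv)"

lemma co_ops:
  assumes "X \<in> carrier_mat d n" "Y \<in> carrier_mat d n"
  shows "co (X + Y) = co X + co Y" "co (X - Y) = co X - co Y" "co (k \<cdot>\<^sub>m X) = k *\<^sub>R co X"
  unfolding co_def using embM_mult_linear[OF assms pinv(1)] by auto

text \<open>The norm comparisons that convert moduli: smoothness \<open>1 / \<mu>_min\<close> in
  \<open>x\<close> becomes \<open>\<beta>\<close> in the coordinates, strong convexity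
  \<open>1 / L_max\<close> becomes \<open>\<alpha>\<close>.\<close>

lemma co_props:
  assumes X: "balanced d n X"
  shows "(norm (embM X))\<^sup>2 \<le> eigenvalue_desc Pm 1 * (norm (co X))\<^sup>2"
    "eigenvalue_desc Pm (n - 1) * (norm (co X))\<^sup>2 \<le> (norm (embM X))\<^sup>2"
    "T \<in> carrier_mat d n \<Longrightarrow> inner (embM T) (embM X) = inner (embM (T * Sm)) (co X)"
proof -
  have Xc: "X \<in> carrier_mat d n" "X *\<^sub>v ones_vec n = 0\<^sub>v d" using X by (auto simp: balanced_def)
  have XR: "X * pinv \<in> carrier_mat d n" using Xc pinv by simp
  have XRo: "(X * pinv) *\<^sub>v ones_vec n = 0\<^sub>v d"
    using balanced_mult[OF Xc(1) pinv(1) pinv(4)] by (simp add: balanced_def)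
  have inv: "X * pinv * Sm = X" by (rule mult_pinv_sqrt[OF Sm(1,2) pinv(1,2) pinv(5) Xc])
  show "(norm (embM X))\<^sup>2 \<le> eigenvalue_desc Pm 1 * (norm (co X))\<^sup>2"
    using norm_mult_gossip_sqrt_le[OF P(1) Sm XR] unfolding inv co_def .
  show "eigenvalue_desc Pm (n - 1) * (norm (co X))\<^sup>2 \<le> (norm (embM X))\<^sup>2"
    using norm_mult_gossip_sqrt_ge[OF P(1) Sm XR XRo] unfolding inv co_def .
  show "inner (embM T) (embM X) = inner (embM (T * Sm)) (co X)" if T: "T \<in> carrier_mat d n"
    using inner_embM_mult_symmetric[OF T XR Sm(1,2)] unfolding inv co_def by simp
qed

text \<open>The Lyapunov function of the accelerated method in these coordinates; the shifted point
  is Nesterov's auxiliary sequence, and the weight is half of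
  \<open>3 / 4 * \<alpha>\<close>.\<close>

definition lyap :: "real mat \<Rightarrow> real mat \<Rightarrow> real mat \<Rightarrow> real" where
  "lyap xs x y = dual_fun y - dual_fun xs + 3 / 8 * \<alpha> * (norm (co x + (1 / r) *\<^sub>R (co x - co y) - co xs))\<^sup>2"

text \<open>In coordinates the update by \<open>H * Pm\<close> is a gradient step with
  \<open>H * Sm\<close>, whose deviation from the exact gradient is \<open>(H - opt x) * Sm\<close>.
  Each passage between coordinates and matrices costs one factor of the largest eigenvalue.\<close>

lemma lyap_step:
  assumes x: "balanced d n x" and y: "balanced d n y" and xs: "balanced d n xs" and H: "H \<in> carrier_mat d n"
  defines "y' \<equiv> x - \<eta> \<cdot>\<^sub>m (H * Pm)"
  defines "x' \<equiv> y' + momentum \<cdot>\<^sub>m (y' - y)"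
  shows "balanced d n y'" "balanced d n x'"
    "lyap xs x' y' \<le> (1 - r) * lyap xs x y + 4 * r / \<alpha> * eigenvalue_desc Pm 1 * (norm (embM (H - opt x)))\<^sup>2
       - 3 / 5 * \<beta> * r / eigenvalue_desc Pm 1 * (norm (embM (x' - x)))\<^sup>2"
proof -
  define hi where "hi = eigenvalue_desc Pm 1"
  have hi: "0 < hi" using gossip_mat_eigenvalues_order[OF P(1)] by (simp add: hi_def)
  have HP: "balanced d n (H * Pm)" by (rule balanced_mult[OF H Pm_carrier gossip_mat_ones[OF P(1)]])
  show y': "balanced d n y'" unfolding y'_def by (intro balanced_ops balanced_smult x HP)
  show x': "balanced d n x'" unfolding x'_def by (intro balanced_ops balanced_smult y y')
  note c = balanced_carrier[OF x] balanced_carrier[OF y] balanced_carrier[OF xs] balanced_carrier[OF y'] balanced_carrier[OF x']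
  define g where "g = embM (opt x * Sm)"
  define e where "e = embM ((H - opt x) * Sm)"
  have HPc: "H * Pm \<in> carrier_mat d n" using H Pm_carrier by simp
  \<comment> \<open>Uses \<open>Pm * pinv = Sm\<close>: the coordinates strip off one of the two
    root factors.\<close>
  have "co (H * Pm) = embM (H * Sm)"
    using H Pm_carrier pinv by (simp add: co_def assoc_mult_mat[of _ d n _ n _ n])
  also have "\<dots> = g + e" unfolding g_def e_def using embM_mult_linear(2)[OF H opt_carrier Sm(1)] by simp
  finally have Yp: "co y' = co x - \<eta> *\<^sub>R (g + e)"
    unfolding y'_def using co_ops(2)[OF c(1), of "\<eta> \<cdot>\<^sub>m (H * Pm)"] co_ops(3)[OF HPc HPc] HPc by simp
  have yc: "y' - y \<in> carrier_mat d n" by (rule minus_carrier_mat[OF c(2)])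
  have Xp: "co x' = co y' + ((1 - r) / (1 + r)) *\<^sub>R (co y' - co y)"
    unfolding x'_def r(6)[symmetric] using co_ops(1)[OF c(4), of "momentum \<cdot>\<^sub>m (y' - y)"] co_ops(3)[OF yc yc] co_ops(2)[OF c(4) c(2)] yc
    by simp
  have etab: "\<eta> = 2 / (15 * \<beta>)" unfolding eta \<beta>_def by simp
  have in1: "inner (embM (opt x)) (embM (z - x)) = inner g (co z - co x)" if "balanced d n z" for z
    using co_props(3)[OF balanced_ops(2)[OF that x] opt_carrier, of x] co_ops(2)[OF balanced_carrier[OF that] c(1)] by (simp add: g_def)
  have up: "dual_fun y' \<le> dual_fun x + inner g (co y' - co x) + \<beta> / 2 * (norm (co y' - co x))\<^sup>2"
  proof -
    have "(norm (embM (y' - x)))\<^sup>2 / (2 * \<mu>_min) \<le> hi * (norm (co y' - co x))\<^sup>2 / (2 * \<mu>_min)"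
      using co_props(1)[OF balanced_ops(2)[OF y' x]] constants(1) co_ops(2)[OF c(4) c(1)] unfolding hi_def
      by (intro divide_right_mono) auto
    then show ?thesis using dual_bounds(2)[OF c(1) c(4)] unfolding in1[OF y'] by (simp add: \<beta>_def hi_def)
  qed
  have low: "dual_fun x + inner g (co z - co x) + \<alpha> / 2 * (norm (co z - co x))\<^sup>2 \<le> dual_fun z" if "balanced d n z" for z
  proof -
    have "eigenvalue_desc Pm (n - 1) * (norm (co z - co x))\<^sup>2 / (2 * L_max) \<le> (norm (embM (z - x)))\<^sup>2 / (2 * L_max)"
      using co_props(2)[OF balanced_ops(2)[OF that x]] constants(2) co_ops(2)[OF balanced_carrier[OF that] c(1)]
      by (intro divide_right_mono) auto
    then show ?thesis using dual_bounds(1)[OF c(1) balanced_carrier[OF that]] unfolding in1[OF that] by (simp add: \<alpha>_def)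
  qed
  have lowy: "dual_fun x + inner g (co y - co x) \<le> dual_fun y"
  proof -
    have "0 \<le> \<alpha> / 2 * (norm (co y - co x))\<^sup>2" using \<alpha>\<beta>(1) by simp
    then show ?thesis using low[OF y] by linarith
  qed
  have acc: "lyap xs x' y' \<le> (1 - r) * lyap xs x y + 4 * r / \<alpha> * (norm e)\<^sup>2 - 3 / 5 * \<beta> * r * (norm (co x' - co x))\<^sup>2"
    unfolding lyap_def
    by (rule accelerated_step[OF \<alpha>\<beta>(1,3) r(1,2,3) etab refl Yp Xp refl refl up lowy low[OF xs]])
  have "(norm e)\<^sup>2 \<le> hi * (norm (embM (H - opt x)))\<^sup>2"
    unfolding e_def hi_def by (rule norm_mult_gossip_sqrt_le[OF P(1) Sm minus_carrier_mat[OF opt_carrier]])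
  then have "4 * r / \<alpha> * (norm e)\<^sup>2 \<le> 4 * r / \<alpha> * (hi * (norm (embM (H - opt x)))\<^sup>2)"
    using r(1) \<alpha>\<beta>(1) by (intro mult_left_mono) auto
  moreover have "3 / 5 * \<beta> * r * ((norm (embM (x' - x)))\<^sup>2 / hi) \<le> 3 / 5 * \<beta> * r * (norm (co x' - co x))\<^sup>2"
  proof -
    have "(norm (embM (x' - x)))\<^sup>2 / hi \<le> (norm (co x' - co x))\<^sup>2"
      using co_props(1)[OF balanced_ops(2)[OF x' x]] co_ops(2)[OF c(5) c(1)] hi by (simp add: hi_def divide_le_eq mult.commute)
    then show ?thesis using r(1) \<alpha>\<beta>(3) by (intro mult_left_mono) auto
  qed
  ultimately have "lyap xs x' y' \<le> (1 - r) * lyap xs x y + 4 * r / \<alpha> * (hi * (norm (embM (H - opt x)))\<^sup>2)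
      - 3 / 5 * \<beta> * r * ((norm (embM (x' - x)))\<^sup>2 / hi)"
    using acc by linarith
  then show "lyap xs x' y' \<le> (1 - r) * lyap xs x y + 4 * r / \<alpha> * eigenvalue_desc Pm 1 * (norm (embM (H - opt x)))\<^sup>2
       - 3 / 5 * \<beta> * r / eigenvalue_desc Pm 1 * (norm (embM (x' - x)))\<^sup>2"
    unfolding hi_def[symmetric] by (simp add: mult.assoc)
qed

text \<open>With \<open>x = y = 0\<close> the auxiliary point is 0, and quadratic growth bounds the
  distance term by \<open>3 / 8 * 4\<close> times the gap.\<close>

lemma lyap_init:
  assumes xs: "balanced d n xs" and gap: "(norm (embM (0\<^sub>m d n - xs)))\<^sup>2 / (4 * L_max) \<le> dual_fun (0\<^sub>m d n) - dual_fun xs"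
  shows "lyap xs (0\<^sub>m d n) (0\<^sub>m d n) \<le> 5 / 2 * (dual_fun (0\<^sub>m d n) - dual_fun xs)"
proof -
  let ?z = "0\<^sub>m d n - xs"
  have z: "balanced d n ?z" by (intro balanced_ops balanced_zero xs)
  have "co ?z = co (0\<^sub>m d n) - co xs" using balanced_carrier[OF xs] by (intro co_ops) auto
  then have "lyap xs (0\<^sub>m d n) (0\<^sub>m d n) = dual_fun (0\<^sub>m d n) - dual_fun xs + 3 / 8 * (\<alpha> * (norm (co ?z))\<^sup>2)"
    by (simp add: lyap_def)
  also have "\<alpha> * (norm (co ?z))\<^sup>2 = eigenvalue_desc Pm (n - 1) * (norm (co ?z))\<^sup>2 / L_max" by (simp add: \<alpha>_def)
  also have "\<dots> \<le> (norm (embM ?z))\<^sup>2 / L_max"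
    using co_props(2)[OF z] constants(2) by (intro divide_right_mono) auto
  also have "\<dots> \<le> 4 * (dual_fun (0\<^sub>m d n) - dual_fun xs)" using gap by simp
  finally show ?thesis by (simp add: add_divide_distrib diff_divide_distrib)
qed

end

section \<open>Convergence of MDLAG\<close>

text \<open>The one-step analysis above depends on step size and momentum only; the lazy parameters,
  the delay and the number of epochs enter here.\<close>

locale mdlag_rate = mdlag_convergence n m d f L \<mu> U \<eta> s c \<gamma> D epochs
  for n m d :: nat and f :: "nat \<Rightarrow> nat \<Rightarrow> real vec \<Rightarrow> real" and L \<mu> :: "nat \<Rightarrow> real"
    and U :: "real mat" and \<eta> s c \<gamma> :: real and D epochs :: nat +
  fixes C0 :: real
  assumes D: "D \<ge> 1"
    and gamma: "\<gamma> = \<alpha> * \<beta> * \<mu>_min\<^sup>2 / (288 * real D * fro_norm Sm ^ 4) * exp (- 2 * real D / sqrt \<kappa>_F)"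
    and c: "c = \<alpha> * \<beta> * \<mu>_min\<^sup>2 / (1200 * real D * fro_norm Sm ^ 4) * exp (- 2 * (real D + 1) / sqrt \<kappa>_F)"
    and C0: "16 \<le> C0"
    and epochs: "epochs = nat \<lceil>C0 * (1 + sqrt (\<kappa>_max / real m)) * ln (2 * \<kappa>_max / c)\<rceil>"
begin

definition ratio :: real where "ratio = \<alpha> * \<beta> * \<mu>_min\<^sup>2 / fro_norm Sm ^ 4"

text \<open>The fourth power of the Frobenius norm is at least the squared largest eigenvalue, which
  is \<open>\<beta>\<^sup>2 * \<mu>_min\<^sup>2\<close>.\<close>

lemma ratio: "0 < ratio" "ratio \<le> \<alpha> / \<beta>"
proof -
  have hi: "eigenvalue_desc Pm 1 = \<beta> * \<mu>_min" using constants(1) by (simp add: \<beta>_def)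
  have pos: "0 < \<beta> * \<mu>_min" using \<alpha>\<beta>(3) constants(1) by simp
  have "(\<beta> * \<mu>_min)\<^sup>2 \<le> ((fro_norm Sm)\<^sup>2)\<^sup>2"
    using fro_norm_sqrt_ge[OF P(1)] pos unfolding hi by (intro power_mono) auto
  then have F: "\<beta>\<^sup>2 * \<mu>_min\<^sup>2 \<le> fro_norm Sm ^ 4" by (simp add: power_mult_distrib)
  have bm: "0 < \<beta>\<^sup>2 * \<mu>_min\<^sup>2" using \<alpha>\<beta>(3) constants(1) by simp
  have F0: "0 < fro_norm Sm ^ 4" using F bm by linarith
  show "0 < ratio" unfolding ratio_def using \<alpha>\<beta> constants(1) by (intro divide_pos_pos[OF _ F0] mult_pos_pos) auto
  have "ratio \<le> \<alpha> * \<beta> * \<mu>_min\<^sup>2 / (\<beta>\<^sup>2 * \<mu>_min\<^sup>2)"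
    unfolding ratio_def using F \<alpha>\<beta> by (intro divide_left_mono mult_pos_pos[OF F0 bm]) auto
  also have "\<dots> = \<alpha> / \<beta>" using \<alpha>\<beta> constants(1) by (simp add: power2_eq_square)
  finally show "ratio \<le> \<alpha> / \<beta>" .
qed

lemma c_eq: "c = ratio / (1200 * real D) * exp (- 2 * (real D + 1) / sqrt \<kappa>_F)"
  and gamma_eq: "\<gamma> = ratio / (288 * real D) * exp (- 2 * real D / sqrt \<kappa>_F)"
  unfolding ratio_def by (subst c, simp) (subst gamma, simp)

lemma c_bounds: "0 < c" "c \<le> 1 / 1200" "0 \<le> \<gamma>"
proof -
  have Dp: "real D \<ge> 1" using D by simp
  show "0 < c" "0 \<le> \<gamma>" unfolding c_eq gamma_eq using ratio(1) Dp by auto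
  have "\<alpha> / \<beta> \<le> 1" using \<alpha>\<beta> by simp
  then have "ratio / (1200 * real D) \<le> 1 / (1200 * 1)" using ratio Dp by (intro frac_le) auto
  then have "c \<le> 1 / 1200 * 1"
    unfolding c_eq using ratio(1) Dp constants(5) by (intro mult_mono) (auto simp: divide_le_0_iff)
  then show "c \<le> 1 / 1200" by simp
qed

text \<open>The exponentials in \<open>c\<close> and \<open>\<gamma>\<close> cancel
  \<open>R ^ Suc D\<close> and \<open>R ^ D\<close>, and their denominators cancel the window
  length. This leaves \<open>(28 + 6) / 1200 + 6 / 288 < 1 / 10\<close> of \<open>ratio\<close>,
  hence \<open>2 / 5\<close> against the available \<open>3 / 5\<close>.\<close>

lemma absorbed:
  defines "R \<equiv> 1 / (1 - r)"
  shows "c * R \<le> 1 / 2"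
    "4 * r / \<alpha> * eigenvalue_desc Pm 1 / \<mu>_min\<^sup>2 * (28 * (c * R ^ Suc D) + 6 * ((c + \<gamma>) * real D * R ^ D))
      \<le> 3 / 5 * \<beta> * r / eigenvalue_desc Pm 1"
proof -
  have Dp: "real D \<ge> 1" using D by simp
  have R0: "0 < R" "R \<le> 2" using r(1,2) by (auto simp: R_def field_simps)
  have "c * R \<le> 1 / 1200 * 2" using c_bounds R0 by (intro mult_mono) auto
  then show "c * R \<le> 1 / 2" by simp
  define t where "t = 2 / sqrt \<kappa>_F"
  have t0: "0 \<le> t" using constants(5) by (simp add: t_def)
  \<comment> \<open>Valid for \<open>r \<le> 1 / 2\<close>; it turns the discount into an
    exponential of \<open>2 * r\<close>.\<close>
  have "R \<le> 1 + 2 * r"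
  proof -
    have "r * r \<le> 1 / 2 * r" using r(1,2) by (intro mult_right_mono) auto
    then have "1 \<le> (1 + 2 * r) * (1 - r)" by (simp add: algebra_simps)
    then show ?thesis unfolding R_def using r(1,2) by (subst pos_divide_le_eq) auto
  qed
  also have "\<dots> \<le> exp (2 * r)" by (rule exp_ge_add_one_self)
  also have "\<dots> \<le> exp t" using r(4) by (simp add: t_def)
  finally have Rt: "R \<le> exp t" .
  have pw: "exp (- (real k * t)) * R ^ j \<le> 1" if "j \<le> k" for j k
  proof -
    have "R ^ j \<le> exp t ^ j" using Rt R0 by (intro power_mono) auto
    also have "\<dots> = exp (real j * t)" by (simp add: exp_of_nat_mult)
    also have "\<dots> \<le> exp (real k * t)" using that t0 by (simp add: mult_right_mono)
    finally have "exp (- (real k * t)) * R ^ j \<le> exp (- (real k * t)) * exp (real k * t)" by (intro mult_left_mono) auto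
    then show ?thesis by (simp add: exp_minus)
  qed
  have c': "c = ratio / (1200 * real D) * exp (- (real (Suc D) * t))" and g': "\<gamma> = ratio / (288 * real D) * exp (- (real D * t))"
    unfolding c_eq gamma_eq t_def by (simp_all add: algebra_simps add_divide_distrib diff_divide_distrib)
  have "c * R ^ Suc D \<le> ratio / 1200"
  proof -
    have "c * R ^ Suc D = ratio / (1200 * real D) * (exp (- (real (Suc D) * t)) * R ^ Suc D)" unfolding c' by simp
    also have "\<dots> \<le> ratio / (1200 * real D) * 1" using pw[of "Suc D" "Suc D"] ratio(1) Dp by (intro mult_left_mono) auto
    also have "\<dots> \<le> ratio / (1200 * 1) * 1" using ratio(1) Dp by (intro mult_right_mono divide_left_mono) auto
    finally show ?thesis by simp
  qed
  moreover have "c * real D * R ^ D \<le> ratio / 1200"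
  proof -
    have "c * real D * R ^ D = ratio / 1200 * (exp (- (real (Suc D) * t)) * R ^ D)" unfolding c' using Dp by simp
    also have "\<dots> \<le> ratio / 1200 * 1" using pw[of D "Suc D"] ratio(1) by (intro mult_left_mono) auto
    finally show ?thesis by simp
  qed
  moreover have "\<gamma> * real D * R ^ D \<le> ratio / 288"
  proof -
    have "\<gamma> * real D * R ^ D = ratio / 288 * (exp (- (real D * t)) * R ^ D)" unfolding g' using Dp by simp
    also have "\<dots> \<le> ratio / 288 * 1" using pw[of D D] ratio(1) by (intro mult_left_mono) auto
    finally show ?thesis by simp
  qed
  ultimately have "28 * (c * R ^ Suc D) + 6 * ((c + \<gamma>) * real D * R ^ D) \<le> 1 / 10 * ratio"
    using ratio(1) by (simp add: algebra_simps)
  also have "\<dots> \<le> 1 / 10 * (\<alpha> / \<beta>)" using ratio(2) by simp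
  finally have K: "28 * (c * R ^ Suc D) + 6 * ((c + \<gamma>) * real D * R ^ D) \<le> 1 / 10 * (\<alpha> / \<beta>)" .
  have hi: "eigenvalue_desc Pm 1 = \<beta> * \<mu>_min" using constants(1) by (simp add: \<beta>_def)
  have "4 * r / \<alpha> * eigenvalue_desc Pm 1 / \<mu>_min\<^sup>2 * (28 * (c * R ^ Suc D) + 6 * ((c + \<gamma>) * real D * R ^ D))
      \<le> 4 * r / \<alpha> * eigenvalue_desc Pm 1 / \<mu>_min\<^sup>2 * (1 / 10 * (\<alpha> / \<beta>))"
    using K r(1) \<alpha>\<beta> constants(1) unfolding hi by (intro mult_left_mono) auto
  also have "\<dots> = 2 / 5 * r / \<mu>_min" unfolding hi using \<alpha>\<beta> constants(1) by (simp add: power2_eq_square)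
  also have "\<dots> \<le> 3 / 5 * r / \<mu>_min" using r(1) constants(1) by (intro divide_right_mono) auto
  also have "\<dots> = 3 / 5 * \<beta> * r / eigenvalue_desc Pm 1" unfolding hi using \<alpha>\<beta> by simp
  finally show "4 * r / \<alpha> * eigenvalue_desc Pm 1 / \<mu>_min\<^sup>2 * (28 * (c * R ^ Suc D) + 6 * ((c + \<gamma>) * real D * R ^ D))
      \<le> 3 / 5 * \<beta> * r / eigenvalue_desc Pm 1" .
qed

text \<open>With \<open>C0 \<ge> 16\<close> the epochs gain the factor
  \<open>(2 * K / c) ^ 4\<close>, so the condition number in front is beaten and
  \<open>c ^ 4 / (4 * K ^ 3) \<le> c / 2\<close> remains. The half is reserved for the split of the
  warm-start error.\<close>

lemma local_solver:
  assumes i: "i < n" and x: "x \<in> carrier_vec d" and t: "\<theta>0 \<in> carrier_vec d"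
  shows "finite (set_pmf (local_solver i x \<theta>0))"
    "q \<in> set_pmf (local_solver i x \<theta>0) \<Longrightarrow> fst q \<in> carrier_vec d \<and> snd q = epochs * (5 * m)"
    "measure_pmf.expectation (local_solver i x \<theta>0) (\<lambda>q. (norm (emb (fst q) - target i (emb x)))\<^sup>2)
      \<le> c / 2 * (norm (emb \<theta>0 - target i (emb x)))\<^sup>2"
proof -
  interpret w: worker d m "f i" "L i" "\<mu> i" by (rule worker_i[OF i])
  interpret k: katyusha_problem d m "f i" "L i" "\<mu> i" x using x by unfold_locales
  have eq: "local_solver i x \<theta>0 = katyusha d m k.h k.psi (L i) (\<mu> i) \<theta>0 epochs"
    unfolding local_solver_def k.h_def k.psi_def ..
  have w: "k.w = target i (emb x)" by (simp add: k.w_def target_def)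
  note conv = k.katyusha_convergence[OF t, where e = epochs, folded eq, unfolded w]
  show "finite (set_pmf (local_solver i x \<theta>0))"
    "q \<in> set_pmf (local_solver i x \<theta>0) \<Longrightarrow> fst q \<in> carrier_vec d \<and> snd q = epochs * (5 * m)"
    using conv by auto
  define K where "K = \<kappa>_max"
  have K1: "K \<ge> 1" using constants(4) by (simp add: K_def)
  define l where "l = ln (2 * K / c)"
  have q1: "2 * K / c \<ge> 1" using K1 c_bounds by (simp add: field_simps)
  then have l0: "0 \<le> l" by (simp add: l_def)
  have ep: "real epochs \<ge> C0 * (1 + sqrt (K / real m)) * l" unfolding epochs l_def K_def by (rule real_nat_ceiling_ge)
  have "(2 * K / c) ^ 4 = exp (4 * l)"
    using q1 exp_of_nat_mult[of 4 l] by (simp add: l_def)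
  also have "\<dots> \<le> exp (C0 * l / 4)" using C0 l0 by (simp add: mult_right_mono)
  also have "\<dots> \<le> (1 + k.tau) ^ epochs"
    using C0 l0 constants(8)[OF i] by (intro k.epochs_rate[OF ep]) (auto simp: K_def)
  finally have pw: "(2 * K / c) ^ 4 \<le> (1 + k.tau) ^ epochs" .
  have "4 * (L i / \<mu> i) / (1 + k.tau) ^ epochs \<le> 4 * K / (2 * K / c) ^ 4"
    using pw constants(8)[OF i] w.L_gt_0 w.mu_gt_0 K1 c_bounds by (intro frac_le) (auto simp: K_def)
  also have "\<dots> = c ^ 4 / (4 * K ^ 3)"
    using K1 c_bounds by (simp add: power_divide power_mult_distrib field_simps eval_nat_numeral)
  also have "\<dots> \<le> c / 2"
  proof -
    have "c ^ 4 \<le> c ^ 1" using c_bounds by (intro power_decreasing) auto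
    moreover have "1 \<le> K ^ 3" using K1 by (rule one_le_power)
    ultimately have "c ^ 4 / (4 * K ^ 3) \<le> c / (4 * 1)" using c_bounds by (intro frac_le) auto
    then show ?thesis using c_bounds by simp
  qed
  finally have "4 * (L i / \<mu> i) / (1 + k.tau) ^ epochs * (norm (emb \<theta>0 - target i (emb x)))\<^sup>2
      \<le> c / 2 * (norm (emb \<theta>0 - target i (emb x)))\<^sup>2" by (intro mult_right_mono) auto
  then show "measure_pmf.expectation (local_solver i x \<theta>0) (\<lambda>q. (norm (emb (fst q) - target i (emb x)))\<^sup>2)
      \<le> c / 2 * (norm (emb \<theta>0 - target i (emb x)))\<^sup>2"
    using conv(1) by linarith
qed

text \<open>Separates the randomness of an iteration from the deterministic state update, so that
  expectations become those of a product distribution and marginals can be taken.\<close>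

definition samples :: "nat \<Rightarrow> mdlag_state \<Rightarrow> (nat \<Rightarrow> real vec \<times> nat) pmf" where
  "samples k S = Pi_pmf {..<n} (0\<^sub>v d, 0) (\<lambda>i. local_solver i (col (xs_of S k) i) (theta_of S i))"

definition send :: "nat \<Rightarrow> mdlag_state \<Rightarrow> (nat \<Rightarrow> real vec \<times> nat) \<Rightarrow> nat \<Rightarrow> bool" where
  "send k S q i \<longleftrightarrow> \<not> lazy_condition k (xs_of S) i (hat_of S i) (fst (q i)) \<or> delay_of S i = D"

definition update :: "nat \<Rightarrow> mdlag_state \<Rightarrow> (nat \<Rightarrow> real vec \<times> nat) \<Rightarrow> mdlag_state" where
  "update k S q = S \<lparr> theta_of := (\<lambda>i. fst (q i)),
      hat_of := (\<lambda>i. if send k S q i then fst (q i) else hat_of S i),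
      delay_of := (\<lambda>i. if send k S q i then 0 else delay_of S i + 1),
      evals_of := evals_of S + (\<Sum>i<n. snd (q i)) \<rparr>"

lemma worker_step_eq: "worker_step k S = map_pmf (update k S) (samples k S)"
  unfolding worker_step_def samples_def map_pmf_def update_def send_def Let_def ..

definition step :: "nat \<Rightarrow> mdlag_state \<Rightarrow> mdlag_state pmf" where
  "step k S = (if k = 0 then return_pmf S else worker_step k S)"

lemma run_Suc: "run (Suc k) = bind_pmf (run k) (\<lambda>S. map_pmf (gossip_update k) (step k S))"
  by (simp add: step_def map_pmf_def)

definition good :: "mdlag_state \<Rightarrow> bool" where
  "good S \<longleftrightarrow> (\<forall>j. balanced d n (xs_of S j)) \<and> balanced d n (y_of S) \<and>
     (\<forall>i<n. theta_of S i \<in> carrier_vec d \<and> hat_of S i \<in> carrier_vec d)"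

lemma good_col: "good S \<Longrightarrow> i < n \<Longrightarrow> col (xs_of S k) i \<in> carrier_vec d"
  using balanced_carrier[of d n "xs_of S k"] by (auto simp: good_def)

lemma finite_samples: "good S \<Longrightarrow> finite (set_pmf (samples k S))"
  unfolding samples_def
  by (subst set_Pi_pmf) (auto simp: good_def intro!: finite_PiE_dflt local_solver(1) good_col)

lemma samples_D:
  assumes "good S" "q \<in> set_pmf (samples k S)" "i < n"
  shows "fst (q i) \<in> carrier_vec d" "snd (q i) = epochs * (5 * m)"
proof -
  have qi: "q i \<in> set_pmf (local_solver i (col (xs_of S k) i) (theta_of S i))"
    using assms unfolding samples_def by (auto simp: set_Pi_pmf PiE_dflt_def)
  have th: "theta_of S i \<in> carrier_vec d" using assms by (simp add: good_def)
  show "fst (q i) \<in> carrier_vec d" "snd (q i) = epochs * (5 * m)"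
    using local_solver(2)[OF assms(3) good_col[OF assms(1,3)] th qi] by auto
qed

lemma step_D:
  assumes S: "good S" and T: "T \<in> set_pmf (step k S)"
  shows "good T" "xs_of T = xs_of S" "y_of T = y_of S" "evals_of T = evals_of S + (if k = 0 then 0 else n * (epochs * (5 * m)))"
    "k \<noteq> 0 \<Longrightarrow> i < n \<Longrightarrow> hat_of T i = theta_of T i \<or> lazy_condition k (xs_of T) i (hat_of T i) (theta_of T i)"
    "k = 0 \<Longrightarrow> T = S"
proof -
  have T': "k = 0 \<and> T = S \<or> k \<noteq> 0 \<and> (\<exists>q\<in>set_pmf (samples k S). T = update k S q)"
    using T by (auto simp: step_def worker_step_eq split: if_splits)
  show "good T" using T' S samples_D[OF S] by (auto simp: good_def update_def)
  show "xs_of T = xs_of S" "y_of T = y_of S" using T' by (auto simp: update_def)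
  show "evals_of T = evals_of S + (if k = 0 then 0 else n * (epochs * (5 * m)))"
    using T' samples_D(2)[OF S] by (auto simp: update_def)
  show "k \<noteq> 0 \<Longrightarrow> i < n \<Longrightarrow> hat_of T i = theta_of T i \<or> lazy_condition k (xs_of T) i (hat_of T i) (theta_of T i)"
    using T' by (auto simp: update_def send_def)
  show "k = 0 \<Longrightarrow> T = S" using T' by simp
qed

lemma finite_step: "good S \<Longrightarrow> finite (set_pmf (step k S))"
  by (simp add: step_def worker_step_eq finite_samples)

lemma gossip_update_fields:
  "xs_of (gossip_update k S) = (xs_of S)(Suc k :=
     (xs_of S k - \<eta> \<cdot>\<^sub>m (collect (hat_of S) * Pm)) + momentum \<cdot>\<^sub>m ((xs_of S k - \<eta> \<cdot>\<^sub>m (collect (hat_of S) * Pm)) - y_of S))"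
  "y_of (gossip_update k S) = xs_of S k - \<eta> \<cdot>\<^sub>m (collect (hat_of S) * Pm)"
  "theta_of (gossip_update k S) = theta_of S" "hat_of (gossip_update k S) = hat_of S" "evals_of (gossip_update k S) = evals_of S"
  by (simp_all add: gossip_update_def Let_def collect_def)

lemma good_gossip_update:
  assumes "good S"
  shows "good (gossip_update k S)"
proof -
  have b: "balanced d n (xs_of S k)" "balanced d n (y_of S)" using assms by (auto simp: good_def)
  note st = lyap_step(1,2)[OF b balanced_zero collect_carrier[of "hat_of S"]]
  show ?thesis using assms st unfolding good_def gossip_update_fields by auto
qed

lemma good_init: "good init_state"
  by (auto simp: good_def init_state_def balanced_zero conjugate_gradient)

lemma run_good: "S \<in> set_pmf (run k) \<Longrightarrow> good S"
proof (induction k arbitrary: S)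
  case 0
  then show ?case using good_init by simp
next
  case (Suc k)
  then obtain S0 T where "S0 \<in> set_pmf (run k)" "T \<in> set_pmf (step k S0)" "S = gossip_update k T"
    unfolding run_Suc by auto
  then show ?case using good_gossip_update[OF step_D(1)[OF Suc.IH]] by blast
qed

lemma finite_run: "finite (set_pmf (run k))"
proof (induction k)
  case (Suc k)
  then show ?case unfolding run_Suc using run_good finite_step by auto
qed simp

text \<open>The cost is deterministic. Iteration 0 calls no solver, hence \<open>k - 1\<close>;
  truncated subtraction covers \<open>k = 0\<close>.\<close>

lemma run_evals: "S \<in> set_pmf (run k) \<Longrightarrow> evals_of S = (k - 1) * (n * (epochs * (5 * m)))"
proof (induction k arbitrary: S)
  case 0
  then show ?case by (simp add: init_state_def)
next
  case (Suc k)
  then obtain S0 T where 1: "S0 \<in> set_pmf (run k)" "T \<in> set_pmf (step k S0)" "S = gossip_update k T"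
    unfolding run_Suc by auto
  then show ?case
    using step_D(4)[OF run_good[OF 1(1)] 1(2)] Suc.IH[OF 1(1)] by (cases k) (auto simp: gossip_update_fields)
qed

abbreviation "E k F \<equiv> measure_pmf.expectation (run k) F"

text \<open>Conditioning on the previous state. The summand \<open>a\<close> puts a quantity of that
  state under the same outer expectation, for use with pathwise inequalities.\<close>

lemma E_run_Suc:
  fixes a G :: "mdlag_state \<Rightarrow> real"
  shows "E k a + E (Suc k) G = E k (\<lambda>S. a S + measure_pmf.expectation (step k S) (\<lambda>T. G (gossip_update k T)))"
proof -
  have "E (Suc k) G = E k (\<lambda>S. measure_pmf.expectation (map_pmf (gossip_update k) (step k S)) G)"
    unfolding run_Suc using run_good finite_step by (intro expectation_bind finite_run) auto
  then show ?thesis by (simp only: expectation_linear(1)[OF finite_run] integral_map_pmf)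
qed

lemma E_run_Suc_le:
  fixes F a G :: "mdlag_state \<Rightarrow> real"
  assumes "\<And>S T. S \<in> set_pmf (run k) \<Longrightarrow> T \<in> set_pmf (step k S) \<Longrightarrow> F (gossip_update k T) \<le> a S + G (gossip_update k T)"
  shows "E (Suc k) F \<le> E k a + E (Suc k) G"
proof -
  have "E (Suc k) F = E k (\<lambda>S. 0 + measure_pmf.expectation (step k S) (\<lambda>T. F (gossip_update k T)))"
    using E_run_Suc[of k "\<lambda>_. 0" F] by simp
  also have "\<dots> \<le> E k (\<lambda>S. a S + measure_pmf.expectation (step k S) (\<lambda>T. G (gossip_update k T)))"
  proof (rule expectation_mono[OF finite_run])
    fix S assume S: "S \<in> set_pmf (run k)"
    have fin: "finite (set_pmf (step k S))" by (rule finite_step[OF run_good[OF S]])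
    have "measure_pmf.expectation (step k S) (\<lambda>T. F (gossip_update k T)) \<le>
        measure_pmf.expectation (step k S) (\<lambda>T. a S + G (gossip_update k T))"
      using assms[OF S] by (intro expectation_mono fin)
    also have "\<dots> = a S + measure_pmf.expectation (step k S) (\<lambda>T. G (gossip_update k T))"
      using expectation_linear(1)[OF fin, of "\<lambda>_. a S"] by simp
    finally show "0 + measure_pmf.expectation (step k S) (\<lambda>T. F (gossip_update k T)) \<le>
        a S + measure_pmf.expectation (step k S) (\<lambda>T. G (gossip_update k T))" by simp
  qed
  finally show ?thesis unfolding E_run_Suc .
qed

section \<open>Recursions for the expected errors\<close>

definition delta :: "nat \<Rightarrow> mdlag_state \<Rightarrow> real" where
  "delta j S = (norm (embM (xs_of S (Suc j) - xs_of S j)))\<^sup>2"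
text \<open>Meant for states of \<open>run (Suc k)\<close>: these hold the approximate gradients
  computed at \<open>x\<close> number \<open>k\<close>, while the history already reaches
  \<open>Suc k\<close>. This explains the shifted indices in the expectations below.\<close>

definition err :: "nat \<Rightarrow> mdlag_state \<Rightarrow> real" where
  "err k S = (\<Sum>i<n. (norm (emb (theta_of S i) - target i (emb (col (xs_of S k) i))))\<^sup>2)"
definition herr :: "nat \<Rightarrow> mdlag_state \<Rightarrow> real" where
  "herr k S = (\<Sum>i<n. (norm (emb (hat_of S i) - target i (emb (col (xs_of S k) i))))\<^sup>2)"

lemma delta_cols:
  assumes "good S"
  shows "delta j S = (\<Sum>i<n. (norm (emb (col (xs_of S j) i) - emb (col (xs_of S (Suc j)) i)))\<^sup>2)"
proof -
  have X: "xs_of S j \<in> carrier_mat d n" "xs_of S (Suc j) \<in> carrier_mat d n"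
    using assms balanced_carrier by (auto simp: good_def)
  have "emb (col (xs_of S (Suc j) - xs_of S j) i) = emb (col (xs_of S (Suc j)) i) - emb (col (xs_of S j) i)" if "i < n" for i
  proof -
    have "col (xs_of S (Suc j) - xs_of S j) i = col (xs_of S (Suc j)) i - col (xs_of S j) i"
      using X that by (intro eq_vecI) auto
    then show ?thesis using good_col[OF assms that] by (simp add: emb_ops[of _ d])
  qed
  then show ?thesis
    unfolding delta_def norm_embM_sq[OF minus_carrier_mat[OF X(1)]] by (simp add: norm_minus_commute)
qed

lemma lyap_expectation:
  assumes xs: "balanced d n xs"
  shows "E (Suc k) (\<lambda>S. lyap xs (xs_of S (Suc k)) (y_of S)) \<le> (1 - r) * E k (\<lambda>S. lyap xs (xs_of S k) (y_of S))
    + 4 * r / \<alpha> * eigenvalue_desc Pm 1 * E (Suc k) (herr k) - 3 / 5 * \<beta> * r / eigenvalue_desc Pm 1 * E (Suc k) (delta k)"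
proof -
  define A where "A = 4 * r / \<alpha> * eigenvalue_desc Pm 1"
  define B where "B = 3 / 5 * \<beta> * r / eigenvalue_desc Pm 1"
  have "E (Suc k) (\<lambda>S. lyap xs (xs_of S (Suc k)) (y_of S)) \<le>
      E k (\<lambda>S. (1 - r) * lyap xs (xs_of S k) (y_of S)) + E (Suc k) (\<lambda>S. A * herr k S - B * delta k S)"
  proof (rule E_run_Suc_le)
    fix S T assume S: "S \<in> set_pmf (run k)" and T: "T \<in> set_pmf (step k S)"
    note sT = step_D[OF run_good[OF S] T]
    have b: "balanced d n (xs_of T k)" "balanced d n (y_of T)" using sT(1) by (auto simp: good_def)
    have Xc: "xs_of T k \<in> carrier_mat d n" using b(1) by (rule balanced_carrier)
    have cols: "emb (col (collect (hat_of T) - opt (xs_of T k)) i) = emb (hat_of T i) - target i (emb (col (xs_of T k) i))"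
      if i: "i < n" for i
    proof -
      have h: "hat_of T i \<in> carrier_vec d" using sT(1) i by (simp add: good_def)
      have "col (collect (hat_of T) - opt (xs_of T k)) i = col (collect (hat_of T)) i - col (opt (xs_of T k)) i"
        using i by (intro eq_vecI) (auto simp: carrier_matD[OF collect_carrier] carrier_matD[OF opt_carrier])
      also have "emb \<dots> = emb (col (collect (hat_of T)) i) - emb (col (opt (xs_of T k)) i)"
        using i collect_carrier[of "hat_of T"] opt_carrier[of "xs_of T k"] by (intro emb_ops(2)[of _ d]) auto
      finally show ?thesis unfolding col_collect[of i "hat_of T", OF i h] emb_col_opt[OF i Xc] .
    qed
    have herr: "(norm (embM (collect (hat_of T) - opt (xs_of T k))))\<^sup>2 = herr k (gossip_update k T)"
      unfolding norm_embM_sq[OF minus_carrier_mat[OF opt_carrier]] herr_def using cols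
      by (simp add: gossip_update_fields)
    show "lyap xs (xs_of (gossip_update k T) (Suc k)) (y_of (gossip_update k T)) \<le>
        (1 - r) * lyap xs (xs_of S k) (y_of S) + (A * herr k (gossip_update k T) - B * delta k (gossip_update k T))"
      using lyap_step(3)[OF b xs collect_carrier[of "hat_of T"]] unfolding herr
      by (simp add: gossip_update_fields delta_def A_def B_def sT(2,3))
  qed
  also have "\<dots> = (1 - r) * E k (\<lambda>S. lyap xs (xs_of S k) (y_of S)) + (A * E (Suc k) (herr k) - B * E (Suc k) (delta k))"
    by (simp only: expectation_linear[OF finite_run])
  finally show ?thesis by (simp add: A_def B_def)
qed

text \<open>Iteration 0 uses the exact conjugate gradients at 0 from the initialization, so the
  recursion starts without error.\<close>

lemma err_0: "E (Suc 0) (err 0) = 0"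
proof -
  have "err 0 S = 0" if S: "S \<in> set_pmf (run (Suc 0))" for S
  proof -
    have "S = gossip_update 0 init_state" using S by (simp add: step_def)
    then have "theta_of S i = unemb d (target i (emb (0\<^sub>v d)))" "xs_of S 0 = 0\<^sub>m d n" if "i < n" for i
      using that by (simp_all add: gossip_update_fields init_state_def conjugate_gradient)
    moreover have "emb (unemb d (target i (emb (0\<^sub>v d)))) = target i (emb (0\<^sub>v d))" if "i < n" for i
      by (rule emb_unemb[OF target(1)[OF that emb_supported[OF zero_carrier_vec] emb_supported[OF zero_carrier_vec]]])
    ultimately show ?thesis by (auto simp: err_def intro!: sum.neutral)
  qed
  then show ?thesis using expectation_cong[of "run (Suc 0)" "err 0" "\<lambda>_. 0"] by simp
qed

text \<open>Warm start: the old solution is compared with the new target through the old target, at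
  the price of a factor 2 that turns \<open>c / 2\<close> into \<open>c\<close>; the shift of the
  target is controlled by the Lipschitz constant \<open>1 / \<mu>_min\<close>.\<close>

lemma err_Suc: "E (Suc (Suc k)) (err (Suc k)) \<le> c * E (Suc k) (err k) + c / \<mu>_min\<^sup>2 * E (Suc k) (delta k)"
proof -
  have "E (Suc (Suc k)) (err (Suc k)) = E (Suc k) (\<lambda>S. measure_pmf.expectation (step (Suc k) S) (\<lambda>T. err (Suc k) (gossip_update (Suc k) T)))"
    using E_run_Suc[of "Suc k" "\<lambda>_. 0" "err (Suc k)"] by simp
  also have "\<dots> \<le> E (Suc k) (\<lambda>S. c * err k S + c / \<mu>_min\<^sup>2 * delta k S)"
  proof (rule expectation_mono[OF finite_run])
    fix S assume "S \<in> set_pmf (run (Suc k))"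
    then have S: "good S" by (rule run_good)
    let ?x = "\<lambda>k i. emb (col (xs_of S k) i)"
    have V: "?x k i \<in> Vd" if "i < n" for k i using good_col[OF S that] by (rule emb_supported)
    have "measure_pmf.expectation (step (Suc k) S) (\<lambda>T. err (Suc k) (gossip_update (Suc k) T)) =
        measure_pmf.expectation (samples (Suc k) S) (\<lambda>q. \<Sum>i<n. (norm (emb (fst (q i)) - target i (?x (Suc k) i)))\<^sup>2)"
      by (simp add: step_def worker_step_eq err_def gossip_update_fields update_def)
    also have "\<dots> = (\<Sum>i<n. measure_pmf.expectation (samples (Suc k) S) (\<lambda>q. (norm (emb (fst (q i)) - target i (?x (Suc k) i)))\<^sup>2))"
      by (intro Bochner_Integration.integral_sum integrable_measure_pmf_finite finite_samples S)
    also have "\<dots> \<le> (\<Sum>i<n. c * (norm (emb (theta_of S i) - target i (?x k i)))\<^sup>2 + c / \<mu>_min\<^sup>2 * (norm (?x k i - ?x (Suc k) i))\<^sup>2)"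
    proof (intro sum_mono)
      fix i assume "i \<in> {..<n}"
      then have i: "i < n" by simp
      have th: "theta_of S i \<in> carrier_vec d" using S i by (simp add: good_def)
      have "measure_pmf.expectation (samples (Suc k) S) (\<lambda>q. (norm (emb (fst (q i)) - target i (?x (Suc k) i)))\<^sup>2) =
          measure_pmf.expectation (map_pmf (\<lambda>q. q i) (samples (Suc k) S)) (\<lambda>q. (norm (emb (fst q) - target i (?x (Suc k) i)))\<^sup>2)"
        by simp
      \<comment> \<open>Only the marginal of worker \<open>i\<close> matters for its own
        error.\<close>
      also have "map_pmf (\<lambda>q. q i) (samples (Suc k) S) = local_solver i (col (xs_of S (Suc k)) i) (theta_of S i)"
        unfolding samples_def using i by (subst Pi_pmf_component) auto
      also have "measure_pmf.expectation \<dots> (\<lambda>q. (norm (emb (fst q) - target i (?x (Suc k) i)))\<^sup>2)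
          \<le> c / 2 * (norm (emb (theta_of S i) - target i (?x (Suc k) i)))\<^sup>2"
        by (rule local_solver(3)[OF i good_col[OF S i] th])
      also have "\<dots> \<le> c / 2 * (2 * (norm (emb (theta_of S i) - target i (?x k i)))\<^sup>2 + 2 * ((norm (?x k i - ?x (Suc k) i))\<^sup>2 / \<mu>_min\<^sup>2))"
      proof (intro mult_left_mono)
        have "(norm (emb (theta_of S i) - target i (?x (Suc k) i)))\<^sup>2 \<le>
          2 * (norm (emb (theta_of S i) - target i (?x k i)))\<^sup>2 + 2 * (norm (target i (?x k i) - target i (?x (Suc k) i)))\<^sup>2"
          using norm_add_sq_le[of "emb (theta_of S i) - target i (?x k i)" "target i (?x k i) - target i (?x (Suc k) i)"] by simp
        then show "(norm (emb (theta_of S i) - target i (?x (Suc k) i)))\<^sup>2 \<le>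
          2 * (norm (emb (theta_of S i) - target i (?x k i)))\<^sup>2 + 2 * ((norm (?x k i - ?x (Suc k) i))\<^sup>2 / \<mu>_min\<^sup>2)"
          using target(4)[OF i V[OF i] V[OF i], of k "Suc k"] by linarith
      qed (use c_bounds in simp)
      finally show "measure_pmf.expectation (samples (Suc k) S) (\<lambda>q. (norm (emb (fst (q i)) - target i (?x (Suc k) i)))\<^sup>2)
          \<le> c * (norm (emb (theta_of S i) - target i (?x k i)))\<^sup>2 + c / \<mu>_min\<^sup>2 * (norm (?x k i - ?x (Suc k) i))\<^sup>2"
        by (simp add: algebra_simps)
    qed
    also have "\<dots> = c * err k S + c / \<mu>_min\<^sup>2 * delta k S"
      unfolding err_def delta_cols[OF S] by (simp only: sum.distrib sum_distrib_left)
    finally show "measure_pmf.expectation (step (Suc k) S) (\<lambda>T. err (Suc k) (gossip_update (Suc k) T)) \<le> c * err k S + c / \<mu>_min\<^sup>2 * delta k S" .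
  qed
  also have "\<dots> = c * E (Suc k) (err k) + c / \<mu>_min\<^sup>2 * E (Suc k) (delta k)"
    by (simp only: expectation_linear[OF finite_run])
  finally show ?thesis .
qed

lemma delta_history: "j < k \<Longrightarrow> E k (delta j) = E (Suc j) (delta j)"
proof (induction k)
  case (Suc k)
  show ?case
  proof (cases "j = k")
    case False
    then have jk: "j < k" using Suc.prems by simp
    have "E (Suc k) (delta j) = E k (\<lambda>S. measure_pmf.expectation (step k S) (\<lambda>T. delta j (gossip_update k T)))"
      using E_run_Suc[of k "\<lambda>_. 0" "delta j"] by simp
    also have "\<dots> = E k (delta j)"
    proof (rule expectation_cong)
      fix S assume S: "S \<in> set_pmf (run k)"
      have "delta j (gossip_update k T) = delta j S" if "T \<in> set_pmf (step k S)" for T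
        using step_D(2)[OF run_good[OF S] that] jk by (simp add: delta_def gossip_update_fields)
      then have "measure_pmf.expectation (step k S) (\<lambda>T. delta j (gossip_update k T)) = measure_pmf.expectation (step k S) (\<lambda>_. delta j S)"
        by (intro expectation_cong) auto
      then show "measure_pmf.expectation (step k S) (\<lambda>T. delta j (gossip_update k T)) = delta j S" by simp
    qed
    finally show ?thesis using Suc.IH[OF jk] by simp
  qed simp
qed simp

text \<open>The condition at iteration \<open>k\<close> reads iterates up to \<open>k\<close> only,
  whereas the gossip update overwrites entry \<open>Suc k\<close>; so it may be evaluated on the
  state after the update.\<close>

lemma lazy_condition_cong:
  assumes "\<And>j. j \<le> k \<Longrightarrow> x j = x' j"
  shows "lazy_condition k x i h t = lazy_condition k x' i h t"
proof -
  let ?d = "\<lambda>x j. (vnorm (col (x j) i - col (x (Suc j)) i))\<^sup>2"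
  have d: "?d x j = ?d x' j" if "j < k" for j using assms[of j] assms[of "Suc j"] that by simp
  have S: "(\<Sum>j\<in>J. w j * ?d x j) = (\<Sum>j\<in>J. w j * ?d x' j)" if "J \<subseteq> {..<k}" for J w
    using that by (intro sum.cong refl arg_cong2[where f = "(*)"] d) auto
  have 1: "(\<Sum>j\<in>{0..<k - D}. c ^ (k - D - j) * ?d x j) = (\<Sum>j\<in>{0..<k - D}. c ^ (k - D - j) * ?d x' j)"
    by (rule S) auto
  have 2: "(\<Sum>j\<in>{0..<k}. c ^ (k - j) * ?d x j) = (\<Sum>j\<in>{0..<k}. c ^ (k - j) * ?d x' j)"
    by (rule S) auto
  have 3: "(\<Sum>j\<in>{k - D..<k}. a * ?d x j) = (\<Sum>j\<in>{k - D..<k}. a * ?d x' j)" for a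
    by (rule S) auto
  show ?thesis unfolding lazy_condition_def Let_def 1 2 3 ..
qed

text \<open>A transmission, including one forced by the delay limit, makes the two vectors equal;
  silence means that the condition held. At \<open>k = 0\<close> they agree by
  initialization.\<close>

lemma run_lazy:
  assumes S: "S \<in> set_pmf (run (Suc k))" and i: "i < n"
  shows "hat_of S i = theta_of S i \<or> lazy_condition k (xs_of S) i (hat_of S i) (theta_of S i)"
proof -
  obtain S0 T where 1: "S0 \<in> set_pmf (run k)" "T \<in> set_pmf (step k S0)" "S = gossip_update k T"
    using S unfolding run_Suc by auto
  show ?thesis
  proof (cases "k = 0")
    case True
    then have "T = init_state" using 1 step_D(6)[OF run_good[OF 1(1)] 1(2)] by simp
    then show ?thesis by (simp add: 1 gossip_update_fields init_state_def)
  next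
    case False
    have "lazy_condition k (xs_of S) i h t = lazy_condition k (xs_of T) i h t" for h t
      by (rule lazy_condition_cong) (auto simp: 1 gossip_update_fields)
    then show ?thesis
      using step_D(5)[OF run_good[OF 1(1)] 1(2) False i] by (simp add: 1(3) gossip_update_fields)
  qed
qed

text \<open>Splits the error of the communicated vector into staleness and solver error. The factor
  2 for the split doubles the 3 of the lazy condition.\<close>

lemma herr_le:
  assumes S: "S \<in> set_pmf (run (Suc k))"
  shows "herr k S \<le> 2 * err k S + 6 / \<mu>_min\<^sup>2 * ((\<Sum>j<k - D. c ^ (k - D - j) * delta j S) + (\<Sum>j<k. c ^ (k - j) * delta j S)
       + (\<Sum>j\<in>{k - D..<k}. (c + \<gamma>) * delta j S))"
proof -
  note gS = run_good[OF S]
  let ?x = "\<lambda>k i. emb (col (xs_of S k) i)"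
  define dd where "dd i j = (norm (?x j i - ?x (Suc j) i))\<^sup>2" for i j
  define B where "B i = (\<Sum>j<k - D. c ^ (k - D - j) * dd i j) + (\<Sum>j<k. c ^ (k - j) * dd i j) + (\<Sum>j\<in>{k - D..<k}. (c + \<gamma>) * dd i j)" for i
  have "(norm (emb (hat_of S i) - target i (?x k i)))\<^sup>2 \<le> 2 * (norm (emb (theta_of S i) - target i (?x k i)))\<^sup>2 + 6 / \<mu>_min\<^sup>2 * B i"
    if i: "i < n" for i
  proof -
    have c: "hat_of S i \<in> carrier_vec d" "theta_of S i \<in> carrier_vec d" using gS i by (auto simp: good_def)
    have B0: "0 \<le> 3 / \<mu>_min\<^sup>2 * B i"
      unfolding B_def dd_def using c_bounds by (intro mult_nonneg_nonneg add_nonneg_nonneg sum_nonneg) auto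
    have vn: "(vnorm (col (xs_of S j) i - col (xs_of S (Suc j)) i))\<^sup>2 = dd i j" for j
      using good_col[OF gS i] by (simp add: vnorm_eq_norm_emb emb_ops[of _ d] dd_def)
    have vh: "vnorm (hat_of S i - theta_of S i) = norm (emb (hat_of S i) - emb (theta_of S i))"
      using c by (simp add: vnorm_eq_norm_emb emb_ops[of _ d])
    have "(norm (emb (hat_of S i) - emb (theta_of S i)))\<^sup>2 \<le> 3 / \<mu>_min\<^sup>2 * B i"
      using run_lazy[OF S i]
    proof
      assume "hat_of S i = theta_of S i"
      then show ?thesis using B0 by simp
    next
      assume "lazy_condition k (xs_of S) i (hat_of S i) (theta_of S i)"
      then show ?thesis
        unfolding lazy_condition_def Let_def vn vh B_def atLeast0LessThan
        by (simp add: distrib_right sum.distrib add.assoc)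
    qed
    moreover have "(norm (emb (hat_of S i) - target i (?x k i)))\<^sup>2 \<le>
        2 * (norm (emb (hat_of S i) - emb (theta_of S i)))\<^sup>2 + 2 * (norm (emb (theta_of S i) - target i (?x k i)))\<^sup>2"
      using norm_add_sq_le[of "emb (hat_of S i) - emb (theta_of S i)" "emb (theta_of S i) - target i (?x k i)"] by simp
    moreover have "6 / \<mu>_min\<^sup>2 * B i = 2 * (3 / \<mu>_min\<^sup>2 * B i)" by simp
    ultimately show ?thesis by linarith
  qed
  then have "herr k S \<le> (\<Sum>i<n. 2 * (norm (emb (theta_of S i) - target i (?x k i)))\<^sup>2 + 6 / \<mu>_min\<^sup>2 * B i)"
    unfolding herr_def by (intro sum_mono) auto
  also have "\<dots> = 2 * err k S + 6 / \<mu>_min\<^sup>2 * (\<Sum>i<n. B i)"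
    unfolding err_def by (simp only: sum.distrib sum_distrib_left)
  also have "(\<Sum>i<n. B i) = (\<Sum>j<k - D. c ^ (k - D - j) * delta j S) + (\<Sum>j<k. c ^ (k - j) * delta j S)
       + (\<Sum>j\<in>{k - D..<k}. (c + \<gamma>) * delta j S)"
  proof -
    have "(\<Sum>j\<in>J. w j * delta j S) = (\<Sum>i<n. \<Sum>j\<in>J. w j * dd i j)" for J :: "nat set" and w
      unfolding delta_cols[OF gS] dd_def sum_distrib_left by (rule sum.swap)
    then show ?thesis unfolding B_def by (simp add: sum.distrib)
  qed
  finally show ?thesis .
qed

lemma E_sum: "E k (\<lambda>S. \<Sum>j\<in>J. w j * F j S) = (\<Sum>j\<in>J. w j * E k (F j))" for F :: "nat \<Rightarrow> mdlag_state \<Rightarrow> real"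
  by (subst Bochner_Integration.integral_sum) (auto intro: integrable_measure_pmf_finite finite_run)

text \<open>A movement is fixed once it has happened, so all past terms can be expressed through one
  deterministic sequence indexed by \<open>j\<close>, as \<open>delayed_error_contraction\<close>
  requires.\<close>

lemma herr_expectation:
  "E (Suc k) (herr k) \<le> 2 * E (Suc k) (err k) + 6 / \<mu>_min\<^sup>2 * ((\<Sum>j<k - D. c ^ (k - D - j) * E (Suc j) (delta j))
     + (\<Sum>j<k. c ^ (k - j) * E (Suc j) (delta j)) + (\<Sum>j\<in>{k - D..<k}. (c + \<gamma>) * E (Suc j) (delta j)))"
proof -
  have "E (Suc k) (herr k) \<le> E (Suc k) (\<lambda>S. 2 * err k S + 6 / \<mu>_min\<^sup>2 * ((\<Sum>j<k - D. c ^ (k - D - j) * delta j S)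
      + (\<Sum>j<k. c ^ (k - j) * delta j S) + (\<Sum>j\<in>{k - D..<k}. (c + \<gamma>) * delta j S)))"
    using herr_le by (intro expectation_mono finite_run)
  also have "\<dots> = 2 * E (Suc k) (err k) + 6 / \<mu>_min\<^sup>2 * ((\<Sum>j<k - D. c ^ (k - D - j) * E (Suc k) (delta j))
     + (\<Sum>j<k. c ^ (k - j) * E (Suc k) (delta j)) + (\<Sum>j\<in>{k - D..<k}. (c + \<gamma>) * E (Suc k) (delta j)))"
    by (simp only: expectation_linear[OF finite_run] E_sum)
  also have "\<dots> = 2 * E (Suc k) (err k) + 6 / \<mu>_min\<^sup>2 * ((\<Sum>j<k - D. c ^ (k - D - j) * E (Suc j) (delta j))
     + (\<Sum>j<k. c ^ (k - j) * E (Suc j) (delta j)) + (\<Sum>j\<in>{k - D..<k}. (c + \<gamma>) * E (Suc j) (delta j)))"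
  proof -
    have S: "(\<Sum>j\<in>J. w j * E (Suc k) (delta j)) = (\<Sum>j\<in>J. w j * E (Suc j) (delta j))" if "J \<subseteq> {..<k}" for J w
      using that by (intro sum.cong refl arg_cong2[where f = "(*)"] delta_history) auto
    have 1: "(\<Sum>j<k - D. c ^ (k - D - j) * E (Suc k) (delta j)) = (\<Sum>j<k - D. c ^ (k - D - j) * E (Suc j) (delta j))"
      by (rule S) auto
    have 2: "(\<Sum>j<k. c ^ (k - j) * E (Suc k) (delta j)) = (\<Sum>j<k. c ^ (k - j) * E (Suc j) (delta j))"
      by (rule S) auto
    have 3: "(\<Sum>j\<in>{k - D..<k}. (c + \<gamma>) * E (Suc k) (delta j)) = (\<Sum>j\<in>{k - D..<k}. (c + \<gamma>) * E (Suc j) (delta j))"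
      by (rule S) auto
    show ?thesis unfolding 1 2 3 ..
  qed
  finally show ?thesis .
qed

theorem dual_gap_expectation:
  assumes xs: "balanced d n xs" and min: "\<And>Y. balanced d n Y \<Longrightarrow> (norm (embM (Y - xs)))\<^sup>2 / (4 * L_max) \<le> dual_fun Y - dual_fun xs"
  shows "E k (\<lambda>S. dual_fun (y_of S)) - dual_fun xs \<le> (1 - r) ^ k * (5 / 2 * (dual_fun (0\<^sub>m d n) - dual_fun xs))"
proof -
  let ?v = "\<lambda>k. E k (\<lambda>S. lyap xs (xs_of S k) (y_of S))"
  have "?v k \<le> (1 - r) ^ k * ?v 0"
  proof (rule delayed_error_contraction[where A = "4 * r / \<alpha> * eigenvalue_desc Pm 1" and B = "3 / 5 * \<beta> * r / eigenvalue_desc Pm 1"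
        and \<mu> = \<mu>_min and dl = "\<lambda>j. E (Suc j) (delta j)" and er = "\<lambda>k. E (Suc k) (err k)"
        and hh = "\<lambda>k. E (Suc k) (herr k)" and c = c and \<gamma> = \<gamma> and D = D])
    show "0 \<le> E (Suc j) (delta j)" for j
      by (rule Bochner_Integration.integral_nonneg) (simp add: delta_def)
    show "0 \<le> 4 * r / \<alpha> * eigenvalue_desc Pm 1"
      using r(1) \<alpha>\<beta>(1) gossip_mat_eigenvalues_order[OF P(1)] by simp
  qed (use r c_bounds constants D absorbed lyap_expectation[OF xs] err_0 err_Suc herr_expectation in \<open>auto simp del: run.simps\<close>)
  also have "?v 0 = lyap xs (0\<^sub>m d n) (0\<^sub>m d n)" by (simp add: init_state_def)
  also have "(1 - r) ^ k * \<dots> \<le> (1 - r) ^ k * (5 / 2 * (dual_fun (0\<^sub>m d n) - dual_fun xs))"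
    using lyap_init[OF xs min[OF balanced_zero]] r(2) by (intro mult_left_mono) auto
  finally have "?v k \<le> (1 - r) ^ k * (5 / 2 * (dual_fun (0\<^sub>m d n) - dual_fun xs))" .
  moreover have "E k (\<lambda>S. dual_fun (y_of S)) - dual_fun xs \<le> ?v k"
  proof -
    have "E k (\<lambda>S. dual_fun (y_of S)) - dual_fun xs = E k (\<lambda>S. dual_fun (y_of S) - dual_fun xs)"
      using expectation_linear(2)[OF finite_run, of k "\<lambda>S. dual_fun (y_of S)" "\<lambda>_. dual_fun xs"] by simp
    also have "\<dots> \<le> ?v k"
      using \<alpha>\<beta>(1) by (intro expectation_mono finite_run) (simp add: lyap_def)
    finally show ?thesis .
  qed
  ultimately show ?thesis by linarith
qed

end

section \<open>The complexity bounds\<close>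

text \<open>Keeps the logarithms away from 0, so that rounding and the initial gap can be absorbed
  into multiplicative constants.\<close>

lemma ln_ge_half: "2 \<le> x \<Longrightarrow> 1 / 2 \<le> ln (x :: real)"
proof -
  assume x: "2 \<le> x"
  have "1 / 2 \<le> - ln (1 / 2 :: real)" using ln_le_minus_one[of "1 / 2 :: real"] by simp
  also have "\<dots> = ln (2 :: real)" by (simp add: ln_div)
  also have "\<dots> \<le> ln x" using x by simp
  finally show "1 / 2 \<le> ln x" .
qed

context mdlag_rate
begin

text \<open>7 bounds \<open>sqrt 40\<close>, \<open>2 * \<bar>ln q\<bar> + 1\<close> absorbs the
  initial gap \<open>q = 5 / 2 * gap\<close> into the logarithm of the accuracy, and the final 2
  pays for rounding up.\<close>

definition iter_const :: "real \<Rightarrow> real" where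
  "iter_const gap = 7 * (2 * \<bar>ln (5 / 2 * gap)\<bar> + 1) + 2"

text \<open>The minimizer over zero row sums is carried back to some \<open>\<xi>\<close> by the
  pseudo-inverse of the root of \<open>U\<close>; conversely every
  \<open>\<xi> * psd_sqrt n U\<close> has zero row sums, so this \<open>\<xi>\<close> is optimal for
  the stated problem.\<close>

lemma suboptimal_within:
  assumes gap: "\<forall>\<xi>\<in>carrier_mat d n. dual_fun (0\<^sub>m d n) - dual_fun (\<xi> * psd_sqrt n U) \<le> gap" "0 < gap"
    and e: "0 < \<epsilon>" "\<epsilon> \<le> 1 / 2"
  shows "\<exists>k. suboptimal \<epsilon> k \<and> real k \<le> iter_const gap * sqrt \<kappa>_F * ln (1 / \<epsilon>)"
proof -
  obtain xs where xs: "balanced d n xs" "\<And>Y. balanced d n Y \<Longrightarrow> dual_fun xs \<le> dual_fun Y"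
    and min: "\<And>Y. balanced d n Y \<Longrightarrow> (norm (embM (Y - xs)))\<^sup>2 / (4 * L_max) \<le> dual_fun Y - dual_fun xs"
    using dual_minimizer by blast
  obtain R where R: "R \<in> carrier_mat n n" "transpose_mat R = R" "U * R = psd_sqrt n U" "R *\<^sub>v ones_vec n = 0\<^sub>v n"
    "\<And>v. v \<in> carrier_vec n \<Longrightarrow> v \<bullet> ones_vec n = 0 \<Longrightarrow> psd_sqrt n U *\<^sub>v (R *\<^sub>v v) = v"
    using gossip_sqrt_pinv[OF U] by metis
  have psd: "psd_mat n U" using U by (simp add: gossip_mat_def)
  have SU: "psd_sqrt n U \<in> carrier_mat n n" "transpose_mat (psd_sqrt n U) = psd_sqrt n U"
    using psd_sqrt[OF psd] psd_mat_carrier psd_mat_symmetric by auto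
  have xsc: "xs \<in> carrier_mat d n" "xs *\<^sub>v ones_vec n = 0\<^sub>v d" using xs(1) by (auto simp: balanced_def)
  define \<xi> where "\<xi> = xs * R"
  have xi: "\<xi> \<in> carrier_mat d n" "\<xi> * psd_sqrt n U = xs"
    using xsc R(1) mult_pinv_sqrt[OF SU R(1,2,5) xsc] by (auto simp: \<xi>_def)
  have argmin: "is_arg_min (\<lambda>\<xi>. dual_fun (\<xi> * psd_sqrt n U)) (\<lambda>\<xi>. \<xi> \<in> carrier_mat d n) \<xi>"
  proof -
    have "dual_fun xs \<le> dual_fun (y * psd_sqrt n U)" if "y \<in> carrier_mat d n" for y
      by (rule xs(2)[OF balanced_mult[OF that SU(1) sqrt_gossip_ones[OF U]]])
    then show ?thesis using xi by (auto simp: is_arg_min_def not_less)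
  qed
  have g: "dual_fun (0\<^sub>m d n) - dual_fun xs \<le> gap" using gap(1) xi by auto
  define q where "q = 5 / 2 * gap"
  have q: "0 < q" using gap(2) by (simp add: q_def)
  define l where "l = ln (1 / \<epsilon>)"
  have l: "1 / 2 \<le> l" unfolding l_def using e by (intro ln_ge_half) (simp add: field_simps)
  \<comment> \<open>Since \<open>r \<ge> 1 / sqrt (40 * \<kappa>_F)\<close>, this many iterations
    make \<open>exp (- r * K)\<close> at most \<open>\<epsilon> / q\<close>.\<close>
  define x where "x = sqrt (40 * \<kappa>_F) * (\<bar>ln q\<bar> + l)"
  have x0: "0 \<le> x" using constants(5) l by (simp add: x_def)
  define K where "K = nat \<lceil>x\<rceil>"
  have Kx: "x \<le> real K" "real K \<le> x + 1" using x0 unfolding K_def by linarith+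
  have "suboptimal \<epsilon> K"
    unfolding suboptimal_def
  proof (intro exI conjI)
    have "1 * (\<bar>ln q\<bar> + l) \<le> r * sqrt (40 * \<kappa>_F) * (\<bar>ln q\<bar> + l)"
      using r(5) constants(5) l by (intro mult_right_mono) (auto simp: pos_divide_le_eq)
    also have "\<dots> = r * x" by (simp add: x_def)
    also have "\<dots> \<le> r * real K" using Kx r(1) by (intro mult_left_mono) auto
    finally have "\<bar>ln q\<bar> + l \<le> r * real K" by (simp only: mult_1)
    moreover have "ln q + l \<le> \<bar>ln q\<bar> + l" by simp
    ultimately have rK: "ln q + l \<le> r * real K" by (rule order_trans[rotated])
    have "(1 - r) ^ K \<le> exp (- r) ^ K"
      using r(1,2) exp_ge_add_one_self[of "- r"] by (intro power_mono) auto
    also have "\<dots> = exp (- (r * real K))" by (simp add: exp_of_nat_mult[symmetric] mult.commute)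
    also have "\<dots> \<le> exp (- (ln q + l))" using rK by simp
    also have "\<dots> = \<epsilon> / q" using q e by (simp add: l_def exp_minus exp_add ln_div exp_diff field_simps)
    finally have pw: "(1 - r) ^ K \<le> \<epsilon> / q" .
    have "E K (\<lambda>S. dual_fun (y_of S)) - dual_fun xs \<le> (1 - r) ^ K * (5 / 2 * (dual_fun (0\<^sub>m d n) - dual_fun xs))"
      by (rule dual_gap_expectation[OF xs(1) min])
    also have "\<dots> \<le> (1 - r) ^ K * q" using g r(2) by (intro mult_left_mono) (auto simp: q_def)
    also have "\<dots> \<le> \<epsilon> / q * q" using pw q by (intro mult_right_mono) auto
    also have "\<dots> = \<epsilon>" using q by simp
    finally show "E K (\<lambda>S. dual_fun (y_of S)) - dual_fun (\<xi> * psd_sqrt n U) \<le> \<epsilon>" unfolding xi(2) .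
  qed (rule argmin)
  moreover have "real K \<le> iter_const gap * sqrt \<kappa>_F * l"
  proof -
    have k: "1 \<le> sqrt \<kappa>_F" using constants(5) by simp
    have "sqrt 40 \<le> (7 :: real)" by (rule real_le_lsqrt) auto
    then have "sqrt (40 * \<kappa>_F) \<le> 7 * sqrt \<kappa>_F" using k by (simp add: real_sqrt_mult)
    moreover have "\<bar>ln q\<bar> + l \<le> (2 * \<bar>ln q\<bar> + 1) * l"
    proof -
      have "\<bar>ln q\<bar> * 1 \<le> \<bar>ln q\<bar> * (2 * l)" using l by (intro mult_left_mono) auto
      then show ?thesis by (simp add: algebra_simps)
    qed
    ultimately have "x \<le> 7 * sqrt \<kappa>_F * ((2 * \<bar>ln q\<bar> + 1) * l)"
      unfolding x_def using constants(5) l by (intro mult_mono) auto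
    moreover have "1 \<le> sqrt \<kappa>_F * (2 * l)" using mult_mono[OF k, of 1 "2 * l"] l k by simp
    ultimately have "real K \<le> 7 * sqrt \<kappa>_F * ((2 * \<bar>ln q\<bar> + 1) * l) + sqrt \<kappa>_F * (2 * l)" using Kx by linarith
    then show ?thesis by (simp add: iter_const_def q_def algebra_simps)
  qed
  ultimately show ?thesis unfolding l_def by blast
qed

text \<open>5 is the cost of an epoch in units of \<open>m\<close>, \<open>C0 + 2\<close> absorbs
  the rounding of the number of epochs, and \<open>m * (1 + sqrt (\<kappa>_max / m))\<close> is the
  stated per-worker cost.\<close>

lemma gradient_complexity_le:
  "gradient_complexity \<epsilon> \<le> real (iteration_complexity \<epsilon>) *
     (5 * (C0 + 2) * (real n * (real m + sqrt (real m * \<kappa>_max)) * ln (2 * \<kappa>_max / c)))"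
proof -
  define I where "I = iteration_complexity \<epsilon>"
  define l where "l = ln (2 * \<kappa>_max / c)"
  define q where "q = sqrt (\<kappa>_max / real m)"
  have m: "real m \<ge> 1" using well_posed by (simp add: well_posed_def)
  have "2 \<le> 2 * \<kappa>_max / c" using constants(4) c_bounds by (simp add: field_simps)
  then have l: "1 / 2 \<le> l" unfolding l_def by (rule ln_ge_half)
  have q: "0 \<le> q" using constants(4) by (simp add: q_def)
  have "gradient_complexity \<epsilon> = E I (\<lambda>S. real ((I - 1) * (n * (epochs * (5 * m)))))"
    unfolding gradient_complexity_def I_def[symmetric] by (intro expectation_cong) (simp only: run_evals)
  also have "\<dots> = real ((I - 1) * (n * (epochs * (5 * m))))" by simp
  also have "\<dots> \<le> real (I * (n * (epochs * (5 * m))))" unfolding of_nat_le_iff by (intro mult_right_mono) auto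
  also have "\<dots> = real I * (5 * (real n * (real m * real epochs)))" by simp
  also have "\<dots> \<le> real I * (5 * (real n * (real m * ((C0 + 2) * (1 + q) * l))))"
  proof -
    have "0 \<le> C0 * (1 + q) * l" using C0 q l by simp
    then have "real epochs \<le> C0 * (1 + q) * l + 1" unfolding epochs q_def[symmetric] l_def[symmetric] by linarith
    also have "\<dots> \<le> (C0 + 2) * (1 + q) * l"
    proof -
      have "1 \<le> 2 * l * (1 + q)" using mult_mono[of 1 "2 * l" 1 "1 + q"] l q by simp
      then show ?thesis by (simp add: algebra_simps)
    qed
    finally show ?thesis using m by (intro mult_left_mono) auto
  qed
  also have "\<dots> = real I * (5 * (C0 + 2) * (real n * (real m * (1 + q)) * l))" by (simp add: mult_ac)
  also have "real m * (1 + q) = real m + sqrt (real m * \<kappa>_max)"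
  proof -
    have "real m * q = sqrt ((real m)\<^sup>2) * q" by simp
    also have "\<dots> = sqrt ((real m)\<^sup>2 * (\<kappa>_max / real m))" unfolding q_def by (simp only: real_sqrt_mult)
    also have "(real m)\<^sup>2 * (\<kappa>_max / real m) = real m * \<kappa>_max" using m by (simp add: power2_eq_square)
    finally show ?thesis by (simp add: distrib_left)
  qed
  finally show ?thesis by (simp add: I_def l_def)
qed

text \<open>A suboptimal index within the bound also bounds the least one. One constant serves both
  claims, since the gradient bound multiplies the iteration bound by
  \<open>5 * (C0 + 2)\<close>.\<close>

lemma complexity:
  assumes gap: "\<forall>\<xi>\<in>carrier_mat d n. dual_fun (0\<^sub>m d n) - dual_fun (\<xi> * psd_sqrt n U) \<le> gap" "0 < gap"
    and e: "0 < \<epsilon>" "\<epsilon> \<le> 1 / 2"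
  defines "C \<equiv> 5 * (C0 + 2) * (7 * (2 * \<bar>ln (5 / 2 * gap)\<bar> + 1) + 2)"
  shows "\<exists>k. suboptimal \<epsilon> k"
    "real (iteration_complexity \<epsilon>) \<le> C * sqrt \<kappa>_F * ln (1 / \<epsilon>)"
    "gradient_complexity \<epsilon> \<le> C * (real n * (real m + sqrt (real m * \<kappa>_max)) * ln (2 * \<kappa>_max / c)) * sqrt \<kappa>_F * ln (1 / \<epsilon>)"
proof -
  obtain k where k: "suboptimal \<epsilon> k" "real k \<le> iter_const gap * sqrt \<kappa>_F * ln (1 / \<epsilon>)"
    using suboptimal_within[OF gap e] by blast
  then show "\<exists>k. suboptimal \<epsilon> k" by blast
  have C: "C = 5 * (C0 + 2) * iter_const gap" by (simp add: C_def iter_const_def)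
  have ic: "0 \<le> iter_const gap" by (simp add: iter_const_def)
  have l: "0 \<le> sqrt \<kappa>_F * ln (1 / \<epsilon>)" using constants(5) e by simp
  have "iteration_complexity \<epsilon> \<le> k" unfolding iteration_complexity_def using k(1) by (rule Least_le)
  then have I: "real (iteration_complexity \<epsilon>) \<le> iter_const gap * (sqrt \<kappa>_F * ln (1 / \<epsilon>))" using k(2) by (simp add: mult.assoc)
  also have "\<dots> \<le> C * (sqrt \<kappa>_F * ln (1 / \<epsilon>))"
  proof (intro mult_right_mono l)
    have "1 * iter_const gap \<le> 5 * (C0 + 2) * iter_const gap" using C0 ic by (intro mult_right_mono) auto
    then show "iter_const gap \<le> C" by (simp add: C)
  qed
  finally show "real (iteration_complexity \<epsilon>) \<le> C * sqrt \<kappa>_F * ln (1 / \<epsilon>)" by (simp add: mult.assoc)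
  define N where "N = real n * (real m + sqrt (real m * \<kappa>_max)) * ln (2 * \<kappa>_max / c)"
  have "2 \<le> 2 * \<kappa>_max / c" using constants(4) c_bounds by (simp add: field_simps)
  then have "0 \<le> ln (2 * \<kappa>_max / c)" using ln_ge_half by fastforce
  then have N: "0 \<le> N" using constants(4) by (simp add: N_def)
  have "gradient_complexity \<epsilon> \<le> real (iteration_complexity \<epsilon>) * (5 * (C0 + 2) * N)"
    unfolding N_def by (rule gradient_complexity_le)
  also have "\<dots> \<le> iter_const gap * (sqrt \<kappa>_F * ln (1 / \<epsilon>)) * (5 * (C0 + 2) * N)"
    using I C0 N by (intro mult_right_mono) auto
  also have "\<dots> = C * N * sqrt \<kappa>_F * ln (1 / \<epsilon>)" by (simp add: C mult_ac)
  finally show "gradient_complexity \<epsilon> \<le> C * (real n * (real m + sqrt (real m * \<kappa>_max)) * ln (2 * \<kappa>_max / c)) * sqrt \<kappa>_F * ln (1 / \<epsilon>)"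
    unfolding N_def .
qed

end

text \<open>Leaves the locales before the quantifiers are assembled, so that the constant visibly
  depends on \<open>C0\<close> and \<open>gap\<close> alone.\<close>

lemma mdlag_complexity:
  fixes C0 gap :: real and n m d D epochs :: nat and f :: "nat \<Rightarrow> nat \<Rightarrow> real vec \<Rightarrow> real"
    and L \<mu> :: "nat \<Rightarrow> real" and E :: "(nat \<times> nat) set" and W :: "real mat" and \<gamma> c \<eta> s \<epsilon> :: real
  defines "U \<equiv> 1\<^sub>m n - W"
  defines "\<alpha>' \<equiv> eigenvalue_desc (accel_gossip n U) (n - 1) / decentralized_problem.L_max n L"
    and "\<beta>' \<equiv> eigenvalue_desc (accel_gossip n U) 1 / decentralized_problem.\<mu>_min n \<mu>"
    and "C \<equiv> 5 * (C0 + 2) * (7 * (2 * \<bar>ln (5 / 2 * gap)\<bar> + 1) + 2)"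
  assumes C0: "16 \<le> C0" and gap: "0 < gap"
    and wp: "decentralized_problem.well_posed n m d f L \<mu>" and net: "gossip_network n E W" and D: "D \<ge> 1"
    and \<gamma>: "\<gamma> = \<alpha>' * \<beta>' * (decentralized_problem.\<mu>_min n \<mu>)\<^sup>2 / (288 * real D * fro_norm (psd_sqrt n (accel_gossip n U)) ^ 4)
            * exp (- 2 * real D / sqrt (decentralized_problem.\<kappa>_F n L \<mu>))"
    and c: "c = \<alpha>' * \<beta>' * (decentralized_problem.\<mu>_min n \<mu>)\<^sup>2 / (1200 * real D * fro_norm (psd_sqrt n (accel_gossip n U)) ^ 4)
            * exp (- 2 * (real D + 1) / sqrt (decentralized_problem.\<kappa>_F n L \<mu>))"
    and \<eta>: "\<eta> = 2 / 15 * (1 / \<beta>')" and s: "s = 10"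
    and epochs: "epochs = nat \<lceil>C0 * (1 + sqrt (decentralized_problem.\<kappa>_max n L \<mu> / real m))
            * ln (2 * decentralized_problem.\<kappa>_max n L \<mu> / c)\<rceil>"
    and g: "\<forall>\<xi>\<in>carrier_mat d n. decentralized_problem.dual_fun n m d f (0\<^sub>m d n)
            - decentralized_problem.dual_fun n m d f (\<xi> * psd_sqrt n U) \<le> gap"
    and e: "0 < \<epsilon>" "\<epsilon> \<le> 1 / 2"
  shows "c < 1 \<and> (\<exists>k. mdlag.suboptimal n m d f L \<mu> U \<eta> s c \<gamma> D epochs \<epsilon> k) \<and>
    real (mdlag.iteration_complexity n m d f L \<mu> U \<eta> s c \<gamma> D epochs \<epsilon>)
      \<le> C * sqrt (decentralized_problem.\<kappa>_F n L \<mu>) * ln (1 / \<epsilon>) \<and>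
    mdlag.gradient_complexity n m d f L \<mu> U \<eta> s c \<gamma> D epochs \<epsilon>
      \<le> C * (real n * (real m + sqrt (real m * decentralized_problem.\<kappa>_max n L \<mu>))
          * ln (2 * decentralized_problem.\<kappa>_max n L \<mu> / c)) * sqrt (decentralized_problem.\<kappa>_F n L \<mu>) * ln (1 / \<epsilon>)"
proof -
  have n2: "n \<ge> 2" using wp by (simp add: decentralized_problem.well_posed_def)
  interpret conv: mdlag_convergence n m d f L \<mu> U \<eta> s c \<gamma> D epochs
    using wp gossip_network_gossip_mat[OF net n2] \<eta> s by unfold_locales (auto simp: U_def \<beta>'_def)
  interpret mdlag_rate n m d f L \<mu> U \<eta> s c \<gamma> D epochs C0
  proof
    show "\<gamma> = conv.\<alpha> * conv.\<beta> * conv.\<mu>_min\<^sup>2 / (288 * real D * fro_norm conv.Sm ^ 4) * exp (- 2 * real D / sqrt conv.\<kappa>_F)"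
      unfolding conv.\<alpha>_def conv.\<beta>_def using \<gamma> unfolding \<alpha>'_def \<beta>'_def .
    show "c = conv.\<alpha> * conv.\<beta> * conv.\<mu>_min\<^sup>2 / (1200 * real D * fro_norm conv.Sm ^ 4) * exp (- 2 * (real D + 1) / sqrt conv.\<kappa>_F)"
      unfolding conv.\<alpha>_def conv.\<beta>_def using c unfolding \<alpha>'_def \<beta>'_def .
  qed (use D C0 epochs in auto)
  have "c < 1" using c_bounds by simp
  with complexity[OF g gap e, folded C_def] show ?thesis by blast
qed

theorem theorem2:
  "\<exists>C_min > (0::real). \<forall>C0 \<ge> C_min. \<forall>gap > (0::real). \<exists>C > (0::real).
     \<forall>(n::nat) (m::nat) (d::nat) (f :: nat \<Rightarrow> nat \<Rightarrow> real vec \<Rightarrow> real) (L :: nat \<Rightarrow> real)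
      (\<mu> :: nat \<Rightarrow> real) (E :: (nat \<times> nat) set) (W :: real mat) (D::nat)
      (\<gamma>::real) (c::real) (\<eta>::real) (s::real) (epochs::nat) (\<epsilon>::real).
     let U = 1\<^sub>m n - W;
         P = accel_gossip n U;
         \<mu>_min = decentralized_problem.\<mu>_min n \<mu>;
         L_max = decentralized_problem.L_max n L;
         \<kappa>_max = decentralized_problem.\<kappa>_max n L \<mu>;
         \<kappa>_F = decentralized_problem.\<kappa>_F n L \<mu>;
         dual = decentralized_problem.dual_fun n m d f;
         \<alpha>' = eigenvalue_desc P (n - 1) / L_max;
         \<beta>' = eigenvalue_desc P 1 / \<mu>_min
     in decentralized_problem.well_posed n m d f L \<mu> \<longrightarrow>
        gossip_network n E W \<longrightarrow>
        D \<ge> 1 \<longrightarrow>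
        \<gamma> = \<alpha>' * \<beta>' * \<mu>_min\<^sup>2 / (288 * real D * fro_norm (psd_sqrt n P) ^ 4)
              * exp (- 2 * real D / sqrt \<kappa>_F) \<longrightarrow>
        c = \<alpha>' * \<beta>' * \<mu>_min\<^sup>2 / (1200 * real D * fro_norm (psd_sqrt n P) ^ 4)
              * exp (- 2 * (real D + 1) / sqrt \<kappa>_F) \<longrightarrow>
        \<eta> = 2 / 15 * (1 / \<beta>') \<longrightarrow>
        s = 10 \<longrightarrow>
        epochs = nat \<lceil>C0 * (1 + sqrt (\<kappa>_max / real m)) * ln (2 * \<kappa>_max / c)\<rceil> \<longrightarrow>
        (\<forall>\<xi>\<in>carrier_mat d n. dual (0\<^sub>m d n) - dual (\<xi> * psd_sqrt n U) \<le> gap) \<longrightarrow>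
        0 < \<epsilon> \<longrightarrow> \<epsilon> \<le> 1 / 2 \<longrightarrow>
        c < 1 \<and>
        (\<exists>k. mdlag.suboptimal n m d f L \<mu> U \<eta> s c \<gamma> D epochs \<epsilon> k) \<and>
        real (mdlag.iteration_complexity n m d f L \<mu> U \<eta> s c \<gamma> D epochs \<epsilon>)
          \<le> C * sqrt \<kappa>_F * ln (1 / \<epsilon>) \<and>
        mdlag.gradient_complexity n m d f L \<mu> U \<eta> s c \<gamma> D epochs \<epsilon>
          \<le> C * (real n * (real m + sqrt (real m * \<kappa>_max)) * ln (2 * \<kappa>_max / c))
              * sqrt \<kappa>_F * ln (1 / \<epsilon>)"
\<comment> \<open>The threshold 16 makes the Katyusha gain \<open>exp (C0 * l / 4)\<close> at least
  the fourth power of \<open>2 * \<kappa>_max / c\<close>.\<close>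
proof (rule exI[of _ "16 :: real"], intro conjI allI impI, goal_cases)
  case (2 C0 gap)
  show ?case
  proof (rule exI[of _ "5 * (C0 + 2) * (7 * (2 * \<bar>ln (5 / 2 * gap)\<bar> + 1) + 2)"], intro conjI allI, goal_cases)
    case 1
    show ?case using 2 by (intro mult_pos_pos) (auto intro: add_nonneg_pos)
  next
    case (2 n m d f L \<mu> E W D \<gamma> c \<eta> s epochs \<epsilon>)
    show ?case
      unfolding Let_def using mdlag_complexity[OF \<open>16 \<le> C0\<close> \<open>0 < gap\<close>] by blast
  qed
qed simp

end
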